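(* Assume the Riemann hypothesis, and assume that the set of positive imaginary parts of the nontrivial zeros of the Riemann zeta function $\zeta(s)$ is linearly independent over $\mathbb{Q}$. Then there exists an (explicitly constructible) density function $M_H:\mathbb{R}\to\mathbb{R}_{\ge 0}$ such that $$\lim_{T\to\infty}\frac1T\int_0^T \Phi(H(e^t))\,dt=\frac{1}{\sqrt{2\pi}}\int_{\mathbb{R}}M_H(u)\Phi(u)\,du$$ holds for every test function $\Phi:\mathbb{R}\to\mathbb{C}$ which is locally Riemann integrable. The function $M_H$ is continuous, nonnegative, compactly supported, and $\frac{1}{\sqrt{2\pi}}\int_{\mathbb{R}}M_H(u)\,du=1$.
   Context: For $X\ge 1$, $H(X):=\sum_{\rho}\frac{X^{\rho-1/2}}{\rho(\rho+1)}$, where the (absolutely convergent) sum runs over all nontrivial zeros $\rho$ of $\zeta(s)$ (zeros with $0<\Re(\rho)<1$), counted with multiplicity; $H(X)$ is real-valued. The linear independence hypothesis concerns the set of imaginary parts (without multiplicity). The Riemann hypothesis asserts $\Re(\rho)=1/2$ for all nontrivial zeros. "Locally Riemann integrable" means Riemann integrable on every bounded interval. The phrase "explicitly constructible" is descriptive only. *)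

theory Defs
  imports "HOL-Complex_Analysis.Complex_Analysis"
begin

text \<open>
  The lemmas up to \<open>zeta_continuation\<close> show that the Dirichlet series continues: Taylor expansion
  of \<open>x\<^sup>1\<^sup>-\<^sup>s\<close> at \<open>x = n\<close>, summed over \<open>n\<close>, expresses \<open>(s - 1) \<zeta>(s)\<close> through the values
  of this function at \<open>s + 1, s + 2, \<dots>\<close> and a remainder convergent further to the left.
\<close>

lemma summable_powr_Suc:
  fixes a :: real
  assumes "a > 1"
  shows "summable (\<lambda>n. real (Suc n) powr (-a))"
proof -
  have "summable (\<lambda>n. real n powr (-a))"
    using assms by (simp add: summable_real_powr_iff)
  thus ?thesis by (subst summable_Suc_iff)
qed

lemma open_Re_gt: "open {s. Re s > a}"
  by (simp add: open_halfspace_Re_gt)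

lemma suminf_holomorphic_half_plane:
  fixes g :: "nat \<Rightarrow> complex \<Rightarrow> complex" and C :: "complex \<Rightarrow> real"
  assumes hol: "\<And>n. g n holomorphic_on {s. Re s > a}"
    and C: "continuous_on UNIV C" "\<And>s. C s \<ge> 0"
    and bd: "\<And>n s. Re s > a \<Longrightarrow> norm (g n s) \<le> C s * real (Suc n) powr (-(Re s + k))"
    and ak: "a + k \<ge> 1"
  shows "(\<lambda>s. \<Sum>n. g n s) holomorphic_on {s. Re s > a}"
    and "Re s > a \<Longrightarrow> summable (\<lambda>n. g n s)"
proof -
  show "(\<lambda>s. \<Sum>n. g n s) holomorphic_on {s. Re s > a}"
  proof (rule holomorphic_uniform_sequence[where f = "\<lambda>N s. \<Sum>n<N. g n s"])
    show "open {s. Re s > a}" by (rule open_Re_gt)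
    show "(\<lambda>s. \<Sum>n<N. g n s) holomorphic_on {s. Re s > a}" for N
      by (intro holomorphic_intros hol)
    fix x assume "x \<in> {s. Re s > a}"
    hence x: "Re x > a" by simp
    define d where "d = (Re x - a) / 2"
    have d: "d > 0" using x by (simp add: d_def)
    have Re_le: "Re y \<ge> a + d" if "y \<in> cball x d" for y
    proof -
      have "\<bar>Re (x - y)\<bar> \<le> norm (x - y)" by (rule abs_Re_le_cmod)
      also have "\<dots> \<le> d" using that by (simp add: dist_norm)
      finally have "\<bar>Re x - Re y\<bar> \<le> d" by simp
      moreover have "Re x = a + 2 * d" by (simp add: d_def field_simps)
      ultimately show ?thesis by linarith
    qed
    have "compact (C ` cball x d)"
      by (intro compact_continuous_image continuous_on_subset[OF C(1)]) auto
    then obtain B where B: "\<And>y. y \<in> cball x d \<Longrightarrow> C y \<le> B"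
      by (metis bounded_has_Sup(1) compact_imp_bounded empty_iff imageI)
    have "uniform_limit (cball x d) (\<lambda>N s. \<Sum>n<N. g n s) (\<lambda>s. \<Sum>n. g n s) sequentially"
    proof (rule Weierstrass_m_test)
      show "summable (\<lambda>n. B * real (Suc n) powr (-(a + d + k)))"
        using ak d by (intro summable_mult summable_powr_Suc) auto
      fix n y assume y: "y \<in> cball x d"
      have "norm (g n y) \<le> C y * real (Suc n) powr (-(Re y + k))"
        using Re_le[OF y] d by (intro bd) auto
      also have "\<dots> \<le> B * real (Suc n) powr (-(a + d + k))"
        using B[OF y] C(2)[of y] Re_le[OF y]
        by (intro mult_mono powr_mono) auto
      finally show "norm (g n y) \<le> \<dots>" .
    qed
    moreover have "cball x d \<subseteq> {s. Re s > a}"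
      using Re_le d by fastforce
    ultimately show "\<exists>d>0. cball x d \<subseteq> {s. Re s > a} \<and>
        uniform_limit (cball x d) (\<lambda>N s. \<Sum>n<N. g n s) (\<lambda>s. \<Sum>n. g n s) sequentially"
      using d by blast
  qed
next
  assume s: "Re s > a"
  show "summable (\<lambda>n. g n s)"
  proof (rule summable_comparison_test)
    show "\<exists>N. \<forall>n\<ge>N. norm (g n s) \<le> C s * real (Suc n) powr (-(Re s + k))"
      using bd[OF s] by blast
    show "summable (\<lambda>n. C s * real (Suc n) powr (-(Re s + k)))"
      using ak s by (intro summable_mult summable_powr_Suc) auto
  qed
qed

definition dirichlet_zeta :: "complex \<Rightarrow> complex" where
  "dirichlet_zeta s = (\<Sum>n. of_nat (Suc n) powr (-s))"

lemma norm_nat_powr: "norm (of_nat (Suc n) powr s :: complex) = real (Suc n) powr (Re s)"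
  using norm_powr_real_powr[of "of_nat (Suc n)" s] by simp

lemma dirichlet_zeta:
  shows "dirichlet_zeta holomorphic_on {s. Re s > 1}"
    and "Re s > 1 \<Longrightarrow> (\<lambda>n. of_nat (Suc n) powr (-s)) sums dirichlet_zeta s"
proof -
  let ?g = "\<lambda>n s. of_nat (Suc n) powr (-s) :: complex"
  have hol: "?g n holomorphic_on {s. Re s > 1}" for n
    by (auto intro!: holomorphic_intros)
  have bd: "norm (?g n s) \<le> (\<lambda>_. 1) s * real (Suc n) powr (-(Re s + 0))" for n s
    by (simp add: norm_nat_powr del: of_nat_Suc)
  note * = suminf_holomorphic_half_plane[of ?g 1 "\<lambda>_. 1" 0, OF hol _ _ bd]
  show "dirichlet_zeta holomorphic_on {s. Re s > 1}"
    unfolding dirichlet_zeta_def [abs_def] using *(1) by simp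
  show "(\<lambda>n. of_nat (Suc n) powr (-s)) sums dirichlet_zeta s" if "Re s > 1"
    unfolding dirichlet_zeta_def using *(2)[of s] that by (intro summable_sums) auto
qed

definition ff :: "nat \<Rightarrow> complex \<Rightarrow> complex" where
  "ff i s = (\<Prod>j<i. 1 - s - of_nat j)"

lemma ff_holo [holomorphic_intros]: "ff i holomorphic_on A"
  unfolding ff_def [abs_def] by (intro holomorphic_intros)

lemma ff_cont: "continuous_on A (ff i)"
  unfolding ff_def [abs_def] by (intro continuous_intros)

definition taylor_rem :: "nat \<Rightarrow> nat \<Rightarrow> complex \<Rightarrow> complex" where
  "taylor_rem m n s = of_nat (Suc (Suc n)) powr (1 - s) -
     (\<Sum>i\<le>m. ff i s * of_nat (Suc n) powr (1 - s - of_nat i) / fact i)"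

lemma norm_taylor_rem:
  assumes "Re s > 1 - real m"
  shows "norm (taylor_rem m n s) \<le> norm (ff (Suc m) s) * real (Suc n) powr (-(Re s + real m))"
proof -
  define S where "S = closed_segment (of_nat (Suc n) :: complex) (of_nat (Suc (Suc n)))"
  have S: "\<exists>t. x = of_real t \<and> t \<ge> real (Suc n)" if "x \<in> S" for x
  proof -
    have "S = closed_segment (of_real (real (Suc n))) (of_real (real (Suc (Suc n))))"
      by (simp add: S_def)
    also have "\<dots> = of_real ` closed_segment (real (Suc n)) (real (Suc (Suc n)))"
      by (rule closed_segment_of_real)
    finally show ?thesis using that by (auto simp: closed_segment_eq_real_ivl)
  qed
  define f where "f = (\<lambda>i x. ff i s * x powr (1 - s - of_nat i))"
  define B where "B = norm (ff (Suc m) s) * real (Suc n) powr (-(Re s + real m))"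
  have "norm (f 0 (of_nat (Suc (Suc n))) -
          (\<Sum>i\<le>m. f i (of_nat (Suc n)) * (of_nat (Suc (Suc n)) - of_nat (Suc n)) ^ i / fact i))
        \<le> B * norm (of_nat (Suc (Suc n)) - of_nat (Suc n) :: complex) ^ Suc m / fact m"
  proof (rule complex_Taylor)
    show "convex S" unfolding S_def by simp
    show "of_nat (Suc n) \<in> S" "of_nat (Suc (Suc n)) \<in> S" unfolding S_def by simp_all
  next
    fix i x assume "x \<in> S" "i \<le> m"
    then obtain t where t: "x = of_real t" "t \<ge> real (Suc n)" using S by blast
    have "x \<notin> \<real>\<^sub>\<le>\<^sub>0" using t by (auto simp: complex_nonpos_Reals_iff)
    from has_field_derivative_powr[OF this, of "1 - s - of_nat i"]
    have "(f i has_field_derivative ff i s * ((1 - s - of_nat i) * x powr (1 - s - of_nat i - 1))) (at x)"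
      unfolding f_def by (intro DERIV_cmult)
    also have "ff i s * ((1 - s - of_nat i) * x powr (1 - s - of_nat i - 1)) = f (Suc i) x"
      by (simp add: f_def ff_def algebra_simps)
    finally show "(f i has_field_derivative f (Suc i) x) (at x within S)"
      by (rule has_field_derivative_at_within)
  next
    fix x assume "x \<in> S"
    then obtain t where t: "x = of_real t" "t \<ge> real (Suc n)" using S by blast
    have "norm (f (Suc m) x) = norm (ff (Suc m) s) * t powr (-(Re s + real m))"
      using t by (simp add: f_def norm_mult norm_powr_real_powr)
    also have "\<dots> \<le> B"
      unfolding B_def using t assms by (intro mult_left_mono powr_mono2') auto
    finally show "norm (f (Suc m) x) \<le> B" .
  qed
  hence "norm (taylor_rem m n s) \<le> B / fact m"
    by (simp add: f_def taylor_rem_def ff_def)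
  also have "\<dots> \<le> B / 1"
    by (intro divide_left_mono) (auto simp: B_def fact_ge_1)
  finally show ?thesis by (simp add: B_def)
qed

lemma taylor_rem_sum:
  shows "(\<lambda>s. \<Sum>n. taylor_rem m n s) holomorphic_on {s. Re s > 1 - real m}"
    and "Re s > 1 - real m \<Longrightarrow> summable (\<lambda>n. taylor_rem m n s)"
proof -
  have hol: "taylor_rem m n holomorphic_on {s. Re s > 1 - real m}" for n
    unfolding taylor_rem_def [abs_def] by (intro holomorphic_intros) auto
  have cont: "continuous_on UNIV (\<lambda>s. norm (ff (Suc m) s))"
    by (intro continuous_intros ff_cont)
  note * = suminf_holomorphic_half_plane[of "taylor_rem m" "1 - real m"
      "\<lambda>s. norm (ff (Suc m) s)" "real m", OF hol cont norm_ge_zero norm_taylor_rem]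
  show "(\<lambda>s. \<Sum>n. taylor_rem m n s) holomorphic_on {s. Re s > 1 - real m}"
    by (rule *(1)) auto
  show "summable (\<lambda>n. taylor_rem m n s)" if "Re s > 1 - real m"
    by (rule *(2)) (use that in auto)
qed

lemma dirichlet_zeta_rec:
  assumes s: "Re s > 1" and m: "m \<ge> 1"
  shows "(s - 1) * dirichlet_zeta s =
           1 - (\<Sum>i\<in>{2..m}. ff (i - 1) s / fact i *
                 ((s + of_nat i - 2) * dirichlet_zeta (s + of_nat i - 1)))
             + (\<Sum>n. taylor_rem m n s)"
proof -
  have "(\<lambda>n. of_nat (Suc n) powr (1 - s) :: complex) \<longlonglongrightarrow> 0"
  proof (rule tendsto_norm_zero_cancel)
    have "(\<lambda>n. real n powr (1 - Re s)) \<longlonglongrightarrow> 0"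
      using s by (intro tendsto_neg_powr filterlim_real_sequentially) auto
    hence "(\<lambda>n. real (Suc n) powr (1 - Re s)) \<longlonglongrightarrow> 0"
      by (rule LIMSEQ_Suc)
    thus "(\<lambda>n. norm (of_nat (Suc n) powr (1 - s) :: complex)) \<longlonglongrightarrow> 0"
      unfolding norm_nat_powr by simp
  qed
  from telescope_sums[OF this]
  have A: "(\<lambda>n. of_nat (Suc (Suc n)) powr (1 - s) - of_nat (Suc n) powr (1 - s) :: complex) sums (-1)"
    by simp
  have Z: "(\<lambda>n. of_nat (Suc n) powr (1 - s - of_nat i)) sums dirichlet_zeta (s + of_nat i - 1)"
    if "i \<ge> 1" for i
  proof -
    have "Re (s + of_nat i - 1) > 1" using s that by simp
    from dirichlet_zeta(2)[OF this] show ?thesis by (simp add: algebra_simps)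
  qed
  have "(\<lambda>n. (\<Sum>i\<in>{1..m}. ff i s / fact i * of_nat (Suc n) powr (1 - s - of_nat i)) + taylor_rem m n s)
          sums ((\<Sum>i\<in>{1..m}. ff i s / fact i * dirichlet_zeta (s + of_nat i - 1)) +
                (\<Sum>n. taylor_rem m n s))"
    using s m by (intro sums_add sums_sum sums_mult Z summable_sums taylor_rem_sum) auto
  also have "(\<lambda>n. (\<Sum>i\<in>{1..m}. ff i s / fact i * of_nat (Suc n) powr (1 - s - of_nat i)) + taylor_rem m n s)
      = (\<lambda>n. of_nat (Suc (Suc n)) powr (1 - s) - of_nat (Suc n) powr (1 - s))"
  proof
    fix n
    have "{..m} = insert 0 {1..m}" by auto
    hence "(\<Sum>i\<le>m. ff i s * of_nat (Suc n) powr (1 - s - of_nat i) / fact i) =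
       of_nat (Suc n) powr (1 - s) + (\<Sum>i\<in>{1..m}. ff i s / fact i * of_nat (Suc n) powr (1 - s - of_nat i))"
      by (simp add: ff_def)
    thus "(\<Sum>i\<in>{1..m}. ff i s / fact i * of_nat (Suc n) powr (1 - s - of_nat i)) + taylor_rem m n s
      = of_nat (Suc (Suc n)) powr (1 - s) - of_nat (Suc n) powr (1 - s)"
      by (simp add: taylor_rem_def)
  qed
  finally have eq: "-1 = (\<Sum>i\<in>{1..m}. ff i s / fact i * dirichlet_zeta (s + of_nat i - 1)) +
                (\<Sum>n. taylor_rem m n s)"
    using A sums_unique2 by blast
  have "ff i s / fact i * dirichlet_zeta (s + of_nat i - 1) =
      - (ff (i - 1) s / fact i * ((s + of_nat i - 2) * dirichlet_zeta (s + of_nat i - 1)))"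
    if i: "i \<in> {2..m}" for i
  proof -
    from i obtain j where "i = Suc j" by (cases i) auto
    have "ff (Suc j) s = - (ff j s * (s + of_nat (Suc j) - 2))"
      by (simp add: ff_def algebra_simps)
    thus ?thesis using \<open>i = Suc j\<close> by (simp only: diff_Suc_1) simp
  qed
  hence "(\<Sum>i\<in>{2..m}. ff i s / fact i * dirichlet_zeta (s + of_nat i - 1)) =
      - (\<Sum>i\<in>{2..m}. ff (i - 1) s / fact i *
          ((s + of_nat i - 2) * dirichlet_zeta (s + of_nat i - 1)))" (is "_ = - ?T")
    by (simp only: sum_negf [symmetric] cong: sum.cong)
  moreover have "{1..m} = insert 1 {2..m}" using m by auto
  hence "(\<Sum>i\<in>{1..m}. ff i s / fact i * dirichlet_zeta (s + of_nat i - 1)) =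
      (1 - s) * dirichlet_zeta s +
      (\<Sum>i\<in>{2..m}. ff i s / fact i * dirichlet_zeta (s + of_nat i - 1))"
    by (simp add: ff_def)
  ultimately have "-1 = (1 - s) * dirichlet_zeta s - ?T + (\<Sum>n. taylor_rem m n s)"
    using eq by simp
  thus ?thesis by (simp add: algebra_simps)
qed

lemma zeta_continuation_half_plane:
  "\<exists>F. F holomorphic_on {s. Re s > 1 - real K} \<and>
       (\<forall>s. Re s > 1 \<longrightarrow> F s = (s - 1) * dirichlet_zeta s)"
proof (induction K)
  case 0
  have "(\<lambda>s. (s - 1) * dirichlet_zeta s) holomorphic_on {s. Re s > 1}"
    by (intro holomorphic_intros dirichlet_zeta)
  thus ?case by auto
next
  case (Suc K)
  then obtain F where F: "F holomorphic_on {s. Re s > 1 - real K}"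
    "\<And>s. Re s > 1 \<Longrightarrow> F s = (s - 1) * dirichlet_zeta s" by blast
  define G where "G = (\<lambda>s. 1 - (\<Sum>i\<in>{2..Suc K}. ff (i - 1) s / fact i * F (s + of_nat i - 1))
             + (\<Sum>n. taylor_rem (Suc K) n s))"
  have hol: "(\<lambda>s. F (s + of_nat i - 1)) holomorphic_on {s. Re s > 1 - real (Suc K)}"
    if "i \<in> {2..Suc K}" for i
    by (rule holomorphic_on_compose_gen[OF _ F(1), unfolded o_def])
       (use that in \<open>auto intro!: holomorphic_intros\<close>)
  have "G holomorphic_on {s. Re s > 1 - real (Suc K)}"
    unfolding G_def by (intro holomorphic_intros hol taylor_rem_sum) auto
  moreover have "G s = (s - 1) * dirichlet_zeta s" if s: "Re s > 1" for s
  proof -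
    have "F (s + of_nat i - 1) = (s + of_nat i - 2) * dirichlet_zeta (s + of_nat i - 1)"
      if "i \<in> {2..Suc K}" for i
      using s that by (subst F(2)) (auto simp: algebra_simps)
    thus ?thesis unfolding G_def
      by (subst dirichlet_zeta_rec[OF s, of "Suc K"]) auto
  qed
  ultimately show ?case by blast
qed

lemma zeta_continuation:
  "\<exists>F. F holomorphic_on UNIV \<and> (\<forall>s. Re s > 1 \<longrightarrow> F s = (s - 1) * dirichlet_zeta s)"
proof -
  let ?H = "\<lambda>K. {s. Re s > 1 - real K}"
  obtain F where F: "\<And>K. F K holomorphic_on ?H K"
    "\<And>K s. Re s > 1 \<Longrightarrow> F K s = (s - 1) * dirichlet_zeta s"
    using zeta_continuation_half_plane by metis
  have eq: "F K s = F L s" if "K \<le> L" "s \<in> ?H K" for K L s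
  proof (rule analytic_continuation_open[of "{s. Re s > 1}" "?H K" "F K" "F L"])
    show "{s. Re s > 1} \<noteq> {}" by (auto intro!: exI[of _ 2])
    show "connected (?H K)" by (intro convex_connected convex_halfspace_Re_gt)
    show "F L holomorphic_on ?H K" using F(1) by (rule holomorphic_on_subset) (use that in auto)
  qed (use F that in \<open>auto intro: open_Re_gt\<close>)
  define G where "G = (\<lambda>s. F (nat \<lceil>2 - Re s\<rceil>) s)"
  have in_H: "s \<in> ?H (nat \<lceil>2 - Re s\<rceil>)" for s
    using of_nat_ceiling[of "2 - Re s"] by simp
  have G_eq: "G s = F K s" if "s \<in> ?H K" for s K
    unfolding G_def using eq[of K "nat \<lceil>2 - Re s\<rceil>" s] eq[of "nat \<lceil>2 - Re s\<rceil>" K s] that in_H[of s]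
    by (cases "K \<le> nat \<lceil>2 - Re s\<rceil>") auto
  have "(\<Union>K. ?H K) = UNIV"
    using in_H by blast
  moreover have "G holomorphic_on (\<Union>K. ?H K)"
  proof (rule holomorphic_on_UN_open)
    show "G holomorphic_on ?H K" for K
      using F(1)[of K] G_eq by (subst holomorphic_cong[OF refl]) auto
    show "open (?H K)" for K by (rule open_Re_gt)
  qed
  moreover have "G s = (s - 1) * dirichlet_zeta s" if "Re s > 1" for s
    unfolding G_def using F(2) that by blast
  ultimately show ?thesis by auto
qed

text \<open>
  The Riemann zeta function is the holomorphic continuation of the Dirichlet series
  \<open>\<Sum>n\<ge>1. n\<^sup>-\<^sup>s\<close> to the plane without the pole at \<open>1\<close>; the value \<open>0\<close>
  at the pole is a convention. Existence and uniqueness are shown in \<open>riemann_zeta_ex1\<close>.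
\<close>
definition is_zeta_continuation :: "(complex \<Rightarrow> complex) \<Rightarrow> bool" where
  "is_zeta_continuation f \<longleftrightarrow>
     f holomorphic_on (-{1}) \<and>
     (\<forall>s. Re s > 1 \<longrightarrow> (\<lambda>n. 1 / of_nat (Suc n) powr s) sums f s) \<and>
     f 1 = 0"

definition riemann_zeta :: "complex \<Rightarrow> complex" where
  "riemann_zeta = (THE f. is_zeta_continuation f)"

lemma riemann_zeta_ex1: "\<exists>!f. is_zeta_continuation f"
proof -
  obtain F where F: "F holomorphic_on UNIV" "\<And>s. Re s > 1 \<Longrightarrow> F s = (s - 1) * dirichlet_zeta s"
    using zeta_continuation by blast
  have "is_zeta_continuation (\<lambda>s. F s / (s - 1))"
    unfolding is_zeta_continuation_def
  proof (intro conjI allI impI)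
    show "(\<lambda>s. F s / (s - 1)) holomorphic_on (-{1})"
      by (intro holomorphic_intros holomorphic_on_subset[OF F(1)]) auto
    fix s :: complex assume s: "Re s > 1"
    hence "F s / (s - 1) = dirichlet_zeta s" using F(2)[OF s] by auto
    thus "(\<lambda>n. 1 / of_nat (Suc n) powr s) sums (F s / (s - 1))"
      using dirichlet_zeta(2)[OF s] by (simp add: powr_minus_divide)
  qed auto
  moreover have "f = g" if f: "is_zeta_continuation f" and g: "is_zeta_continuation g" for f g
  proof
    fix s
    show "f s = g s"
    proof (cases "s = 1")
      case True
      thus ?thesis using f g by (simp add: is_zeta_continuation_def)
    next
      case False
      show ?thesis
      proof (rule analytic_continuation_open[of "{s. Re s > 1}" "-{1}" f g])
        show "{s. Re s > 1} \<noteq> {}" by (auto intro!: exI[of _ 2])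
        show "connected (-{1::complex})"
          by (intro connected_punctured_universe) auto
        show "f z = g z" if "z \<in> {s. Re s > 1}" for z
          using f g that unfolding is_zeta_continuation_def by (blast intro: sums_unique2)
      qed (use f g False in \<open>auto simp: is_zeta_continuation_def intro: open_Re_gt\<close>)
    qed
  qed
  ultimately show ?thesis by blast
qed

lemma riemann_zeta: "is_zeta_continuation riemann_zeta"
  unfolding riemann_zeta_def by (rule theI'[OF riemann_zeta_ex1])

definition nontrivial_zeros :: "complex set" where
  "nontrivial_zeros = {\<rho>. riemann_zeta \<rho> = 0 \<and> 0 < Re \<rho> \<and> Re \<rho> < 1}"

definition riemann_hypothesis :: bool where
  "riemann_hypothesis \<longleftrightarrow> (\<forall>\<rho>\<in>nontrivial_zeros. Re \<rho> = 1 / 2)"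

definition linear_independence_hypothesis :: bool where
  "linear_independence_hypothesis \<longleftrightarrow>
     module.independent (\<lambda>(q::rat) (x::real). of_rat q * x) {\<gamma>. \<gamma> > 0 \<and> (\<exists>\<rho>\<in>nontrivial_zeros. Im \<rho> = \<gamma>)}"

text \<open>\<open>module.independent\<close> carries its meaning only for an actual module, hence:\<close>
lemma vector_space_rat_real: "vector_space (\<lambda>(q::rat) (x::real). of_rat q * x)"
  by unfold_locales (auto simp: algebra_simps of_rat_add of_rat_mult)

text \<open>
  Multiplicities are given by \<^const>\<open>zorder\<close>. The series is real, since the zeros
  are symmetric about the real axis; \<^const>\<open>Re\<close> only changes the type.
\<close>
definition H :: "real \<Rightarrow> real" where
  "H X = Re (\<Sum>\<^sub>\<infinity>\<rho>\<in>nontrivial_zeros.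
            of_int (zorder riemann_zeta \<rho>) * (of_real X powr (\<rho> - 1 / 2) / (\<rho> * (\<rho> + 1))))"

text \<open>
  Riemann's integral: convergence of the Riemann sums as the mesh of the tagged partition
  tends to \<open>0\<close>. By \<open>riemann_integrable_imp_integrable_on\<close> such functions are integrable for the
  library's gauge integral, which is the one used for all integrals.
\<close>
definition riemann_integrable_on ::
    "(real \<Rightarrow> 'a::real_normed_vector) \<Rightarrow> real \<Rightarrow> real \<Rightarrow> bool" where
  "riemann_integrable_on f a b \<longleftrightarrow>
     (\<exists>I. \<forall>e>0. \<exists>d>0. \<forall>p. p tagged_division_of {a..b} \<and> (\<forall>(x, K)\<in>p. diameter K < d) \<longrightarrow>
        norm ((\<Sum>(x, K)\<in>p. measure lborel K *\<^sub>R f x) - I) < e)"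

definition locally_riemann_integrable :: "(real \<Rightarrow> 'a::real_normed_vector) \<Rightarrow> bool" where
  "locally_riemann_integrable f \<longleftrightarrow> (\<forall>a b. a \<le> b \<longrightarrow> riemann_integrable_on f a b)"

lemma riemann_integrable_imp_integrable_on:
  assumes "riemann_integrable_on f a b"
  shows "f integrable_on {a..b}"
proof -
  from assms obtain I where I: "\<And>e. e > 0 \<Longrightarrow> \<exists>d>0. \<forall>p. p tagged_division_of {a..b} \<and>
      (\<forall>(x, K)\<in>p. diameter K < d) \<longrightarrow> norm ((\<Sum>(x, K)\<in>p. measure lborel K *\<^sub>R f x) - I) < e"
    unfolding riemann_integrable_on_def by blast
  have "(f has_integral I) (cbox a b)"
    unfolding has_integral
  proof (intro allI impI)
    fix e :: real assume "e > 0"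
    from I[OF this] obtain d where d: "d > 0"
      "\<And>p. p tagged_division_of {a..b} \<Longrightarrow> \<forall>(x, K)\<in>p. diameter K < d \<Longrightarrow>
         norm ((\<Sum>(x, K)\<in>p. measure lborel K *\<^sub>R f x) - I) < e" by blast
    show "\<exists>\<gamma>. gauge \<gamma> \<and> (\<forall>p. p tagged_division_of cbox a b \<and> \<gamma> fine p \<longrightarrow>
        norm ((\<Sum>(x, K)\<in>p. measure lborel K *\<^sub>R f x) - I) < e)"
    proof (intro exI conjI allI impI)
      show "gauge (\<lambda>x. ball x (d / 3))" using d by (intro gauge_ball) auto
      fix p assume p: "p tagged_division_of cbox a b \<and> (\<lambda>x. ball x (d / 3)) fine p"
      have "diameter K < d" if "(x, K) \<in> p" for x K
      proof -
        have "K \<subseteq> ball x (d / 3)" using p that by (auto simp: fine_def)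
        hence "diameter K \<le> diameter (ball x (d / 3))"
          by (intro diameter_subset) auto
        also have "\<dots> < d" using d(1) by (simp add: diameter_ball)
        finally show ?thesis .
      qed
      thus "norm ((\<Sum>(x, K)\<in>p. measure lborel K *\<^sub>R f x) - I) < e"
        using p by (intro d(2)) auto
    qed
  qed
  thus ?thesis by (auto simp: integrable_on_def)
qed

end

theory Submission
  imports Defs "HOL-Real_Asymp.Real_Asymp" "HOL-Probability.Probability" "HOL-Number_Theory.Prime_Powers"
begin

text \<open>
  Write \<open>H(e\<^sup>t) = \<Sum>\<^sub>\<gamma> r\<^sub>\<gamma> cos (\<gamma> t + \<phi>\<^sub>\<gamma>)\<close>, uniformly in \<open>t\<close>. By independence of the frequencies, the mean value
  of \<open>e\<^sup>i\<^sup>x\<^sup>H\<close> is \<open>\<Prod>\<^sub>\<gamma> J\<^sub>0(x r\<^sub>\<gamma>)\<close>. Four of the factors already make this \<open>O(x\<^sup>-\<^sup>2)\<close>, so it is the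
  characteristic function of a law with a continuous density, which is the limit law of \<open>H(e\<^sup>t)\<close>;
  continuity of the density passes the convergence on to Riemann integrable test functions.

  It remains to see that \<open>\<Phi>(H(e\<^sup>t))\<close> is integrable at all: \<open>\<Phi>\<close> is in general only Lebesgue measurable, so
  continuity of \<open>H(e\<^sup>t)\<close> does not suffice. The explicit formula shows that \<open>H(e\<^sup>t)\<close> is analytic
  between the logarithms of consecutive integers, so on each such interval it is constant or
  preimages of null sets are null sets.
  Its corner at \<open>ln 2\<close> also shows that there are infinitely many zeros.
\<close>

section \<open>The theta series\<close>

text \<open>The proof uses no estimate for the number of zeros up to a given height and no contour
  integral. As a function of \<open>(s - 1/2)\<^sup>2\<close>, \<open>xi\<close> is entire of order
  1/2, so its logarithmic derivative in that variable is a limit of sums over zeros in growing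
  discs, without correction term. Under the Riemann hypothesis these zeros are negative reals; at
  positive reals all terms are positive and the limit is an absolutely convergent sum, with which
  the series of \<open>H\<close> is compared. Non-vanishing on Re s = 1 is needed so that the zeros
  of \<open>xi\<close> are exactly those counted by \<open>H\<close>. The weight 1 / (\<rho> (\<rho>
  + 1)) makes both sides of the explicit formula continuous in \<open>t\<close>, and bounded after
  damping, so that comparing Laplace transforms at real points of the half-plane of convergence is
  enough. Four factors are taken because each Bessel factor decays like |x|^(-1/2). Linear
  independence enters through integer combinations of ordinates: these are the frequencies of
  trigonometric polynomials, and only the trivial combination has a nonzero mean.\<close>

lemma sums_integral_uniform:
  fixes f :: "nat \<Rightarrow> real \<Rightarrow> 'a::euclidean_space"
  assumes cont: "\<And>n. continuous_on {a..b} (f n)"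
    and bd: "\<And>n y. y \<in> {a..b} \<Longrightarrow> norm (f n y) \<le> M n"
    and M: "summable M"
  shows "continuous_on {a..b} (\<lambda>y. \<Sum>n. f n y)"
    and "(\<lambda>n. integral {a..b} (f n)) sums integral {a..b} (\<lambda>y. \<Sum>n. f n y)"
proof -
  have ul: "uniform_limit {a..b} (\<lambda>N y. \<Sum>n<N. f n y) (\<lambda>y. \<Sum>n. f n y) sequentially"
    by (rule Weierstrass_m_test[OF bd M])
  have c: "continuous_on {a..b} (\<lambda>y. \<Sum>n<N. f n y)" for N
    by (intro continuous_intros cont)
  show "continuous_on {a..b} (\<lambda>y. \<Sum>n. f n y)"
    by (rule uniform_limit_theorem[OF always_eventually ul]) (auto intro!: c)
  have "(\<lambda>N. integral {a..b} (\<lambda>y. \<Sum>n<N. f n y)) \<longlonglongrightarrow> integral {a..b} (\<lambda>y. \<Sum>n. f n y)"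
  proof -
    obtain I J where I: "\<And>n. ((\<lambda>y. \<Sum>n<n. f n y) has_integral I n) {a..b}"
       and J: "((\<lambda>y. \<Sum>n. f n y) has_integral J) {a..b}" and IJ: "I \<longlonglongrightarrow> J"
      using uniform_limit_integral[OF ul c] by auto
    have "integral {a..b} (\<lambda>y. \<Sum>n<N. f n y) = I N" for N by (rule integral_unique[OF I])
    thus ?thesis using IJ by (simp add: integral_unique[OF J])
  qed
  moreover have "integral {a..b} (\<lambda>y. \<Sum>n<N. f n y) = (\<Sum>n<N. integral {a..b} (f n))" for N
    by (rule integral_sum) (auto intro!: integrable_continuous_real cont)
  ultimately show "(\<lambda>n. integral {a..b} (f n)) sums integral {a..b} (\<lambda>y. \<Sum>n. f n y)"
    by (simp add: sums_def)
qed

text \<open>The powers of \<open>cos (pi * y)\<close> concentrate at 0: compared with their size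
  near 0 they are exponentially small away from it. A positive value of \<open>g\<close> at 0 would
  therefore make the integral positive for large \<open>n\<close>.\<close>

lemma cos_kernel_pos_false:
  fixes g :: "real \<Rightarrow> real"
  assumes cont: "continuous_on {-1/2..1/2} g"
    and zero: "\<And>n. integral {-1/2..1/2} (\<lambda>y. g y * cos (pi * y) ^ (2 * n)) = 0"
  shows "\<not> g 0 > 0"
proof
  assume pos: "g 0 > 0"
  define c where "c = g 0"
  have c: "c > 0" using pos by (simp add: c_def)
  obtain M where M: "\<And>y. y \<in> {-1/2..1/2} \<Longrightarrow> \<bar>g y\<bar> \<le> M"
    using compact_imp_bounded[OF compact_continuous_image[OF cont compact_Icc]]
    unfolding bounded_iff real_norm_def by blast
  have M0: "M > 0" using M[of 0] pos by simp
  obtain d where d: "d > 0" "\<And>y. y \<in> {-1/2..1/2} \<Longrightarrow> \<bar>y\<bar> < d \<Longrightarrow> \<bar>g y - g 0\<bar> < c / 2"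
    using cont[unfolded continuous_on_iff, rule_format, of 0 "c/2"] c by (auto simp: dist_real_def)
  \<comment> \<open>Two radii are used. Up to \<open>e / 2\<close> the kernel is at least
    \<open>q' ^ n\<close> and \<open>g\<close> at least \<open>c / 2\<close>; beyond
    \<open>e\<close> the kernel is at most \<open>q ^ n\<close>; in between only the sign of the
    integrand matters.\<close>
  define e where "e = min (d / 2) (1 / 4)"
  have e: "e > 0" "e \<le> 1 / 4" "e < d" using d(1) by (auto simp: e_def)
  define q where "q = (cos (pi * e))\<^sup>2"
  define q' where "q' = (cos (pi * (e / 2)))\<^sup>2"
  have pe: "pi * e > 0" "pi * e \<le> pi / 4" using e by auto
  have cos_pos: "cos (pi * e) > 0"
  proof (rule cos_gt_zero_pi)
    show "- (pi / 2) < pi * e" using pe pi_gt_zero by linarith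
    show "pi * e < pi / 2" using pe pi_gt_zero by linarith
  qed
  have "cos (pi * e) < cos (pi * (e / 2))"
    using e by (intro cos_monotone_0_pi) auto
  hence qq: "0 < q" "q < q'" using cos_pos
    by (auto simp: q_def q'_def intro!: power_strict_mono)
  have ge: "g y * cos (pi * y) ^ (2 * n) \<ge> (c / 2) * q' ^ n * indicator {-e/2..e/2} y - M * q ^ n"
    if y: "y \<in> {-1/2..1/2}" for y n
  proof -
    have cy: "cos (pi * y) = cos (pi * \<bar>y\<bar>)" by (cases "y \<ge> 0") auto
    have c0: "cos (pi * y) \<ge> 0"
    proof (rule cos_ge_zero)
      show "- (pi / 2) \<le> pi * y" using mult_left_mono[of "-1/2" y pi] y by simp
      show "pi * y \<le> pi / 2" using mult_left_mono[of y "1/2" pi] y by simp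
    qed
    have P: "cos (pi * y) ^ (2 * n) = ((cos (pi * y))\<^sup>2) ^ n" by (simp add: power_mult)
    have Pn: "cos (pi * y) ^ (2 * n) \<ge> 0" unfolding P by simp
    show ?thesis
    proof (cases "\<bar>y\<bar> \<le> e")
      case True
      hence "\<bar>g y - c\<bar> < c / 2" using d(2)[OF y] e by (simp add: c_def)
      hence gy: "g y \<ge> c / 2" by (simp only: abs_less_iff) linarith
      show ?thesis
      proof (cases "y \<in> {-e/2..e/2}")
        case True
        hence "\<bar>y\<bar> \<le> e / 2" by auto
        hence "cos (pi * \<bar>y\<bar>) \<ge> cos (pi * (e / 2))"
          using e by (intro cos_monotone_0_pi_le) auto
        hence "(cos (pi * y))\<^sup>2 \<ge> q'" unfolding q'_def cy

        proof (intro power_mono cos_ge_zero)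
          show "- (pi / 2) \<le> pi * (e / 2)" "pi * (e / 2) \<le> pi / 2" using pe pi_gt_zero by linarith+
        qed
        hence "cos (pi * y) ^ (2 * n) \<ge> q' ^ n" unfolding P using qq by (intro power_mono) auto
        hence "g y * cos (pi * y) ^ (2 * n) \<ge> (c / 2) * q' ^ n"
          using gy c qq by (intro mult_mono) auto
        moreover have "M * q ^ n \<ge> 0" using M0 qq by simp
        ultimately show ?thesis using True by simp
      next
        case False
        have "g y * cos (pi * y) ^ (2 * n) \<ge> 0" using gy c Pn by simp
        moreover have "M * q ^ n \<ge> 0" using M0 qq by simp
        ultimately show ?thesis using False by simp
      qed
    next
      case False
      hence F: "y \<notin> {-e/2..e/2}" using e by auto
      have "cos (pi * \<bar>y\<bar>) \<le> cos (pi * e)"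
        using e y False by (intro cos_monotone_0_pi_le) (auto simp: field_simps)
      hence "(cos (pi * y))\<^sup>2 \<le> q" unfolding q_def using c0 cy by (intro power_mono) auto
      hence Q: "cos (pi * y) ^ (2 * n) \<le> q ^ n" unfolding P by (intro power_mono) auto
      have "\<bar>g y * cos (pi * y) ^ (2 * n)\<bar> \<le> M * q ^ n"
        unfolding abs_mult using M[OF y] Q Pn M0 by (intro mult_mono) auto
      thus ?thesis using F by simp
    qed
  qed
  have key: "(c / 2) * q' ^ n * e - M * q ^ n \<le> 0" for n
  proof -
    have "((\<lambda>y. (c / 2) * q' ^ n * indicator {-e/2..e/2} y) has_integral (c / 2) * q' ^ n * e) {-1/2..1/2}"
    proof -
      have "((\<lambda>y. 1) has_integral (1::real) * e) {-e/2..e/2}"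
        using has_integral_const_real[of "1::real" "-e/2" "e/2"] e by simp
      hence "((\<lambda>y. if y \<in> {-e/2..e/2} then 1 else 0) has_integral e) {-1/2..1/2}"
        using e by (subst has_integral_restrict) auto
      hence "((\<lambda>y. indicator {-e/2..e/2} y) has_integral e) {-1/2..1/2}"
        by (simp add: indicator_def of_bool_def cong: if_cong)
      thus ?thesis by (rule has_integral_mult_right)
    qed
    moreover have "((\<lambda>y::real. M * q ^ n) has_integral M * q ^ n) {-1/2..1/2}"
      using has_integral_const_real[of "M * q ^ n" "-1/2" "1/2"] by simp
    ultimately have A: "((\<lambda>y. (c / 2) * q' ^ n * indicator {-e/2..e/2} y - M * q ^ n)
        has_integral ((c / 2) * q' ^ n * e - M * q ^ n)) {-1/2..1/2}"
      by (rule has_integral_diff)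
    have "(\<lambda>y. g y * cos (pi * y) ^ (2 * n)) integrable_on {-1/2..1/2}"
      by (intro integrable_continuous_real continuous_intros cont)
    hence B: "((\<lambda>y. g y * cos (pi * y) ^ (2 * n)) has_integral 0) {-1/2..1/2}"
      using zero[of n] by (metis has_integral_integral)
    show ?thesis by (rule has_integral_le[OF A B]) (use ge in blast)
  qed
  have "(\<lambda>n. (q / q') ^ n) \<longlonglongrightarrow> 0"
    using qq by (intro LIMSEQ_power_zero) auto
  moreover have "c * e / (2 * M) > 0" using c e M0 by simp
  ultimately obtain n where "(q / q') ^ n < c * e / (2 * M)"
    using order_tendstoD(2) eventually_happens' sequentially_bot by metis
  hence "M * q ^ n < (c / 2) * q' ^ n * e"
    using M0 qq by (simp add: power_divide field_simps)
  thus False using key[of n] by simp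
qed

text \<open>Since cos^2 (pi y) = (1 + cos (2 pi y)) / 2, multiplication by it mixes the coefficient
  at \<open>k\<close> with those at \<open>k - 1\<close> and \<open>k + 1\<close>. Hence
  \<open>g\<close> times any power of the kernel has vanishing coefficients too, and the kernel
  isolates the value at 0. Pointwise convergence of a Fourier series is never invoked.\<close>

lemma cos_coeffs_zero_imp_zero:
  fixes g :: "real \<Rightarrow> real"
  assumes cont: "continuous_on {-1/2..1/2} g"
    and zero: "\<And>k::int. integral {-1/2..1/2} (\<lambda>y. g y * cos (2 * pi * k * y)) = 0"
  shows "g 0 = 0"
proof -
  have *: "integral {-1/2..1/2} (\<lambda>y. g y * cos (pi * y) ^ (2 * n) * cos (2 * pi * real_of_int k * y)) = 0"
    for n k
  proof (induction n arbitrary: k)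
    case (Suc n)
    let ?G = "\<lambda>k y. g y * cos (pi * y) ^ (2 * n) * cos (2 * pi * real_of_int k * y)"
    have "(\<lambda>y. g y * cos (pi * y) ^ (2 * Suc n) * cos (2 * pi * k * y)) =
      (\<lambda>y. 1/2 * ?G k y + (1/4 * ?G (k+1) y + 1/4 * ?G (k-1) y))"
    proof
      fix y
      have "(cos (pi * y))\<^sup>2 = (1 + cos (2 * pi * y)) / 2"
        using cos_double_cos[of "pi * y"] by (simp add: mult.assoc)
      moreover have "cos (2 * pi * y) * cos (2 * pi * k * y) =
          (cos (2 * pi * (k+1) * y) + cos (2 * pi * (k-1) * y)) / 2"
        by (simp add: cos_times_cos algebra_simps) (metis cos_minus minus_diff_eq add.commute)
      moreover have "a = (1 + b) / 2 \<Longrightarrow> b * c = d / 2 \<Longrightarrow> a * c = 1/2 * c + 1/4 * d" for a b c d :: real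
        by (simp only:) (simp add: distrib_right add_divide_distrib)
      ultimately have "(cos (pi * y))\<^sup>2 * cos (2 * pi * k * y) = 1/2 * cos (2 * pi * k * y) +
         1/4 * (cos (2 * pi * (k+1) * y) + cos (2 * pi * (k-1) * y))"
        by blast
      hence "g y * cos (pi * y) ^ (2 * n) * ((cos (pi * y))\<^sup>2 * cos (2 * pi * k * y)) =
         g y * cos (pi * y) ^ (2 * n) * (1/2 * cos (2 * pi * k * y) +
         1/4 * (cos (2 * pi * (k+1) * y) + cos (2 * pi * (k-1) * y)))" by simp
      thus "g y * cos (pi * y) ^ (2 * Suc n) * cos (2 * pi * k * y) =
        1/2 * ?G k y + (1/4 * ?G (k+1) y + 1/4 * ?G (k-1) y)"
        by (simp add: power2_eq_square algebra_simps)
    qed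
    moreover have "?G k integrable_on {-1/2..1/2}" for k
      by (intro integrable_continuous_real continuous_intros cont)
    hence "((\<lambda>y. c * ?G k y) has_integral c * 0) {-1/2..1/2}" for k c
      using Suc.IH[of k] by (intro has_integral_mult_right) (metis (mono_tags, lifting) has_integral_integral)
    note h = this[of "1/2" k] this[of "1/4" "k+1"] this[of "1/4" "k-1"]
    have "((\<lambda>y. 1/2 * ?G k y + (1/4 * ?G (k+1) y + 1/4 * ?G (k-1) y)) has_integral
             (1/2 * 0 + (1/4 * 0 + 1/4 * 0))) {-1/2..1/2}"
      by (rule has_integral_add[OF h(1) has_integral_add[OF h(2) h(3)]])
    ultimately show ?case by (simp add: integral_unique)
  qed (use zero in simp)
  have z: "integral {-1/2..1/2} (\<lambda>y. g y * cos (pi * y) ^ (2 * n)) = 0" for n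
    using *[of n 0] by simp
  hence "\<not> g 0 > 0" by (rule cos_kernel_pos_false[OF cont])
  moreover have "\<not> - g 0 > 0"
    using cos_kernel_pos_false[of "\<lambda>y. - g y"] cont z by (auto intro: continuous_intros)
  ultimately show ?thesis by simp
qed

text \<open>This is the characteristic function of the standard normal law after scaling by
  \<open>c\<close>, chosen so that the density becomes exp (- pi x y^2) up to a constant
  factor.\<close>

lemma gaussian_cos_integral:
  fixes x k :: real
  assumes x: "x > 0"
  shows "integrable lborel (\<lambda>y. exp (- pi * x * y\<^sup>2) * cos (2 * pi * k * y))"
    and "integral\<^sup>L lborel (\<lambda>y. exp (- pi * x * y\<^sup>2) * cos (2 * pi * k * y)) = exp (- pi * k\<^sup>2 / x) / sqrt x"
proof -
  define c where "c = sqrt (2 * pi * x)"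
  define t where "t = 2 * pi * k / c"
  have c: "c > 0" using x by (simp add: c_def)
  have c2: "c\<^sup>2 = 2 * pi * x" using x by (simp add: c_def)
  have int: "integrable lborel (\<lambda>u. std_normal_density u *\<^sub>R iexp (t * u))"
    by (rule Bochner_Integration.integrable_bound[OF integrable_normal_density]) (auto simp: norm_mult)
  have "char std_normal_distribution t = (LINT u|lborel. std_normal_density u *\<^sub>R iexp (t * u))"
    unfolding char_def by (subst integral_density) auto
  hence "(LINT u|lborel. std_normal_density u *\<^sub>R iexp (t * u)) = complex_of_real (exp (- (t\<^sup>2) / 2))"
    by (simp add: char_std_normal_distribution)
  hence "Re (LINT u|lborel. std_normal_density u *\<^sub>R iexp (t * u)) = exp (- (t\<^sup>2) / 2)" by simp
  hence I: "(LINT u|lborel. std_normal_density u * cos (t * u)) = exp (- (t\<^sup>2) / 2)"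
    by (subst (asm) integral_Re[OF int, symmetric]) (simp add: Re_exp)
  have int': "integrable lborel (\<lambda>u. std_normal_density u * cos (t * u))"
    using integrable_Re[OF int] by (simp add: Re_exp)
  have eq: "std_normal_density (0 + c * y) * cos (t * (0 + c * y)) =
      exp (- pi * x * y\<^sup>2) * cos (2 * pi * k * y) / sqrt (2 * pi)" for y
    using c by (simp add: std_normal_density_def power_mult_distrib c2 t_def mult.assoc c_def [symmetric] )
  have "integrable lborel (\<lambda>y. exp (- pi * x * y\<^sup>2) * cos (2 * pi * k * y) / sqrt (2 * pi))"
    using lborel_integrable_real_affine[OF int', of c 0] c unfolding eq by simp
  hence "integrable lborel (\<lambda>y. exp (- pi * x * y\<^sup>2) * cos (2 * pi * k * y) / sqrt (2 * pi) * sqrt (2 * pi))"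
    by (rule integrable_mult_left)
  thus "integrable lborel (\<lambda>y. exp (- pi * x * y\<^sup>2) * cos (2 * pi * k * y))" by simp
  have "exp (- (t\<^sup>2) / 2) = c * (LINT y|lborel. exp (- pi * x * y\<^sup>2) * cos (2 * pi * k * y) / sqrt (2 * pi))"
    using lborel_integral_real_affine[of c "\<lambda>u. std_normal_density u * cos (t * u)" 0] c
    unfolding eq I by simp
  also have "\<dots> = sqrt x * (LINT y|lborel. exp (- pi * x * y\<^sup>2) * cos (2 * pi * k * y))"
    by (simp add: c_def real_sqrt_mult)
  finally have "integral\<^sup>L lborel (\<lambda>y. exp (- pi * x * y\<^sup>2) * cos (2 * pi * k * y)) = exp (- (t\<^sup>2) / 2) / sqrt x"
    using x by (simp add: field_simps)
  also have "- (t\<^sup>2) / 2 = - pi * k\<^sup>2 / x"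
    using x by (simp add: t_def power_divide power_mult_distrib c2) (simp add: power2_eq_square field_simps)
  finally show "integral\<^sup>L lborel (\<lambda>y. exp (- pi * x * y\<^sup>2) * cos (2 * pi * k * y)) = exp (- pi * k\<^sup>2 / x) / sqrt x" .
qed

text \<open>Half of the theta series without its constant term: \<open>1 + 2 * omega x\<close> is
  the sum of exp (- pi x n^2) over all integers \<open>n\<close>.\<close>

definition omega :: "real \<Rightarrow> real" where
  "omega x = (\<Sum>n. exp (- pi * x * (real (Suc n))\<^sup>2))"

lemma omega_summand_le:
  assumes "x > 0"
  shows "exp (- pi * x * (real (Suc n))\<^sup>2) \<le> exp (- pi * x) * exp (- pi * x) ^ n"
proof -
  have "real (Suc n) * 1 \<le> real (Suc n) * real (Suc n)" by (intro mult_left_mono) auto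
  hence "pi * x * real (Suc n) \<le> pi * x * (real (Suc n))\<^sup>2"
    using assms by (intro mult_left_mono) (auto simp: power2_eq_square)
  hence "exp (- pi * x * (real (Suc n))\<^sup>2) \<le> exp (- (pi * x) * real (Suc n))" by simp
  also have "\<dots> = exp (- pi * x) * exp (- pi * x) ^ n"
    by (simp add: algebra_simps exp_add [symmetric] flip: exp_of_nat_mult)
  finally show ?thesis .
qed

lemma omega_geometric:
  assumes "x > 0"
  shows "summable (\<lambda>n. exp (- pi * x) * exp (- pi * x) ^ n)"
    and "(\<Sum>n. exp (- pi * x) * exp (- pi * x) ^ n) = exp (- pi * x) / (1 - exp (- pi * x))"
proof -
  have *: "norm (exp (- pi * x)) < 1" using assms by simp
  show "summable (\<lambda>n. exp (- pi * x) * exp (- pi * x) ^ n)"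
    by (intro summable_mult summable_geometric *)
  show "(\<Sum>n. exp (- pi * x) * exp (- pi * x) ^ n) = exp (- pi * x) / (1 - exp (- pi * x))"
    using suminf_geometric[OF *] by (subst suminf_mult) (use * in \<open>auto intro!: summable_geometric\<close>)
qed

lemma summable_omega:
  assumes "x > 0"
  shows "summable (\<lambda>n. exp (- pi * x * (real (Suc n))\<^sup>2))"
  by (rule summable_comparison_test'[OF omega_geometric(1)[OF assms], of 0])
     (use omega_summand_le[OF assms] in auto)

lemma omega_nonneg: "x > 0 \<Longrightarrow> omega x \<ge> 0"
  unfolding omega_def by (intro suminf_nonneg summable_omega) auto

lemma omega_le:
  assumes "x \<ge> 1"
  shows "omega x \<le> 2 * exp (- x)"
proof -
  have x: "x > 0" using assms by simp
  have "omega x \<le> exp (- pi * x) / (1 - exp (- pi * x))"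
    unfolding omega_def omega_geometric(2)[OF x, symmetric]
    by (intro suminf_le omega_summand_le summable_omega omega_geometric x)
  also have "exp (- pi * x) \<le> 1 / 2"
  proof -
    have "pi * x \<ge> 1 * 1" using assms pi_gt3 by (intro mult_mono) auto
    hence "exp (- pi * x) \<le> exp (-1)" by simp
    also have "\<dots> \<le> 1 / (2::real)" using exp_ge_add_one_self[of 1] by (simp add: exp_minus field_simps)
    finally show ?thesis .
  qed
  hence "exp (- pi * x) / (1 - exp (- pi * x)) \<le> exp (- pi * x) / (1 / 2)"
    using x by (intro divide_left_mono) (auto intro!: mult_pos_pos)
  also have "\<dots> \<le> 2 * exp (- x)"
    using assms pi_gt3 mult_right_mono[of 1 pi x] by simp
  finally show ?thesis .
qed

lemma continuous_on_omega: "continuous_on {0<..} omega"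
proof -
  have "continuous_on {a..b} omega" if "a > 0" for a b
  proof -
    have le: "norm (exp (- pi * x * (real (Suc n))\<^sup>2)) \<le> exp (- pi * a * (real (Suc n))\<^sup>2)"
      if "x \<in> {a..b}" for x n
      using that by (auto intro!: mult_right_mono)
    show ?thesis unfolding omega_def [abs_def]
      by (rule sums_integral_uniform(1)[OF _ le summable_omega[OF \<open>a > 0\<close>]]) (intro continuous_intros)
  qed
  hence "isCont omega x" if "x > 0" for x
    by (intro continuous_on_interior[of "{x/2..2*x}"]) (use that in auto)
  thus ?thesis by (simp add: continuous_at_imp_continuous_on)
qed

text \<open>A lower bound linear in the shift turns the shifted Gaussians of the periodisation into
  a geometric series, uniformly over one period.\<close>

lemma theta_lattice_bound:
  assumes y: "y \<in> {-1/2..1/2::real}"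
  shows "(y + real (Suc n))\<^sup>2 \<ge> real (Suc n) / 4" "(y - real (Suc n))\<^sup>2 \<ge> real (Suc n) / 4"
proof -
  have *: "(real (Suc n) - 1/2)\<^sup>2 \<ge> real (Suc n) / 4"
    by (simp add: power2_eq_square algebra_simps)
  have "(y + real (Suc n))\<^sup>2 \<ge> (real (Suc n) - 1/2)\<^sup>2"
    using y by (intro power_mono) auto
  thus "(y + real (Suc n))\<^sup>2 \<ge> real (Suc n) / 4" using * by linarith
  have "(real (Suc n) - y)\<^sup>2 \<ge> (real (Suc n) - 1/2)\<^sup>2"
    using y by (intro power_mono) auto
  thus "(y - real (Suc n))\<^sup>2 \<ge> real (Suc n) / 4" using * by (simp add: power2_commute)
qed

lemma cos_orthogonal:
  fixes k m :: int
  shows "integral {-1/2..1/2} (\<lambda>y. cos (2 * pi * k * y)) = (if k = 0 then 1 else 0)"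
proof (cases "k = 0")
  case False
  have "((\<lambda>y. cos (2 * pi * k * y)) has_integral
     (sin (2 * pi * k * (1/2)) / (2 * pi * k) - sin (2 * pi * k * (-1/2)) / (2 * pi * k))) {-1/2..1/2}"
    using False by (intro fundamental_theorem_of_calculus[of "-1/2" "1/2" "\<lambda>y. sin (2 * pi * k * y) / (2 * pi * k)"])
      (auto intro!: derivative_eq_intros simp flip: has_real_derivative_iff_has_vector_derivative)
  moreover have "sin (pi * k) = 0" using sin_int_times_real[of k pi] by (simp add: mult.commute)
  ultimately show ?thesis using False by (simp add: integral_unique)
qed simp

lemma cos_orthogonal2:
  fixes k :: int and m :: nat
  shows "integral {-1/2..1/2} (\<lambda>y. cos (2 * pi * real (Suc m) * y) * cos (2 * pi * k * y)) =
    (if \<bar>k\<bar> = int (Suc m) then 1/2 else 0)"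
proof -
  have eq: "cos (2 * pi * real (Suc m) * y) * cos (2 * pi * k * y) =
     1/2 * cos (2 * pi * (int (Suc m) - k) * y) + 1/2 * cos (2 * pi * (int (Suc m) + k) * y)" for y
    unfolding cos_times_cos by (simp add: algebra_simps)
  have hi: "((\<lambda>y. cos (2 * pi * real_of_int j * y)) has_integral (if j = 0 then 1 else 0)) {-1/2..1/2}" for j
    unfolding cos_orthogonal[of j, symmetric]
    by (intro integrable_integral integrable_continuous_real continuous_intros)
  have "((\<lambda>y. 1/2 * cos (2 * pi * (int (Suc m) - k) * y) + 1/2 * cos (2 * pi * (int (Suc m) + k) * y))
    has_integral (1/2 * (if int (Suc m) - k = 0 then 1 else 0) + 1/2 * (if int (Suc m) + k = 0 then 1 else 0))) {-1/2..1/2}"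
    by (intro has_integral_add has_integral_mult_right hi)
  hence "integral {-1/2..1/2} (\<lambda>y. 1/2 * cos (2 * pi * (int (Suc m) - k) * y) + 1/2 * cos (2 * pi * (int (Suc m) + k) * y))
    = (1/2 * (if int (Suc m) - k = 0 then 1 else 0) + 1/2 * (if int (Suc m) + k = 0 then 1 else 0))"
    by (rule integral_unique)
  also have "\<dots> = (if \<bar>k\<bar> = int (Suc m) then 1/2 else 0)" by auto
  finally show ?thesis unfolding eq .
qed

text \<open>
  Both sides are values at \<open>0\<close> of functions on \<open>[-1/2, 1/2]\<close> with the same cosine coefficients:
  the periodised Gaussian and its Fourier series.
\<close>
lemma omega_inversion:
  assumes x: "x > 0"
  shows "1 + 2 * omega (1 / x) = sqrt x * (1 + 2 * omega x)"
proof -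
  define G where "G = (\<lambda>y::real. exp (- pi * x * y\<^sup>2))"
  \<comment> \<open>The shifts by \<open>n\<close> and by \<open>- n\<close> are taken together, so
    that the partial sums of the integrals over one period are integrals over symmetric
    intervals.\<close>
  define a where "a = (\<lambda>n y. case n of 0 \<Rightarrow> G y | Suc m \<Rightarrow> G (y + real n) + G (y - real n))"
  define M where "M = (\<lambda>n::nat. 2 * exp (- pi * x / 4) ^ n)"
  have M: "summable M" unfolding M_def by (intro summable_mult summable_geometric) (use x in auto)
  have Gle: "G z \<le> exp (- pi * x / 4) ^ n" if "z\<^sup>2 \<ge> real n / 4" for z n
  proof -
    have "pi * x * (real n / 4) \<le> pi * x * z\<^sup>2" using that x by (intro mult_left_mono) auto
    hence "G z \<le> exp (real n * (- pi * x / 4))" by (simp add: G_def mult_ac)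
    thus ?thesis by (simp only: exp_of_nat_mult)
  qed
  have abd: "norm (a n y) \<le> M n" if y: "y \<in> {-1/2..1/2}" for n y
  proof (cases n)
    case 0
    have "0 \<le> G y" "G y \<le> 1" using x by (simp_all add: G_def)
    thus ?thesis using 0 by (simp add: a_def M_def)
  next
    case (Suc m)
    have "G (y + real n) + G (y - real n) \<le> M n" unfolding M_def
      using Gle[OF theta_lattice_bound(1)[OF y, of m]] Gle[OF theta_lattice_bound(2)[OF y, of m]] Suc by simp
    moreover have "G (y + real n) + G (y - real n) \<ge> 0" by (simp add: G_def)
    ultimately show ?thesis using Suc by (simp add: a_def)
  qed
  have acont: "continuous_on A (a n)" for A n
    by (cases n) (auto simp: a_def G_def intro!: continuous_intros)
  define f where "f = (\<lambda>y. \<Sum>n. a n y)"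
  have fcont: "continuous_on {-1/2..1/2} f"
    unfolding f_def by (rule sums_integral_uniform(1)[OF acont abd M])
  define c where "c = (\<lambda>k::real. exp (- pi * k\<^sup>2 / x) / sqrt x)"
  have fcoeff: "integral {-1/2..1/2} (\<lambda>y. f y * cos (2 * pi * k * y)) = c (real_of_int k)" for k :: int
  proof -
    let ?C = "\<lambda>y. cos (2 * pi * k * y)"
    let ?F = "\<lambda>y. G y * ?C y"
    have F_int: "?F integrable_on S" if "\<exists>u v. S = {u..v}" for S
      using that by (auto simp: G_def intro!: integrable_continuous_real continuous_intros)
    have Cper: "?C (y + real n) = ?C y" "?C (y - real n) = ?C y" for y n
    proof -
      have "2 * pi * k * real n = 2 * pi * of_int (k * int n)" by simp
      hence s: "sin (2 * pi * k * real n) = 0" and c: "cos (2 * pi * k * real n) = 1"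
        using sin_int_2pin[of "k * int n"] cos_int_2pin[of "k * int n"] by (simp_all only:)
      show "?C (y + real n) = ?C y" by (simp only: distrib_left cos_add s c)
      show "?C (y - real n) = ?C y" by (simp only: right_diff_distrib cos_diff s c)
    qed
    have b: "norm (a n y * ?C y) \<le> M n" if y: "y \<in> {-1/2..1/2}" for n y
    proof -
      have "norm (a n y * ?C y) \<le> norm (a n y) * 1" unfolding norm_mult by (intro mult_left_mono) auto
      thus ?thesis using abd[OF y, of n] by simp
    qed
    have sm: "summable (\<lambda>n. a n y)" if "y \<in> {-1/2..1/2}" for y
      by (rule summable_comparison_test'[OF M, of 0]) (use abd[OF that] in auto)
    have "(\<lambda>n. integral {-1/2..1/2} (\<lambda>y. a n y * ?C y)) sums integral {-1/2..1/2} (\<lambda>y. \<Sum>n. a n y * ?C y)"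
      by (rule sums_integral_uniform(2)[OF _ b M]) (intro continuous_intros acont)
    moreover have "integral {-1/2..1/2} (\<lambda>y. \<Sum>n. a n y * ?C y) = integral {-1/2..1/2} (\<lambda>y. f y * ?C y)"
      unfolding f_def by (intro integral_cong suminf_mult2 [symmetric] sm) auto
    ultimately have S1: "(\<lambda>N. \<Sum>n<N. integral {-1/2..1/2} (\<lambda>y. a n y * ?C y)) \<longlonglongrightarrow>
        integral {-1/2..1/2} (\<lambda>y. f y * ?C y)" by (simp add: sums_def)
    have S2: "(\<Sum>n<Suc N. integral {-1/2..1/2} (\<lambda>y. a n y * ?C y)) = integral {-(real N + 1/2)..real N + 1/2} ?F" for N
    proof (induction N)
      case (Suc N)
      let ?n = "real (Suc N)"
      have "integral {-1/2..1/2} (\<lambda>y. a (Suc N) y * ?C y) =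
        integral {-1/2..1/2} (\<lambda>y. (?F \<circ> (\<lambda>y. y + ?n)) y + (?F \<circ> (\<lambda>y. y + (- ?n))) y)"
        by (intro integral_cong) (simp add: a_def distrib_right Cper(1)[of _ "Suc N"] Cper(2)[of _ "Suc N"] del: of_nat_Suc)
      also have "\<dots> = integral {-1/2..1/2} (?F \<circ> (\<lambda>y. y + ?n)) + integral {-1/2..1/2} (?F \<circ> (\<lambda>y. y + (- ?n)))"
        by (intro integral_add) (auto simp: o_def G_def intro!: integrable_continuous_real continuous_intros)
      also have "\<dots> = integral {-1/2 + ?n..1/2 + ?n} ?F + integral {-1/2 + (-?n)..1/2 + (-?n)} ?F"
        by (subst (1 2) integral_shift) (auto simp: G_def intro!: continuous_intros)
      also have "-1/2 + ?n = real N + 1/2" by simp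
      also have "1/2 + ?n = ?n + 1/2" by simp
      also have "-1/2 + (-?n) = -(?n + 1/2)" by simp
      also have "1/2 + (-?n) = -(real N + 1/2)" by simp
      finally have e1: "integral {-1/2..1/2} (\<lambda>y. a (Suc N) y * ?C y) =
        integral {real N + 1/2..?n + 1/2} ?F + integral {-(?n + 1/2)..-(real N + 1/2)} ?F" .
      have e2: "integral {-(?n + 1/2)..-(real N + 1/2)} ?F + integral {-(real N + 1/2)..real N + 1/2} ?F =
          integral {-(?n + 1/2)..real N + 1/2} ?F"
        by (rule Henstock_Kurzweil_Integration.integral_combine) (auto intro!: F_int)
      have e3: "integral {-(?n + 1/2)..real N + 1/2} ?F + integral {real N + 1/2..?n + 1/2} ?F =
          integral {-(?n + 1/2)..?n + 1/2} ?F"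
        by (rule Henstock_Kurzweil_Integration.integral_combine) (auto intro!: F_int)
      show ?case using Suc.IH e1 e2 e3 by simp
    qed (simp add: a_def)
    have Fint: "integrable lborel ?F" and FI: "integral\<^sup>L lborel ?F = c k"
      using gaussian_cos_integral[OF x, of k] by (simp_all add: G_def c_def)
    let ?I = "\<lambda>N::nat. {-(real N + 1/2)..real N + 1/2}"
    have U: "(\<Union>N. ?I N) = (UNIV :: real set)"
    proof -
      have "z \<in> (\<Union>N. ?I N)" for z :: real
      proof -
        obtain N where "real N \<ge> \<bar>z\<bar>" using real_arch_simple by blast
        hence "z \<in> ?I N" by auto
        thus ?thesis by blast
      qed
      thus ?thesis by blast
    qed
    have "(\<lambda>N. set_lebesgue_integral lborel (?I N) ?F) \<longlonglongrightarrow> set_lebesgue_integral lborel (\<Union>N. ?I N) ?F"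
      by (rule set_integral_cont_up) (use Fint in \<open>auto simp only: incseq_def U set_integrable_def sets_lborel
         indicator_UNIV scaleR_one atLeastatMost_subset_iff borel_closed closed_atLeastAtMost of_nat_le_iff add_right_mono neg_le_iff_le intro!: add_right_mono\<close>)
    also have "set_lebesgue_integral lborel (\<Union>N. ?I N) ?F = c k"
      unfolding U set_lebesgue_integral_def using FI by simp
    also have "(\<lambda>N. set_lebesgue_integral lborel (?I N) ?F) = (\<lambda>N. integral (?I N) ?F)"
      by (intro ext set_borel_integral_eq_integral(2) borel_integrable_compact[unfolded set_integrable_def [symmetric]])
         (auto simp: G_def intro!: continuous_intros)
    finally have "(\<lambda>N. \<Sum>n<Suc N. integral {-1/2..1/2} (\<lambda>y. a n y * ?C y)) \<longlonglongrightarrow> c k"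
      unfolding S2 .
    from LIMSEQ_unique[OF LIMSEQ_Suc[OF S1] this] show ?thesis .
  qed
  define b where "b = (\<lambda>n y. c (real (Suc n)) * cos (2 * pi * real (Suc n) * y))"
  have c_eq: "c (real (Suc n)) = exp (- pi * (1/x) * (real (Suc n))\<^sup>2) / sqrt x" for n by (simp add: c_def)
  have csum: "summable (\<lambda>n. c (real (Suc n)))"
    unfolding c_eq using summable_omega[of "1/x"] x by (intro summable_divide) auto
  have c0: "c k > 0" for k using x by (simp add: c_def)
  have bbd: "norm (b n y) \<le> c (real (Suc n))" for n y
    unfolding b_def norm_mult using c0[of "real (Suc n)"] by (simp add: abs_mult mult_left_le)
  have bcont: "continuous_on A (b n)" for A n by (auto simp: b_def intro!: continuous_intros)
  \<comment> \<open>The Fourier series of the periodised Gaussian: \<open>c k\<close> is the Fourier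
    transform of \<open>G\<close> at \<open>k\<close>, and the frequencies \<open>k\<close> and
    \<open>- k\<close> share one cosine, whence the factor 2.\<close>
  define S where "S = (\<lambda>y. c 0 + 2 * (\<Sum>n. b n y))"
  have Scont: "continuous_on {-1/2..1/2} S"
    unfolding S_def by (intro continuous_intros sums_integral_uniform(1)[OF bcont bbd csum])
  have Scoeff: "integral {-1/2..1/2} (\<lambda>y. S y * cos (2 * pi * k * y)) = c (real_of_int k)" for k :: int
  proof -
    let ?C = "\<lambda>y. cos (2 * pi * k * y)"
    have bb: "norm (b n y * ?C y) \<le> c (real (Suc n))" for n y
    proof -
      have "norm (b n y * ?C y) \<le> norm (b n y) * 1" unfolding norm_mult by (intro mult_left_mono) auto
      thus ?thesis using bbd[of n y] by simp
    qed
    have sm: "summable (\<lambda>n. b n y)" for y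
      by (rule summable_comparison_test'[OF csum, of 0]) (use bbd in auto)
    have bC: "continuous_on {-1/2..1/2} (\<lambda>y. b n y * ?C y)" for n by (intro continuous_intros bcont)
    have "(\<lambda>n. integral {-1/2..1/2} (\<lambda>y. b n y * ?C y)) sums integral {-1/2..1/2} (\<lambda>y. \<Sum>n. b n y * ?C y)"
      by (rule sums_integral_uniform(2)[OF bC bb csum])
    \<comment> \<open>The index \<open>n\<close> stands for the frequency \<open>n + 1\<close>, so
      the only contribution comes from \<open>n = nat \<bar>k\<bar> - 1\<close>. Its factor 1/2
      cancels the factor 2 in \<open>S\<close>.\<close>
    moreover have "integral {-1/2..1/2} (\<lambda>y. b n y * ?C y) =
        (if n = nat \<bar>k\<bar> - 1 \<and> k \<noteq> 0 then c k / 2 else 0)" for n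
    proof -
      have "integral {-1/2..1/2} (\<lambda>y. b n y * ?C y) =
         c (real (Suc n)) * integral {-1/2..1/2} (\<lambda>y. cos (2 * pi * real (Suc n) * y) * ?C y)"
        by (simp add: b_def mult.assoc)
      also have "\<dots> = c (real (Suc n)) * (if \<bar>k\<bar> = int (Suc n) then 1/2 else 0)"
        unfolding cos_orthogonal2 ..
      also have "\<bar>k\<bar> = int (Suc n) \<longleftrightarrow> n = nat \<bar>k\<bar> - 1 \<and> k \<noteq> 0" by auto
      finally have e: "integral {-1/2..1/2} (\<lambda>y. b n y * ?C y) =
        c (real (Suc n)) * (if n = nat \<bar>k\<bar> - 1 \<and> k \<noteq> 0 then 1/2 else 0)" .
      show ?thesis
      proof (cases "n = nat \<bar>k\<bar> - 1 \<and> k \<noteq> 0")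
        case True
        hence "real (Suc n) = \<bar>real_of_int k\<bar>" by auto
        hence "c (real (Suc n)) = c k" by (simp add: c_def)
        thus ?thesis unfolding e using True by simp
      next
        case False
        show ?thesis unfolding e if_not_P[OF False] by simp
      qed
    qed
    ultimately have B: "(\<lambda>n. if n = nat \<bar>k\<bar> - 1 \<and> k \<noteq> 0 then c k / 2 else 0) sums
        integral {-1/2..1/2} (\<lambda>y. \<Sum>n. b n y * ?C y)" by simp
    have "(\<lambda>n. if n = nat \<bar>k\<bar> - 1 \<and> k \<noteq> 0 then c k / 2 else 0) sums (if k \<noteq> 0 then c k / 2 else 0)"
      by (cases "k = 0") (use sums_single[of "nat \<bar>k\<bar> - 1" "\<lambda>_. c k / 2"] in \<open>simp_all cong: if_cong\<close>)
    from sums_unique2[OF B this]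
    have B': "integral {-1/2..1/2} (\<lambda>y. \<Sum>n. b n y * ?C y) = (if k \<noteq> 0 then c k / 2 else 0)" .
    have "integral {-1/2..1/2} (\<lambda>y. S y * ?C y) =
       integral {-1/2..1/2} (\<lambda>y. c 0 * ?C y + 2 * (\<Sum>n. b n y * ?C y))"
      by (intro integral_cong) (simp add: S_def distrib_right suminf_mult2[OF sm] mult.assoc)
    also have "\<dots> = integral {-1/2..1/2} (\<lambda>y. c 0 * ?C y) + integral {-1/2..1/2} (\<lambda>y. 2 * (\<Sum>n. b n y * ?C y))"
      by (intro integral_add integrable_continuous_real continuous_intros sums_integral_uniform(1)[OF bC bb csum])
    also have "\<dots> = c k" using B' cos_orthogonal[of k] by simp
    finally show ?thesis .
  qed
  have "f 0 - S 0 = 0"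
  proof (rule cos_coeffs_zero_imp_zero[of "\<lambda>y. f y - S y"])
    fix k :: int
    have "integral {-1/2..1/2} (\<lambda>y. (f y - S y) * cos (2 * pi * k * y)) =
      integral {-1/2..1/2} (\<lambda>y. f y * cos (2 * pi * k * y) - S y * cos (2 * pi * k * y))"
      by (simp add: left_diff_distrib)
    also have "\<dots> = integral {-1/2..1/2} (\<lambda>y. f y * cos (2 * pi * k * y)) -
       integral {-1/2..1/2} (\<lambda>y. S y * cos (2 * pi * k * y))"
      by (intro integral_diff integrable_continuous_real continuous_intros fcont Scont)
    also have "\<dots> = 0" by (simp only: fcoeff Scoeff diff_self)
    finally show "integral {-1/2..1/2} (\<lambda>y. (f y - S y) * cos (2 * pi * k * y)) = 0" .
  qed (intro continuous_intros fcont Scont)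
  moreover have "f 0 = 1 + 2 * omega x"
  proof -
    have sm: "summable (\<lambda>n. a n 0)"
      by (rule summable_comparison_test'[OF M, of 0]) (use abd[of 0] in auto)
    have "f 0 = a 0 0 + (\<Sum>n. a (Suc n) 0)" unfolding f_def using suminf_split_head[OF sm] by simp
    also have "(\<lambda>n. a (Suc n) 0) = (\<lambda>n. 2 * exp (- pi * x * (real (Suc n))\<^sup>2))"
      by (simp add: a_def G_def fun_eq_iff power2_eq_square algebra_simps)
    also have "(\<Sum>n. 2 * exp (- pi * x * (real (Suc n))\<^sup>2)) = 2 * omega x"
      unfolding omega_def by (intro suminf_mult summable_omega x)
    finally show ?thesis by (simp add: a_def G_def)
  qed
  moreover have "S 0 = (1 + 2 * omega (1 / x)) / sqrt x"
  proof -
    have "(\<Sum>n. b n 0) = omega (1 / x) / sqrt x"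
      unfolding b_def omega_def c_eq using x by (simp add: suminf_divide[OF summable_omega[of "1/x"], simplified])
    thus ?thesis by (simp add: S_def c_def add_divide_distrib)
  qed
  ultimately show ?thesis using x by (simp add: field_simps)
qed

section \<open>Entire functions of order less than one\<close>

text \<open>The map u -> u / (2 B - u) sends the half-plane Re u < B into the unit disc and 0 to 0,
  with derivative 1 / (2 B) there. Schwarz's lemma, applied to its composition with \<open>g\<close>
  translated and rescaled to the unit disc, bounds the derivative at the centre.\<close>

lemma borel_caratheodory_deriv:
  assumes hol: "g holomorphic_on ball z R" and R: "R > 0"
    and le: "\<And>w. w \<in> ball z R \<Longrightarrow> Re (g w) < A"
  shows "norm (deriv g z) \<le> 2 * (A - Re (g z)) / R"
proof -
  define B where "B = A - Re (g z)"
  have B: "B > 0" using le[of z] R by (simp add: B_def)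
  define u where "u = (\<lambda>w. g (z + of_real R * w) - g z)"
  define f where "f = (\<lambda>w. u w / (2 * of_real B - u w))"
  have inball: "z + of_real R * w \<in> ball z R" if "norm w < 1" for w
    using that R by (simp add: dist_norm norm_mult)
  have u_hol: "u holomorphic_on ball 0 1" unfolding u_def
    by (intro holomorphic_intros holomorphic_on_compose_gen[OF _ hol, unfolded o_def])
       (use inball in auto)
  have Re_u: "Re (u w) < B" if "norm w < 1" for w
    using le[OF inball[OF that]] by (simp add: u_def B_def)
  have nz: "2 * of_real B - u w \<noteq> 0" if "norm w < 1" for w
  proof
    assume "2 * of_real B - u w = 0"
    hence "Re (u w) = 2 * B" by (simp add: complex_eq_iff)
    thus False using Re_u[OF that] B by simp
  qed
  have "norm (deriv f 0) \<le> 1"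
  proof (rule Schwarz_Lemma(2)[of f 0])
    show "f holomorphic_on ball 0 1" unfolding f_def
      by (intro holomorphic_intros u_hol) (use nz in auto)
    show "f 0 = 0" by (simp add: f_def u_def)
    fix w :: complex assume w: "norm w < 1"
    have "(norm (u w))\<^sup>2 < (norm (2 * of_real B - u w))\<^sup>2"
      using Re_u[OF w] B by (simp add: cmod_power2) (simp add: power2_eq_square algebra_simps)
    hence "norm (u w) < norm (2 * of_real B - u w)"
      by (rule power2_less_imp_less) simp
    thus "norm (f w) < 1" using nz[OF w] by (simp add: f_def norm_divide)
  qed simp
  moreover have "deriv f 0 = of_real R * deriv g z / (2 * of_real B)"
  proof (rule DERIV_imp_deriv)
    have "(g has_field_derivative deriv g z) (at (z + of_real R * 0))"
      using holomorphic_derivI[OF hol open_ball, of z] R by simp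
    hence "((\<lambda>w. g (z + of_real R * w)) has_field_derivative (deriv g z * of_real R)) (at 0)"
      by (rule DERIV_chain2) (auto intro!: derivative_eq_intros)
    hence u': "(u has_field_derivative (deriv g z * of_real R)) (at 0)"
      unfolding u_def by (auto intro!: derivative_eq_intros)
    have u_0: "u 0 = 0" by (simp add: u_def)
    show "(f has_field_derivative of_real R * deriv g z / (2 * of_real B)) (at 0)"
      unfolding f_def using B nz[of 0]
      by (auto intro!: derivative_eq_intros DERIV_divide[THEN DERIV_cong] u' simp: u_0 power2_eq_square field_simps)
  qed
  ultimately have "R * norm (deriv g z) / (2 * B) \<le> 1"
    using R B by (simp add: norm_mult norm_divide)
  thus ?thesis using R B by (simp add: field_simps B_def)
qed

lemma entire_divide_zero:
  assumes hol: "f holomorphic_on UNIV" and nz: "f z0 \<noteq> 0"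
  shows "\<exists>h. h holomorphic_on UNIV \<and> h a \<noteq> 0 \<and> (\<forall>z. f z = h z * (z - a) ^ nat (zorder f a))"
proof -
  define n where "n = nat (zorder f a)"
  from zorder_exist_zero[where z = a, OF hol open_UNIV connected_UNIV UNIV_I] nz obtain r where
    r: "r > 0" "zor_poly f a holomorphic_on cball a r"
      "\<And>w. w \<in> cball a r \<Longrightarrow> f w = zor_poly f a w * (w - a) ^ n \<and> zor_poly f a w \<noteq> 0"
    unfolding n_def by blast
  define h where "h = (\<lambda>z. if z = a then zor_poly f a a else f z / (z - a) ^ n)"
  have h_eq: "h w = zor_poly f a w" if "w \<in> ball a r" for w
    using r(3)[of w] that by (cases "w = a") (auto simp: h_def)
  have "h holomorphic_on ball a r"
    by (rule holomorphic_transform[of "zor_poly f a"]) (use r(2) h_eq in \<open>auto intro: holomorphic_on_subset\<close>)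
  moreover have "h holomorphic_on - {a}"
    by (rule holomorphic_transform[of "\<lambda>z. f z / (z - a) ^ n"])
       (auto simp: h_def intro!: holomorphic_intros holomorphic_on_subset[OF hol])
  ultimately have "h holomorphic_on (ball a r \<union> - {a})"
    by (intro holomorphic_on_Un) auto
  moreover have "ball a r \<union> - {a} = UNIV" using r(1) by auto
  moreover have "h a \<noteq> 0" using r(1) r(3)[of a] by (simp add: h_def)
  moreover have "f z = h z * (z - a) ^ n" for z
    using r(1) r(3)[of a] by (cases "z = a") (auto simp: h_def)
  ultimately show ?thesis unfolding n_def by metis
qed

text \<open>The zeros are removed one at a time. The exponents stay existential: as the cofactor
  does not vanish on \<open>Z\<close>, they can be recognised afterwards as the orders of
  \<open>f\<close>.\<close>

lemma entire_divide_zeros: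
  assumes hol: "f holomorphic_on UNIV" and nz: "f z0 \<noteq> 0" and fin: "finite Z"
  shows "\<exists>h n. h holomorphic_on UNIV \<and> (\<forall>a\<in>Z. h a \<noteq> 0) \<and>
     (\<forall>z. f z = h z * (\<Prod>a\<in>Z. (z - a) ^ n a)) \<and>
     (z0 \<notin> Z \<longrightarrow> deriv f z0 / f z0 = deriv h z0 / h z0 + (\<Sum>a\<in>Z. of_nat (n a) / (z0 - a)))"
  using fin
proof (induction Z)
  case empty
  show ?case using hol by (intro exI[of _ f] exI[of _ "\<lambda>_. 0"]) auto
next
  case (insert b Z)
  then obtain h n where h: "h holomorphic_on UNIV" "\<And>a. a \<in> Z \<Longrightarrow> h a \<noteq> 0"
    "\<And>z. f z = h z * (\<Prod>a\<in>Z. (z - a) ^ n a)"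
    "z0 \<notin> Z \<longrightarrow> deriv f z0 / f z0 = deriv h z0 / h z0 + (\<Sum>a\<in>Z. of_nat (n a) / (z0 - a))"
    by blast
  have hz0: "h z0 \<noteq> 0" using nz h(3)[of z0] by auto
  obtain h' where h': "h' holomorphic_on UNIV" "h' b \<noteq> 0" "\<And>z. h z = h' z * (z - b) ^ nat (zorder h b)"
    using entire_divide_zero[OF h(1) hz0, of b] by blast
  define k where "k = nat (zorder h b)"
  define n' where "n' = n(b := k)"
  have P: "(\<Prod>a\<in>Z. (z - a) ^ n' a) = (\<Prod>a\<in>Z. (z - a) ^ n a)" for z
    using insert.hyps by (intro prod.cong) (auto simp: n'_def)
  have S: "(\<Sum>a\<in>Z. of_nat (n' a) / (z0 - a)) = (\<Sum>a\<in>Z. of_nat (n a) / (z0 - a))"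
    using insert.hyps by (intro sum.cong) (auto simp: n'_def)
  have 1: "f z = h' z * (\<Prod>a\<in>insert b Z. (z - a) ^ n' a)" for z
    using insert.hyps h(3)[of z] h'(3)[of z] by (simp add: P k_def [symmetric]) (simp add: n'_def)
  have 2: "deriv f z0 / f z0 = deriv h' z0 / h' z0 + (\<Sum>a\<in>insert b Z. of_nat (n' a) / (z0 - a))"
    if "z0 \<notin> insert b Z"
  proof -
    have ne: "z0 \<noteq> b" using that by auto
    have h'z0: "h' z0 \<noteq> 0" using hz0 h'(3)[of z0] by auto
    have "(h' has_field_derivative deriv h' z0) (at z0)"
      using holomorphic_derivI[OF h'(1) open_UNIV] by simp
    hence "((\<lambda>z. h' z * (z - b) ^ k) has_field_derivative
       (h' z0 * (of_nat k * (z0 - b) ^ (k - 1)) + deriv h' z0 * (z0 - b) ^ k)) (at z0)"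
      by (auto intro!: derivative_eq_intros)
    moreover have "(\<lambda>z. h' z * (z - b) ^ k) = h" using h'(3) by (auto simp: k_def)
    ultimately have d: "deriv h z0 = h' z0 * (of_nat k * (z0 - b) ^ (k - 1)) + deriv h' z0 * (z0 - b) ^ k"
      by (metis DERIV_imp_deriv)
    have kk: "of_nat k * (z0 - b) ^ (k - 1) = of_nat k * ((z0 - b) ^ k / (z0 - b))"
      using ne by (cases k) auto
    have "h z0 = h' z0 * (z0 - b) ^ k" "(z0 - b) ^ k \<noteq> 0" using h'(3)[of z0] ne by (auto simp: k_def)
    hence "deriv h z0 / h z0 = deriv h' z0 / h' z0 + of_nat k / (z0 - b)"
      unfolding d kk using h'z0 by (simp add: add_divide_distrib)
    thus ?thesis using h(4) that insert.hyps by (simp add: S) (simp add: n'_def)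
  qed
  have 3: "h' a \<noteq> 0" if "a \<in> insert b Z" for a
    using that h(2)[of a] h'(2) h'(3)[of a] by auto
  show ?case by (intro exI[of _ h'] exI[of _ n'] conjI ballI allI impI h'(1) 1 2 3)
qed

text \<open>The zeros within distance \<open>R\<close> are divided out, and the removed factor is
  replaced by its value \<open>c\<close> at \<open>z0\<close>. On the circle of radius
  \<open>2 * R\<close> each removed zero is at least as far away as it is from \<open>z0\<close>, so
  the bound \<open>exp M\<close> persists there and, by the maximum principle, inside. The quotient
  has no zero in \<open>ball z0 R\<close>, hence a logarithm with real part at most
  \<open>M\<close>, to which \<open>borel_caratheodory_deriv\<close> applies.\<close>

lemma log_deriv_minus_zeros_bound:
  assumes hol: "f holomorphic_on UNIV" and nz: "f z0 \<noteq> 0" and R: "R > 0"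
    and M: "\<And>z. z \<in> cball z0 (2 * R) \<Longrightarrow> norm (f z) \<le> exp M"
  defines "Z \<equiv> {z. f z = 0 \<and> dist z0 z \<le> R}"
  shows "finite Z"
    and "norm (deriv f z0 / f z0 - (\<Sum>a\<in>Z. of_int (zorder f a) / (z0 - a)))
           \<le> 2 * (M + 1 - ln (norm (f z0))) / R"
proof -
  have nonc: "\<not> f constant_on UNIV \<or> (\<forall>z. f z \<noteq> 0)"
    using nz by (auto simp: constant_on_def)
  show fin: "finite Z"
  proof (cases "\<forall>z. f z \<noteq> 0")
    case False
    hence "\<not> f constant_on UNIV" using nonc by auto
    hence "finite {z\<in>cball z0 R. f z = 0}"
      by (intro holomorphic_compact_finite_zeros[OF hol open_UNIV connected_UNIV]) auto
    moreover have "Z = {z\<in>cball z0 R. f z = 0}" by (auto simp: Z_def)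
    ultimately show ?thesis by simp
  qed (simp add: Z_def)
  have z0: "z0 \<notin> Z" using nz by (simp add: Z_def)
  from entire_divide_zeros[OF hol nz fin] obtain h where
    "\<exists>n. h holomorphic_on UNIV \<and> (\<forall>a\<in>Z. h a \<noteq> 0) \<and>
     (\<forall>z. f z = h z * (\<Prod>a\<in>Z. (z - a) ^ n a)) \<and>
     (z0 \<notin> Z \<longrightarrow> deriv f z0 / f z0 = deriv h z0 / h z0 + (\<Sum>a\<in>Z. of_nat (n a) / (z0 - a)))" ..
  then obtain n where
    "h holomorphic_on UNIV \<and> (\<forall>a\<in>Z. h a \<noteq> 0) \<and>
     (\<forall>z. f z = h z * (\<Prod>a\<in>Z. (z - a) ^ n a)) \<and>
     (z0 \<notin> Z \<longrightarrow> deriv f z0 / f z0 = deriv h z0 / h z0 + (\<Sum>a\<in>Z. of_nat (n a) / (z0 - a)))" ..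
  hence h: "h holomorphic_on UNIV" "\<And>a. a \<in> Z \<Longrightarrow> h a \<noteq> 0"
     "\<And>z. f z = h z * (\<Prod>a\<in>Z. (z - a) ^ n a)"
     "deriv f z0 / f z0 = deriv h z0 / h z0 + (\<Sum>a\<in>Z. of_nat (n a) / (z0 - a))"
    using z0 by (blast, blast, blast, blast)
  have zo: "zorder f a = int (n a)" if a: "a \<in> Z" for a
  proof (rule zorder_eqI[of UNIV a "\<lambda>z. h z * (\<Prod>b\<in>Z-{a}. (z - b) ^ n b)"])
    show "(\<lambda>z. h z * (\<Prod>b\<in>Z-{a}. (z - b) ^ n b)) holomorphic_on UNIV"
      by (intro holomorphic_intros h)
    show "h a * (\<Prod>b\<in>Z-{a}. (a - b) ^ n b) \<noteq> 0"
      using h(2)[OF a] fin by auto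
    fix w assume "w \<noteq> a"
    show "f w = h w * (\<Prod>b\<in>Z-{a}. (w - b) ^ n b) * (w - a) powi int (n a)"
      using h(3)[of w] prod.remove[OF fin a, of "\<lambda>b. (w - b) ^ n b"] by simp
  qed auto
  define c where "c = (\<Prod>a\<in>Z. (z0 - a) ^ n a)"
  have c: "c \<noteq> 0" using z0 fin by (auto simp: c_def)
  define F where "F = (\<lambda>z. h z * c)"
  have F_hol: "F holomorphic_on UNIV" unfolding F_def by (intro holomorphic_intros h)
  have Fz0: "F z0 = f z0" using h(3)[of z0] by (simp add: F_def c_def)
  have F_sphere: "norm (F z) \<le> exp M" if z: "dist z0 z = 2 * R" for z
  proof -
    have "norm c \<le> norm (\<Prod>a\<in>Z. (z - a) ^ n a)"
      unfolding c_def prod_norm [symmetric] norm_power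
    proof (intro prod_mono conjI power_mono)
      fix a assume "a \<in> Z"
      hence "dist z0 a \<le> R" by (simp add: Z_def)
      moreover have "dist z0 z \<le> dist z0 a + dist z a" by (metis dist_triangle dist_commute)
      ultimately have "dist z a \<ge> dist z0 a" using z by simp
      thus "norm (z0 - a) \<le> norm (z - a)" by (simp add: dist_norm)
    qed auto
    hence "norm (F z) \<le> norm (f z)"
      unfolding F_def h(3)[of z] norm_mult by (intro mult_left_mono) auto
    also have "\<dots> \<le> exp M" using z R by (intro M) auto
    finally show ?thesis .
  qed
  have F_le: "norm (F w) \<le> exp M" if "w \<in> ball z0 R" for w
  proof (rule maximum_modulus_frontier[of F "cball z0 (2 * R)"])
    show "F holomorphic_on interior (cball z0 (2 * R))" by (rule holomorphic_on_subset[OF F_hol]) auto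
    show "continuous_on (closure (cball z0 (2 * R))) F"
      by (rule holomorphic_on_imp_continuous_on[OF holomorphic_on_subset[OF F_hol]]) auto
    show "bounded (cball z0 (2 * R))" by simp
    show "norm (F z) \<le> exp M" if "z \<in> frontier (cball z0 (2 * R))" for z
      using that R F_sphere by (auto simp: frontier_cball)
    show "w \<in> cball z0 (2 * R)" using that R by auto
  qed
  have F_nz: "F w \<noteq> 0" if "w \<in> ball z0 R" for w
  proof
    assume "F w = 0"
    hence "h w = 0" using c by (simp add: F_def)
    hence "f w = 0" using h(3)[of w] by simp
    hence "w \<in> Z" using that by (simp add: Z_def)
    thus False using h(2) \<open>h w = 0\<close> by blast
  qed
  obtain g where g: "g holomorphic_on ball z0 R" "\<And>x. x \<in> ball z0 R \<Longrightarrow> exp (g x) = F x"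
    using holomorphic_logarithm_exists[of "ball z0 R" F z0] F_nz F_hol R
    by (auto intro: holomorphic_on_subset)
  have Re_g: "exp (Re (g w)) = norm (F w)" if "w \<in> ball z0 R" for w
    using g(2)[OF that] by (metis norm_exp_eq_Re)
  have z0in: "z0 \<in> ball z0 R" using R by simp
  have "norm (deriv g z0) \<le> 2 * (M + 1 - Re (g z0)) / R"
  proof (rule borel_caratheodory_deriv[OF g(1) R])
    fix w assume w: "w \<in> ball z0 R"
    have "exp (Re (g w)) \<le> exp M" using F_le[OF w] Re_g[OF w] by simp
    \<comment> \<open>The added 1 provides the strict inequality that
      \<open>borel_caratheodory_deriv\<close> asks for.\<close>
    thus "Re (g w) < M + 1" by simp
  qed
  moreover have "Re (g z0) = ln (norm (f z0))"
    using Re_g[OF z0in] Fz0 by (metis ln_exp)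
  moreover have "deriv g z0 = deriv h z0 / h z0"
  proof -
    have "(g has_field_derivative deriv g z0) (at z0)"
      using holomorphic_derivI[OF g(1) open_ball z0in] .
    hence "((\<lambda>w. exp (g w)) has_field_derivative (exp (g z0) * deriv g z0)) (at z0)"
      by (auto intro!: derivative_eq_intros)
    hence "(F has_field_derivative (exp (g z0) * deriv g z0)) (at z0)"
      by (rule has_field_derivative_transform_within_open[OF _ open_ball z0in]) (use g(2) in auto)
    moreover have "(F has_field_derivative (deriv h z0 * c)) (at z0)"
      unfolding F_def by (intro DERIV_cmult_right holomorphic_derivI[OF h(1)]) auto
    ultimately have "exp (g z0) * deriv g z0 = deriv h z0 * c" by (rule DERIV_unique)
    moreover have "exp (g z0) = h z0 * c" using g(2)[OF z0in] by (simp add: F_def)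
    moreover have "h z0 \<noteq> 0" using nz h(3)[of z0] by auto
    ultimately show ?thesis using c by (simp add: field_simps)
  qed
  moreover have "(\<Sum>a\<in>Z. of_int (zorder f a) / (z0 - a)) = (\<Sum>a\<in>Z. of_nat (n a) / (z0 - a))"
    by (intro sum.cong) (auto simp: zo)
  ultimately show "norm (deriv f z0 / f z0 - (\<Sum>a\<in>Z. of_int (zorder f a) / (z0 - a)))
           \<le> 2 * (M + 1 - ln (norm (f z0))) / R"
    using h(4) by simp
qed

text \<open>With growth exponent 3/4 the error in \<open>log_deriv_minus_zeros_bound\<close> is of
  size R^(3/4) / R and tends to 0, so neither an exponential factor nor convergence factors appear.
  The convergence is along discs around \<open>z0\<close> and is not claimed to be absolute.\<close>

lemma hadamard_genus_zero:
  assumes hol: "f holomorphic_on UNIV" and nz: "f z0 \<noteq> 0"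
    and growth: "\<And>z. norm (f z) \<le> exp (A * (1 + norm z) powr (3/4))" and A: "A \<ge> 0"
  shows "((\<lambda>R. \<Sum>a\<in>{z. f z = 0 \<and> dist z0 z \<le> R}. of_int (zorder f a) / (z0 - a))
     \<longlongrightarrow> deriv f z0 / f z0) at_top"
proof -
  define b where "b = (\<lambda>R. 2 * (A * (1 + norm z0 + 2 * R) powr (3/4) + 1 - ln (norm (f z0))) / R)"
  have "((\<lambda>R. (1 + norm z0 + 2 * R) powr (3/4) / R) \<longlongrightarrow> 0) at_top" by real_asymp
  hence "((\<lambda>R. 2 * A * ((1 + norm z0 + 2 * R) powr (3/4) / R) + 2 * (1 - ln (norm (f z0))) / R) \<longlongrightarrow>
     2 * A * 0 + 0) at_top"
    by (intro tendsto_add tendsto_mult tendsto_const real_tendsto_divide_at_top[OF tendsto_const filterlim_ident])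
  moreover have "(\<lambda>R. 2 * A * ((1 + norm z0 + 2 * R) powr (3/4) / R) + 2 * (1 - ln (norm (f z0))) / R) = b"
    by (auto simp: b_def fun_eq_iff add_divide_distrib [symmetric] diff_divide_distrib [symmetric] algebra_simps)
  ultimately have b: "(b \<longlongrightarrow> 0) at_top" by simp
  have "((\<lambda>R. deriv f z0 / f z0 - (\<Sum>a\<in>{z. f z = 0 \<and> dist z0 z \<le> R}. of_int (zorder f a) / (z0 - a)))
     \<longlongrightarrow> 0) at_top"
  proof (rule Lim_null_comparison[OF _ b])
    show "\<forall>\<^sub>F R in at_top. norm (deriv f z0 / f z0 -
       (\<Sum>a\<in>{z. f z = 0 \<and> dist z0 z \<le> R}. of_int (zorder f a) / (z0 - a))) \<le> b R"
      using eventually_gt_at_top[of 0]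
    proof eventually_elim
      case (elim R)
      show ?case unfolding b_def
      proof (rule log_deriv_minus_zeros_bound(2)[OF hol nz elim])
        fix z assume z: "z \<in> cball z0 (2 * R)"
        have "norm z \<le> norm z0 + 2 * R"
          using z norm_triangle_ineq3[of z z0] by (simp add: dist_norm norm_minus_commute abs_le_iff)
        hence "A * (1 + norm z) powr (3/4) \<le> A * (1 + norm z0 + 2 * R) powr (3/4)"
          using A by (intro mult_left_mono powr_mono2) auto
        thus "norm (f z) \<le> exp (A * (1 + norm z0 + 2 * R) powr (3/4))"
          using growth[of z] by (smt (verit) exp_le_cancel_iff)
      qed
    qed
  qed
  from tendsto_diff[OF tendsto_const[of "deriv f z0 / f z0"] this] show ?thesis by simp
qed

text \<open>Composing with a branch of the square root gives a function that does not depend on the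
  branch, because \<open>f\<close> is even. Two branches with opposite cuts cover everything except
  0, where continuity removes the singularity.\<close>

lemma even_entire_sqrt:
  assumes hol: "f holomorphic_on UNIV" and even: "\<And>w. f (- w) = f w"
  shows "\<exists>g. g holomorphic_on UNIV \<and> (\<forall>w. g (w\<^sup>2) = f w)"
proof -
  define g where "g = (\<lambda>v. f (csqrt v))"
  have g_sq: "g (w\<^sup>2) = f w" for w
  proof -
    have "(csqrt (w\<^sup>2))\<^sup>2 = w\<^sup>2" by simp
    hence "csqrt (w\<^sup>2) = w \<or> csqrt (w\<^sup>2) = - w" by (simp only: power2_eq_iff)
    thus ?thesis using even by (auto simp: g_def)
  qed
  have g1: "g holomorphic_on (- \<real>\<^sub>\<le>\<^sub>0)" unfolding g_def
    by (intro holomorphic_on_compose_gen[OF _ hol, unfolded o_def]) (auto intro!: holomorphic_intros)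
  \<comment> \<open>The other square root of \<open>v\<close>, or the same one: evenness makes the
    sign irrelevant, and the cut moves to the nonnegative reals.\<close>
  have "g = (\<lambda>v. f (\<i> * csqrt (- v)))"
  proof
    fix v
    have "(\<i> * csqrt (- v))\<^sup>2 = v" by (simp add: power_mult_distrib)
    thus "g v = f (\<i> * csqrt (- v))" using g_sq[of "\<i> * csqrt (- v)"] by simp
  qed
  moreover have "(\<lambda>v. f (\<i> * csqrt (- v))) holomorphic_on (uminus ` (- \<real>\<^sub>\<le>\<^sub>0))"
    by (intro holomorphic_on_compose_gen[OF _ hol, unfolded o_def]) (auto intro!: holomorphic_intros)
  ultimately have g2: "g holomorphic_on (uminus ` (- \<real>\<^sub>\<le>\<^sub>0))" by simp
  have "g holomorphic_on (- \<real>\<^sub>\<le>\<^sub>0) \<union> (uminus ` (- \<real>\<^sub>\<le>\<^sub>0))"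
    by (intro holomorphic_on_Un g1 g2) (auto intro!: open_negations closed_nonpos_Reals_complex simp: open_Compl)
  moreover have "UNIV - {0} \<subseteq> (- \<real>\<^sub>\<le>\<^sub>0) \<union> (uminus ` (- \<real>\<^sub>\<le>\<^sub>0 :: complex set))"
  proof
    fix v :: complex assume v: "v \<in> UNIV - {0}"
    have "- v \<in> - \<real>\<^sub>\<le>\<^sub>0" if "v \<in> \<real>\<^sub>\<le>\<^sub>0"
      using that v by (auto simp: complex_nonpos_Reals_iff complex_eq_iff)
    thus "v \<in> (- \<real>\<^sub>\<le>\<^sub>0) \<union> (uminus ` (- \<real>\<^sub>\<le>\<^sub>0))"
      by (metis ComplI UnI1 UnI2 image_eqI minus_minus)
  qed
  ultimately have hol0: "g holomorphic_on (UNIV - {0})" by (rule holomorphic_on_subset)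
  have "g holomorphic_on UNIV"
  proof (rule no_isolated_singularity'[OF _ hol0])
    fix z :: complex assume "z \<in> {0}"
    have "(csqrt \<longlongrightarrow> 0) (at 0)"
    proof (rule tendsto_norm_zero_cancel)
      have "((\<lambda>x. sqrt (norm x)) \<longlongrightarrow> sqrt (norm (0::complex))) (at (0::complex))" by (intro tendsto_intros)
      moreover have "norm (csqrt x) = sqrt (norm x)" for x
        by (metis norm_power power2_csqrt real_sqrt_abs abs_norm_cancel)
      ultimately show "((\<lambda>x. norm (csqrt x)) \<longlongrightarrow> 0) (at 0)" by simp
    qed
    moreover have "isCont f 0"
      using holomorphic_on_imp_continuous_on[OF hol] by (simp add: continuous_on_eq_continuous_at)
    ultimately have "((\<lambda>v. f (csqrt v)) \<longlongrightarrow> f 0) (at 0)"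
      by (rule isCont_tendsto_compose[rotated])
    thus "(g \<longlongrightarrow> g z) (at z within UNIV)" using \<open>z \<in> {0}\<close> by (simp add: g_def)
  qed auto
  thus ?thesis using g_sq by blast
qed

section \<open>The completed zeta function\<close>

lemma integrable_dominated:
  fixes f :: "real \<Rightarrow> 'a::euclidean_space"
  assumes "continuous_on S f" "S \<in> sets lebesgue" "g integrable_on S" "\<And>x. x \<in> S \<Longrightarrow> norm (f x) \<le> g x"
  shows "f integrable_on S" "f absolutely_integrable_on S"
  using measurable_bounded_by_integrable_imp_integrable[OF continuous_imp_measurable_on_sets_lebesgue[OF assms(1,2)] assms(3,4,2)]
    measurable_bounded_by_integrable_imp_absolutely_integrable[OF continuous_imp_measurable_on_sets_lebesgue[OF assms(1,2)] assms(2,3,4)]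
  by auto

text \<open>Riemann's integrand (x^(s/2) + x^((1-s)/2)) omega(x) dx / x over x >= 1, after the
  substitution x = e^u. It is visibly symmetric under s -> 1 - s.\<close>

definition xi_kernel :: "complex \<Rightarrow> real \<Rightarrow> complex" where
  "xi_kernel s u = (exp (s * of_real (u / 2)) + exp ((1 - s) * of_real (u / 2))) * of_real (omega (exp u))"

definition xi_integral :: "complex \<Rightarrow> complex" where
  "xi_integral s = integral {0..} (xi_kernel s)"

text \<open>Twice the usual function, so that \<open>xi 0 = 1\<close>.\<close>
definition xi :: "complex \<Rightarrow> complex" where
  "xi s = 1 + s * (s - 1) * xi_integral s"

text \<open>The factor exp (- exp u) is traded for \<open>fact n * exp (- real n * u)\<close>. The
  exponentials contribute at most (R + 1) / 2 to the rate, so the threshold for \<open>n\<close>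
  leaves a rate of 1. Keeping \<open>n\<close> free matters: a fixed \<open>n\<close> gives local
  uniformity in \<open>s\<close>, while the smallest admissible \<open>n\<close> gives the growth of
  \<open>xi\<close>.\<close>

lemma xi_kernel_bound:
  assumes u: "u \<ge> 0" and s: "norm s \<le> R" and n: "real n \<ge> (R + 3) / 2"
  shows "norm (xi_kernel s u) \<le> 4 * fact n * exp (- 1 * u)"
proof -
  have R: "R \<ge> 0" using s norm_ge_zero order_trans by blast
  have e: "norm (exp (z * of_real (u / 2))) \<le> exp ((R + 1) / 2 * u)" if "norm z \<le> R + 1" for z :: complex
  proof -
    have "Re z * (u / 2) \<le> (R + 1) * (u / 2)"
      using u that abs_Re_le_cmod[of z] by (intro mult_right_mono) auto
    thus ?thesis by (simp add: norm_exp_eq_Re)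
  qed
  have "norm (1 - s) \<le> R + 1" using norm_triangle_ineq4[of 1 s] s by simp
  hence a: "norm (exp (s * of_real (u / 2)) + exp ((1 - s) * of_real (u / 2))) \<le> 2 * exp ((R + 1) / 2 * u)"
    using add_mono[OF e[of s] e[of "1 - s"]] s by (intro order_trans[OF norm_triangle_ineq]) simp
  have b: "\<bar>omega (exp u)\<bar> \<le> 2 * (fact n * exp (- real n * u))"
  proof -
    have "exp u ^ n / fact n \<le> exp (exp u)"
    proof -
      have sm: "summable (\<lambda>k. exp u ^ k /\<^sub>R fact k)" and eq: "(\<Sum>k. exp u ^ k /\<^sub>R fact k) = exp (exp u)"
        using exp_converges[of "exp u"] by (auto simp: sums_iff)
      have "(\<Sum>k\<in>{n}. exp u ^ k /\<^sub>R fact k) \<le> (\<Sum>k. exp u ^ k /\<^sub>R fact k)"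
        by (rule sum_le_suminf[OF sm]) auto
      thus ?thesis unfolding eq by (simp add: field_simps)
    qed
    hence "exp (- exp u) \<le> fact n / exp u ^ n" by (simp add: exp_minus field_simps)
    also have "\<dots> = fact n * exp (- real n * u)" by (simp add: exp_minus exp_of_nat_mult divide_inverse)
    finally have "omega (exp u) \<le> 2 * (fact n * exp (- real n * u))"
      using omega_le[of "exp u"] u by simp
    thus ?thesis using omega_nonneg[of "exp u"] by simp
  qed
  have "norm (xi_kernel s u) \<le> (2 * exp ((R + 1) / 2 * u)) * (2 * (fact n * exp (- real n * u)))"
    unfolding xi_kernel_def norm_mult norm_of_real by (intro mult_mono a b) auto
  also have "\<dots> = 4 * fact n * exp ((R + 1) / 2 * u + - real n * u)"
    by (subst exp_add) simp
  also have "(R + 1) / 2 * u + - real n * u \<le> - 1 * u"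
    using n u mult_right_mono[of "(R + 3) / 2" "real n" u] by (simp add: field_simps)
  hence "4 * fact n * exp ((R + 1) / 2 * u + - real n * u) \<le> 4 * fact n * exp (- 1 * u)" by simp
  finally show ?thesis .
qed

lemma continuous_on_omega_exp: "continuous_on A (\<lambda>u. omega (exp u))"
  by (rule continuous_on_compose2[OF continuous_on_omega]) (auto intro!: continuous_intros)

lemma continuous_on_xi_kernel: "continuous_on A (xi_kernel s)"
  unfolding xi_kernel_def [abs_def] by (intro continuous_intros continuous_on_omega_exp) auto

lemma xi_kernel_integrable: "xi_kernel s integrable_on {a..}" if "a \<ge> 0"
proof -
  obtain n where n: "real n \<ge> (norm s + 3) / 2" using real_arch_simple by blast
  show ?thesis
  proof (rule integrable_dominated(1)[OF continuous_on_xi_kernel])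
    show "(\<lambda>u. 4 * fact n * exp (- 1 * u)) integrable_on {a..}"
      using has_integral_mult_right[OF has_integral_exp_minus_to_infinity[of 1 a], of "4 * fact n"]
      by (auto simp: integrable_on_def)
    show "norm (xi_kernel s u) \<le> 4 * fact n * exp (- 1 * u)" if "u \<in> {a..}" for u
      using that \<open>a \<ge> 0\<close> n by (intro xi_kernel_bound[of _ _ "norm s"]) auto
  qed auto
qed

lemma xi_integral_tail:
  assumes a: "a \<ge> 0" and s: "norm s \<le> R" and n: "real n \<ge> (R + 3) / 2"
  shows "norm (integral {a..} (xi_kernel s)) \<le> 4 * fact n * exp (- 1 * a)"
proof -
  have i: "((\<lambda>u. 4 * fact n * exp (- 1 * u)) has_integral (4 * fact n * (exp (- 1 * a) / 1))) {a..}"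
    by (intro has_integral_mult_right has_integral_exp_minus_to_infinity) auto
  have "norm (integral {a..} (xi_kernel s)) \<le> integral {a..} (\<lambda>u. 4 * fact n * exp (- 1 * u))"
    by (intro integral_norm_bound_integral xi_kernel_integrable xi_kernel_bound[OF _ s n])
       (use a i in \<open>auto simp: integrable_on_def\<close>)
  also have "\<dots> = 4 * fact n * exp (- 1 * a)" using integral_unique[OF i] by simp
  finally show ?thesis .
qed

lemma xi_integral_split:
  assumes "a \<ge> 0"
  shows "xi_integral s = integral {0..a} (xi_kernel s) + integral {a..} (xi_kernel s)"
proof -
  have "{0..a} \<union> {a..} = {0::real..}" using assms by auto
  moreover have "{0..a} \<inter> {a..} = {a::real}" using assms by auto
  ultimately show ?thesis unfolding xi_integral_def
    using integral_Un[of "xi_kernel s" "{0..a}" "{a..}"] xi_kernel_integrable[of a s] assms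
    by (simp add: integrable_continuous_real continuous_on_xi_kernel)
qed

lemma xi_integral_holomorphic: "xi_integral holomorphic_on UNIV"
proof (rule holomorphic_uniform_sequence[where f = "\<lambda>N s. integral (cbox 0 (real N)) (xi_kernel s)"])
  fix N :: nat
  define k' where "k' = (\<lambda>s u. (of_real (u / 2) * exp (s * of_real (u / 2)) - of_real (u / 2) * exp ((1 - s) * of_real (u / 2)))
     * of_real (omega (exp u)) :: complex)"
  show "(\<lambda>s. integral (cbox 0 (real N)) (xi_kernel s)) holomorphic_on UNIV"
  proof (rule leibniz_rule_holomorphic[where fx = k'])
    show "((\<lambda>s. xi_kernel s u) has_field_derivative k' s u) (at s within UNIV)" for s u
      unfolding xi_kernel_def k'_def by (auto intro!: derivative_eq_intros simp: algebra_simps)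
    show "xi_kernel s integrable_on cbox 0 (real N)" for s
      by (intro integrable_continuous continuous_on_xi_kernel)
    have "continuous_on (UNIV \<times> cbox 0 (real N)) (\<lambda>p::complex \<times> real. omega (exp (snd p)))"
      by (rule continuous_on_compose2[OF continuous_on_omega]) (auto intro!: continuous_intros)
    thus "continuous_on (UNIV \<times> cbox 0 (real N)) (\<lambda>(s, u). k' s u)"
      unfolding k'_def case_prod_unfold by (intro continuous_intros) auto
  qed auto
next
  fix s :: complex
  define R where "R = norm s + 1"
  obtain n where n: "real n \<ge> (R + 3) / 2" using real_arch_simple by blast
  have in_R: "norm z \<le> R" if "z \<in> cball s 1" for z
    using that norm_triangle_ineq3[of z s] by (auto simp: R_def dist_norm norm_minus_commute abs_le_iff)
  have "uniform_limit (cball s 1) (\<lambda>N s. integral (cbox 0 (real N)) (xi_kernel s)) xi_integral sequentially"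
  proof (rule uniform_limitI)
    fix e :: real assume e: "e > 0"
    have "(\<lambda>N. 4 * fact n * exp (- 1 * real N)) \<longlonglongrightarrow> 0" by real_asymp
    hence "\<forall>\<^sub>F N in sequentially. 4 * fact n * exp (- 1 * real N) < e"
      using e by (rule order_tendstoD)
    thus "\<forall>\<^sub>F N in sequentially. \<forall>z\<in>cball s 1. dist (integral (cbox 0 (real N)) (xi_kernel z)) (xi_integral z) < e"
    proof eventually_elim
      case (elim N)
      show ?case
      proof
        fix z assume "z \<in> cball s 1"
        hence "norm (integral {real N..} (xi_kernel z)) \<le> 4 * fact n * exp (- 1 * real N)"
          by (intro xi_integral_tail[OF _ in_R n]) auto
        thus "dist (integral (cbox 0 (real N)) (xi_kernel z)) (xi_integral z) < e"
          using xi_integral_split[of "real N" z] elim by (simp add: dist_norm)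
      qed
    qed
  qed
  thus "\<exists>d>0. cball s d \<subseteq> UNIV \<and> uniform_limit (cball s d)
     (\<lambda>N s. integral (cbox 0 (real N)) (xi_kernel s)) xi_integral sequentially"
    by (intro exI[of _ 1]) auto
qed auto

lemma xi_holomorphic: "xi holomorphic_on A"
proof -
  have "xi holomorphic_on UNIV"
    unfolding xi_def [abs_def] by (intro holomorphic_intros xi_integral_holomorphic)
  thus ?thesis by (rule holomorphic_on_subset) auto
qed

lemma xi_symmetric: "xi (1 - s) = xi s"
proof -
  have "xi_kernel (1 - s) = xi_kernel s" by (auto simp: xi_kernel_def fun_eq_iff add.commute)
  thus ?thesis by (simp add: xi_def xi_integral_def algebra_simps)
qed

lemma xi_0 [simp]: "xi 0 = 1" and xi_1 [simp]: "xi 1 = 1"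
  by (simp_all add: xi_def)

text \<open>With \<open>n\<close> about half of \<open>norm s\<close> the factorial is exp (O (r ln
  r)), and the logarithm is weakened to ln x <= 2 sqrt x. The exponent 3/2 is good enough, since
  passing to the variable \<open>(s - 1/2)\<^sup>2\<close> halves it to 3/4. The constant is 17 = 2
  + 4 + 11: the numerical factor 5, the factor \<open>r\<^sup>2\<close> and the factorial, where 6
  sqrt 3 <= 11.\<close>

lemma xi_growth: "norm (xi s) \<le> exp (17 * (1 + norm s) powr (3/2))"
proof -
  define r where "r = 1 + norm s"
  have r: "r \<ge> 1" by (simp add: r_def)
  define n where "n = nat \<lceil>(norm s + 3) / 2\<rceil>"
  have n: "real n \<ge> (norm s + 3) / 2" unfolding n_def by linarith
  have "real n = real_of_int \<lceil>(norm s + 3) / 2\<rceil>"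
    unfolding n_def using norm_ge_zero[of s] by (intro of_nat_nat) (simp add: add_pos_nonneg)
  hence "real n \<le> (norm s + 3) / 2 + 1" using of_int_ceiling_le_add_one[of "(norm s + 3) / 2"] by simp
  also have "(x + 3) / 2 + 1 \<le> 3 * (1 + x)" if "x \<ge> 0" for x :: real using that by simp
  from this[OF norm_ge_zero[of s]] have "(norm s + 3) / 2 + 1 \<le> 3 * r" unfolding r_def .
  finally have n3: "real n \<le> 3 * r" .
  have r32: "r powr (3/2) = r * sqrt r"
    using r powr_add[of r 1 "1/2"] by (simp add: powr_half_sqrt)
  have sq: "sqrt r \<ge> 1" using r by simp
  have ln_le: "ln x \<le> 2 * sqrt x" if "x \<ge> 1" for x :: real
  proof -
    have "ln (sqrt x) \<le> sqrt x" using that by (intro less_imp_le[OF ln_less_self]) auto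
    thus ?thesis using that by (simp add: ln_sqrt)
  qed
  have "fact n \<le> exp (11 * (r * sqrt r))"
  proof -
    have "fact n \<le> (real n) ^ n" using fact_le_power[of n, where 'a = real] by simp
    also have "\<dots> \<le> (3 * r) ^ n" using n3 by (intro power_mono) auto
    also have "\<dots> = exp (real n * ln (3 * r))" using r by (simp add: exp_of_nat_mult)
    also have "real n * ln (3 * r) \<le> 3 * r * (2 * sqrt (3 * r))"
      using n3 r ln_le[of "3 * r"] by (intro mult_mono) auto
    also have "\<dots> = 6 * sqrt 3 * (r * sqrt r)" by (simp add: real_sqrt_mult)
    also have "\<dots> \<le> 11 * (r * sqrt r)"
    proof (rule mult_right_mono)
      have "sqrt 3 \<le> 11 / 6" by (rule real_le_lsqrt) (auto simp: power2_eq_square)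
      thus "6 * sqrt 3 \<le> (11::real)" by simp
    qed (use r in simp)
    finally show ?thesis by simp
  qed
  moreover have "r\<^sup>2 \<le> exp (4 * (r * sqrt r))"
  proof -
    have "2 * ln r \<le> 4 * sqrt r" using ln_le[OF r] by simp
    also have "\<dots> \<le> 4 * (r * sqrt r)" using r mult_right_mono[of 1 r "sqrt r"] by simp
    finally have "exp (2 * ln r) \<le> exp (4 * (r * sqrt r))" by simp
    thus ?thesis using r by (simp add: exp_double)
  qed
  moreover have "5 \<le> exp (2 * (r * sqrt r))"
  proof -
    have "1 * 1 \<le> r * sqrt r" using r sq by (intro mult_mono) auto
    moreover have "(5::real) \<le> exp 2"
      using exp_lower_Taylor_quadratic[of "2::real"] by simp
    ultimately show ?thesis by (smt (verit) exp_le_cancel_iff)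
  qed
  ultimately have main: "5 * (r\<^sup>2 * fact n) \<le> exp (2 * (r * sqrt r)) * (exp (4 * (r * sqrt r)) * exp (11 * (r * sqrt r)))"
    by (intro mult_mono) auto
  have "norm (xi_integral s) \<le> 4 * fact n"
    using xi_integral_tail[of 0 s "norm s" n] n by (simp add: xi_integral_def)
  moreover have "norm (s * (s - 1)) \<le> r\<^sup>2"
    unfolding norm_mult power2_eq_square r_def using norm_triangle_ineq4[of s 1]
    by (intro mult_mono) auto
  ultimately have "norm (s * (s - 1) * xi_integral s) \<le> r\<^sup>2 * (4 * fact n)"
    unfolding norm_mult[of "s * (s - 1)"] by (intro mult_mono) auto
  hence "norm (xi s) \<le> 1 + 4 * (r\<^sup>2 * fact n)"
    unfolding xi_def using norm_triangle_ineq[of 1 "s * (s - 1) * xi_integral s"] by simp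
  also have "1 * 1 \<le> r\<^sup>2 * fact n"
    by (rule mult_mono) (use r in \<open>auto simp: fact_ge_1 one_le_power\<close>)
  hence "1 + 4 * (r\<^sup>2 * fact n) \<le> 5 * (r\<^sup>2 * fact n)" by linarith
  also note main
  also have "exp (2 * (r * sqrt r)) * (exp (4 * (r * sqrt r)) * exp (11 * (r * sqrt r))) = exp (17 * (r * sqrt r))"
    by (simp flip: exp_add)
  finally show ?thesis using r32 by (simp add: r_def)
qed

section \<open>The Mellin transform of the theta series\<close>

lemma nn_integral_Gamma_exp:
  assumes x: "x > 0"
  shows "(\<integral>\<^sup>+u. ennreal (exp (x * u - exp u)) \<partial>lborel) = ennreal (Gamma x)"
proof -
  define f where "f = (\<lambda>t::real. t powr (x - 1) / exp t)"
  have f: "(f has_integral Gamma x) {0<..}"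
  proof -
    have "((\<lambda>t. if t \<in> {0<..} then f t else 0) has_integral Gamma x) {0..}"
      by (rule has_integral_spike [of "{0}", OF _ _ Gamma_integral_real[OF x]]) (auto simp: f_def)
    also have "?this = ?thesis" by (subst has_integral_restrict) auto
    finally show ?thesis .
  qed
  have "f absolutely_integrable_on {0<..}"
    using f by (intro nonnegative_absolutely_integrable_1) (auto simp: f_def integrable_on_def)
  moreover have range: "range exp = {0::real<..}"
  proof -
    have "t \<in> range exp" if "t > 0" for t :: real using that rangeI[of exp "ln t"] by simp
    thus ?thesis by auto
  qed
  ultimately have "(\<lambda>u. \<bar>exp u\<bar> * f (exp u)) absolutely_integrable_on UNIV \<and>
      integral UNIV (\<lambda>u. \<bar>exp u\<bar> * f (exp u)) = Gamma x"
    using integral_unique[OF f]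
    by (subst has_absolute_integral_change_of_variables_1') (auto intro!: derivative_eq_intros inj_onI)
  moreover have "(\<lambda>u. \<bar>exp u\<bar> * f (exp u)) = (\<lambda>u. exp (x * u - exp u))"
    by (auto simp: f_def fun_eq_iff powr_def exp_diff left_diff_distrib)
  ultimately have "((\<lambda>u. exp (x * u - exp u)) has_integral Gamma x) UNIV"
    using set_lebesgue_integral_eq_integral(1) has_integral_integral by metis
  thus ?thesis by (intro nn_integral_has_integral_lborel) auto
qed

lemma nn_integral_Gamma_exp_scaled:
  assumes x: "x > 0" and a: "a > 0"
  shows "(\<integral>\<^sup>+u. ennreal (exp (x * u) * exp (- (a * exp u))) \<partial>lborel) = ennreal (a powr (-x) * Gamma x)"
proof -
  have "(\<integral>\<^sup>+u. ennreal (exp (x * u) * exp (- (a * exp u))) \<partial>lborel) =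
     ennreal \<bar>1\<bar> * (\<integral>\<^sup>+u. ennreal (exp (x * (- ln a + 1 * u)) * exp (- (a * exp (- ln a + 1 * u)))) \<partial>lborel)"
    by (rule nn_integral_real_affine) auto
  also have "(\<integral>\<^sup>+u. ennreal (exp (x * (- ln a + 1 * u)) * exp (- (a * exp (- ln a + 1 * u)))) \<partial>lborel) =
      (\<integral>\<^sup>+u. ennreal (a powr (-x)) * ennreal (exp (x * u - exp u)) \<partial>lborel)"
  proof (rule nn_integral_cong)
    fix u
    have "exp (x * (- ln a + 1 * u)) * exp (- (a * exp (- ln a + 1 * u))) = a powr (-x) * exp (x * u - exp u)"
      using a by (simp add: exp_diff exp_minus exp_add powr_def right_diff_distrib field_simps)
    thus "ennreal (exp (x * (- ln a + 1 * u)) * exp (- (a * exp (- ln a + 1 * u)))) =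
       ennreal (a powr (-x)) * ennreal (exp (x * u - exp u))"
      by (simp add: ennreal_mult')
  qed
  also have "\<dots> = ennreal (a powr (-x)) * (\<integral>\<^sup>+u. ennreal (exp (x * u - exp u)) \<partial>lborel)"
    by (rule nn_integral_cmult) auto
  finally show ?thesis using x a by (simp add: nn_integral_Gamma_exp ennreal_mult' Gamma_real_pos less_imp_le)
qed

definition real_zeta :: "real \<Rightarrow> real" where
  "real_zeta s = (\<Sum>n. real (Suc n) powr (-s))"

lemma real_zeta_nonneg: "s > 1 \<Longrightarrow> real_zeta s \<ge> 0"
  unfolding real_zeta_def by (intro suminf_nonneg summable_powr_Suc) auto

lemma riemann_zeta_of_real:
  assumes "s > 1"
  shows "riemann_zeta (of_real s) = of_real (real_zeta s)"
proof -
  have "(\<lambda>n. 1 / of_nat (Suc n) powr complex_of_real s) sums riemann_zeta (of_real s)"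
    using riemann_zeta assms by (simp add: is_zeta_continuation_def)
  moreover have "1 / of_nat (Suc n) powr complex_of_real s = of_real (real (Suc n) powr (-s))" for n
    using powr_of_real[of "real (Suc n)" s] by (simp add: powr_minus divide_simps del: of_nat_Suc)
  ultimately have "(\<lambda>n. complex_of_real (real (Suc n) powr (-s))) sums riemann_zeta (of_real s)" by simp
  moreover have "(\<lambda>n. real (Suc n) powr (-s)) sums real_zeta s"
    unfolding real_zeta_def by (intro summable_sums summable_powr_Suc assms)
  hence "(\<lambda>n. complex_of_real (real (Suc n) powr (-s))) sums of_real (real_zeta s)"
    by (rule sums_of_real)
  ultimately show ?thesis by (rule sums_unique2)
qed

text \<open>All terms are nonnegative, so the series may be integrated termwise without a
  convergence condition; each term is a rescaled Gamma integral.\<close>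

lemma nn_integral_omega:
  assumes s: "s > 1"
  shows "(\<integral>\<^sup>+u. ennreal (exp (s * u / 2) * omega (exp u)) \<partial>lborel) =
     ennreal (pi powr (-s/2) * Gamma (s/2) * real_zeta s)"
proof -
  have G: "Gamma (s/2) > 0" using s by (intro Gamma_real_pos) auto
  have "(\<integral>\<^sup>+u. ennreal (exp (s * u / 2) * omega (exp u)) \<partial>lborel) =
     (\<integral>\<^sup>+u. (\<Sum>n. ennreal (exp (s/2 * u) * exp (- (pi * (real (Suc n))\<^sup>2 * exp u)))) \<partial>lborel)"
  proof (intro nn_integral_cong)
    fix u :: real
    have "(\<lambda>n. exp (s/2 * u) * exp (- pi * exp u * (real (Suc n))\<^sup>2)) sums (exp (s/2 * u) * omega (exp u))"
      unfolding omega_def by (intro sums_mult summable_sums summable_omega) auto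
    hence "(\<Sum>n. ennreal (exp (s/2 * u) * exp (- pi * exp u * (real (Suc n))\<^sup>2))) = ennreal (exp (s/2 * u) * omega (exp u))"
      by (intro suminf_ennreal_eq) auto
    thus "ennreal (exp (s * u / 2) * omega (exp u)) = (\<Sum>n. ennreal (exp (s/2 * u) * exp (- (pi * (real (Suc n))\<^sup>2 * exp u))))"
      by (simp add: mult_ac)
  qed
  also have "\<dots> = (\<Sum>n. \<integral>\<^sup>+u. ennreal (exp (s/2 * u) * exp (- (pi * (real (Suc n))\<^sup>2 * exp u))) \<partial>lborel)"
    by (rule nn_integral_suminf) auto
  also have "\<dots> = (\<Sum>n. ennreal ((pi * (real (Suc n))\<^sup>2) powr (-(s/2)) * Gamma (s/2)))"
    using s by (intro suminf_cong nn_integral_Gamma_exp_scaled) auto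
  also have "\<dots> = ennreal (pi powr (-s/2) * Gamma (s/2) * real_zeta s)"
  proof (rule suminf_ennreal_eq)
    have "(pi * (real (Suc n))\<^sup>2) powr (-(s/2)) = pi powr (-s/2) * real (Suc n) powr (-s)" for n
    proof -
      have "((real (Suc n))\<^sup>2) powr (-(s/2)) = (real (Suc n) powr 2) powr (-(s/2))" by (simp add: powr_numeral)
      also have "\<dots> = real (Suc n) powr (-s)" unfolding powr_powr by simp
      finally show ?thesis by (simp add: powr_mult)
    qed
    moreover have "(\<lambda>n. pi powr (-s/2) * Gamma (s/2) * real (Suc n) powr (-s)) sums (pi powr (-s/2) * Gamma (s/2) * real_zeta s)"
      unfolding real_zeta_def by (intro sums_mult summable_sums summable_powr_Suc s)
    ultimately show "(\<lambda>n. (pi * (real (Suc n))\<^sup>2) powr (-(s/2)) * Gamma (s/2)) sums (pi powr (-s/2) * Gamma (s/2) * real_zeta s)"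
      by (simp add: mult_ac)
  qed (use G in auto)
  finally show ?thesis .
qed

text \<open>The functional equation of theta in the variable u = ln x. The summand
  \<open>(exp (u/2) - 1) / 2\<close> is what produces the polar term 1 / (s (s - 1)).\<close>

lemma omega_exp_minus: "omega (exp (-u)) = exp (u/2) * omega (exp u) + (exp (u/2) - 1) / 2"
proof -
  have "sqrt (exp u) = exp (u/2)" using real_sqrt_unique[of "exp (u/2)" "exp u"]
    by (simp add: power2_eq_square flip: exp_add)
  thus ?thesis using omega_inversion[of "exp u"] by (simp add: exp_minus inverse_eq_divide field_simps)
qed

text \<open>The Mellin integral over the whole line is cut at 0 and its negative half reflected by
  \<open>omega_exp_minus\<close>. The two halves combine to the kernel \<open>k\<close> plus the
  elementary function \<open>q\<close>, whose integral is the polar term.\<close>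

lemma xi_integral_of_real:
  assumes s: "s > 1"
  shows "xi_integral (of_real s) = of_real (pi powr (-s/2) * Gamma (s/2) * real_zeta s - 1 / (s * (s - 1)))"
proof -
  define k where "k = (\<lambda>u. (exp (s * u / 2) + exp ((1 - s) * u / 2)) * omega (exp u))"
  define q where "q = (\<lambda>u::real. (exp ((1 - s) * u / 2) - exp (- s * u / 2)) / 2)"
  have k_of_real: "xi_kernel (of_real s) u = of_real (k u)" for u
    unfolding xi_kernel_def k_def by (simp add: exp_of_real [symmetric] flip: exp_of_real)
  have kint: "k integrable_on {0..}"
  proof -
    have "(\<lambda>u. Re (xi_kernel (of_real s) u)) integrable_on {0..}"
      using integrable_linear[OF xi_kernel_integrable[of 0 "of_real s"] bounded_linear_Re] by (simp add: o_def)
    thus ?thesis by (simp add: k_of_real)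
  qed
  define K where "K = integral {0..} k"
  have K: "(k has_integral K) {0..}" unfolding K_def using kint by (rule integrable_integral)
  have knn: "k u \<ge> 0" for u unfolding k_def using omega_nonneg[of "exp u"] by simp
  have K0: "K \<ge> 0" using K knn by (rule has_integral_nonneg)
  have "((\<lambda>u. of_real (k u)) has_integral complex_of_real K) {0..}"
    using has_integral_linear[OF K bounded_linear_of_real] by (simp add: o_def)
  hence XK: "xi_integral (of_real s) = of_real K"
    unfolding xi_integral_def ext[of "xi_kernel (of_real s)", OF k_of_real] by (rule integral_unique)
  have q: "(q has_integral (1 / (s * (s - 1)))) {0..}"
  proof -
    have "((\<lambda>u. 1/2 * (exp (- ((s - 1)/2) * u) - exp (- (s/2) * u))) has_integral
        1/2 * (exp (- ((s - 1)/2) * 0) / ((s - 1)/2) - exp (- (s/2) * 0) / (s/2))) {0..}"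
      using s by (intro has_integral_mult_right has_integral_diff has_integral_exp_minus_to_infinity) auto
    moreover have "(\<lambda>u. 1/2 * (exp (- ((s - 1)/2) * u) - exp (- (s/2) * u))) = q"
      by (auto simp: q_def fun_eq_iff field_simps)
    moreover have "1/2 * (exp (- ((s - 1)/2) * 0) / ((s - 1)/2) - exp (- (s/2) * 0) / (s/2)) = 1 / (s * (s - 1))"
      using s by (simp add: field_simps)
    ultimately show ?thesis by simp
  qed
  have qnn: "q u \<ge> 0" if "u \<ge> 0" for u
    using that by (simp add: q_def field_simps)
  have om: "\<And>u. omega (exp u) \<ge> 0" by (simp add: omega_nonneg)
  have om_meas [measurable]: "(\<lambda>u. omega (exp u)) \<in> borel_measurable borel"
    by (intro borel_measurable_continuous_onI continuous_on_omega_exp)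
  have "(\<integral>\<^sup>+u. ennreal (exp (s * u / 2) * omega (exp u)) \<partial>lborel) =
     (\<integral>\<^sup>+u. ennreal (indicator {0..} u * (exp (s * u / 2) * omega (exp u))) +
        ennreal (indicator {..<0} u * (exp (s * u / 2) * omega (exp u))) \<partial>lborel)"
    by (intro nn_integral_cong) (auto simp: indicator_def)
  also have "\<dots> = (\<integral>\<^sup>+u. ennreal (indicator {0..} u * (exp (s * u / 2) * omega (exp u))) \<partial>lborel) +
     (\<integral>\<^sup>+u. ennreal (indicator {..<0} u * (exp (s * u / 2) * omega (exp u))) \<partial>lborel)"
    by (rule nn_integral_add) auto
  also have "(\<integral>\<^sup>+u. ennreal (indicator {..<0} u * (exp (s * u / 2) * omega (exp u))) \<partial>lborel) =
     ennreal \<bar>-1\<bar> * (\<integral>\<^sup>+u. ennreal (indicator {..<0} (0 + -1 * u) * (exp (s * (0 + -1 * u) / 2) * omega (exp (0 + -1 * u)))) \<partial>lborel)"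
    by (rule nn_integral_real_affine) auto
  also have "\<dots> = (\<integral>\<^sup>+u. ennreal (indicator {0<..} u * (exp (- s * u / 2) * omega (exp (- u)))) \<partial>lborel)"
    by (simp add: indicator_def)
  also have "\<dots> = (\<integral>\<^sup>+u. ennreal (indicator {0..} u * (exp (- s * u / 2) * omega (exp (- u)))) \<partial>lborel)"
    by (intro nn_integral_cong_AE eventually_mono[OF AE_lborel_singleton[of 0]]) (auto simp: indicator_def)
  also have "(\<integral>\<^sup>+u. ennreal (indicator {0..} u * (exp (s * u / 2) * omega (exp u))) \<partial>lborel) + \<dots> =
     (\<integral>\<^sup>+u. ennreal (indicator {0..} u * (exp (s * u / 2) * omega (exp u))) +
        ennreal (indicator {0..} u * (exp (- s * u / 2) * omega (exp (- u)))) \<partial>lborel)"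
    by (rule nn_integral_add [symmetric]) (auto simp: om_meas omega_exp_minus)
  also have "\<dots> = (\<integral>\<^sup>+u. ennreal (indicator {0..} u * k u) + ennreal (indicator {0..} u * q u) \<partial>lborel)"
  proof (rule nn_integral_cong)
    fix u :: real
    show "ennreal (indicator {0..} u * (exp (s * u / 2) * omega (exp u))) +
        ennreal (indicator {0..} u * (exp (- s * u / 2) * omega (exp (- u)))) =
       ennreal (indicator {0..} u * k u) + ennreal (indicator {0..} u * q u)"
    proof (cases "u \<ge> 0")
      case True
      have "exp (- s * u / 2) * exp (u/2) = exp ((1 - s) * u / 2)"
        by (simp add: field_simps flip: exp_add)
      hence "exp (s * u / 2) * omega (exp u) + exp (- s * u / 2) * omega (exp (- u)) = k u + q u"
        unfolding omega_exp_minus k_def q_def by (simp add: algebra_simps add_divide_distrib diff_divide_distrib)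
      thus ?thesis using True om[of u] om[of "-u"] knn[of u] qnn[of u]
        by (simp flip: ennreal_plus)
    qed simp
  qed
  also have "\<dots> = (\<integral>\<^sup>+u. ennreal (indicator {0..} u * k u) \<partial>lborel) + (\<integral>\<^sup>+u. ennreal (indicator {0..} u * q u) \<partial>lborel)"
    by (rule nn_integral_add) (auto simp: k_def q_def)
  also have "\<dots> = ennreal K + ennreal (1 / (s * (s - 1)))"
    using nn_integral_has_integral_lebesgue[OF _ K] nn_integral_has_integral_lebesgue[OF _ q] knn qnn by simp
  also have "\<dots> = ennreal (K + 1 / (s * (s - 1)))"
    using K0 s by (intro ennreal_plus [symmetric]) auto
  finally have "pi powr (-s/2) * Gamma (s/2) * real_zeta s = K + 1 / (s * (s - 1))"
    unfolding nn_integral_omega[OF s] using K0 s real_zeta_nonneg[OF s] Gamma_real_pos[of "s/2"]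
    by (subst (asm) ennreal_inj) auto
  thus ?thesis using XK by simp
qed

text \<open>With \<open>rGamma\<close> in place of Gamma both sides are holomorphic off 1. Agreement
  on the real ray beyond 1, where the integral has been computed, then forces the identity
  everywhere else, including the points where Gamma has poles.\<close>

lemma xi_riemann_zeta:
  assumes "s \<noteq> 1"
  shows "xi s * rGamma (s / 2) = s * (s - 1) * exp (- (s / 2) * of_real (ln pi)) * riemann_zeta s"
proof (rule analytic_continuation[of "\<lambda>s. xi s * rGamma (s / 2) - s * (s - 1) * exp (- (s / 2) * of_real (ln pi)) * riemann_zeta s"
     "-{1}" "of_real ` {1<..}" 2 s, unfolded right_minus_eq])
  have z: "riemann_zeta holomorphic_on -{1}" using riemann_zeta by (simp add: is_zeta_continuation_def)
  show "(\<lambda>s. xi s * rGamma (s / 2) - s * (s - 1) * exp (- (s / 2) * of_real (ln pi)) * riemann_zeta s) holomorphic_on -{1}"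
    by (intro holomorphic_intros xi_holomorphic z holomorphic_on_compose_gen[OF _ holomorphic_rGamma, unfolded o_def]) auto
  show "connected (-{1::complex})" by (intro connected_punctured_universe) auto
  show "(2::complex) islimpt of_real ` {1<..}"
    unfolding islimpt_sequential
  proof (intro exI[of _ "\<lambda>n. of_real (2 + 1 / real (Suc n))"] conjI allI)
    show "complex_of_real (2 + 1 / real (Suc n)) \<in> of_real ` {1<..} - {2}" for n
      by (auto simp: complex_eq_iff intro!: imageI simp: add_pos_pos simp del: of_real_add)
    have "(\<lambda>n. 2 + 1 / real (Suc n)) \<longlonglongrightarrow> 2" by real_asymp
    from tendsto_of_real[OF this, where 'a = complex] show "(\<lambda>n. complex_of_real (2 + 1 / real (Suc n))) \<longlonglongrightarrow> 2" by simp
  qed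
  fix z :: complex assume "z \<in> of_real ` {1<..}"
  then obtain t where t: "z = of_real t" "t > 1" by auto
  have "xi z = of_real (1 + t * (t - 1) * (pi powr (-t/2) * Gamma (t/2) * real_zeta t - 1 / (t * (t - 1))))"
    unfolding xi_def t(1) xi_integral_of_real[OF t(2)] by simp
  also have "1 + t * (t - 1) * (pi powr (-t/2) * Gamma (t/2) * real_zeta t - 1 / (t * (t - 1))) =
      t * (t - 1) * (pi powr (-t/2) * Gamma (t/2) * real_zeta t)"
    using t(2) by (simp add: right_diff_distrib)
  finally have "xi z * rGamma (z / 2) = of_real (t * (t - 1) * (pi powr (-t/2) * Gamma (t/2) * real_zeta t)) * of_real (rGamma (t / 2))"
    using rGamma_complex_of_real[of "t/2"] t(1) by simp
  also have "\<dots> = of_real (t * (t - 1) * (pi powr (-t/2)) * real_zeta t * (Gamma (t/2) * rGamma (t/2)))"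
    by simp
  also have "Gamma (t/2) * rGamma (t/2) = 1"
    using less_imp_neq[OF Gamma_real_pos[of "t/2"]] t(2) by (simp add: rGamma_inverse_Gamma)
  also have "pi powr (-t/2) = exp (- (t/2) * ln pi)" by (simp add: powr_def)
  finally show "xi z * rGamma (z / 2) = z * (z - 1) * exp (- (z / 2) * of_real (ln pi)) * riemann_zeta z"
    unfolding t(1) riemann_zeta_of_real[OF t(2)] by (simp add: exp_of_real [symmetric] flip: exp_of_real)
qed (use assms in auto)

section \<open>The logarithmic derivative of the zeta function\<close>

text \<open>The Dirichlet monomial with base \<open>n + 1\<close>, in a form that is visibly entire
  in \<open>s\<close>; the shift of the index runs through all Dirichlet series below.\<close>

definition nexp :: "nat \<Rightarrow> complex \<Rightarrow> complex" where
  "nexp n s = exp (- s * of_real (ln (real (Suc n))))"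

lemma norm_nexp: "norm (nexp n s) = real (Suc n) powr (- Re s)"
  by (simp add: nexp_def norm_exp_eq_Re powr_def)

lemma inverse_powr_eq_nexp: "1 / of_nat (Suc n) powr s = nexp n s"
proof -
  have "of_nat (Suc n) powr s = exp (s * of_real (ln (real (Suc n))))"
    by (simp add: powr_def Ln_of_nat del: of_nat_Suc)
  thus ?thesis by (simp add: nexp_def exp_minus inverse_eq_divide)
qed

lemma nexp_mult: "nexp d s * nexp e s = nexp (Suc d * Suc e - 1) s"
proof -
  have "ln (real (Suc (Suc d * Suc e - 1))) = ln (real (Suc d)) + ln (real (Suc e))"
  proof -
    have "real (Suc (Suc d * Suc e - 1)) = real (Suc d) * real (Suc e)" by (simp add: algebra_simps)
    thus ?thesis by (simp only: ln_mult) simp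
  qed
  thus ?thesis by (simp add: nexp_def exp_add [symmetric] algebra_simps)
qed

lemma zeta_sums: "Re s > 1 \<Longrightarrow> (\<lambda>n. nexp n s) sums riemann_zeta s"
  using riemann_zeta by (simp add: is_zeta_continuation_def inverse_powr_eq_nexp del: of_nat_Suc)

lemma zeta_holomorphic: "riemann_zeta holomorphic_on - {1}"
  using riemann_zeta by (simp add: is_zeta_continuation_def)

lemma zeta_deriv_sums:
  assumes s: "Re s > 1"
  shows "(\<lambda>n. - of_real (ln (real (Suc n))) * nexp n s) sums deriv riemann_zeta s"
proof -
  let ?S = "{s. Re s > 1}"
  have "\<exists>g g'. \<forall>x \<in> ?S. ((\<lambda>n. nexp n x) sums g x) \<and>
     ((\<lambda>n. - of_real (ln (real (Suc n))) * nexp n x) sums g' x) \<and> (g has_field_derivative g' x) (at x)"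
  proof (rule series_and_derivative_comparison_complex)
    show "open ?S" by (rule open_Re_gt)
    show "(nexp n has_field_derivative - of_real (ln (real (Suc n))) * nexp n x) (at x)" for n x
      unfolding nexp_def [abs_def] by (auto intro!: derivative_eq_intros)
    fix x :: complex assume x: "x \<in> ?S"
    define d where "d = (Re x - 1) / 2"
    have d: "d > 0" using x by (simp add: d_def)
    have le: "norm (nexp n y) \<le> norm (complex_of_real (real (Suc n) powr (-(1 + d))))" if "y \<in> ball x d" for n y
    proof -
      have "\<bar>Re x - Re y\<bar> < d" using that abs_Re_le_cmod[of "x - y"] by (simp add: dist_norm)
      hence "Re y \<ge> 1 + d" unfolding d_def abs_less_iff by (simp add: field_simps)
      hence "real (Suc n) powr (- Re y) \<le> real (Suc n) powr (-(1 + d))" by (intro powr_mono) auto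
      thus ?thesis by (simp add: norm_nexp)
    qed
    have "summable (\<lambda>n. complex_of_real (real (Suc n) powr (-(1 + d))))"
      using summable_powr_Suc[of "1 + d"] d by (subst summable_of_real_iff) auto
    thus "\<exists>d h. 0 < d \<and> summable h \<and> range h \<subseteq> \<real>\<^sub>\<ge>\<^sub>0 \<and>
       (\<forall>\<^sub>F n in sequentially. \<forall>y\<in>ball x d \<inter> ?S. norm (nexp n y) \<le> norm (h n :: complex))"
      using d le by (intro exI[of _ d] exI[of _ "\<lambda>n. complex_of_real (real (Suc n) powr (-(1 + d)))"] conjI
         always_eventually allI ballI) auto
  qed
  then obtain g g' where g: "\<And>x. Re x > 1 \<Longrightarrow> (\<lambda>n. nexp n x) sums g x"
     "\<And>x. Re x > 1 \<Longrightarrow> (\<lambda>n. - of_real (ln (real (Suc n))) * nexp n x) sums g' x"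
     "\<And>x. Re x > 1 \<Longrightarrow> (g has_field_derivative g' x) (at x)" by blast
  have "(riemann_zeta has_field_derivative g' s) (at s)"
    by (rule has_field_derivative_transform_within_open[OF g(3)[OF s] open_Re_gt, of 1])
       (use s sums_unique2[OF g(1) zeta_sums] in auto)
  hence "deriv riemann_zeta s = g' s" by (rule DERIV_imp_deriv)
  thus ?thesis using g(2)[OF s] by simp
qed

section \<open>The von Mangoldt series\<close>

lemma has_sum_product:
  fixes a b :: "'a \<Rightarrow> complex"
  assumes a: "(a has_sum A) UNIV" "(\<lambda>x. norm (a x)) summable_on UNIV" and b: "(b has_sum B) UNIV" "(\<lambda>x. norm (b x)) summable_on UNIV"
  shows "((\<lambda>(x, y). a x * b y) has_sum (A * B)) (UNIV \<times> UNIV)"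
proof (rule has_sum_SigmaI[where g = "\<lambda>x. a x * B"])
  show "((\<lambda>y. case (x, y) of (x, y) \<Rightarrow> a x * b y) has_sum a x * B) UNIV" for x
    using has_sum_cmult_right[OF b(1)] by simp
  show "((\<lambda>x. a x * B) has_sum A * B) UNIV" by (rule has_sum_cmult_left[OF a(1)])
  have "(\<lambda>p. norm (case p of (x, y) \<Rightarrow> a x * b y)) summable_on UNIV \<times> UNIV"
    unfolding Infinite_Sum.abs_summable_on_Sigma_iff
    using a(2) b(2) by (auto simp: norm_mult infsum_cmult_right' abs_mult
        intro!: summable_on_cmult_right summable_on_cmult_left infsum_nonneg)
  thus "(\<lambda>(x, y). a x * b y) summable_on UNIV \<times> UNIV" by (rule Infinite_Sum.abs_summable_summable)
qed

definition mangoldt_series :: "complex \<Rightarrow> complex" where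
  "mangoldt_series s = (\<Sum>n. mangoldt (Suc n) * nexp n s)"

lemma mangoldt_nonneg: "(mangoldt n :: real) \<ge> 0"
proof (cases "primepow n")
  case True
  hence "aprimedivisor n > 0" using aprimedivisor_pos_nat[of n] primepow_gt_Suc_0[of n] by simp
  thus ?thesis by (simp add: mangoldt_def)
qed (simp add: mangoldt_def)

lemma mangoldt_le_ln: "n > 0 \<Longrightarrow> (mangoldt n :: real) \<le> ln (real n)"
proof -
  assume n: "n > 0"
  have "(\<Sum>d\<in>{n}. mangoldt d :: real) \<le> (\<Sum>d | d dvd n. mangoldt d)"
    using n by (intro sum_mono2 finite_divisors_nat mangoldt_nonneg) auto
  thus ?thesis using mangoldt_sum[of n, where 'a = real] n by simp
qed

lemma norm_mangoldt_term: "norm (mangoldt (Suc n) * nexp n s) = mangoldt (Suc n) * real (Suc n) powr (- Re s)"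
proof -
  have "norm (mangoldt (Suc n) :: complex) = \<bar>mangoldt (Suc n) :: real\<bar>"
    by (metis norm_of_real of_real_mangoldt)
  hence n: "norm (mangoldt (Suc n) :: complex) = mangoldt (Suc n)" using mangoldt_nonneg[of "Suc n"] by simp
  show ?thesis by (simp only: norm_mult norm_nexp n)
qed

lemma summable_mangoldt:
  assumes s: "s > 1"
  shows "summable (\<lambda>n. mangoldt (Suc n) * real (Suc n) powr (- s))"
proof -
  define d where "d = (s - 1) / 2"
  have d: "d > 0" using s by (simp add: d_def)
  have "summable (\<lambda>n. 1 / d * real (Suc n) powr (-(1 + d)))"
    using d by (intro summable_mult summable_powr_Suc) auto
  thus ?thesis
  proof (rule summable_comparison_test'[of _ 0])
    fix n :: nat
    have "d * ln (real (Suc n)) \<le> real (Suc n) powr d"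
    proof -
      have "real (Suc n) powr d = exp (d * ln (real (Suc n)))" by (simp add: powr_def)
      thus ?thesis using exp_ge_add_one_self[of "d * ln (real (Suc n))"] by linarith
    qed
    moreover have "d * mangoldt (Suc n) \<le> d * ln (real (Suc n))"
      using d by (intro mult_left_mono mangoldt_le_ln) auto
    ultimately have "d * mangoldt (Suc n) \<le> real (Suc n) powr d" by linarith
    hence "mangoldt (Suc n) \<le> 1 / d * real (Suc n) powr d" using d by (simp add: field_simps)
    hence "mangoldt (Suc n) * real (Suc n) powr (- s) \<le> 1 / d * real (Suc n) powr d * real (Suc n) powr (- s)"
      by (intro mult_right_mono) auto
    also have "\<dots> = 1 / d * real (Suc n) powr (d + - s)" by (subst powr_add) simp
    also have "d + - s = - (1 + d)" by (simp add: d_def field_simps)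
    finally show "norm (mangoldt (Suc n) * real (Suc n) powr (- s)) \<le> 1 / d * real (Suc n) powr (- (1 + d))"
      using mangoldt_nonneg[of "Suc n"] by simp
  qed
qed

lemma mangoldt_series_sums:
  assumes "Re s > 1"
  shows "(\<lambda>n. mangoldt (Suc n) * nexp n s) sums mangoldt_series s"
    and "summable (\<lambda>n. norm (mangoldt (Suc n) * nexp n s))"
proof -
  show "summable (\<lambda>n. norm (mangoldt (Suc n) * nexp n s))"
    unfolding norm_mangoldt_term by (rule summable_mangoldt[OF assms])
  thus "(\<lambda>n. mangoldt (Suc n) * nexp n s) sums mangoldt_series s"
    unfolding mangoldt_series_def by (intro summable_sums) (rule summable_norm_cancel)
qed

text \<open>The sum of \<open>mangoldt d\<close> over the divisors \<open>d\<close> of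
  \<open>n\<close> is ln n. Hence the product of the two absolutely convergent series, regrouped by
  the product of the summation variables, is the series of - zeta'.\<close>

lemma zeta_deriv_mangoldt:
  assumes s: "Re s > 1"
  shows "deriv riemann_zeta s = - riemann_zeta s * mangoldt_series s"
proof -
  have nz: "summable (\<lambda>n. norm (nexp n s))" unfolding norm_nexp by (rule summable_powr_Suc[OF s])
  have a: "((\<lambda>n. mangoldt (Suc n) * nexp n s) has_sum mangoldt_series s) UNIV"
    by (rule norm_summable_imp_has_sum[OF mangoldt_series_sums(2)[OF s] mangoldt_series_sums(1)[OF s]])
  have b: "((\<lambda>n. nexp n s) has_sum riemann_zeta s) UNIV"
    by (rule norm_summable_imp_has_sum[OF nz zeta_sums[OF s]])
  have "((\<lambda>(d, e). (mangoldt (Suc d) * nexp d s) * nexp e s) has_sum (mangoldt_series s * riemann_zeta s)) (UNIV \<times> UNIV)"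
    by (rule has_sum_product[OF a _ b]) (use nz mangoldt_series_sums(2)[OF s] in \<open>auto intro!: norm_summable_imp_summable_on simp: summable_on_UNIV_nonneg_real_iff\<close>)
  \<comment> \<open>A pair of factors is traded for their product and the first factor. Because
    indices are shifted by one, the product of the factors with indices \<open>d\<close> and
    \<open>e\<close> has index \<open>Suc d * Suc e - 1\<close>.\<close>
  also have "?this \<longleftrightarrow> ((\<lambda>(n, d). mangoldt (Suc d) * nexp n s) has_sum (mangoldt_series s * riemann_zeta s))
      (Sigma UNIV (\<lambda>n. {d. Suc d dvd Suc n}))"
  proof (rule has_sum_reindex_bij_witness[of _ "\<lambda>(n, d). (d, Suc n div Suc d - 1)" "\<lambda>(d, e). (Suc d * Suc e - 1, d)"])
    fix p :: "nat \<times> nat"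
    obtain d e where p: "p = (d, e)" by (cases p)
    have S: "Suc (Suc d * Suc e - 1) = Suc d * Suc e" by simp
    have "Suc (Suc d * Suc e - 1) div Suc d - 1 = e" unfolding S by (subst nonzero_mult_div_cancel_left) auto
    thus "(case (case p of (d, e) \<Rightarrow> (Suc d * Suc e - 1, d)) of (n, d) \<Rightarrow> (d, Suc n div Suc d - 1)) = p"
      by (simp only: p prod.case)
    show "(case p of (d, e) \<Rightarrow> (Suc d * Suc e - 1, d)) \<in> Sigma UNIV (\<lambda>n. {d. Suc d dvd Suc n})"
      unfolding p prod.case using S by (metis (mono_tags, lifting) UNIV_I dvd_triv_left mem_Collect_eq mem_Sigma_iff)
    show "(case (case p of (d, e) \<Rightarrow> (Suc d * Suc e - 1, d)) of (n, d) \<Rightarrow> mangoldt (Suc d) * nexp n s) =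
       (case p of (d, e) \<Rightarrow> mangoldt (Suc d) * nexp d s * nexp e s)"
      unfolding p prod.case mult.assoc nexp_mult ..
  next
    fix q assume q: "q \<in> Sigma UNIV (\<lambda>n::nat. {d. Suc d dvd Suc n})"
    obtain n d where nd: "q = (n, d)" by (cases q)
    have "Suc d dvd Suc n" using q nd by simp
    then obtain k where k: "Suc n = Suc d * k" unfolding dvd_def ..
    hence "k > 0" by (cases k) auto
    hence "Suc d * Suc (Suc n div Suc d - 1) - 1 = n"
      using k by (metis Suc_diff_1 diff_Suc_1 nonzero_mult_div_cancel_left nat.distinct(1))
    thus "(case (case q of (n, d) \<Rightarrow> (d, Suc n div Suc d - 1)) of (d, e) \<Rightarrow> (Suc d * Suc e - 1, d)) = q"
      by (simp only: nd prod.case)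
  qed auto
  finally have S: "((\<lambda>(n, d). mangoldt (Suc d) * nexp n s) has_sum (mangoldt_series s * riemann_zeta s))
      (Sigma UNIV (\<lambda>n. {d. Suc d dvd Suc n}))" .
  have fin: "finite {d. Suc d dvd Suc n}" for n
    by (rule finite_subset[of _ "{..n}"]) (auto dest: dvd_imp_le)
  have "((\<lambda>n. \<Sum>d | Suc d dvd Suc n. mangoldt (Suc d) * nexp n s) has_sum (mangoldt_series s * riemann_zeta s)) UNIV"
    by (rule has_sum_SigmaD[OF S]) (use fin in \<open>simp add: has_sum_finite\<close>)
  moreover have "(\<Sum>d | Suc d dvd Suc n. mangoldt (Suc d) * nexp n s) = of_real (ln (real (Suc n))) * nexp n s" for n
  proof -
    have S: "Suc (b - Suc 0) = b" if "b dvd Suc n" for b using dvd_pos_nat[OF _ that] by simp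
    have "(\<Sum>d | Suc d dvd Suc n. mangoldt (Suc d) :: complex) = (\<Sum>d | d dvd Suc n. mangoldt d)"
      by (rule sum.reindex_bij_witness[of _ "\<lambda>d. d - 1" Suc]) (auto simp: S)
    thus ?thesis using mangoldt_sum[of "Suc n", where 'a = complex] by (simp add: sum_distrib_right [symmetric])
  qed
  ultimately have "(\<lambda>n. of_real (ln (real (Suc n))) * nexp n s) sums (mangoldt_series s * riemann_zeta s)"
    by (simp add: has_sum_imp_sums)
  from sums_minus[OF this] zeta_deriv_sums[OF s] show ?thesis
    by (simp add: sums_unique2 mult.commute)
qed

text \<open>The archimedean factor together with the factor \<open>s\<close> of \<open>xi\<close>.
  The factor \<open>s - 1\<close> is kept apart, as it belongs to the pole of zeta.\<close>

definition gamma_factor :: "complex \<Rightarrow> complex" where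
  "gamma_factor s = s * exp (- (s / 2) * of_real (ln pi)) * Gamma (s / 2)"

lemma half_not_nonpos_Int: "Re s > 0 \<Longrightarrow> s / 2 \<notin> \<int>\<^sub>\<le>\<^sub>0"
proof
  assume s: "Re s > 0" "s / 2 \<in> \<int>\<^sub>\<le>\<^sub>0"
  hence "Re (s / 2) \<le> 0" by (auto elim!: nonpos_Ints_cases)
  thus False using s(1) by simp
qed

lemma gamma_factor_nonzero: "Re s > 0 \<Longrightarrow> gamma_factor s \<noteq> 0"
  using half_not_nonpos_Int[of s] by (auto simp: gamma_factor_def Gamma_eq_zero_iff)

lemma gamma_factor_holomorphic: "gamma_factor holomorphic_on {s. Re s > 0}"
  unfolding gamma_factor_def [abs_def]
  using half_not_nonpos_Int by (intro holomorphic_intros holomorphic_Gamma) auto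

lemma gamma_factor_log_deriv:
  assumes "Re s > 0"
  shows "deriv gamma_factor s / gamma_factor s = 1 / s - of_real (ln pi) / 2 + Digamma (s / 2) / 2"
proof -
  have s: "s \<noteq> 0" using assms by auto
  have G: "Gamma (s/2) \<noteq> 0" using half_not_nonpos_Int[OF assms] by (simp add: Gamma_eq_zero_iff)
  have "(gamma_factor has_field_derivative
     exp (- (s / 2) * of_real (ln pi)) * Gamma (s / 2)
     + s * (- (of_real (ln pi) / 2)) * exp (- (s / 2) * of_real (ln pi)) * Gamma (s/2)
     + s * exp (- (s / 2) * of_real (ln pi)) * (Gamma (s/2) * Digamma (s/2) / 2)) (at s)"
    unfolding gamma_factor_def [abs_def] using half_not_nonpos_Int[OF assms]
    by (auto intro!: derivative_eq_intros simp: algebra_simps)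
  hence "deriv gamma_factor s = exp (- (s / 2) * of_real (ln pi)) * Gamma (s / 2) *
     (1 + s * (- (of_real (ln pi) / 2)) + s * (Digamma (s/2) / 2))"
    by (auto dest!: DERIV_imp_deriv simp: algebra_simps)
  also have "\<dots> / gamma_factor s = (1 + s * (- (of_real (ln pi) / 2)) + s * (Digamma (s/2) / 2)) / s"
    unfolding gamma_factor_def using G s by simp
  finally show ?thesis using s by (simp add: add_divide_distrib diff_divide_distrib)
qed

lemma xi_eq_zeta:
  assumes "Re s > 0" "s \<noteq> 1"
  shows "xi s = gamma_factor s * (s - 1) * riemann_zeta s"
proof -
  have "Gamma (s/2) * rGamma (s/2) = 1"
    using half_not_nonpos_Int[OF assms(1)] by (simp add: rGamma_inverse_Gamma Gamma_eq_zero_iff)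
  hence "xi s = xi s * rGamma (s/2) * Gamma (s/2)" by (simp add: mult_ac)
  also have "\<dots> = gamma_factor s * (s - 1) * riemann_zeta s"
    unfolding xi_riemann_zeta[OF assms(2)] gamma_factor_def by simp
  finally show ?thesis .
qed

lemma xi_log_deriv:
  assumes s: "Re s > 0" "s \<noteq> 1" and nz: "xi s \<noteq> 0"
  shows "deriv xi s / xi s = deriv gamma_factor s / gamma_factor s + 1 / (s - 1) + deriv riemann_zeta s / riemann_zeta s"
proof -
  have z: "riemann_zeta s \<noteq> 0" using nz xi_eq_zeta[OF s] by auto
  have op: "open ({s. Re s > 0} - {1})" by (intro open_Diff open_Re_gt) auto
  have "(gamma_factor has_field_derivative deriv gamma_factor s) (at s)"
    using s by (intro holomorphic_derivI[OF gamma_factor_holomorphic open_Re_gt]) auto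
  moreover have "(riemann_zeta has_field_derivative deriv riemann_zeta s) (at s)"
    using s by (intro holomorphic_derivI[OF zeta_holomorphic]) auto
  ultimately have "((\<lambda>s. gamma_factor s * (s - 1) * riemann_zeta s) has_field_derivative
     (deriv gamma_factor s * (s - 1) * riemann_zeta s + gamma_factor s * riemann_zeta s
      + gamma_factor s * (s - 1) * deriv riemann_zeta s)) (at s)"
    by (auto intro!: derivative_eq_intros simp: algebra_simps)
  hence "(xi has_field_derivative
     (deriv gamma_factor s * (s - 1) * riemann_zeta s + gamma_factor s * riemann_zeta s
      + gamma_factor s * (s - 1) * deriv riemann_zeta s)) (at s)"
    by (rule has_field_derivative_transform_within_open[OF _ op]) (use s xi_eq_zeta in auto)
  hence "deriv xi s = deriv gamma_factor s * (s - 1) * riemann_zeta s + gamma_factor s * riemann_zeta s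
      + gamma_factor s * (s - 1) * deriv riemann_zeta s" by (rule DERIV_imp_deriv)
  thus ?thesis unfolding xi_eq_zeta[OF s]
    using s z gamma_factor_nonzero[OF s(1)] by (simp add: add_divide_distrib)
qed

text \<open>The residue of a logarithmic derivative, read off along a horizontal ray. Approaching
  from the right is what suits points on the edge of the half-plane of convergence.\<close>

lemma log_deriv_zorder_limit:
  assumes hol: "f holomorphic_on UNIV" and nz: "f z0 \<noteq> 0"
  shows "eventually (\<lambda>x::real. f (a + of_real x) \<noteq> 0) (at_right 0)"
    and "((\<lambda>x::real. of_real x * (deriv f (a + of_real x) / f (a + of_real x))) \<longlongrightarrow> of_nat (nat (zorder f a))) (at_right 0)"
proof -
  define n where "n = nat (zorder f a)"
  obtain h where h: "h holomorphic_on UNIV" "h a \<noteq> 0" "\<And>z. f z = h z * (z - a) ^ n"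
    unfolding n_def using entire_divide_zero[OF hol nz, of a] by blast
  have hd: "(h has_field_derivative deriv h z) (at z)" for z
    by (rule holomorphic_derivI[OF h(1)]) auto
  have lim: "((\<lambda>x::real. a + of_real x) \<longlongrightarrow> a) (at_right 0)" by (auto intro!: tendsto_eq_intros)
  have hl: "((\<lambda>x::real. h (a + of_real x)) \<longlongrightarrow> h a) (at_right 0)"
    by (rule isCont_tendsto_compose[OF _ lim]) (use DERIV_isCont[OF hd] in blast)
  have hol': "deriv h holomorphic_on UNIV" by (rule holomorphic_deriv[OF h(1) open_UNIV])
  have hl': "((\<lambda>x::real. deriv h (a + of_real x)) \<longlongrightarrow> deriv h a) (at_right 0)"
    by (rule isCont_tendsto_compose[OF _ lim])
       (use holomorphic_on_imp_continuous_on[OF hol'] in \<open>simp add: continuous_on_eq_continuous_at\<close>)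
  have ev: "eventually (\<lambda>x::real. h (a + of_real x) \<noteq> 0 \<and> x > 0) (at_right 0)"
    using tendsto_imp_eventually_ne[OF hl h(2)] eventually_at_right_less by (rule eventually_conj)
  show "eventually (\<lambda>x::real. f (a + of_real x) \<noteq> 0) (at_right 0)"
    using ev by eventually_elim (simp add: h(3))
  have "((\<lambda>x::real. of_real x * (deriv h (a + of_real x) / h (a + of_real x)) + of_nat n) \<longlongrightarrow>
      of_real 0 * (deriv h a / h a) + of_nat n) (at_right 0)"
    by (intro tendsto_intros hl hl' h(2))
  moreover have "eventually (\<lambda>x::real. of_real x * (deriv h (a + of_real x) / h (a + of_real x)) + of_nat n =
      of_real x * (deriv f (a + of_real x) / f (a + of_real x))) (at_right 0)"
    using ev
  proof eventually_elim
    case (elim x)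
    define z where "z = a + of_real x"
    have x: "z - a = of_real x" "of_real x \<noteq> (0::complex)" using elim by (simp_all add: z_def)
    have fn: "f = (\<lambda>z. h z * (z - a) ^ n)" using h(3) by auto
    have "(f has_field_derivative (deriv h z * (z - a) ^ n + h z * (of_nat n * (z - a) ^ (n - 1)))) (at z)"
      unfolding fn by (auto intro!: derivative_eq_intros hd simp: mult_ac)
    hence "deriv f z = deriv h z * (z - a) ^ n + h z * (of_nat n * (z - a) ^ (n - 1))" by (rule DERIV_imp_deriv)
    hence "of_real x * deriv f z = of_real x * deriv h z * (z - a) ^ n + h z * (of_real x * (of_nat n * (z - a) ^ (n - 1)))"
      by (simp add: algebra_simps)
    also have "of_real x * (of_nat n * (z - a) ^ (n - 1)) = of_nat n * (z - a) ^ n"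
      unfolding x(1) by (cases n) (auto simp: mult_ac)
    finally have "of_real x * deriv f z = (of_real x * deriv h z + of_nat n * h z) * (z - a) ^ n"
      by (simp add: algebra_simps)
    hence "of_real x * deriv f z / f z = (of_real x * deriv h z + of_nat n * h z) / h z"
      unfolding h(3)[of z] using x by simp
    moreover have "h z \<noteq> 0" using elim by (simp add: z_def)
    ultimately show ?case by (simp add: add_divide_distrib z_def)
  qed
  ultimately show "((\<lambda>x::real. of_real x * (deriv f (a + of_real x) / f (a + of_real x))) \<longlongrightarrow> of_nat (nat (zorder f a))) (at_right 0)"
    unfolding n_def [symmetric] of_real_0 mult_zero_left add_0 by (rule Lim_transform_eventually)
qed

lemma mangoldt_series_eq:
  assumes s: "Re s > 1" and nz: "xi s \<noteq> 0"
  shows "mangoldt_series s = deriv gamma_factor s / gamma_factor s + 1 / (s - 1) - deriv xi s / xi s"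
proof -
  have s': "Re s > 0" "s \<noteq> 1" using s by auto
  have "riemann_zeta s \<noteq> 0" using nz unfolding xi_eq_zeta[OF s'] by simp
  hence "deriv riemann_zeta s / riemann_zeta s = - mangoldt_series s"
    unfolding zeta_deriv_mangoldt[OF s] by simp
  thus ?thesis unfolding xi_log_deriv[OF s' nz] by simp
qed

section \<open>Non-vanishing on the closed half-plane Re s >= 1\<close>

lemma mangoldt_series_limit:
  assumes a: "Re a \<ge> 1"
  shows "((\<lambda>x::real. of_real x * mangoldt_series (a + of_real x)) \<longlongrightarrow>
      (if a = 1 then 1 else 0) - of_nat (nat (zorder xi a))) (at_right 0)"
proof -
  note hol = xi_holomorphic[of UNIV]
  have nz: "xi 1 \<noteq> 0" by simp
  have lim: "((\<lambda>x::real. a + of_real x) \<longlongrightarrow> a) (at_right 0)" by (auto intro!: tendsto_eq_intros)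
  have a0: "a \<in> {s. Re s > 0}" using a by auto
  have hol': "deriv gamma_factor holomorphic_on {s. Re s > 0}"
    by (rule holomorphic_deriv[OF gamma_factor_holomorphic open_Re_gt])
  have g: "((\<lambda>x::real. gamma_factor (a + of_real x)) \<longlongrightarrow> gamma_factor a) (at_right 0)"
    by (rule isCont_tendsto_compose[OF _ lim])
       (use a0 holomorphic_on_imp_continuous_on[OF gamma_factor_holomorphic] open_Re_gt in \<open>auto simp: continuous_on_eq_continuous_at\<close>)
  have g': "((\<lambda>x::real. deriv gamma_factor (a + of_real x)) \<longlongrightarrow> deriv gamma_factor a) (at_right 0)"
    by (rule isCont_tendsto_compose[OF _ lim])
       (use a0 holomorphic_on_imp_continuous_on[OF hol'] open_Re_gt in \<open>auto simp: continuous_on_eq_continuous_at\<close>)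
  have 1: "((\<lambda>x::real. of_real x * (1 / (a + of_real x - 1))) \<longlongrightarrow> (if a = 1 then 1 else 0)) (at_right (0::real))"
  proof (cases "a = 1")
    case True
    have "eventually (\<lambda>x::real. of_real x * (1 / (a + of_real x - 1)) = (1::complex)) (at_right 0)"
      using eventually_at_right_less[of 0] by eventually_elim (simp add: True)
    thus ?thesis using True by (simp add: tendsto_eventually)
  next
    case False
    have "((\<lambda>x::real. of_real x * (1 / (a + of_real x - 1))) \<longlongrightarrow> of_real 0 * (1 / (a + of_real 0 - 1))) (at_right (0::real))"
      using False by (intro tendsto_intros) auto
    thus ?thesis using False by simp
  qed
  have "((\<lambda>x::real. of_real x * (deriv gamma_factor (a + of_real x) / gamma_factor (a + of_real x)) +
       of_real x * (1 / (a + of_real x - 1)) - of_real x * (deriv xi (a + of_real x) / xi (a + of_real x))) \<longlongrightarrow>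
       of_real 0 * (deriv gamma_factor a / gamma_factor a) + (if a = 1 then 1 else 0) - of_nat (nat (zorder xi a))) (at_right 0)"
    by (rule tendsto_diff[OF tendsto_add[OF tendsto_mult[OF tendsto_of_real[OF tendsto_ident_at]
         tendsto_divide[OF g' g]] 1] log_deriv_zorder_limit(2)[OF hol nz]])
       (use gamma_factor_nonzero a0 in auto)
  moreover have "eventually (\<lambda>x::real. of_real x * (deriv gamma_factor (a + of_real x) / gamma_factor (a + of_real x)) +
       of_real x * (1 / (a + of_real x - 1)) - of_real x * (deriv xi (a + of_real x) / xi (a + of_real x)) =
       of_real x * mangoldt_series (a + of_real x)) (at_right 0)"
    using log_deriv_zorder_limit(1)[OF hol nz, of a] eventually_at_right_less[of 0]
  proof eventually_elim
    case (elim x)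
    have M: "mangoldt_series (a + of_real x) = deriv gamma_factor (a + of_real x) / gamma_factor (a + of_real x)
       + 1 / (a + of_real x - 1) - deriv xi (a + of_real x) / xi (a + of_real x)"
      by (rule mangoldt_series_eq) (use elim a in auto)
    show ?case unfolding M by (simp only: distrib_left right_diff_distrib)
  qed
  ultimately show ?thesis unfolding of_real_0 mult_zero_left add_0 by (rule Lim_transform_eventually)
qed

text \<open>Mertens's inequality 3 + 4 cos \<theta> + cos 2\<theta> = 2 (1 + cos \<theta>)^2 >= 0,
  applied to each term of the series.\<close>

lemma mangoldt_series_341:
  assumes "x > 1"
  shows "Re (3 * mangoldt_series (of_real x) + 4 * mangoldt_series (of_real x + \<i> * of_real t)
    + mangoldt_series (of_real x + \<i> * of_real (2 * t))) \<ge> 0"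
proof -
  let ?f = "\<lambda>n. 3 * (mangoldt (Suc n) * nexp n (of_real x)) + 4 * (mangoldt (Suc n) * nexp n (of_real x + \<i> * of_real t))
     + mangoldt (Suc n) * nexp n (of_real x + \<i> * of_real (2 * t))"
  have "?f sums (3 * mangoldt_series (of_real x) + 4 * mangoldt_series (of_real x + \<i> * of_real t)
    + mangoldt_series (of_real x + \<i> * of_real (2 * t)))"
    using assms by (intro sums_add sums_mult mangoldt_series_sums) auto
  hence S: "(\<lambda>n. Re (?f n)) sums Re (3 * mangoldt_series (of_real x) + 4 * mangoldt_series (of_real x + \<i> * of_real t)
    + mangoldt_series (of_real x + \<i> * of_real (2 * t)))" by (rule sums_Re)
  have nonneg: "Re (?f n) \<ge> 0" for n
  proof -
    define L where "L = ln (real (Suc n))"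
    have M: "mangoldt (Suc n) = complex_of_real (mangoldt (Suc n))" by (rule of_real_mangoldt [symmetric])
    have N: "Re (nexp n (of_real x + \<i> * of_real u)) = exp (- x * L) * cos (u * L)" for u
      by (simp add: nexp_def L_def Re_exp)
    have N0: "Re (nexp n (of_real x)) = exp (- x * L)" using N[of 0] by simp
    have "Re (?f n) = mangoldt (Suc n) * (3 * exp (- x * L) + 4 * (exp (- x * L) * cos (t * L)) + exp (- x * L) * cos (2 * t * L))"
      unfolding M using N[of "2 * t"] N[of t] N0 by (simp add: algebra_simps)
    also have "3 * exp (- x * L) + 4 * (exp (- x * L) * cos (t * L)) + exp (- x * L) * cos (2 * t * L)
       = exp (- x * L) * (2 * (1 + cos (t * L))\<^sup>2)"
    proof -
      have c: "cos (2 * t * L) = 2 * (cos (t * L))\<^sup>2 - 1" using cos_double_cos[of "t * L"] by (simp add: mult.assoc)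
      show ?thesis unfolding c by (simp add: power2_eq_square algebra_simps)
    qed
    also have "mangoldt (Suc n) * \<dots> \<ge> 0" using mangoldt_nonneg[of "Suc n"] by simp
    finally show ?thesis .
  qed
  show ?thesis using sums_le[OF nonneg sums_zero S] .
qed

lemma zorder_xi_nonneg:
  assumes "xi a = 0"
  shows "nat (zorder xi a) > 0"
proof -
  have "\<exists>w\<in>UNIV. xi w \<noteq> 0" by (intro bexI[of _ 1]) auto
  from zorder_exist_zero[where z = a, OF xi_holomorphic open_UNIV connected_UNIV UNIV_I this, THEN conjunct1]
  show ?thesis using assms by simp
qed

text \<open>At a zero of order n on the line Re s = 1 the von Mangoldt series has residue - n, at 1
  it has residue at most 1, and at the point of twice the height a residue at most 0. The inequality
  \<open>mangoldt_series_341\<close>, multiplied by the distance to the line, becomes 0 <= 3 - 4 n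
  in the limit.\<close>

lemma xi_nonzero_right:
  assumes "Re a \<ge> 1"
  shows "xi a \<noteq> 0"
proof
  assume z: "xi a = 0"
  have a1: "a \<noteq> 1" using z by auto
  define n where "n = nat (zorder xi a)"
  have n: "n > 0" using zorder_xi_nonneg[OF z] by (simp add: n_def)
  define t where "t = Im a"
  define L where "L = (\<lambda>a. (if a = 1 then 1 else 0) - of_nat (nat (zorder xi a)) :: complex)"
  have lim: "((\<lambda>x::real. of_real x * mangoldt_series (b + of_real x)) \<longlongrightarrow> L b) (at_right 0)" if "Re b \<ge> 1" for b
    unfolding L_def by (rule mangoldt_series_limit[OF that])
  \<comment> \<open>Inside the half-plane of absolute convergence the series stays bounded near
    \<open>a\<close>, so its residue there is 0 and cannot be minus a positive order.\<close>
  have "Re a = 1"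
  proof (rule ccontr)
    assume "Re a \<noteq> 1"
    hence a: "Re a > 1" using assms by simp
    have bound: "norm (mangoldt_series (a + of_real x)) \<le> (\<Sum>n. mangoldt (Suc n) * real (Suc n) powr (- Re a))"
      if x: "x > 0" for x :: real
    proof -
      have r: "Re (a + of_real x) > 1" using a x by simp
      have "norm (mangoldt_series (a + of_real x)) \<le> (\<Sum>n. norm (mangoldt (Suc n) * nexp n (a + of_real x)))"
        unfolding mangoldt_series_def by (rule summable_norm[OF mangoldt_series_sums(2)[OF r]])
      also have "\<dots> \<le> (\<Sum>n. mangoldt (Suc n) * real (Suc n) powr (- Re a))"
      proof (rule suminf_le[OF _ mangoldt_series_sums(2)[OF r] summable_mangoldt[OF a]])
        show "norm (mangoldt (Suc n) * nexp n (a + of_real x)) \<le> mangoldt (Suc n) * real (Suc n) powr (- Re a)" for n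
          unfolding norm_mangoldt_term using x by (intro mult_left_mono powr_mono mangoldt_nonneg) auto
      qed
      finally show ?thesis .
    qed
    have "((\<lambda>x::real. of_real x * mangoldt_series (a + of_real x)) \<longlongrightarrow> 0) (at_right 0)"
    proof (rule Lim_null_comparison)
      show "eventually (\<lambda>x::real. norm (of_real x * mangoldt_series (a + of_real x)) \<le>
           x * (\<Sum>n. mangoldt (Suc n) * real (Suc n) powr (- Re a))) (at_right 0)"
        using eventually_at_right_less[of 0]
        by eventually_elim (use bound in \<open>simp add: norm_mult\<close>)
      have "((\<lambda>x::real. x * (\<Sum>n. mangoldt (Suc n) * real (Suc n) powr (- Re a))) \<longlongrightarrow>
          0 * (\<Sum>n. mangoldt (Suc n) * real (Suc n) powr (- Re a))) (at_right 0)" by (intro tendsto_intros)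
      thus "((\<lambda>x::real. x * (\<Sum>n. mangoldt (Suc n) * real (Suc n) powr (- Re a))) \<longlongrightarrow> 0) (at_right 0)" by simp
    qed
    hence "L a = 0" using lim[OF assms] tendsto_unique[OF trivial_limit_at_right_real] by blast
    thus False using a1 n by (simp add: L_def n_def)
  qed
  hence a_eq: "a = 1 + \<i> * of_real t" by (simp add: complex_eq_iff t_def)
  define b where "b = 1 + \<i> * of_real (2 * t)"
  have t0: "t \<noteq> 0" using a1 a_eq by auto
  hence b1: "b \<noteq> 1" by (simp add: b_def)
  have "((\<lambda>x::real. 3 * (of_real x * mangoldt_series (1 + of_real x)) + 4 * (of_real x * mangoldt_series (a + of_real x))
     + of_real x * mangoldt_series (b + of_real x)) \<longlongrightarrow> 3 * L 1 + 4 * L a + L b) (at_right 0)"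
    by (intro tendsto_intros lim) (auto simp: b_def assms)
  hence "((\<lambda>x::real. Re (3 * (of_real x * mangoldt_series (1 + of_real x)) + 4 * (of_real x * mangoldt_series (a + of_real x))
     + of_real x * mangoldt_series (b + of_real x))) \<longlongrightarrow> Re (3 * L 1 + 4 * L a + L b)) (at_right 0)"
    by (rule tendsto_Re)
  moreover have "eventually (\<lambda>x::real. Re (3 * (of_real x * mangoldt_series (1 + of_real x)) + 4 * (of_real x * mangoldt_series (a + of_real x))
     + of_real x * mangoldt_series (b + of_real x)) \<ge> 0) (at_right 0)"
    using eventually_at_right_less[of 0]
  proof eventually_elim
    case (elim x)
    have e: "1 + of_real x = complex_of_real (1 + x)" "a + of_real x = of_real (1 + x) + \<i> * of_real t"
      "b + of_real x = of_real (1 + x) + \<i> * of_real (2 * t)" by (auto simp: a_eq b_def)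
    have "0 \<le> x * Re (3 * mangoldt_series (of_real (1 + x)) + 4 * mangoldt_series (of_real (1 + x) + \<i> * of_real t)
    + mangoldt_series (of_real (1 + x) + \<i> * of_real (2 * t)))"
      using elim mangoldt_series_341[of "1 + x" t] by (intro mult_nonneg_nonneg) auto
    thus ?case unfolding e by (simp add: algebra_simps)
  qed
  ultimately have "0 \<le> Re (3 * L 1 + 4 * L a + L b)"
    by (rule tendsto_lowerbound) simp
  hence "0 \<le> 3 - 3 * real (nat (zorder xi 1)) - 4 * real n - real (nat (zorder xi b))"
    using a1 b1 by (simp add: L_def n_def)
  thus False using n by linarith
qed

lemma xi_nonzero_left: "Re a \<le> 0 \<Longrightarrow> xi a \<noteq> 0"
  using xi_nonzero_right[of "1 - a"] by (simp add: xi_symmetric)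

text \<open>Non-vanishing on the closed half-planes left and right of the strip makes the strip
  condition automatic. The Hadamard expansion, which runs over all zeros of \<open>xi\<close>,
  thereby speaks of the same set as \<open>H\<close>.\<close>

lemma nontrivial_zeros_eq: "nontrivial_zeros = {\<rho>. xi \<rho> = 0}"
  unfolding nontrivial_zeros_def
proof (rule Collect_cong)
  fix \<rho> :: complex
  show "(riemann_zeta \<rho> = 0 \<and> 0 < Re \<rho> \<and> Re \<rho> < 1) = (xi \<rho> = 0)"
  proof
    assume a: "riemann_zeta \<rho> = 0 \<and> 0 < Re \<rho> \<and> Re \<rho> < 1"
    hence "\<rho> \<noteq> 1" by auto
    thus "xi \<rho> = 0" using xi_eq_zeta[of \<rho>] a by simp
  next
    assume z: "xi \<rho> = 0"
    have "\<not> Re \<rho> \<ge> 1" using xi_nonzero_right[of \<rho>] z by blast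
    moreover have "\<not> Re \<rho> \<le> 0" using xi_nonzero_left[of \<rho>] z by blast
    ultimately have r: "0 < Re \<rho>" "Re \<rho> < 1" by simp_all
    hence "\<rho> \<noteq> 1" by auto
    hence "riemann_zeta \<rho> = 0"
      using xi_eq_zeta[of \<rho>] gamma_factor_nonzero[of \<rho>] r z by simp
    thus "riemann_zeta \<rho> = 0 \<and> 0 < Re \<rho> \<and> Re \<rho> < 1" using r by simp
  qed
qed

lemma zorder_zeta_eq_xi:
  assumes "xi \<rho> = 0"
  shows "zorder riemann_zeta \<rho> = zorder xi \<rho>"
proof -
  have "\<rho> \<in> nontrivial_zeros" using assms unfolding nontrivial_zeros_eq by simp
  hence r: "0 < Re \<rho>" "Re \<rho> < 1" unfolding nontrivial_zeros_def by auto
  define n where "n = nat (zorder xi \<rho>)"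
  have n0: "n > 0" unfolding n_def by (rule zorder_xi_nonneg[OF assms])
  have nz: "xi 1 \<noteq> 0" by simp
  obtain h where h: "h holomorphic_on UNIV" "h \<rho> \<noteq> 0" "\<And>z. xi z = h z * (z - \<rho>) ^ n"
    unfolding n_def using entire_divide_zero[OF xi_holomorphic nz, of \<rho>] by blast
  have "zorder riemann_zeta \<rho> = int n"
  proof (rule zorder_eqI[of "{s. Re s > 0} - {1}" \<rho> "\<lambda>s. h s / (gamma_factor s * (s - 1))"])
    show "open ({s. Re s > 0} - {1})" by (intro open_Diff open_Re_gt) auto
    show "(\<lambda>s. h s / (gamma_factor s * (s - 1))) holomorphic_on {s. Re s > 0} - {1}"
      using gamma_factor_nonzero
      by (intro holomorphic_intros holomorphic_on_subset[OF h(1)] holomorphic_on_subset[OF gamma_factor_holomorphic]) auto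
    show "h \<rho> / (gamma_factor \<rho> * (\<rho> - 1)) \<noteq> 0" using h(2) gamma_factor_nonzero[OF r(1)] r by auto
    fix w assume w: "w \<in> {s. Re s > 0} - {1}" "w \<noteq> \<rho>"
    show "riemann_zeta w = h w / (gamma_factor w * (w - 1)) * (w - \<rho>) powi int n"
      using w xi_eq_zeta[of w] h(3)[of w] gamma_factor_nonzero[of w] by (simp add: field_simps)
  qed (use r in auto)
  thus ?thesis using n0 by (simp add: n_def)
qed

section \<open>Partial fractions over the zeros\<close>

text \<open>A zero at 1/2 would have ordinate 0 and be missed by a sum over positive ordinates. It
  would require \<open>xi_integral (1/2) = 4\<close>, whereas the decay of \<open>omega\<close>
  bounds that integral by 8/3.\<close>

lemma xi_half_nonzero: "xi (1/2) \<noteq> 0"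
proof
  assume "xi (1/2) = 0"
  hence I: "xi_integral (1/2) = 4" by (simp add: xi_def)
  have bd: "norm (xi_kernel (1/2) u) \<le> 4 * exp (-1) * exp (- (3/4) * u)" if u: "u \<in> {0..}" for u
  proof -
    have e: "exp u \<ge> 1 + u" by simp
    have "omega (exp u) \<le> 2 * exp (- exp u)" using omega_le[of "exp u"] u by simp
    also have "- exp u \<le> - 1 - u" using e by linarith
    hence "2 * exp (- exp u) \<le> 2 * exp (- 1 - u)" by simp
    finally have o: "omega (exp u) \<le> 2 * exp (- 1 - u)" .
    have "xi_kernel (1/2) u = of_real (2 * exp (u / 4) * omega (exp u))"
      by (simp add: xi_kernel_def exp_of_real [symmetric] flip: exp_of_real)
    hence "norm (xi_kernel (1/2) u) = 2 * exp (u / 4) * omega (exp u)"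
      using omega_nonneg[of "exp u"] by (simp only: norm_of_real) simp
    also have "\<dots> \<le> 2 * exp (u / 4) * (2 * exp (- 1 - u))" using o by (intro mult_left_mono) auto
    also have "\<dots> = 4 * (exp (u / 4) * exp (- 1 - u))" by simp
    also have "exp (u / 4) * exp (- 1 - u) = exp (-1) * exp (- (3/4) * u)"
      by (simp add: exp_add [symmetric])
    finally show ?thesis by simp
  qed
  have h: "((\<lambda>u. 4 * exp (-1) * exp (- (3/4) * u)) has_integral 4 * exp (-1) * (exp (- (3/4) * 0) / (3/4))) {0::real..}"
    by (intro has_integral_mult_right has_integral_exp_minus_to_infinity) auto
  have "norm (xi_integral (1/2)) \<le> integral {0..} (\<lambda>u. 4 * exp (-1) * exp (- (3/4) * u))"
    unfolding xi_integral_def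
    by (rule integral_norm_bound_integral[OF xi_kernel_integrable _ bd]) (use h in \<open>auto simp: integrable_on_def\<close>)
  also have "\<dots> = 4 * exp (-1) * (4/3)" using integral_unique[OF h] by simp
  also have "exp (-1) \<le> 1 / (2::real)" using exp_ge_add_one_self[of 1] by (simp add: exp_minus field_simps)
  hence "4 * exp (-1) * (4/3) \<le> 4 * (1 / 2) * (4/3::real)" by (intro mult_right_mono mult_left_mono) auto
  finally show False using I by simp
qed

text \<open>Only zeros on the critical line are recorded, and without multiplicity: under the
  Riemann hypothesis all zeros come from these by conjugation, and \<open>zero_mult\<close> carries
  the multiplicities.\<close>

definition ordinates :: "real set" where
  "ordinates = {\<gamma>. \<gamma> > 0 \<and> xi (1/2 + \<i> * of_real \<gamma>) = 0}"

definition zero_mult :: "real \<Rightarrow> real" where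
  "zero_mult \<gamma> = real (nat (zorder xi (1/2 + \<i> * of_real \<gamma>)))"

lemma zero_mult_pos: "\<gamma> \<in> ordinates \<Longrightarrow> zero_mult \<gamma> > 0"
  using zorder_xi_nonneg[of "1/2 + \<i> * of_real \<gamma>"] by (simp add: ordinates_def zero_mult_def)

text \<open>For nonnegative terms the sums along the exhaustion are monotone, and every finite
  subset is contained in one of its members; the order of summation given by \<open>d\<close>
  therefore loses its significance. This is where convergence along discs becomes absolute.\<close>

lemma has_sum_of_exhausting:
  fixes f :: "'a \<Rightarrow> real"
  assumes nonneg: "\<And>x. x \<in> V \<Longrightarrow> f x \<ge> 0"
    and fin: "\<And>R. finite {x\<in>V. d x \<le> R}"
    and lim: "((\<lambda>R::real. sum f {x\<in>V. d x \<le> R}) \<longlongrightarrow> L) at_top"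
  shows "(f has_sum L) V"
proof -
  have mono: "sum f {x\<in>V. d x \<le> R} \<le> sum f {x\<in>V. d x \<le> R'}" if "R \<le> R'" for R R'
    by (rule sum_mono2[OF fin]) (use that nonneg in auto)
  have le: "sum f {x\<in>V. d x \<le> R} \<le> L" for R
  proof (rule tendsto_lowerbound[OF lim])
    show "\<forall>\<^sub>F R' in at_top. sum f {x\<in>V. d x \<le> R} \<le> sum f {x\<in>V. d x \<le> R'}"
      using eventually_ge_at_top[of R] by eventually_elim (use mono in blast)
  qed simp
  have le': "sum f Y \<le> L" if Y: "finite Y" "Y \<subseteq> V" for Y
  proof -
    have "Y \<subseteq> {x\<in>V. d x \<le> Max (insert 0 (d ` Y))}" using Y by auto
    hence "sum f Y \<le> sum f {x\<in>V. d x \<le> Max (insert 0 (d ` Y))}"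
      by (intro sum_mono2[OF fin]) (use nonneg in auto)
    thus ?thesis using le order_trans by blast
  qed
  show ?thesis unfolding has_sum_def
  proof (rule order_tendstoI)
    fix a assume "a < L"
    hence "\<forall>\<^sub>F R in at_top. a < sum f {x\<in>V. d x \<le> R}" by (rule order_tendstoD(1)[OF lim])
    then obtain R where R: "a < sum f {x\<in>V. d x \<le> R}"
      using eventually_happens'[OF trivial_limit_at_top_linorder] by blast
    have "a < sum f Y" if Y: "finite Y" "{x\<in>V. d x \<le> R} \<subseteq> Y" "Y \<subseteq> V" for Y
    proof -
      have "sum f {x\<in>V. d x \<le> R} \<le> sum f Y" by (rule sum_mono2) (use Y nonneg in auto)
      thus ?thesis using R by simp
    qed
    thus "\<forall>\<^sub>F Y in finite_subsets_at_top V. a < sum f Y"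
      unfolding eventually_finite_subsets_at_top using fin[of R] by (intro exI[of _ "{x\<in>V. d x \<le> R}"]) auto
  next
    fix a assume "L < a"
    thus "\<forall>\<^sub>F Y in finite_subsets_at_top V. sum f Y < a"
      unfolding eventually_finite_subsets_at_top using le' by (intro exI[of _ "{}"]) force
  qed
qed

text \<open>
  \<open>xi (1/2 + w) = \<Phi> (w\<^sup>2)\<close> with \<open>\<Phi>\<close> of order \<open>1/2\<close>; under the Riemann hypothesis the zeros of
  \<open>\<Phi>\<close> are the negative reals \<open>- \<gamma>\<^sup>2\<close>, so at positive reals all terms of the Hadamard expansion
  of \<open>\<Phi>'/\<Phi>\<close> are positive and its convergence along discs is unconditional.
\<close>
lemma xi_partial_fraction:
  assumes RH: "riemann_hypothesis" and w: "w \<ge> (1/2::real)"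
  shows "((\<lambda>\<gamma>. zero_mult \<gamma> * (2 * w / (w\<^sup>2 + \<gamma>\<^sup>2))) has_sum Re (deriv xi (1/2 + of_real w) / xi (1/2 + of_real w))) ordinates"
proof -
  define f where "f = (\<lambda>u. xi (1/2 + u))"
  have f_hol: "f holomorphic_on UNIV" unfolding f_def
    by (intro holomorphic_on_compose_gen[OF _ xi_holomorphic[of UNIV], unfolded o_def] holomorphic_intros) auto
  have f_even: "f (- u) = f u" for u
    using xi_symmetric[of "1/2 + u"] by (simp add: f_def algebra_simps)
  obtain \<Phi> where \<Phi>: "\<Phi> holomorphic_on UNIV" "\<And>u. \<Phi> (u\<^sup>2) = f u"
    using even_entire_sqrt[OF f_hol f_even] by blast
  \<comment> \<open>The constant 17 comes from \<open>xi_growth\<close>; the factor 3 from 1 + |1/2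
    + u| <= 3 sqrt (1 + |v|) when u^2 = v.\<close>
  define A where "A = 17 * 3 powr (3/2 :: real)"
  have growth: "norm (\<Phi> v) \<le> exp (A * (1 + norm v) powr (3/4))" for v
  proof -
    define r where "r = 1 + norm v"
    have r: "r \<ge> 1" by (simp add: r_def)
    define u where "u = csqrt v"
    have u2: "u\<^sup>2 = v" by (simp add: u_def)
    have "(norm u)\<^sup>2 = norm v" using u2 by (metis norm_power)
    hence "norm u = sqrt (norm v)" by (metis norm_ge_zero real_sqrt_abs abs_of_nonneg)
    hence nu: "norm u \<le> sqrt r" by (simp add: r_def)
    have "norm (1/2 + u) \<le> 1/2 + norm u" using norm_triangle_ineq[of "1/2" u] by simp
    moreover have "sqrt r \<ge> 1" using r by simp
    ultimately have "1 + norm (1/2 + u) \<le> 3 * sqrt r" using nu by linarith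
    hence "(1 + norm (1/2 + u)) powr (3/2) \<le> (3 * sqrt r) powr (3/2)" by (intro powr_mono2) auto
    also have "\<dots> = 3 powr (3/2) * r powr (3/4)"
      using r by (simp add: powr_mult powr_half_sqrt [symmetric] powr_powr)
    finally have "17 * (1 + norm (1/2 + u)) powr (3/2) \<le> A * r powr (3/4)" by (simp add: A_def)
    moreover have "norm (\<Phi> v) \<le> exp (17 * (1 + norm (1/2 + u)) powr (3/2))"
      using xi_growth[of "1/2 + u"] \<Phi>(2)[of u] by (simp add: f_def u2)
    ultimately show ?thesis unfolding r_def by (meson exp_le_cancel_iff order_trans)
  qed
  have A0: "A \<ge> 0" by (simp add: A_def)
  define v0 where "v0 = (complex_of_real w)\<^sup>2"
  have xi_w: "xi (1/2 + of_real w) \<noteq> 0" by (rule xi_nonzero_right) (use w in simp)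
  have \<Phi>v0: "\<Phi> v0 = xi (1/2 + of_real w)" by (simp add: v0_def \<Phi>(2) f_def)
  have xi_zero: "Re z = 1/2" if "xi z = 0" for z
  proof -
    have "z \<in> nontrivial_zeros" using that by (simp add: nontrivial_zeros_eq)
    thus ?thesis using RH by (simp add: riemann_hypothesis_def)
  qed
  have zeros: "{v. \<Phi> v = 0} = (\<lambda>\<gamma>. - (of_real \<gamma>)\<^sup>2) ` ordinates"
  proof (intro equalityI subsetI)
    fix v assume "v \<in> {v. \<Phi> v = 0}"
    hence z: "xi (1/2 + csqrt v) = 0" using \<Phi>(2)[of "csqrt v"] by (simp add: f_def)
    hence "Re (csqrt v) = 0" using xi_zero[OF z] by simp
    hence cs: "csqrt v = \<i> * of_real (Im (csqrt v))" by (simp add: complex_eq_iff)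
    define \<gamma> where "\<gamma> = \<bar>Im (csqrt v)\<bar>"
    have "(csqrt v)\<^sup>2 = (\<i> * of_real (Im (csqrt v)))\<^sup>2" using cs by simp
    hence v: "v = - (of_real \<gamma>)\<^sup>2" by (simp add: power_mult_distrib \<gamma>_def flip: of_real_power)
    have "Im (csqrt v) \<noteq> 0" using z cs xi_half_nonzero by auto
    hence "\<gamma> > 0" by (simp add: \<gamma>_def)
    moreover have "xi (1/2 + \<i> * of_real \<gamma>) = 0"
    proof -
      have "(\<i> * of_real \<gamma>)\<^sup>2 = v" by (simp add: v power_mult_distrib)
      hence "f (\<i> * of_real \<gamma>) = \<Phi> v" using \<Phi>(2)[of "\<i> * of_real \<gamma>"] by simp
      also have "\<dots> = 0" using z \<Phi>(2)[of "csqrt v"] by (simp add: f_def)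
      finally show ?thesis by (simp add: f_def)
    qed
    ultimately show "v \<in> (\<lambda>\<gamma>. - (of_real \<gamma>)\<^sup>2) ` ordinates" using v by (auto simp: ordinates_def)
  next
    fix v :: complex assume "v \<in> (\<lambda>\<gamma>. - (of_real \<gamma>)\<^sup>2) ` ordinates"
    then obtain \<gamma> where \<gamma>: "v = - (of_real \<gamma>)\<^sup>2" "\<gamma> \<in> ordinates" by auto
    hence "v = (\<i> * of_real \<gamma>)\<^sup>2" by (simp add: power_mult_distrib)
    thus "v \<in> {v. \<Phi> v = 0}" using \<Phi>(2)[of "\<i> * of_real \<gamma>"] \<gamma>(2) by (simp add: f_def ordinates_def)
  qed
  \<comment> \<open>Near 1/2 + i \<gamma> the factor \<open>(z - 1/2)\<^sup>2 - v\<close> splits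
    into two linear factors, of which only one vanishes there because \<gamma> is not 0. Squaring
    therefore preserves the order of the zero.\<close>
  have order: "zorder \<Phi> (- (of_real \<gamma>)\<^sup>2) = zero_mult \<gamma>" if \<gamma>: "\<gamma> \<in> ordinates" for \<gamma>
  proof -
    define v where "v = - (complex_of_real \<gamma>)\<^sup>2"
    define n where "n = nat (zorder \<Phi> v)"
    have \<gamma>0: "\<gamma> > 0" using \<gamma> by (simp add: ordinates_def)
    have nz: "\<Phi> v0 \<noteq> 0" using \<Phi>v0 xi_w by simp
    obtain h where h: "h holomorphic_on UNIV" "h v \<noteq> 0" "\<And>z. \<Phi> z = h z * (z - v) ^ n"
      unfolding n_def using entire_divide_zero[OF \<Phi>(1) nz, of v] by blast
    have vi: "v = (\<i> * of_real \<gamma>)\<^sup>2" by (simp add: v_def power_mult_distrib)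
    have "\<Phi> v = 0" using zeros \<gamma> by (auto simp: v_def)
    hence pos: "zorder \<Phi> v > 0"
      using zorder_exist_zero[where z = v, OF \<Phi>(1) open_UNIV connected_UNIV UNIV_I bexI[of _ v0], THEN conjunct1] nz by simp
    have "zorder xi (1/2 + \<i> * of_real \<gamma>) = int n"
    proof (rule zorder_eqI[of UNIV _ "\<lambda>z. h ((z - 1/2)\<^sup>2) * (z - 1/2 + \<i> * of_real \<gamma>) ^ n"])
      show "(\<lambda>z. h ((z - 1/2)\<^sup>2) * (z - 1/2 + \<i> * of_real \<gamma>) ^ n) holomorphic_on UNIV"
        by (intro holomorphic_intros holomorphic_on_compose_gen[OF _ h(1), unfolded o_def]) auto
      show "h ((1/2 + \<i> * of_real \<gamma> - 1/2)\<^sup>2) * (1/2 + \<i> * of_real \<gamma> - 1/2 + \<i> * of_real \<gamma>) ^ n \<noteq> 0"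
        using h(2) \<gamma>0 by (simp add: vi)
      fix z :: complex
      have "xi z = \<Phi> ((z - 1/2)\<^sup>2)" by (simp add: \<Phi>(2) f_def)
      also have "\<dots> = h ((z - 1/2)\<^sup>2) * ((z - 1/2)\<^sup>2 - v) ^ n" by (rule h(3))
      also have "(z - 1/2)\<^sup>2 - v = (z - 1/2 + \<i> * of_real \<gamma>) * (z - (1/2 + \<i> * of_real \<gamma>))"
        unfolding vi by (simp add: power2_eq_square algebra_simps)
      finally show "xi z = h ((z - 1/2)\<^sup>2) * (z - 1/2 + \<i> * of_real \<gamma>) ^ n * (z - (1/2 + \<i> * of_real \<gamma>)) powi int n"
        by (simp add: power_mult_distrib)
    qed auto
    thus ?thesis using pos by (simp add: zero_mult_def n_def v_def)
  qed
  have inj: "inj_on (\<lambda>\<gamma>. - (complex_of_real \<gamma>)\<^sup>2) ordinates"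
    by (auto simp: inj_on_def ordinates_def power2_eq_iff_nonneg simp flip: of_real_power)
  define d where "d = (\<lambda>\<gamma>. dist v0 (- (complex_of_real \<gamma>)\<^sup>2))"
  have set_eq: "{z. \<Phi> z = 0 \<and> dist v0 z \<le> R} = (\<lambda>\<gamma>. - (of_real \<gamma>)\<^sup>2) ` {\<gamma>\<in>ordinates. d \<gamma> \<le> R}" for R
    using zeros by (auto simp: d_def)
  have inj': "inj_on (\<lambda>\<gamma>. - (complex_of_real \<gamma>)\<^sup>2) {\<gamma>\<in>ordinates. d \<gamma> \<le> R}" for R
    by (rule inj_on_subset[OF inj]) auto
  have nz: "\<Phi> v0 \<noteq> 0" using \<Phi>v0 xi_w by simp
  have lim: "((\<lambda>R. \<Sum>a\<in>{z. \<Phi> z = 0 \<and> dist v0 z \<le> R}. of_int (zorder \<Phi> a) / (v0 - a)) \<longlongrightarrow> deriv \<Phi> v0 / \<Phi> v0) at_top"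
    by (rule hadamard_genus_zero[OF \<Phi>(1) nz growth A0])
  define k where "k = (\<lambda>\<gamma>. zero_mult \<gamma> * (1 / (w\<^sup>2 + \<gamma>\<^sup>2)))"
  have "(\<Sum>a\<in>{z. \<Phi> z = 0 \<and> dist v0 z \<le> R}. of_int (zorder \<Phi> a) / (v0 - a)) =
      of_real (sum k {\<gamma>\<in>ordinates. d \<gamma> \<le> R})" for R
  proof -
    have "(\<Sum>a\<in>{z. \<Phi> z = 0 \<and> dist v0 z \<le> R}. of_int (zorder \<Phi> a) / (v0 - a)) =
      (\<Sum>\<gamma>\<in>{\<gamma>\<in>ordinates. d \<gamma> \<le> R}. of_int (zorder \<Phi> (- (of_real \<gamma>)\<^sup>2)) / (v0 - (- (of_real \<gamma>)\<^sup>2)))"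
      unfolding set_eq by (subst sum.reindex[OF inj']) (simp add: o_def)
    also have "\<dots> = (\<Sum>\<gamma>\<in>{\<gamma>\<in>ordinates. d \<gamma> \<le> R}. of_real (k \<gamma>))"
    proof (rule sum.cong)
      fix \<gamma> assume "\<gamma> \<in> {\<gamma>\<in>ordinates. d \<gamma> \<le> R}"
      hence "real_of_int (zorder \<Phi> (- (of_real \<gamma>)\<^sup>2)) = zero_mult \<gamma>" using order by simp
      hence "complex_of_real (real_of_int (zorder \<Phi> (- (of_real \<gamma>)\<^sup>2))) = of_real (zero_mult \<gamma>)" by simp
      thus "of_int (zorder \<Phi> (- (of_real \<gamma>)\<^sup>2)) / (v0 - (- (of_real \<gamma>)\<^sup>2)) = complex_of_real (k \<gamma>)"
        by (simp add: k_def v0_def)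
    qed simp
    finally show ?thesis by simp
  qed
  with lim have "((\<lambda>R. complex_of_real (sum k {\<gamma>\<in>ordinates. d \<gamma> \<le> R})) \<longlongrightarrow> deriv \<Phi> v0 / \<Phi> v0) at_top" by simp
  from tendsto_Re[OF this]
  have lim': "((\<lambda>R. sum k {\<gamma>\<in>ordinates. d \<gamma> \<le> R}) \<longlongrightarrow> Re (deriv \<Phi> v0 / \<Phi> v0)) at_top" by simp
  have "(k has_sum Re (deriv \<Phi> v0 / \<Phi> v0)) ordinates"
  proof (rule has_sum_of_exhausting[OF _ _ lim'])
    show "k \<gamma> \<ge> 0" for \<gamma> by (simp add: k_def zero_mult_def)
    show "finite {\<gamma>\<in>ordinates. d \<gamma> \<le> R}" for R
    proof -
      define R' where "R' = max R 1"
      have "finite {z. \<Phi> z = 0 \<and> dist v0 z \<le> R'}"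
      proof (rule log_deriv_minus_zeros_bound(1)[OF \<Phi>(1) nz])
        show "R' > 0" by (simp add: R'_def)
        fix z assume z: "z \<in> cball v0 (2 * R')"
        have "norm z \<le> norm v0 + 2 * R'"
          using z norm_triangle_ineq3[of z v0] by (simp add: dist_norm norm_minus_commute abs_le_iff)
        hence "A * (1 + norm z) powr (3/4) \<le> A * (1 + norm v0 + 2 * R') powr (3/4)"
          using A0 by (intro mult_left_mono powr_mono2) auto
        thus "norm (\<Phi> z) \<le> exp (A * (1 + norm v0 + 2 * R') powr (3/4))"
          using growth[of z] by (smt (verit) exp_le_cancel_iff)
      qed
      hence "finite {\<gamma>\<in>ordinates. d \<gamma> \<le> R'}" unfolding set_eq by (rule finite_imageD[OF _ inj'])
      thus ?thesis by (rule rev_finite_subset) (auto simp: R'_def)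
    qed
  qed
  \<comment> \<open>The factor \<open>2 * w\<close> is the derivative of the square, from the chain
    rule between \<open>xi\<close> and \<open>\<Phi>\<close>.\<close>
  from has_sum_cmult_right[OF this, of "2 * w"]
  have S: "((\<lambda>\<gamma>. zero_mult \<gamma> * (2 * w / (w\<^sup>2 + \<gamma>\<^sup>2))) has_sum 2 * w * Re (deriv \<Phi> v0 / \<Phi> v0)) ordinates"
    by (simp add: k_def mult_ac)
  have "deriv xi (1/2 + of_real w) = deriv \<Phi> v0 * (2 * of_real w)"
  proof -
    have "(\<Phi> has_field_derivative deriv \<Phi> v0) (at ((1/2 + of_real w - 1/2)\<^sup>2))"
      using holomorphic_derivI[OF \<Phi>(1) open_UNIV, of v0] by (simp add: v0_def)
    moreover have "((\<lambda>z. (z - 1/2)\<^sup>2) has_field_derivative (2 * of_real w)) (at (1/2 + of_real w :: complex))"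
      by (auto intro!: derivative_eq_intros)
    ultimately have "((\<lambda>z. \<Phi> ((z - 1/2)\<^sup>2)) has_field_derivative deriv \<Phi> v0 * (2 * of_real w)) (at (1/2 + of_real w))"
      by (rule DERIV_chain2)
    moreover have "(\<lambda>z. \<Phi> ((z - 1/2)\<^sup>2)) = xi" by (auto simp: \<Phi>(2) f_def)
    ultimately show ?thesis by (metis DERIV_imp_deriv)
  qed
  hence "deriv xi (1/2 + of_real w) / xi (1/2 + of_real w) = of_real (2 * w) * (deriv \<Phi> v0 / \<Phi> v0)"
    using \<Phi>v0 by simp
  moreover have "Re (of_real c * z) = c * Re z" for c z by simp
  ultimately have "Re (deriv xi (1/2 + of_real w) / xi (1/2 + of_real w)) = 2 * w * Re (deriv \<Phi> v0 / \<Phi> v0)"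
    by (simp only:)
  thus ?thesis using S by simp
qed

section \<open>Laplace transforms\<close>

lemma has_integral_exp_neg: "s > 0 \<Longrightarrow> ((\<lambda>t. exp (- s * t)) has_integral 1 / s) {0::real..}"
  using has_integral_exp_minus_to_infinity[of s 0] by simp

text \<open>A uniform error e on the half-line contributes at most e / s to the transform. The
  filter is arbitrary because it serves both for series and for sums over zeros, which run along the
  finite subsets of \<open>ordinates\<close>.\<close>

lemma laplace_uniform_limit:
  fixes f :: "'i \<Rightarrow> real \<Rightarrow> real"
  assumes ul: "uniform_limit {0..} f g F" and F: "F \<noteq> bot" and s: "s > 0"
    and cont: "\<And>i. continuous_on {0..} (f i)"
    and L: "\<And>i. ((\<lambda>t. f i t * exp (- s * t)) has_integral L i) {0..}"
  shows "continuous_on {0..} g"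
    and "(\<lambda>t. g t * exp (- s * t)) integrable_on {0..}"
    and "(L \<longlongrightarrow> integral {0..} (\<lambda>t. g t * exp (- s * t))) F"
proof -
  show gc: "continuous_on {0..} g"
    by (rule uniform_limit_theorem[OF always_eventually ul F]) (use cont in blast)
  have diff: "(\<lambda>t. (f i t - g t) * exp (- s * t)) integrable_on {0..} \<and>
      norm (integral {0..} (\<lambda>t. (f i t - g t) * exp (- s * t))) \<le> e / s"
    if le: "\<And>t. t \<ge> 0 \<Longrightarrow> \<bar>f i t - g t\<bar> \<le> e" for i e
  proof -
    have h: "((\<lambda>t. e * exp (- s * t)) has_integral e * (1 / s)) {0..}"
      by (intro has_integral_mult_right has_integral_exp_neg s)
    have bd: "norm ((f i t - g t) * exp (- s * t)) \<le> e * exp (- s * t)" if "t \<in> {0..}" for t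
      using le[of t] that by (simp add: abs_mult mult_right_mono)
    have i: "(\<lambda>t. (f i t - g t) * exp (- s * t)) integrable_on {0..}"
      by (rule integrable_dominated(1)[OF _ _ _ bd])
         (use h in \<open>auto intro!: continuous_intros cont gc simp: integrable_on_def\<close>)
    have "norm (integral {0..} (\<lambda>t. (f i t - g t) * exp (- s * t))) \<le> integral {0..} (\<lambda>t. e * exp (- s * t))"
      by (rule integral_norm_bound_integral[OF i _ bd]) (use h in \<open>auto simp: integrable_on_def\<close>)
    thus ?thesis using i integral_unique[OF h] by simp
  qed
  have ev: "eventually (\<lambda>i. \<forall>t\<in>{0..}. dist (f i t) (g t) < e) F" if "e > 0" for e
    using ul that by (rule uniform_limitD)
  obtain i where "\<forall>t\<in>{0..}. dist (f i t) (g t) < 1"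
    using eventually_happens'[OF F ev[of 1]] by auto
  hence "(\<lambda>t. (f i t - g t) * exp (- s * t)) integrable_on {0..}"
    using diff[of i 1] by (force simp: dist_real_def)
  hence "(\<lambda>t. f i t * exp (- s * t) - (f i t - g t) * exp (- s * t)) integrable_on {0..}"
    using L[of i] by (intro integrable_diff) (auto simp: integrable_on_def)
  thus gi: "(\<lambda>t. g t * exp (- s * t)) integrable_on {0..}"
    by (simp add: algebra_simps)
  show "(L \<longlongrightarrow> integral {0..} (\<lambda>t. g t * exp (- s * t))) F"
  proof (rule tendstoI)
    fix e :: real assume e: "e > 0"
    have "e * s / 2 > 0" using e s by simp
    from ev[OF this] show "eventually (\<lambda>i. dist (L i) (integral {0..} (\<lambda>t. g t * exp (- s * t))) < e) F"
    proof eventually_elim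
      case (elim i)
      have "norm (integral {0..} (\<lambda>t. (f i t - g t) * exp (- s * t))) \<le> (e * s / 2) / s"
        using diff[of i "e * s / 2"] elim by (force simp: dist_real_def)
      moreover have "integral {0..} (\<lambda>t. (f i t - g t) * exp (- s * t)) = L i - integral {0..} (\<lambda>t. g t * exp (- s * t))"
      proof -
        have "((\<lambda>t. f i t * exp (- s * t) - g t * exp (- s * t)) has_integral
           L i - integral {0..} (\<lambda>t. g t * exp (- s * t))) {0..}"
          by (rule has_integral_diff[OF L integrable_integral[OF gi]])
        thus ?thesis by (simp add: left_diff_distrib integral_unique)
      qed
      ultimately show ?case using e s by (simp add: dist_real_def)
    qed
  qed
qed

text \<open>
  Injectivity of the Laplace transform: by Weierstrass, \<open>f(t) e\<^sup>-\<^sup>t\<close> is a uniform limit of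
  polynomials in \<open>e\<^sup>-\<^sup>t\<close>, all of which are orthogonal to \<open>f(t) e\<^sup>-\<^sup>t\<close>.
\<close>
lemma laplace_injective:
  fixes f :: "real \<Rightarrow> real"
  assumes cont: "continuous_on {0..} f" and bd: "\<And>t. t \<ge> 0 \<Longrightarrow> \<bar>f t\<bar> \<le> C"
    and zero: "\<And>s. s > 0 \<Longrightarrow> integral {0..} (\<lambda>t. f t * exp (- s * t)) = 0"
    and t: "t \<ge> 0"
  shows "f t = 0"
proof -
  have C: "C \<ge> 0" using bd[of 0] by simp
  \<comment> \<open>The function f(t) e^(-t) in the variable u = e^(-t). The factor u makes it
    continuous at u = 0 with value 0 although \<open>f\<close> is merely bounded and need not have a
    limit at infinity.\<close>
  define \<phi> where "\<phi> = (\<lambda>u. if u = 0 then 0 else f (- ln u) * u)"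
  have \<phi>_exp: "\<phi> (exp (- t)) = f t * exp (- t)" for t by (simp add: \<phi>_def)
  have "continuous (at u within {0..1}) \<phi>" if u: "u \<in> {0..1}" for u
  proof (cases "u = 0")
    case True
    have "((\<lambda>u. C * \<bar>u\<bar>) \<longlongrightarrow> C * \<bar>0\<bar>) (at 0 within {0..1})" by (intro tendsto_intros)
    moreover have "eventually (\<lambda>u. norm (\<phi> u) \<le> C * \<bar>u\<bar>) (at 0 within {0..1})"
      unfolding eventually_at_filter
    proof (intro always_eventually allI impI)
      fix u :: real assume "u \<noteq> 0" "u \<in> {0..1}"
      hence "- ln u \<ge> 0" by simp
      thus "norm (\<phi> u) \<le> C * \<bar>u\<bar>" using bd[of "- ln u"] \<open>u \<noteq> 0\<close>
        by (auto simp: \<phi>_def abs_mult intro!: mult_right_mono)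
    qed
    ultimately have "(\<phi> \<longlongrightarrow> 0) (at 0 within {0..1})" by (simp add: Lim_null_comparison)
    thus ?thesis using True by (simp add: continuous_within \<phi>_def)
  next
    case False
    have c: "continuous_on {0<..1} (\<lambda>u. f (- ln u) * u)"
      by (intro continuous_intros continuous_on_compose2[OF cont]) auto
    have "continuous_on {0<..1} \<phi>"
      by (rule continuous_on_eq[OF c]) (auto simp: \<phi>_def)
    hence "continuous (at u within {0<..1}) \<phi>" using u False by (simp add: continuous_on_eq_continuous_within)
    moreover have "at u within {0<..1} = at u within {0..1}"
      by (rule at_within_nhd[of _ "{0<..}"]) (use u False in auto)
    ultimately show ?thesis by simp
  qed
  hence \<phi>_cont: "continuous_on {0..1} \<phi>" by (simp add: continuous_on_eq_continuous_within)
  have f_exp: "(\<lambda>t. f t * exp (- s * t)) integrable_on {0..}" if "s > 0" for s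
    by (rule integrable_dominated(1)[of _ _ "\<lambda>t. C * exp (- s * t)"])
       (use has_integral_mult_right[OF has_integral_exp_neg[OF that], of C] in
         \<open>auto intro!: continuous_intros cont mult_right_mono bd simp: abs_mult integrable_on_def\<close>)
  define I where "I = integral {0..} (\<lambda>t. f t * exp (- t) * \<phi> (exp (- t)))"
  have sq: "f t * exp (- t) * \<phi> (exp (- t)) = (f t * exp (- t))\<^sup>2" for t
    by (simp add: \<phi>_exp power2_eq_square)
  have sq_bd: "(f t * exp (- t))\<^sup>2 \<le> C\<^sup>2 * exp (- 2 * t)" if "t \<in> {0..}" for t
  proof -
    have "(f t)\<^sup>2 \<le> C\<^sup>2" using power_mono[OF bd[of t], of 2] that by simp
    thus ?thesis unfolding power_mult_distrib exp_double[symmetric] by (intro mult_mono) auto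
  qed
  have sq_int: "(\<lambda>t. (f t * exp (- t))\<^sup>2) integrable_on {0..}"
    by (rule integrable_dominated(1)[of _ _ "\<lambda>t. C\<^sup>2 * exp (- 2 * t)"])
       (use sq_bd has_integral_mult_right[OF has_integral_exp_neg[of 2], of "C\<^sup>2"] in \<open>auto intro!: continuous_intros cont simp: integrable_on_def\<close>)
  have Ie: "\<bar>I\<bar> \<le> e * C" if e: "e > 0" for e
  proof -
    obtain p where p: "real_polynomial_function p" "\<And>x. x \<in> {0..1} \<Longrightarrow> \<bar>\<phi> x - p x\<bar> < e"
      using Stone_Weierstrass_real_polynomial_function[OF compact_Icc \<phi>_cont e] by auto
    then obtain a n where pa: "p = (\<lambda>x. \<Sum>i\<le>n. a i * x ^ i)"
      by (auto simp: real_polynomial_function_iff_sum)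
    \<comment> \<open>The extra factor exp (- t) raises the exponents to \<open>Suc i\<close>, so
      each monomial gives a transform at a positive point, where it vanishes by assumption.\<close>
    have "((\<lambda>t. f t * exp (- t) * p (exp (- t))) has_integral (\<Sum>i\<le>n. a i * 0)) {0..}"
    proof -
      have "((\<lambda>t. f t * exp (- real (Suc i) * t)) has_integral 0) {0..}" for i
        using integrable_integral[OF f_exp[of "real (Suc i)"]] zero[of "real (Suc i)"] by simp
      hence "((\<lambda>t. \<Sum>i\<le>n. a i * (f t * exp (- real (Suc i) * t))) has_integral (\<Sum>i\<le>n. a i * 0)) {0..}"
        by (intro has_integral_sum has_integral_mult_right) auto
      moreover have "a i * (f t * exp (- real (Suc i) * t)) = f t * exp (- t) * (a i * exp (- t) ^ i)" for i t
        by (simp add: algebra_simps exp_add [symmetric] flip: exp_of_nat_mult)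
      ultimately show ?thesis unfolding pa sum_distrib_left by (simp only:)
    qed
    hence P: "((\<lambda>t. f t * exp (- t) * p (exp (- t))) has_integral 0) {0..}" by simp
    have "((\<lambda>t. f t * exp (- t) * \<phi> (exp (- t))) has_integral I) {0..}"
      unfolding I_def using sq_int by (intro integrable_integral) (simp add: sq)
    from has_integral_diff[OF this P]
    have D: "((\<lambda>t. f t * exp (- t) * (\<phi> (exp (- t)) - p (exp (- t)))) has_integral I) {0..}"
      by (simp add: right_diff_distrib)
    have B: "((\<lambda>t. e * C * exp (- 1 * t)) has_integral e * C * (1 / 1)) {0..}"
      by (intro has_integral_mult_right has_integral_exp_neg) simp
    have "norm (integral {0..} (\<lambda>t. f t * exp (- t) * (\<phi> (exp (- t)) - p (exp (- t))))) \<le>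
        integral {0..} (\<lambda>t. e * C * exp (- 1 * t))"
    proof (rule integral_norm_bound_integral)
      fix t :: real assume t: "t \<in> {0..}"
      have "\<bar>f t\<bar> * exp (- t) * \<bar>\<phi> (exp (- t)) - p (exp (- t))\<bar> \<le> C * exp (- t) * e"
        using bd[of t] p(2)[of "exp (- t)"] t C by (intro mult_mono) auto
      thus "norm (f t * exp (- t) * (\<phi> (exp (- t)) - p (exp (- t)))) \<le> e * C * exp (- 1 * t)"
        by (simp add: abs_mult mult_ac)
    qed (use D B in \<open>auto simp: integrable_on_def\<close>)
    thus ?thesis unfolding integral_unique[OF D] integral_unique[OF B] by simp
  qed
  have I0: "I = 0"
  proof (rule ccontr)
    assume "I \<noteq> 0"
    hence Ip: "\<bar>I\<bar> > 0" by simp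
    define e where "e = \<bar>I\<bar> / (2 * (C + 1))"
    have "e > 0" unfolding e_def using Ip C by (intro divide_pos_pos) auto
    hence "\<bar>I\<bar> \<le> e * C" by (rule Ie)
    also have "\<dots> \<le> e * (C + 1)" using \<open>e > 0\<close> by simp
    also have "\<dots> = \<bar>I\<bar> / 2" unfolding e_def using C by (simp add: field_simps)
    finally show False using Ip by linarith
  qed
  have "integral {0..t + 1} (\<lambda>t. (f t * exp (- t))\<^sup>2) \<le> integral {0..} (\<lambda>t. (f t * exp (- t))\<^sup>2)"
    by (rule integral_subset_le) (use sq_int in \<open>auto intro!: integrable_continuous_real continuous_intros continuous_on_subset[OF cont]\<close>)
  also have "\<dots> = 0" using I0 by (simp add: I_def sq)
  finally have le: "integral {0..t + 1} (\<lambda>t. (f t * exp (- t))\<^sup>2) \<le> 0" .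
  have c: "continuous_on {0..t + 1} (\<lambda>t. (f t * exp (- t))\<^sup>2)"
    by (auto intro!: continuous_intros continuous_on_subset[OF cont])
  have "integral {0..t + 1} (\<lambda>t. (f t * exp (- t))\<^sup>2) \<ge> 0"
    by (rule integral_nonneg) (auto intro!: integrable_continuous_real c)
  with le have "integral {0..t + 1} (\<lambda>t. (f t * exp (- t))\<^sup>2) = 0" by simp
  hence "(f t * exp (- t))\<^sup>2 = 0"
    using integral_eq_0_iff[OF c] t by simp
  thus ?thesis by simp
qed

lemma has_integral_exp_neg_complex:
  assumes z: "Re z > 0"
  shows "((\<lambda>t. exp (- z * of_real t)) has_integral 1 / z) {0..}"
proof -
  let ?f = "\<lambda>t::real. exp (- z * of_real t)"
  have z0: "z \<noteq> 0" using z by auto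
  have bd: "norm (?f t) \<le> exp (- Re z * t)" for t by (simp add: norm_exp_eq_Re)
  have int: "?f integrable_on {a..}" if "a \<ge> 0" for a
    by (rule integrable_dominated(1)[OF _ _ _ bd])
       (use has_integral_exp_minus_to_infinity[OF z, of a] in \<open>auto intro!: continuous_intros simp: integrable_on_def\<close>)
  have tail: "norm (integral {real N..} ?f) \<le> exp (- Re z * real N) / Re z" for N
  proof -
    have "norm (integral {real N..} ?f) \<le> integral {real N..} (\<lambda>t. exp (- Re z * t))"
      by (rule integral_norm_bound_integral[OF int])
         (use has_integral_exp_minus_to_infinity[OF z, of "real N"] bd in \<open>auto simp: integrable_on_def\<close>)
    thus ?thesis using integral_unique[OF has_integral_exp_minus_to_infinity[OF z, of "real N"]] by simp
  qed
  have part: "integral {0..real N} ?f = (1 - exp (- z * of_real (real N))) / z" for N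
  proof -
    have "(?f has_integral (- exp (- z * of_real (real N)) / z) - (- exp (- z * of_real 0) / z)) {0..real N}"
      by (rule fundamental_theorem_of_calculus)
         (use z0 in \<open>auto intro!: derivative_eq_intros has_vector_derivative_real_field\<close>)
    thus ?thesis by (simp add: integral_unique diff_divide_distrib)
  qed
  have split: "integral {0..} ?f = integral {0..real N} ?f + integral {real N..} ?f" for N
  proof -
    have "{0..real N} \<union> {real N..} = {0::real..}" "{0..real N} \<inter> {real N..} = {real N}" by auto
    thus ?thesis using integral_Un[of ?f "{0..real N}" "{real N..}"] int[of "real N"]
      by (simp add: integrable_continuous_real continuous_intros)
  qed
  have "(\<lambda>N. exp (- Re z * real N) / Re z) \<longlonglongrightarrow> 0" using z by real_asymp
  hence t1: "(\<lambda>N. integral {real N..} ?f) \<longlonglongrightarrow> 0"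
    by (rule Lim_null_comparison[rotated]) (use tail in auto)
  have t2: "(\<lambda>N. (1 - exp (- z * of_real (real N))) / z) \<longlonglongrightarrow> (1 - 0) / z"
  proof (intro tendsto_intros z0)
    have "(\<lambda>N. exp (- Re z * real N)) \<longlonglongrightarrow> 0" using z by real_asymp
    thus "(\<lambda>N. exp (- z * complex_of_real (real N))) \<longlonglongrightarrow> 0"
      by (rule Lim_null_comparison[rotated]) (use bd in auto)
  qed
  have "(\<lambda>N. integral {0..real N} ?f + integral {real N..} ?f) \<longlonglongrightarrow> (1 - 0) / z + 0"
    unfolding part by (rule tendsto_add[OF t2 t1])
  hence "(\<lambda>N::nat. integral {0..} ?f) \<longlonglongrightarrow> 1 / z" unfolding split [symmetric] by simp
  hence "integral {0..} ?f = 1 / z" using LIMSEQ_const_iff by blast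
  thus ?thesis using integrable_integral[OF int[of 0]] by simp
qed

text \<open>The ramp starts at t = ln x and is the inverse transform of x^(-s) / (s (s + 1)): the
  smoothing that gives the weight 1 / (\<rho> (\<rho> + 1)) to zeros gives a ramp to each prime
  power.\<close>

lemma laplace_ramp:
  fixes x s :: real
  assumes x: "x \<ge> 1" and s: "s > 0"
  shows "((\<lambda>t. max 0 (1 - x * exp (- t)) * exp (- s * t)) has_integral x powr (- s) / (s * (s + 1))) {0..}"
proof -
  have "((\<lambda>t. exp (- s * t) - x * exp (- (s + 1) * t)) has_integral
      (exp (- s * ln x) / s - x * (exp (- (s + 1) * ln x) / (s + 1)))) {ln x..}"
    using s by (intro has_integral_diff has_integral_mult_right has_integral_exp_minus_to_infinity) auto
  also have "exp (- s * ln x) = x powr (- s)" using x by (simp add: powr_def)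
  also have "exp (- (s + 1) * ln x) = x powr (- s) / x"
  proof -
    have "exp (- (s + 1) * ln x) = exp (- s * ln x) * exp (- ln x)"
      by (simp add: algebra_simps flip: exp_add)
    thus ?thesis using x by (simp add: powr_def exp_minus divide_inverse)
  qed
  also have "x powr (- s) / s - x * (x powr (- s) / x / (s + 1)) = x powr (- s) / (s * (s + 1))"
  proof -
    have "x * (x powr (- s) / x / (s + 1)) = x powr (- s) / (s + 1)" using x by simp
    moreover have "y / s - y / (s + 1) = y / (s * (s + 1))" for y :: real using s by (simp add: field_simps)
    ultimately show ?thesis by simp
  qed
  finally have "((\<lambda>t. if t \<in> {ln x..} then exp (- s * t) - x * exp (- (s + 1) * t) else 0) has_integral
      x powr (- s) / (s * (s + 1))) {0..}"
    using x by (subst has_integral_restrict) auto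
  moreover have "(if t \<in> {ln x..} then exp (- s * t) - x * exp (- (s + 1) * t) else 0) =
      max 0 (1 - x * exp (- t)) * exp (- s * t)" for t
  proof (cases "t \<ge> ln x")
    case True
    hence "x \<le> exp t" using x by (metis exp_le_cancel_iff exp_ln less_le_trans zero_less_one)
    hence "x * exp (- t) \<le> 1" by (simp add: exp_minus field_simps)
    thus ?thesis using True by (simp add: algebra_simps flip: exp_add)
  next
    case False
    hence "x > exp t" using x by (metis exp_less_cancel_iff exp_ln less_le_trans not_le zero_less_one)
    hence "x * exp (- t) > 1" by (simp add: exp_minus field_simps)
    thus ?thesis using False by simp
  qed
  ultimately show ?thesis by simp
qed

section \<open>The explicit formula\<close>

text \<open>The coefficient 1 / (\<rho> (\<rho> + 1)) at \<rho> = 1/2 + i \<gamma>, with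
  multiplicity. Conjugate zeros contribute conjugate terms, whence the factor 2 here and the real
  part in \<open>osc\<close>.\<close>

definition amp :: "real \<Rightarrow> complex" where
  "amp \<gamma> = 2 * of_real (zero_mult \<gamma>) / ((1/2 + \<i> * of_real \<gamma>) * (1/2 + \<i> * of_real \<gamma> + 1))"

definition osc :: "real \<Rightarrow> real \<Rightarrow> real" where
  "osc \<gamma> t = Re (amp \<gamma> * exp (\<i> * of_real (\<gamma> * t)))"

lemma abs_osc_le: "\<bar>osc \<gamma> t\<bar> \<le> norm (amp \<gamma>)"
proof -
  have "\<bar>osc \<gamma> t\<bar> \<le> norm (amp \<gamma> * exp (\<i> * of_real (\<gamma> * t)))" unfolding osc_def by (rule abs_Re_le_cmod)
  also have "\<dots> = norm (amp \<gamma>)" unfolding norm_mult norm_exp_i_times by simp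
  finally show ?thesis .
qed

text \<open>The partial fraction expansion at \<open>w = 1\<close> supplies a convergent series of
  terms 2 m / (1 + \<gamma>^2), where m is the multiplicity. It dominates because |\<rho> (\<rho> +
  1)| >= 3/4 (1 + \<gamma>^2).\<close>

lemma amp_summable:
  assumes RH: "riemann_hypothesis"
  shows "(\<lambda>\<gamma>. norm (amp \<gamma>)) summable_on ordinates"
proof -
  have "(\<lambda>\<gamma>. zero_mult \<gamma> * (2 * 1 / (1\<^sup>2 + \<gamma>\<^sup>2))) summable_on ordinates"
    using xi_partial_fraction[OF RH, of 1] by (auto simp: summable_on_def)
  hence "(\<lambda>\<gamma>. 4 / 3 * (zero_mult \<gamma> * (2 * 1 / (1\<^sup>2 + \<gamma>\<^sup>2)))) summable_on ordinates"
    by (rule summable_on_cmult_right)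
  thus ?thesis
  proof (rule summable_on_comparison_test)
    fix \<gamma> assume "\<gamma> \<in> ordinates"
    define z where "z = (1/2 + \<i> * of_real \<gamma>) * (1/2 + \<i> * of_real \<gamma> + 1)"
    have "(norm z)\<^sup>2 = (1/4 + \<gamma>\<^sup>2) * (9/4 + \<gamma>\<^sup>2)"
      unfolding z_def norm_mult power_mult_distrib cmod_power2 by (simp add: power2_eq_square)
    moreover have "(3/4 * (1 + \<gamma>\<^sup>2))\<^sup>2 \<le> (1/4 + \<gamma>\<^sup>2) * (9/4 + \<gamma>\<^sup>2)"
    proof -
      have "(1/4 + y) * (9/4 + y) = (3/4 * (1 + y))\<^sup>2 + (7/16 * y\<^sup>2 + 11/8 * y)" for y :: real
        by (simp add: power2_eq_square field_simps)
      moreover have "7/16 * (\<gamma>\<^sup>2)\<^sup>2 + 11/8 * \<gamma>\<^sup>2 \<ge> 0" by simp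
      ultimately show ?thesis by (metis add_increasing2 order_refl)
    qed
    ultimately have z: "3/4 * (1 + \<gamma>\<^sup>2) \<le> norm z"
      by (intro power2_le_imp_le[of "3/4 * (1 + \<gamma>\<^sup>2)"]) auto
    have p: "1 + \<gamma>\<^sup>2 > 0" by (simp add: add_pos_nonneg)
    have m: "zero_mult \<gamma> \<ge> 0" by (simp add: zero_mult_def)
    have "norm (amp \<gamma>) = 2 * zero_mult \<gamma> / norm z"
      using m by (simp add: amp_def z_def norm_divide norm_mult)
    also have "\<dots> \<le> 2 * zero_mult \<gamma> / (3/4 * (1 + \<gamma>\<^sup>2))"
      using z p m by (intro divide_left_mono mult_pos_pos) auto
    also have "\<dots> = 4 / 3 * (zero_mult \<gamma> * (2 * 1 / (1\<^sup>2 + \<gamma>\<^sup>2)))" using p by (simp add: field_simps)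
    finally show "norm (amp \<gamma>) \<le> 4 / 3 * (zero_mult \<gamma> * (2 * 1 / (1\<^sup>2 + \<gamma>\<^sup>2)))" .
  qed auto
qed

lemma zorder_xi_symmetric: "zorder xi (1 - s) = zorder xi s"
proof -
  have "xi 1 \<noteq> 0" by simp
  then obtain h where h: "h holomorphic_on UNIV" "h s \<noteq> 0" "\<And>z. xi z = h z * (z - s) ^ nat (zorder xi s)"
    using entire_divide_zero[OF xi_holomorphic, of 1 s] by blast
  define n where "n = nat (zorder xi s)"
  have "zorder xi (1 - s) = int n"
  proof (rule zorder_eqI[of UNIV _ "\<lambda>z. (-1) ^ n * h (1 - z)"])
    show "(\<lambda>z. (-1) ^ n * h (1 - z)) holomorphic_on UNIV"
      by (intro holomorphic_intros holomorphic_on_compose_gen[OF _ h(1), unfolded o_def]) auto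
    fix z :: complex
    have "xi z = h (1 - z) * (1 - z - s) ^ n" using h(3)[of "1 - z"] by (simp add: xi_symmetric n_def)
    also have "1 - z - s = (-1) * (z - (1 - s))" by simp
    finally show "xi z = (-1) ^ n * h (1 - z) * (z - (1 - s)) powi int n"
      by (simp only: power_mult_distrib power_int_of_nat mult_ac)
  qed (use h(2) in auto)
  moreover have "zorder xi s = int n"
  proof (rule zorder_eqI[of UNIV _ h])
    show "xi z = h z * (z - s) powi int n" for z unfolding power_int_of_nat n_def by (rule h(3))
  qed (use h in auto)
  ultimately show ?thesis by simp
qed

lemma nontrivial_zeros_RH:
  assumes RH: "riemann_hypothesis"
  shows "nontrivial_zeros = (\<lambda>\<gamma>. 1/2 + \<i> * of_real \<gamma>) ` ordinates \<union> (\<lambda>\<gamma>. 1/2 - \<i> * of_real \<gamma>) ` ordinates"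
proof (intro equalityI subsetI)
  fix \<rho> assume r: "\<rho> \<in> nontrivial_zeros"
  hence z: "xi \<rho> = 0" by (simp add: nontrivial_zeros_eq)
  have "Re \<rho> = 1/2" using RH r by (simp add: riemann_hypothesis_def)
  hence \<rho>: "\<rho> = 1/2 + \<i> * of_real (Im \<rho>)" by (simp add: complex_eq_iff)
  have "Im \<rho> \<noteq> 0"
  proof
    assume "Im \<rho> = 0"
    hence "\<rho> = 1/2" using \<rho> by simp
    thus False using z xi_half_nonzero by (simp only:)
  qed
  then consider "Im \<rho> > 0" | "Im \<rho> < 0" by linarith
  thus "\<rho> \<in> (\<lambda>\<gamma>. 1/2 + \<i> * of_real \<gamma>) ` ordinates \<union> (\<lambda>\<gamma>. 1/2 - \<i> * of_real \<gamma>) ` ordinates"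
  proof cases
    case 1
    have "Im \<rho> \<in> ordinates" using 1 z \<rho> by (simp add: ordinates_def)
    thus ?thesis using \<rho> by blast
  next
    case 2
    have "1 - \<rho> = 1/2 + \<i> * of_real (- Im \<rho>)" by (subst \<rho>) simp
    hence "- Im \<rho> \<in> ordinates" using 2 z xi_symmetric[of \<rho>] by (simp add: ordinates_def)
    moreover have "\<rho> = 1/2 - \<i> * of_real (- Im \<rho>)" by (subst \<rho>) simp
    ultimately show ?thesis by blast
  qed
next
  fix \<rho> :: complex
  assume "\<rho> \<in> (\<lambda>\<gamma>. 1/2 + \<i> * of_real \<gamma>) ` ordinates \<union> (\<lambda>\<gamma>. 1/2 - \<i> * of_real \<gamma>) ` ordinates"
  then obtain \<gamma> where g: "\<gamma> \<in> ordinates" "\<rho> = 1/2 + \<i> * of_real \<gamma> \<or> \<rho> = 1/2 - \<i> * of_real \<gamma>" by auto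
  have "1 - (1/2 + \<i> * of_real \<gamma>) = 1/2 - \<i> * of_real \<gamma>" by simp
  hence "xi (1/2 - \<i> * of_real \<gamma>) = xi (1/2 + \<i> * of_real \<gamma>)" using xi_symmetric[of "1/2 + \<i> * of_real \<gamma>"] by simp
  thus "\<rho> \<in> nontrivial_zeros" using g by (auto simp: nontrivial_zeros_eq ordinates_def)
qed

lemma H_exp:
  assumes RH: "riemann_hypothesis"
  shows "((\<lambda>\<gamma>. osc \<gamma> t) has_sum H (exp t)) ordinates"
proof -
  define f where "f = (\<lambda>\<rho>. of_int (zorder riemann_zeta \<rho>) * (of_real (exp t) powr (\<rho> - 1/2) / (\<rho> * (\<rho> + 1))) :: complex)"
  define g where "g = (\<lambda>\<gamma>. amp \<gamma> * exp (\<i> * of_real (\<gamma> * t)))"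
  have ln_exp: "Ln (complex_of_real (exp t)) = of_real t" by (subst Ln_of_real) auto
  have zo: "zorder riemann_zeta (1/2 + \<i> * of_real \<gamma>) = zero_mult \<gamma>" "zorder riemann_zeta (1/2 - \<i> * of_real \<gamma>) = zero_mult \<gamma>"
    if \<gamma>: "\<gamma> \<in> ordinates" for \<gamma>
  proof -
    have eq: "1/2 - \<i> * of_real \<gamma> = 1 - (1/2 + \<i> * of_real \<gamma>)" by simp
    have z: "xi (1/2 + \<i> * of_real \<gamma>) = 0" using \<gamma> by (simp add: ordinates_def)
    hence z': "xi (1/2 - \<i> * of_real \<gamma>) = 0" unfolding eq xi_symmetric .
    have "zorder xi (1/2 + \<i> * of_real \<gamma>) > 0" using zorder_xi_nonneg[OF z] by simp
    hence m: "real_of_int (zorder xi (1/2 + \<i> * of_real \<gamma>)) = zero_mult \<gamma>" by (simp add: zero_mult_def)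
    thus "zorder riemann_zeta (1/2 + \<i> * of_real \<gamma>) = zero_mult \<gamma>" by (simp add: zorder_zeta_eq_xi[OF z])
    show "zorder riemann_zeta (1/2 - \<i> * of_real \<gamma>) = zero_mult \<gamma>"
      using m unfolding zorder_zeta_eq_xi[OF z'] unfolding eq zorder_xi_symmetric .
  qed
  have f1: "f (1/2 + \<i> * of_real \<gamma>) = g \<gamma> / 2" and f2: "f (1/2 - \<i> * of_real \<gamma>) = cnj (g \<gamma> / 2)"
    if \<gamma>: "\<gamma> \<in> ordinates" for \<gamma>
  proof -
    have c1: "complex_of_int (zorder riemann_zeta (1/2 + \<i> * of_real \<gamma>)) = of_real (zero_mult \<gamma>)"
      using arg_cong[OF zo(1)[OF \<gamma>], of complex_of_real] by simp
    have c2: "complex_of_int (zorder riemann_zeta (1/2 - \<i> * of_real \<gamma>)) = of_real (zero_mult \<gamma>)"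
      using arg_cong[OF zo(2)[OF \<gamma>], of complex_of_real] by simp
    have p1: "of_real (exp t) powr (1/2 + \<i> * of_real \<gamma> - 1/2) = exp (\<i> * of_real (\<gamma> * t))"
      unfolding powr_def ln_exp by (simp add: mult_ac)
    have p2: "of_real (exp t) powr (1/2 - \<i> * of_real \<gamma> - 1/2) = exp (- (\<i> * of_real (\<gamma> * t)))"
      unfolding powr_def ln_exp by (simp add: mult_ac)
    show "f (1/2 + \<i> * of_real \<gamma>) = g \<gamma> / 2" unfolding f_def c1 p1 g_def amp_def by simp
    have "cnj (g \<gamma> / 2) = of_real (zero_mult \<gamma>) * (exp (- (\<i> * of_real (\<gamma> * t))) / ((1/2 - \<i> * of_real \<gamma>) * (1/2 - \<i> * of_real \<gamma> + 1)))"
      by (simp add: g_def amp_def exp_cnj)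
    thus "f (1/2 - \<i> * of_real \<gamma>) = cnj (g \<gamma> / 2)" unfolding f_def c2 p2 by simp
  qed
  have ng: "norm (g \<gamma>) = norm (amp \<gamma>)" for \<gamma>
    unfolding g_def norm_mult norm_exp_i_times by simp
  have "g summable_on ordinates"
    by (rule Infinite_Sum.abs_summable_summable) (simp only: ng amp_summable[OF RH])
  then obtain G where G: "(g has_sum G) ordinates" by (auto simp: summable_on_def)
  have "((\<lambda>\<gamma>. g \<gamma> / 2) has_sum G / 2) ordinates"
    using has_sum_cmult_right[OF G, of "1/2"] by simp
  hence h1: "((\<lambda>\<gamma>. f (1/2 + \<i> * of_real \<gamma>)) has_sum G / 2) ordinates"
    using has_sum_cong[of ordinates "\<lambda>\<gamma>. f (1/2 + \<i> * of_real \<gamma>)" "\<lambda>\<gamma>. g \<gamma> / 2"] f1 by blast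
  have "((\<lambda>\<gamma>. cnj (g \<gamma> / 2)) has_sum cnj (G / 2)) ordinates"
    using \<open>((\<lambda>\<gamma>. g \<gamma> / 2) has_sum G / 2) ordinates\<close> by (simp only: has_sum_cnj_iff)
  hence h2: "((\<lambda>\<gamma>. f (1/2 - \<i> * of_real \<gamma>)) has_sum cnj (G / 2)) ordinates"
    using has_sum_cong[of ordinates "\<lambda>\<gamma>. f (1/2 - \<i> * of_real \<gamma>)" "\<lambda>\<gamma>. cnj (g \<gamma> / 2)"] f2 by blast
  have "(f has_sum G / 2) ((\<lambda>\<gamma>. 1/2 + \<i> * of_real \<gamma>) ` ordinates)"
    by (subst has_sum_reindex) (use h1 in \<open>auto simp: inj_on_def o_def\<close>)
  moreover have "(f has_sum cnj (G / 2)) ((\<lambda>\<gamma>. 1/2 - \<i> * of_real \<gamma>) ` ordinates)"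
    by (subst has_sum_reindex) (use h2 in \<open>auto simp: inj_on_def o_def\<close>)
  moreover have "(\<lambda>\<gamma>. 1/2 + \<i> * complex_of_real \<gamma>) ` ordinates \<inter> (\<lambda>\<gamma>. 1/2 - \<i> * of_real \<gamma>) ` ordinates = {}"
    by (auto simp: ordinates_def complex_eq_iff)
  ultimately have "(f has_sum (G / 2 + cnj (G / 2))) nontrivial_zeros"
    unfolding nontrivial_zeros_RH[OF RH] by (rule has_sum_Un_disjoint)
  hence "infsum f nontrivial_zeros = G / 2 + cnj (G / 2)" by (rule infsumI)
  hence "H (exp t) = Re G" unfolding H_def f_def [symmetric] by simp
  moreover have "((\<lambda>\<gamma>. osc \<gamma> t) has_sum Re G) ordinates"
  proof -
    have "Re (g \<gamma>) = osc \<gamma> t" for \<gamma> by (simp add: g_def osc_def)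
    thus ?thesis using has_sum_bounded_linear[OF bounded_linear_Re G] by simp
  qed
  ultimately show ?thesis by simp
qed

lemma laplace_series:
  fixes g :: "nat \<Rightarrow> real \<Rightarrow> real"
  assumes bd: "\<And>n t. t \<ge> 0 \<Longrightarrow> \<bar>g n t\<bar> \<le> M n" and M: "summable M" and s: "s > 0"
    and cont: "\<And>n. continuous_on {0..} (g n)"
    and L: "\<And>n. ((\<lambda>t. g n t * exp (- s * t)) has_integral L n) {0..}"
    and sum: "L sums S"
  shows "((\<lambda>t. (\<Sum>n. g n t) * exp (- s * t)) has_integral S) {0..}"
    and "continuous_on {0..} (\<lambda>t. \<Sum>n. g n t)"
    and "t \<ge> 0 \<Longrightarrow> \<bar>\<Sum>n. g n t\<bar> \<le> suminf M"
proof -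
  have ul: "uniform_limit {0..} (\<lambda>N t. \<Sum>n<N. g n t) (\<lambda>t. \<Sum>n. g n t) sequentially"
    by (rule Weierstrass_m_test[OF _ M]) (use bd in auto)
  have c: "continuous_on {0..} (\<lambda>t. \<Sum>n<N. g n t)" for N by (intro continuous_intros cont)
  have L': "((\<lambda>t. (\<Sum>n<N. g n t) * exp (- s * t)) has_integral (\<Sum>n<N. L n)) {0..}" for N
    unfolding sum_distrib_right by (intro has_integral_sum L) auto
  note * = laplace_uniform_limit[OF ul sequentially_bot s c L']
  show "continuous_on {0..} (\<lambda>t. \<Sum>n. g n t)" by (rule *(1))
  have "integral {0..} (\<lambda>t. (\<Sum>n. g n t) * exp (- s * t)) = S"
    using LIMSEQ_unique[OF *(3)] sum by (simp add: sums_def)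
  thus "((\<lambda>t. (\<Sum>n. g n t) * exp (- s * t)) has_integral S) {0..}"
    using integrable_integral[OF *(2)] by simp
  assume t: "t \<ge> 0"
  have "summable (\<lambda>n. \<bar>g n t\<bar>)" by (rule summable_comparison_test'[OF M, of 0]) (use bd t in auto)
  from summable_rabs[OF this] suminf_le[OF _ this M] bd[OF t]
  show "\<bar>\<Sum>n. g n t\<bar> \<le> suminf M" by (meson order_trans)
qed

text \<open>The contribution of the trivial zeros - k with k = 2 n + 2, for which \<rho> (\<rho> +
  1) = k (k - 1). The term exp (- t) comes from the pole of 1 / (s (s + 1)) at -1; with it the
  transform of each summand is (1 / k - 1 / (s + k)) / (s (s + 1)), which matches the series of
  Digamma.\<close>

definition trivial_part :: "real \<Rightarrow> real" where
  "trivial_part t = (\<Sum>n. (exp (- t) - exp (- real (2 * n + 2) * t)) / (real (2 * n + 2) * real (2 * n + 1)))"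

text \<open>With x = e^t this is the smoothed Chebyshev function, the sum of \<Lambda>(n) (1 - n /
  x) over n <= x. The maximum with 0 makes it a series with a fixed index set.\<close>

definition prime_part :: "real \<Rightarrow> real" where
  "prime_part t = (\<Sum>n. mangoldt (Suc n) * max 0 (1 - real (Suc n) * exp (- t)))"

lemma mangoldt_series_of_real:
  assumes "s > 1"
  shows "(\<lambda>n. mangoldt (Suc n) * real (Suc n) powr (- s)) sums Re (mangoldt_series (of_real s))"
proof -
  have "(\<lambda>n. Re (mangoldt (Suc n) * nexp n (of_real s))) sums Re (mangoldt_series (of_real s))"
    using assms by (intro sums_Re mangoldt_series_sums) auto
  moreover have "Re (mangoldt (Suc n) * nexp n (of_real s)) = mangoldt (Suc n) * real (Suc n) powr (- s)" for n
  proof -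
    have "nexp n (of_real s) = of_real (real (Suc n) powr (- s))"
      by (simp add: nexp_def powr_def exp_of_real [symmetric] flip: exp_of_real)
    hence "mangoldt (Suc n) * nexp n (of_real s) = of_real (mangoldt (Suc n) * real (Suc n) powr (- s))"
      by (simp only: of_real_mult of_real_mangoldt)
    thus ?thesis by (simp only: Re_complex_of_real)
  qed
  ultimately show ?thesis by (simp only:)
qed

lemma exp_weight: "exp (- 2 * t) * exp (- (s - 2) * t) = exp (- s * (t::real))"
  by (simp add: algebra_simps flip: exp_add)

lemma exp_weight_mult: "(exp (- 2 * t) * x) * exp (- (s - 2) * t) = x * exp (- s * (t::real))"
proof -
  have "(exp (- 2 * t) * x) * exp (- (s - 2) * t) = x * (exp (- 2 * t) * exp (- (s - 2) * t))" by (simp only: mult_ac)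
  thus ?thesis unfolding exp_weight .
qed

text \<open>\<open>T\<close> is a parameter here; \<open>xi_log_deriv_of_real\<close> later provides
  its value through Digamma. The weight exp (- 2 t) is the common damping of all parts of the
  explicit formula, so the transform is evaluated at \<open>s - 2\<close>.\<close>

lemma laplace_trivial_part:
  fixes s :: real
  assumes s: "s > 2" and T: "(\<lambda>n. 1 / real (2 * n + 2) - 1 / (s + real (2 * n + 2))) sums T"
  shows "((\<lambda>t. (exp (- 2 * t) * trivial_part t) * exp (- (s - 2) * t)) has_integral T / (s * (s + 1))) {0..}"
    and "continuous_on {0..} (\<lambda>t. exp (- 2 * t) * trivial_part t)"
    and "\<exists>C. \<forall>t\<ge>0. \<bar>exp (- 2 * t) * trivial_part t\<bar> \<le> C"
proof -
  define q where "q = (\<lambda>n. real (2 * n + 2) * real (2 * n + 1))"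
  define e where "e = (\<lambda>n t. (exp (- t) - exp (- real (2 * n + 2) * t)) / q n)"
  define M where "M = (\<lambda>n. real (Suc n) powr (- 2))"
  have q: "q n > 0" "(real (Suc n))\<^sup>2 \<le> q n" for n by (auto simp: q_def power2_eq_square intro!: mult_mono mult_pos_pos)
  have M: "summable M" unfolding M_def by (rule summable_powr_Suc) simp
  have ebd: "\<bar>e n t\<bar> \<le> M n" if t: "t \<ge> 0" for n t
  proof -
    have "exp (- real (2 * n + 2) * t) \<le> exp (- t)"
    proof -
      have "t \<le> real (2 * n + 2) * t" using t mult_right_mono[of 1 "real (2 * n + 2)" t] by simp
      hence "- real (2 * n + 2) * t \<le> - t" by (simp only: minus_mult_left [symmetric] neg_le_iff_le)
      thus ?thesis by (simp only: exp_le_cancel_iff)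
    qed
    moreover have "exp (- t) \<le> 1" using t by simp
    ultimately have "\<bar>exp (- t) - exp (- real (2 * n + 2) * t)\<bar> \<le> 1" by (smt (verit) exp_gt_zero)
    hence "\<bar>e n t\<bar> \<le> 1 / q n" using q(1)[of n] by (simp add: e_def divide_right_mono)
    also have "\<dots> \<le> 1 / (real (Suc n))\<^sup>2" using q[of n] by (intro divide_left_mono) auto
    also have "\<dots> = M n" by (simp add: M_def powr_minus powr_numeral divide_inverse del: of_nat_Suc)
    finally show ?thesis .
  qed
  have bd: "\<bar>exp (- 2 * t) * e n t\<bar> \<le> M n" if t: "t \<ge> 0" for n t
    using mult_mono[of "exp (- 2 * t)" 1 "\<bar>e n t\<bar>" "M n"] ebd[OF t, of n] t by (simp add: abs_mult)
  have cont: "continuous_on {0..} (\<lambda>t. exp (- 2 * t) * e n t)" for n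
    unfolding e_def using q(1)[of n] by (intro continuous_intros) auto
  have int: "((\<lambda>t. (exp (- 2 * t) * e n t) * exp (- (s - 2) * t)) has_integral
      1 / (s * (s + 1)) * (1 / real (2 * n + 2) - 1 / (s + real (2 * n + 2)))) {0..}" for n
  proof -
    have "((\<lambda>t. 1 / q n * (exp (- (s + 1) * t) - exp (- (s + real (2 * n + 2)) * t))) has_integral
       1 / q n * (1 / (s + 1) - 1 / (s + real (2 * n + 2)))) {0..}"
      using s by (intro has_integral_mult_right has_integral_diff has_integral_exp_neg) auto
    moreover have "1 / q n * (exp (- (s + 1) * t) - exp (- (s + real (2 * n + 2)) * t)) =
        (exp (- 2 * t) * e n t) * exp (- (s - 2) * t)" for t
    proof -
      have "(exp (- 2 * t) * e n t) * exp (- (s - 2) * t) = e n t * exp (- s * t)"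
        by (rule exp_weight_mult)
      also have "\<dots> = 1 / q n * (exp (- t) * exp (- s * t) - exp (- real (2 * n + 2) * t) * exp (- s * t))"
        by (simp add: e_def left_diff_distrib diff_divide_distrib)
      finally show ?thesis by (simp add: algebra_simps flip: exp_add)
    qed
    moreover have "1 / q n * (1 / (s + 1) - 1 / (s + real (2 * n + 2))) =
       1 / (s * (s + 1)) * (1 / real (2 * n + 2) - 1 / (s + real (2 * n + 2)))"
    proof -
      define k where "k = real (2 * n + 2)"
      have k: "k > 1" "q n = k * (k - 1)" by (auto simp: k_def q_def)
      have "1 / (k * (k - 1)) * (1 / (s + 1) - 1 / (s + k)) = 1 / (k * (k - 1)) * ((k - 1) / ((s + 1) * (s + k)))"
        using s k(1) by (simp add: field_simps)
      also have "\<dots> = 1 / (k * (s + 1) * (s + k))" using k(1) by simp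
      also have "\<dots> = 1 / (s * (s + 1)) * (s / (k * (s + k)))" using s k(1) by simp
      also have "s / (k * (s + k)) = 1 / k - 1 / (s + k)" using s k(1) by (simp add: field_simps)
      finally show ?thesis by (simp only: k(2) k_def [symmetric])
    qed
    ultimately show ?thesis by simp
  qed
  have sum: "(\<lambda>n. 1 / (s * (s + 1)) * (1 / real (2 * n + 2) - 1 / (s + real (2 * n + 2)))) sums (1 / (s * (s + 1)) * T)"
    by (rule sums_mult[OF T])
  have s2: "s - 2 > 0" using s by simp
  have tp: "(\<Sum>n. exp (- 2 * t) * e n t) = exp (- 2 * t) * trivial_part t" if t: "t \<ge> 0" for t
  proof -
    have "summable (\<lambda>n. e n t)" by (rule summable_comparison_test'[OF M, of 0]) (use ebd[OF t] in auto)
    from suminf_mult[OF this] show ?thesis by (simp add: trivial_part_def e_def q_def)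
  qed
  note * = laplace_series[OF bd M s2 cont int sum]
  show "((\<lambda>t. (exp (- 2 * t) * trivial_part t) * exp (- (s - 2) * t)) has_integral T / (s * (s + 1))) {0..}"
    by (rule has_integral_eq[OF _ *(1)[simplified]]) (use tp in \<open>simp add: mult_ac\<close>)
  show "continuous_on {0..} (\<lambda>t. exp (- 2 * t) * trivial_part t)"
  proof (rule continuous_on_eq[OF *(2)])
    show "(\<Sum>n. exp (- 2 * t) * e n t) = exp (- 2 * t) * trivial_part t" if "t \<in> {0..}" for t
      using tp that by simp
  qed
  show "\<exists>C. \<forall>t\<ge>0. \<bar>exp (- 2 * t) * trivial_part t\<bar> \<le> C"
    using *(3) tp by metis
qed

text \<open>Origin of the weight exp (- 2 t): the ramp of an integer n vanishes unless e^t > n, so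
  the weighted term is at most \<Lambda>(n) n^(-2), uniformly in \<open>t\<close>. The majorant
  converges without any estimate for primes.\<close>

lemma laplace_prime_part:
  fixes s :: real
  assumes s: "s > 2"
  shows "((\<lambda>t. (exp (- 2 * t) * prime_part t) * exp (- (s - 2) * t)) has_integral
      Re (mangoldt_series (of_real s)) / (s * (s + 1))) {0..}"
    and "continuous_on {0..} (\<lambda>t. exp (- 2 * t) * prime_part t)"
    and "\<exists>C. \<forall>t\<ge>0. \<bar>exp (- 2 * t) * prime_part t\<bar> \<le> C"
proof -
  define r where "r = (\<lambda>n t. mangoldt (Suc n) * max 0 (1 - real (Suc n) * exp (- t)))"
  define M where "M = (\<lambda>n. mangoldt (Suc n) * real (Suc n) powr (- 2))"
  have M: "summable M" unfolding M_def by (rule summable_mangoldt) simp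
  have r0: "r n t \<ge> 0" for n t by (simp add: r_def mangoldt_nonneg)
  have rbd: "exp (- 2 * t) * r n t \<le> M n" for n t
  proof (cases "exp t \<le> real (Suc n)")
    case True
    hence "real (Suc n) * exp (- t) \<ge> 1" by (simp add: exp_minus field_simps)
    hence "r n t = 0" by (simp add: r_def del: of_nat_Suc)
    thus ?thesis by (simp add: M_def mangoldt_nonneg)
  next
    case False
    have "exp (- 2 * t) = 1 / (exp t)\<^sup>2" by (simp add: exp_minus exp_double divide_inverse flip: power_inverse)
    also have "\<dots> \<le> 1 / (real (Suc n))\<^sup>2" using False by (intro divide_left_mono power_mono) auto
    also have "\<dots> = real (Suc n) powr (- 2)" by (simp add: powr_minus powr_numeral divide_inverse del: of_nat_Suc)
    finally have "exp (- 2 * t) \<le> real (Suc n) powr (- 2)" .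
    moreover have "r n t \<le> mangoldt (Suc n) * 1"
      unfolding r_def by (intro mult_left_mono mangoldt_nonneg) auto
    ultimately have "exp (- 2 * t) * r n t \<le> real (Suc n) powr (- 2) * mangoldt (Suc n)"
      using r0[of n t] by (intro mult_mono) auto
    thus ?thesis by (simp add: M_def mult.commute)
  qed
  have bd: "\<bar>exp (- 2 * t) * r n t\<bar> \<le> M n" for n t using rbd[of t n] r0[of n t] by simp
  have cont: "continuous_on {0..} (\<lambda>t. exp (- 2 * t) * r n t)" for n
    unfolding r_def by (intro continuous_intros)
  have int: "((\<lambda>t. (exp (- 2 * t) * r n t) * exp (- (s - 2) * t)) has_integral
      1 / (s * (s + 1)) * (mangoldt (Suc n) * real (Suc n) powr (- s))) {0..}" for n
  proof -
    have "((\<lambda>t. mangoldt (Suc n) * (max 0 (1 - real (Suc n) * exp (- t)) * exp (- s * t))) has_integral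
      mangoldt (Suc n) * (real (Suc n) powr (- s) / (s * (s + 1)))) {0..}"
      using s by (intro has_integral_mult_right laplace_ramp) auto
    moreover have "mangoldt (Suc n) * (max 0 (1 - real (Suc n) * exp (- t)) * exp (- s * t)) =
       (exp (- 2 * t) * r n t) * exp (- (s - 2) * t)" for t
      unfolding exp_weight_mult r_def by (simp only: mult_ac)
    moreover have "m * (x / p) = 1 / p * (m * x)" for m x p :: real by simp
    ultimately show ?thesis by (simp only:)
  qed
  have sum: "(\<lambda>n. 1 / (s * (s + 1)) * (mangoldt (Suc n) * real (Suc n) powr (- s))) sums
      (1 / (s * (s + 1)) * Re (mangoldt_series (of_real s)))"
    using s by (intro sums_mult mangoldt_series_of_real) auto
  have s2: "s - 2 > 0" using s by simp
  have rs: "summable (\<lambda>n. r n t)" for t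
  proof -
    have "summable (\<lambda>n. exp (- 2 * t) * r n t)"
      by (rule summable_comparison_test'[OF M, of 0]) (use bd in auto)
    from summable_mult[OF this, of "exp (2 * t)"] show ?thesis
      by (simp add: mult.assoc [symmetric] flip: exp_add)
  qed
  have tp: "(\<Sum>n. exp (- 2 * t) * r n t) = exp (- 2 * t) * prime_part t" for t
    using suminf_mult[OF rs] by (simp add: prime_part_def r_def)
  have bd': "\<And>n t. t \<ge> 0 \<Longrightarrow> \<bar>exp (- 2 * t) * r n t\<bar> \<le> M n" by (rule bd)
  note * = laplace_series[OF bd' M s2 cont int sum]
  have "((\<lambda>t. (\<Sum>n. exp (- 2 * t) * r n t) * exp (- (s - 2) * t)) has_integral
      1 / (s * (s + 1)) * Re (mangoldt_series (of_real s))) {0..}" by (rule *(1))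
  thus "((\<lambda>t. (exp (- 2 * t) * prime_part t) * exp (- (s - 2) * t)) has_integral
      Re (mangoldt_series (of_real s)) / (s * (s + 1))) {0..}" unfolding tp by simp
  show "continuous_on {0..} (\<lambda>t. exp (- 2 * t) * prime_part t)" using *(2) by (simp only: tp)
  show "\<exists>C. \<forall>t\<ge>0. \<bar>exp (- 2 * t) * prime_part t\<bar> \<le> C" using *(3) unfolding tp by blast
qed

section \<open>The Laplace transform of the sum over zeros\<close>

lemma H_exp_uniform:
  assumes RH: "riemann_hypothesis"
  shows "uniform_limit UNIV (\<lambda>F t. \<Sum>\<gamma>\<in>F. osc \<gamma> t) (\<lambda>t. H (exp t)) (finite_subsets_at_top ordinates)"
    and "\<bar>H (exp t)\<bar> \<le> (\<Sum>\<^sub>\<infinity>\<gamma>\<in>ordinates. norm (amp \<gamma>))"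
    and "continuous_on A (\<lambda>t. H (exp t))"
proof -
  have eq: "(\<Sum>\<^sub>\<infinity>\<gamma>\<in>ordinates. osc \<gamma> t) = H (exp t)" for t by (rule infsumI[OF H_exp[OF RH]])
  have "uniform_limit UNIV (\<lambda>F t. \<Sum>\<gamma>\<in>F. osc \<gamma> t) (\<lambda>t. \<Sum>\<^sub>\<infinity>\<gamma>\<in>ordinates. osc \<gamma> t) (finite_subsets_at_top ordinates)"
    by (rule Weierstrass_m_test_general[OF _ amp_summable[OF RH]]) (simp add: abs_osc_le)
  thus ul: "uniform_limit UNIV (\<lambda>F t. \<Sum>\<gamma>\<in>F. osc \<gamma> t) (\<lambda>t. H (exp t)) (finite_subsets_at_top ordinates)"
    unfolding eq .
  have "continuous_on UNIV (\<lambda>t. H (exp t))"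
    by (rule uniform_limit_theorem[OF always_eventually ul])
       (auto simp: osc_def intro!: continuous_intros)
  thus "continuous_on A (\<lambda>t. H (exp t))" by (rule continuous_on_subset) auto
  have 1: "((\<lambda>\<gamma>. norm (amp \<gamma>)) has_sum (\<Sum>\<^sub>\<infinity>\<gamma>\<in>ordinates. norm (amp \<gamma>))) ordinates"
    by (rule has_sum_infsum[OF amp_summable[OF RH]])
  have "H (exp t) \<le> (\<Sum>\<^sub>\<infinity>\<gamma>\<in>ordinates. norm (amp \<gamma>))"
    by (rule has_sum_mono[OF H_exp[OF RH] 1]) (use abs_osc_le in \<open>simp add: abs_le_iff\<close>)
  moreover have "- H (exp t) \<le> (\<Sum>\<^sub>\<infinity>\<gamma>\<in>ordinates. norm (amp \<gamma>))"
    by (rule has_sum_mono[OF _ 1, of "\<lambda>\<gamma>. - osc \<gamma> t"])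
       (use abs_osc_le H_exp[OF RH] in \<open>auto simp: abs_le_iff has_sum_uminus\<close>)
  ultimately show "\<bar>H (exp t)\<bar> \<le> (\<Sum>\<^sub>\<infinity>\<gamma>\<in>ordinates. norm (amp \<gamma>))" by (simp add: abs_le_iff)
qed

text \<open>Partial fractions of 1 / (\<rho> (\<rho> + 1) (s - \<rho>)) in \<rho>. After summation
  over the zeros the first two pieces give constants and the last one the logarithmic derivative of
  \<open>xi\<close> at \<open>s\<close>; the real part pairs each zero with its conjugate.\<close>

lemma amp_over_identity:
  fixes s \<gamma> :: real
  assumes s: "s > 1"
  defines "w \<equiv> s - 1/2"
  shows "Re (amp \<gamma> / (of_real w - \<i> * of_real \<gamma>)) = 1 / (s + 1) * Re (amp \<gamma>) +
    1 / (s * (s + 1)) * (zero_mult \<gamma> * (1 / (1/4 + \<gamma>\<^sup>2)) + zero_mult \<gamma> * (2 * w / (w\<^sup>2 + \<gamma>\<^sup>2)))"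
proof -
  define \<rho> where "\<rho> = 1/2 + \<i> * complex_of_real \<gamma>"
  define S where "S = complex_of_real s"
  define m where "m = complex_of_real (zero_mult \<gamma>)"
  have nz: "\<rho> \<noteq> 0" "\<rho> + 1 \<noteq> 0" "S - \<rho> \<noteq> 0" "S \<noteq> 0" "S + 1 \<noteq> 0"
    using s by (auto simp: \<rho>_def S_def complex_eq_iff)
  have d: "of_real w - \<i> * of_real \<gamma> = S - \<rho>" by (simp add: w_def S_def \<rho>_def)
  have amp: "amp \<gamma> = m * (2 / (\<rho> * (\<rho> + 1)))" by (simp add: amp_def \<rho>_def m_def)
  have "2 / (\<rho> * (\<rho> + 1)) / (S - \<rho>) = 1 / (S + 1) * (2 / (\<rho> * (\<rho> + 1))) + 1 / (S * (S + 1)) * (2 / \<rho> + 2 / (S - \<rho>))"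
  proof -
    have inv_add: "1 / x + 1 / y = (x + y) / (x * y)" if "x \<noteq> 0" "y \<noteq> 0" for x y :: complex
      using that by (simp add: field_simps)
    have "2 / \<rho> + 2 / (S - \<rho>) = 2 * (1 / \<rho> + 1 / (S - \<rho>))" by simp
    also have "\<dots> = 2 * (S / (\<rho> * (S - \<rho>)))" using inv_add[of \<rho> "S - \<rho>"] nz by simp
    finally have "1 / (S * (S + 1)) * (2 / \<rho> + 2 / (S - \<rho>)) = 2 / ((S + 1) * \<rho>) * (1 / (S - \<rho>))"
      using nz by simp
    hence "1 / (S + 1) * (2 / (\<rho> * (\<rho> + 1))) + 1 / (S * (S + 1)) * (2 / \<rho> + 2 / (S - \<rho>)) =
       2 / ((S + 1) * \<rho>) * (1 / (\<rho> + 1) + 1 / (S - \<rho>))" by (simp add: distrib_left)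
    also have "1 / (\<rho> + 1) + 1 / (S - \<rho>) = (S + 1) / ((\<rho> + 1) * (S - \<rho>))"
      using inv_add[of "\<rho> + 1" "S - \<rho>"] nz by (simp add: add.commute)
    also have "2 / (a * b) * (a / (c * d)) = 2 / (b * c) / d" if "a \<noteq> 0" for a b c d :: complex
      using that by simp
    from this[OF nz(5)] have "2 / ((S + 1) * \<rho>) * ((S + 1) / ((\<rho> + 1) * (S - \<rho>))) = 2 / (\<rho> * (\<rho> + 1)) / (S - \<rho>)" .
    finally show ?thesis by (rule sym)
  qed
  hence "m * (2 / (\<rho> * (\<rho> + 1)) / (S - \<rho>)) =
     m * (1 / (S + 1) * (2 / (\<rho> * (\<rho> + 1))) + 1 / (S * (S + 1)) * (2 / \<rho> + 2 / (S - \<rho>)))" by (simp only:)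
  moreover have "m * (a * q + b * (u + v)) = a * (m * q) + b * (m * u + m * v)" for a b q u v
    by (simp add: algebra_simps)
  ultimately have "amp \<gamma> / (S - \<rho>) = 1 / (S + 1) * amp \<gamma> + 1 / (S * (S + 1)) * (m * (2 / \<rho>) + m * (2 / (S - \<rho>)))"
    unfolding amp by (simp only: times_divide_eq_right [symmetric])
  also have "1 / (S + 1) = of_real (1 / (s + 1))" by (simp add: S_def)
  also have "1 / (S * (S + 1)) = of_real (1 / (s * (s + 1)))" by (simp add: S_def)
  finally have "amp \<gamma> / (S - \<rho>) = of_real (1 / (s + 1)) * amp \<gamma> +
     of_real (1 / (s * (s + 1))) * (m * (2 / \<rho>) + m * (2 / (S - \<rho>)))" .
  moreover have "Re (of_real c * z) = c * Re z" for c z by simp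
  ultimately have "Re (amp \<gamma> / (S - \<rho>)) = 1 / (s + 1) * Re (amp \<gamma>) + 1 / (s * (s + 1)) * (zero_mult \<gamma> * Re (2 / \<rho>) + zero_mult \<gamma> * Re (2 / (S - \<rho>)))"
    unfolding m_def by (simp only: plus_complex.sel)
  moreover have "Re (2 / \<rho>) = 1 / (1/4 + \<gamma>\<^sup>2)"
    by (simp add: Re_divide \<rho>_def power2_eq_square)
  moreover have "Re (2 / (S - \<rho>)) = 2 * w / (w\<^sup>2 + \<gamma>\<^sup>2)"
    by (simp add: Re_divide \<rho>_def S_def w_def power2_eq_square)
  ultimately show ?thesis unfolding d by simp
qed

text \<open>The logarithmic derivative of the factorisation of \<open>xi\<close>, solved for the
  Digamma series. The term 1 / s from the factor \<open>s\<close> is absorbed by Digamma (s/2 + 1),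
  whose series runs over the trivial zeros.\<close>

lemma xi_log_deriv_of_real:
  assumes s: "s > 1"
  shows "(\<lambda>n. 1 / real (2 * n + 2) - 1 / (s + real (2 * n + 2))) sums
     (Re (deriv xi (of_real s) / xi (of_real s)) + Re (mangoldt_series (of_real s)) - 1 / (s - 1)
        + ln pi / 2 + euler_mascheroni / 2)"
proof -
  have nz: "xi (of_real s) \<noteq> 0" by (rule xi_nonzero_right) (use s in simp)
  have "mangoldt_series (of_real s) = deriv gamma_factor (of_real s) / gamma_factor (of_real s) +
      1 / (of_real s - 1) - deriv xi (of_real s) / xi (of_real s)"
    by (rule mangoldt_series_eq) (use s nz in auto)
  moreover have "deriv gamma_factor (of_real s) / gamma_factor (of_real s) =
      of_real (1 / s - ln pi / 2 + Digamma (s / 2) / 2)"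
    using s Polygamma_of_real[of "s/2" 0, where 'a = complex] by (subst gamma_factor_log_deriv) auto
  moreover have "1 / (of_real s - 1) = complex_of_real (1 / (s - 1))" by simp
  ultimately have "Re (mangoldt_series (of_real s)) =
     1 / s - ln pi / 2 + Digamma (s / 2) / 2 + 1 / (s - 1) - Re (deriv xi (of_real s) / xi (of_real s))"
    by (simp del: of_real_divide of_real_add of_real_diff of_real_mult)
  moreover have "1 / s + Digamma (s / 2) / 2 = Digamma (s / 2 + 1) / 2"
    using s Digamma_plus1[of "s/2"] by simp
  ultimately have D: "Digamma (s / 2 + 1) / 2 = Re (mangoldt_series (of_real s)) + ln pi / 2 - 1 / (s - 1)
      + Re (deriv xi (of_real s) / xi (of_real s))" by simp
  have "(\<lambda>n. inverse (real (Suc n)) - inverse (s / 2 + 1 + real n)) sums (Digamma (s / 2 + 1) + euler_mascheroni)"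
    using summable_sums[OF summable_Digamma[of "s / 2 + 1"]] s by (simp add: Digamma_def)
  hence "(\<lambda>n. 1 / 2 * (inverse (real (Suc n)) - inverse (s / 2 + 1 + real n))) sums
     (1 / 2 * (Digamma (s / 2 + 1) + euler_mascheroni))" by (rule sums_mult)
  moreover have "1 / 2 * (inverse (real (Suc n)) - inverse (s / 2 + 1 + real n)) =
      1 / real (2 * n + 2) - 1 / (s + real (2 * n + 2))" for n
  proof -
    have "s / 2 + 1 + real n = (s + real (2 * n + 2)) / 2" "real (Suc n) = real (2 * n + 2) / 2" by simp_all
    thus ?thesis by (simp only: inverse_eq_divide) simp
  qed
  ultimately have S: "(\<lambda>n. 1 / real (2 * n + 2) - 1 / (s + real (2 * n + 2))) sums
     (1 / 2 * (Digamma (s / 2 + 1) + euler_mascheroni))" by (simp only:)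
  have "1 / 2 * (Digamma (s / 2 + 1) + euler_mascheroni) = Digamma (s / 2 + 1) / 2 + euler_mascheroni / 2" by simp
  also note D
  also have "Re (mangoldt_series (of_real s)) + ln pi / 2 - 1 / (s - 1) + Re (deriv xi (of_real s) / xi (of_real s)) + euler_mascheroni / 2
     = Re (deriv xi (of_real s) / xi (of_real s)) + Re (mangoldt_series (of_real s)) - 1 / (s - 1)
        + ln pi / 2 + euler_mascheroni / 2" by simp
  finally show ?thesis using S by (simp only:)
qed

text \<open>For finitely many zeros the transform is explicit. The uniform convergence of the sum
  over zeros allows the limit along finite subsets, and \<open>amp_over_identity\<close> splits it
  into three sums that converge separately.\<close>

lemma laplace_H:
  assumes RH: "riemann_hypothesis" and s: "s > 2"
    and A: "((\<lambda>\<gamma>. Re (amp \<gamma>)) has_sum A) ordinates"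
    and B: "((\<lambda>\<gamma>. zero_mult \<gamma> * (1 / (1/4 + \<gamma>\<^sup>2))) has_sum B) ordinates"
  shows "((\<lambda>t. (exp (- 2 * t) * (exp (t / 2) * H (exp t))) * exp (- (s - 2) * t)) has_integral
     A / (s + 1) + (B + Re (deriv xi (of_real s) / xi (of_real s))) / (s * (s + 1))) {0..}"
proof -
  \<comment> \<open>The factor exp (t / 2) belongs to the critical line: together the weights give
    exp (- w t), and \<open>of_real w - \<i> * of_real \<gamma>\<close> is the distance s -
    \<rho>.\<close>
  define w where "w = s - 1/2"
  define c where "c = (\<lambda>t::real. exp (- 2 * t) * exp (t / 2))"
  have ul: "uniform_limit {0..} (\<lambda>F t. c t * (\<Sum>\<gamma>\<in>F. osc \<gamma> t)) (\<lambda>t. c t * H (exp t)) (finite_subsets_at_top ordinates)"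
  proof (rule uniform_limitI)
    fix e :: real assume "e > 0"
    from uniform_limitD[OF H_exp_uniform(1)[OF RH] this]
    show "\<forall>\<^sub>F F in finite_subsets_at_top ordinates. \<forall>t\<in>{0..}. dist (c t * (\<Sum>\<gamma>\<in>F. osc \<gamma> t)) (c t * H (exp t)) < e"
    proof eventually_elim
      case (elim F)
      show ?case
      proof
        fix t :: real assume t: "t \<in> {0..}"
        have "c t \<le> 1" "c t \<ge> 0" using t by (auto simp: c_def simp flip: exp_add)
        hence "c t * \<bar>(\<Sum>\<gamma>\<in>F. osc \<gamma> t) - H (exp t)\<bar> \<le> 1 * \<bar>(\<Sum>\<gamma>\<in>F. osc \<gamma> t) - H (exp t)\<bar>"
          by (intro mult_right_mono) auto
        also have "\<dots> < e" using elim by (simp add: dist_real_def)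
        finally show "dist (c t * (\<Sum>\<gamma>\<in>F. osc \<gamma> t)) (c t * H (exp t)) < e"
          using \<open>c t \<ge> 0\<close> by (simp add: dist_real_def abs_mult flip: right_diff_distrib)
      qed
    qed
  qed
  have cont: "continuous_on {0..} (\<lambda>t. c t * (\<Sum>\<gamma>\<in>F. osc \<gamma> t))" for F
    unfolding c_def osc_def by (intro continuous_intros) auto
  have osc_int: "((\<lambda>t. c t * osc \<gamma> t * exp (- (s - 2) * t)) has_integral Re (amp \<gamma> / (of_real w - \<i> * of_real \<gamma>))) {0..}" for \<gamma>
  proof -
    have "((\<lambda>t. exp (- (of_real w - \<i> * of_real \<gamma>) * of_real t)) has_integral 1 / (of_real w - \<i> * of_real \<gamma>)) {0::real..}"
      by (rule has_integral_exp_neg_complex) (use s in \<open>simp add: w_def\<close>)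
    from has_integral_linear[OF has_integral_mult_right[OF this, of "amp \<gamma>"] bounded_linear_Re]
    have "((\<lambda>t. Re (amp \<gamma> * exp (- (of_real w - \<i> * of_real \<gamma>) * of_real t))) has_integral
        Re (amp \<gamma> / (of_real w - \<i> * of_real \<gamma>))) {0::real..}" by (simp add: o_def)
    moreover have "Re (amp \<gamma> * exp (- (of_real w - \<i> * of_real \<gamma>) * of_real t)) = c t * osc \<gamma> t * exp (- (s - 2) * t)" for t
    proof -
      have "c t * exp (- (s - 2) * t) = exp (- w * t)" unfolding c_def w_def by (simp add: algebra_simps flip: exp_add)
      moreover have "exp (- (of_real w - \<i> * of_real \<gamma>) * complex_of_real t) = of_real (exp (- w * t)) * exp (\<i> * of_real (\<gamma> * t))"
        by (simp add: exp_of_real [symmetric] algebra_simps flip: exp_add exp_of_real)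
      moreover have "Re (a * (of_real c * z)) = c * Re (a * z)" for a z c by (simp add: algebra_simps)
      ultimately have "Re (amp \<gamma> * exp (- (of_real w - \<i> * of_real \<gamma>) * complex_of_real t)) = c t * exp (- (s - 2) * t) * osc \<gamma> t"
        unfolding osc_def by (simp only:)
      thus ?thesis by (simp only: mult_ac)
    qed
    ultimately show ?thesis by simp
  qed
  have fin: "((\<lambda>t. c t * (\<Sum>\<gamma>\<in>F. osc \<gamma> t) * exp (- (s - 2) * t)) has_integral
     (\<Sum>\<gamma>\<in>F. Re (amp \<gamma> / (of_real w - \<i> * of_real \<gamma>)))) {0..}" for F
  proof (cases "finite F")
    case True
    thus ?thesis unfolding sum_distrib_left sum_distrib_right by (intro has_integral_sum osc_int)
  qed simp
  have s2: "s - 2 > 0" using s by simp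
  note * = laplace_uniform_limit[OF ul finite_subsets_at_top_neq_bot s2 cont fin]
  define X where "X = Re (deriv xi (of_real s) / xi (of_real s))"
  have "((\<lambda>\<gamma>. zero_mult \<gamma> * (2 * w / (w\<^sup>2 + \<gamma>\<^sup>2))) has_sum X) ordinates"
    using xi_partial_fraction[OF RH, of w] s by (simp add: w_def X_def)
  hence "((\<lambda>\<gamma>. 1 / (s + 1) * Re (amp \<gamma>) +
    1 / (s * (s + 1)) * (zero_mult \<gamma> * (1 / (1/4 + \<gamma>\<^sup>2)) + zero_mult \<gamma> * (2 * w / (w\<^sup>2 + \<gamma>\<^sup>2)))) has_sum
     (1 / (s + 1) * A + 1 / (s * (s + 1)) * (B + X))) ordinates"
    by (intro has_sum_add has_sum_cmult_right A B)
  hence "((\<lambda>\<gamma>. Re (amp \<gamma> / (of_real w - \<i> * of_real \<gamma>))) has_sum (1 / (s + 1) * A + 1 / (s * (s + 1)) * (B + X))) ordinates"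
    using amp_over_identity[of s] s unfolding w_def by simp
  hence "((\<lambda>F. \<Sum>\<gamma>\<in>F. Re (amp \<gamma> / (of_real w - \<i> * of_real \<gamma>))) \<longlongrightarrow> (1 / (s + 1) * A + 1 / (s * (s + 1)) * (B + X)))
      (finite_subsets_at_top ordinates)" by (simp add: has_sum_def)
  from tendsto_unique[OF finite_subsets_at_top_neq_bot *(3) this] integrable_integral[OF *(2)]
  have "((\<lambda>t. c t * H (exp t) * exp (- (s - 2) * t)) has_integral (1 / (s + 1) * A + 1 / (s * (s + 1)) * (B + X))) {0..}"
    by simp
  thus ?thesis by (simp add: c_def X_def mult.assoc)
qed

text \<open>
  Both sides, damped by \<open>e\<^sup>-\<^sup>2\<^sup>t\<close>, are bounded and continuous and have the same Laplace transform:
  this is the partial fraction expansion of \<open>\<zeta>'/\<zeta>\<close>.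
\<close>
lemma explicit_formula:
  assumes RH: "riemann_hypothesis"
  shows "\<exists>A B. \<forall>t\<ge>0. exp (t / 2) * H (exp t) =
     A * exp (- t) + B * (1 - exp (- t)) + (exp t / 2 - 1 + exp (- t) / 2) + trivial_part t - prime_part t"
proof -
  have "(\<lambda>\<gamma>. Re (amp \<gamma>)) summable_on ordinates"
    by (rule Infinite_Sum.abs_summable_summable, rule summable_on_comparison_test[OF amp_summable[OF RH]])
       (use abs_Re_le_cmod in auto)
  then obtain A where A: "((\<lambda>\<gamma>. Re (amp \<gamma>)) has_sum A) ordinates" by (auto simp: summable_on_def)
  have "((\<lambda>\<gamma>. zero_mult \<gamma> * (1 / (1/4 + \<gamma>\<^sup>2))) has_sum Re (deriv xi (1/2 + of_real (1/2)) / xi (1/2 + of_real (1/2)))) ordinates"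
    using xi_partial_fraction[OF RH, of "1/2"] by (simp add: power2_eq_square)
  then obtain B where B: "((\<lambda>\<gamma>. zero_mult \<gamma> * (1 / (1/4 + \<gamma>\<^sup>2))) has_sum B) ordinates" by blast
  \<comment> \<open>The coefficient \<open>B\<close> of the statement is this \<open>c\<close>: the
    constants ln pi / 2 and euler_mascheroni / 2 are moved over from the Digamma side.\<close>
  define c where "c = B - ln pi / 2 - euler_mascheroni / 2"
  \<comment> \<open>The elementary part: exp (- t) and 1 - exp (- t) have the transforms 1 / (s + 1)
    and 1 / (s (s + 1)), and the bracket has 1 / ((s - 1) s (s + 1)), the contribution of the pole
    of zeta.\<close>
  define E where "E = (\<lambda>t::real. A * exp (- t) + c * (1 - exp (- t)) + (exp t / 2 - 1 + exp (- t) / 2))"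
  define f where "f = (\<lambda>t. exp (- 2 * t) * (exp (t / 2) * H (exp t)) - (exp (- 2 * t) * E t +
      exp (- 2 * t) * trivial_part t - exp (- 2 * t) * prime_part t))"
  \<comment> \<open>The value 3 is an arbitrary sample point beyond 2: continuity and boundedness of
    the damped parts do not mention \<open>s\<close>, but the lemmas providing them carry it as a
    parameter.\<close>
  have tp: "\<exists>T. (\<lambda>n. 1 / real (2 * n + 2) - 1 / (3 + real (2 * n + 2))) sums T"
    using xi_log_deriv_of_real[of 3] by auto
  then obtain T where T: "(\<lambda>n. 1 / real (2 * n + 2) - 1 / (3 + real (2 * n + 2))) sums T" ..
  obtain C1 where C1: "\<And>t. t \<ge> 0 \<Longrightarrow> \<bar>exp (- 2 * t) * trivial_part t\<bar> \<le> C1"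
    using laplace_trivial_part(3)[OF _ T] by auto
  obtain C2 where C2: "\<And>t. t \<ge> 0 \<Longrightarrow> \<bar>exp (- 2 * t) * prime_part t\<bar> \<le> C2"
    using laplace_prime_part(3)[of 3] by auto
  define C0 where "C0 = (\<Sum>\<^sub>\<infinity>\<gamma>\<in>ordinates. norm (amp \<gamma>))"
  have f0: "f t = 0" if t: "t \<ge> 0" for t
  proof (rule laplace_injective[OF _ _ _ t])
    have c1: "continuous_on {0..} (\<lambda>t. exp (- 2 * t) * (exp (t / 2) * H (exp t)))"
      by (intro continuous_on_mult H_exp_uniform(3)[OF RH]) (auto intro!: continuous_intros)
    have c2: "continuous_on {0..} (\<lambda>t. exp (- 2 * t) * E t)"
      unfolding E_def by (intro continuous_intros) auto
    have c3: "continuous_on {0..} (\<lambda>t. exp (- 2 * t) * trivial_part t)"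
      by (rule laplace_trivial_part(2)[OF _ T]) simp
    have c4: "continuous_on {0..} (\<lambda>t. exp (- 2 * t) * prime_part t)"
      by (rule laplace_prime_part(2)[of 3]) simp
    show "continuous_on {0..} f" unfolding f_def
      by (rule continuous_on_diff[OF c1 continuous_on_diff[OF continuous_on_add[OF c2 c3] c4]])
    fix t :: real assume t: "t \<ge> 0"
    have e: "\<bar>exp (- 2 * t) * x\<bar> \<le> \<bar>x\<bar>" for x using t by (simp add: abs_mult mult_left_le_one_le)
    have "\<bar>exp (- 2 * t) * (exp (t / 2) * H (exp t))\<bar> = exp (- (3/2) * t) * \<bar>H (exp t)\<bar>"
    proof -
      have "exp (- 2 * t) * exp (t / 2) = exp (- (3/2) * t)" by (simp add: algebra_simps flip: exp_add)
      hence "exp (- 2 * t) * (exp (t / 2) * H (exp t)) = exp (- (3/2) * t) * H (exp t)"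
        by (simp only: mult.assoc [symmetric])
      thus ?thesis by (simp only: abs_mult abs_exp_cancel)
    qed
    also have "\<dots> \<le> 1 * C0" using t H_exp_uniform(2)[OF RH, of t] unfolding C0_def by (intro mult_mono) auto
    finally have 1: "\<bar>exp (- 2 * t) * (exp (t / 2) * H (exp t))\<bar> \<le> C0" by simp
    have 2: "\<bar>exp (- 2 * t) * E t\<bar> \<le> \<bar>A\<bar> + \<bar>c\<bar> + 1"
    proof -
      have x: "exp (- t) \<le> 1" "exp (- t) > 0" using t by auto
      have "exp (- 2 * t) * E t = exp (- 2 * t) * (A * exp (- t)) + exp (- 2 * t) * (c * (1 - exp (- t))) +
          exp (- 2 * t) * (exp t / 2 - 1 + exp (- t) / 2)" by (simp add: E_def algebra_simps)
      moreover have "\<bar>exp (- 2 * t) * (A * exp (- t))\<bar> \<le> \<bar>A\<bar>"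
        using e[of "A * exp (- t)"] x mult_left_le[of "exp (- t)" "\<bar>A\<bar>"] by (simp add: abs_mult)
      moreover have "\<bar>exp (- 2 * t) * (c * (1 - exp (- t)))\<bar> \<le> \<bar>c\<bar>"
        using e[of "c * (1 - exp (- t))"] x mult_left_le[of "1 - exp (- t)" "\<bar>c\<bar>"] by (simp add: abs_mult)
      moreover have "\<bar>exp (- 2 * t) * (exp t / 2 - 1 + exp (- t) / 2)\<bar> \<le> 1"
      proof -
        define y where "y = exp (- t)"
        have y: "0 < y" "y \<le> 1" using x by (auto simp: y_def)
        have "exp (- 2 * t) = y * y" by (simp add: y_def flip: exp_add)
        moreover have "exp t = 1 / y" by (simp add: y_def exp_minus divide_inverse)
        ultimately have "exp (- 2 * t) * (exp t / 2 - 1 + exp (- t) / 2) = y * (1 - y)\<^sup>2 / 2"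
          using y by (simp add: y_def [symmetric] power2_eq_square field_simps)
        moreover have "y * (1 - y)\<^sup>2 \<le> 1 * 1" using y by (intro mult_mono power_le_one) auto
        moreover have "y * (1 - y)\<^sup>2 \<ge> 0" using y by simp
        ultimately show ?thesis by (simp only: abs_le_iff) simp
      qed
      ultimately show ?thesis by linarith
    qed
    show "\<bar>f t\<bar> \<le> C0 + (\<bar>A\<bar> + \<bar>c\<bar> + 1) + C1 + C2"
      unfolding f_def using 1 2 C1[OF t] C2[OF t] by linarith
  next
    fix s' :: real assume "s' > 0"
    define s where "s = s' + 2"
    have s: "s > 2" and s': "s' = s - 2" using \<open>s' > 0\<close> by (auto simp: s_def)
    define X where "X = Re (deriv xi (of_real s) / xi (of_real s))"
    define D where "D = Re (mangoldt_series (of_real s))"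
    define T where "T = X + D - 1 / (s - 1) + ln pi / 2 + euler_mascheroni / 2"
    have T: "(\<lambda>n. 1 / real (2 * n + 2) - 1 / (s + real (2 * n + 2))) sums T"
      using xi_log_deriv_of_real[of s] s by (simp add: T_def X_def D_def)
    have h: "((\<lambda>t. (exp (- 2 * t) * (exp (t / 2) * H (exp t))) * exp (- (s - 2) * t)) has_integral
      A / (s + 1) + (B + X) / (s * (s + 1))) {0..}"
      unfolding X_def by (rule laplace_H[OF RH s A B])
    have Ei: "((\<lambda>t. (exp (- 2 * t) * E t) * exp (- (s - 2) * t)) has_integral
       (A / (s + 1) + c / (s * (s + 1)) + 1 / ((s - 1) * (s * (s + 1))))) {0..}"
    proof -
      have "((\<lambda>t. (A * exp (- (s + 1) * t) + c * (exp (- s * t) - exp (- (s + 1) * t)))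
           + (1/2 * exp (- (s - 1) * t) - exp (- s * t) + 1/2 * exp (- (s + 1) * t))) has_integral
         ((A * (1 / (s + 1)) + c * (1 / s - 1 / (s + 1))) + (1/2 * (1 / (s - 1)) - 1 / s + 1/2 * (1 / (s + 1))))) {0..}"
        using s by (intro has_integral_add has_integral_diff has_integral_mult_right has_integral_exp_neg) auto
      moreover have "(A * exp (- (s + 1) * t) + c * (exp (- s * t) - exp (- (s + 1) * t)))
           + (1/2 * exp (- (s - 1) * t) - exp (- s * t) + 1/2 * exp (- (s + 1) * t)) =
           (exp (- 2 * t) * E t) * exp (- (s - 2) * t)" for t
      proof -
        have "(exp (- 2 * t) * E t) * exp (- (s - 2) * t) = E t * exp (- s * t)"
          by (rule exp_weight_mult)
        moreover have "exp (- (s + 1) * t) = exp (- t) * exp (- s * t)" "exp (- (s - 1) * t) = exp t * exp (- s * t)"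
          by (simp_all add: algebra_simps flip: exp_add)
        ultimately show ?thesis by (simp add: E_def algebra_simps)
      qed
      moreover have "(A * (1 / (s + 1)) + c * (1 / s - 1 / (s + 1))) + (1/2 * (1 / (s - 1)) - 1 / s + 1/2 * (1 / (s + 1))) =
         A / (s + 1) + c / (s * (s + 1)) + 1 / ((s - 1) * (s * (s + 1)))"
      proof -
        have 1: "1 / s - 1 / (s + 1) = 1 / (s * (s + 1))" using s by (simp add: field_simps)
        have 2: "1/2 * (1 / (s - 1)) - 1 / s + 1/2 * (1 / (s + 1)) = 1 / ((s - 1) * (s * (s + 1)))"
          using s by (simp add: divide_simps) (simp add: algebra_simps)
        show ?thesis unfolding 1 2 by simp
      qed
      ultimately show ?thesis by (simp only:)
    qed
    have frac: "a + b / p - (a + c / p + d / p + e / p - g / p) = (b - c - d - e + g) / p" for a b c d e g p :: real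
      by (simp add: add_divide_distrib diff_divide_distrib)
    have P: "((\<lambda>t. (exp (- 2 * t) * prime_part t) * exp (- (s - 2) * t)) has_integral D / (s * (s + 1))) {0..}"
      unfolding D_def by (rule laplace_prime_part(1)[OF s])
    have dist: "(a - (b + c - d)) * e = a * e - (b * e + c * e - d * e)" for a b c d e :: real
      by (simp add: algebra_simps)
    have fd: "(\<lambda>t. f t * exp (- s' * t)) = (\<lambda>t. (exp (- 2 * t) * (exp (t / 2) * H (exp t))) * exp (- (s - 2) * t) -
        ((exp (- 2 * t) * E t) * exp (- (s - 2) * t) + (exp (- 2 * t) * trivial_part t) * exp (- (s - 2) * t) -
         (exp (- 2 * t) * prime_part t) * exp (- (s - 2) * t)))"
      by (rule ext) (simp only: f_def s' dist)
    have "((\<lambda>t. f t * exp (- s' * t)) has_integral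
      (A / (s + 1) + (B + X) / (s * (s + 1)) -
      (A / (s + 1) + c / (s * (s + 1)) + 1 / ((s - 1) * (s * (s + 1))) + T / (s * (s + 1)) - D / (s * (s + 1))))) {0..}"
      unfolding fd
      by (rule has_integral_diff[OF h has_integral_diff[OF has_integral_add[OF Ei laplace_trivial_part(1)[OF s T]] P]])
    hence I: "integral {0..} (\<lambda>t. f t * exp (- s' * t)) = A / (s + 1) + (B + X) / (s * (s + 1)) -
      (A / (s + 1) + c / (s * (s + 1)) + 1 / ((s - 1) * (s * (s + 1))) + T / (s * (s + 1)) - D / (s * (s + 1)))"
      by (rule integral_unique)
    have e1: "1 / ((s - 1) * (s * (s + 1))) = (1 / (s - 1)) / (s * (s + 1))" by simp
    have cancel: "b + x - (b - l - m) - u - (x + d - u + l + m) + d = 0" for b x l m u d :: real by simp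
    have e2: "B + X - c - 1 / (s - 1) - T + D = 0" unfolding c_def T_def by (rule cancel)
    have "A / (s + 1) + (B + X) / (s * (s + 1)) -
      (A / (s + 1) + c / (s * (s + 1)) + 1 / ((s - 1) * (s * (s + 1))) + T / (s * (s + 1)) - D / (s * (s + 1))) = 0"
      unfolding e1 by (rule trans[OF frac]) (simp only: e2 div_0)
    with I show "integral {0..} (\<lambda>t. f t * exp (- s' * t)) = 0" by (rule trans)
  qed
  have "exp (t / 2) * H (exp t) = E t + trivial_part t - prime_part t" if "t \<ge> 0" for t
  proof -
    have "exp (- 2 * t) * (exp (t / 2) * H (exp t) - (E t + trivial_part t - prime_part t)) = 0"
      using f0[OF that] by (simp add: f_def algebra_simps)
    thus ?thesis by simp
  qed
  thus ?thesis unfolding E_def by blast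
qed

section \<open>Analyticity between logarithms of integers\<close>

lemma trivial_part_holomorphic:
  "\<exists>\<tau>. \<tau> holomorphic_on {z. Re z > 0} \<and> (\<forall>t>0. \<tau> (of_real t) = of_real (trivial_part t))"
proof -
  define q where "q = (\<lambda>n. real (2 * n + 2) * real (2 * n + 1))"
  define e where "e = (\<lambda>n z. (exp (- z) - exp (- of_nat (2 * n + 2) * z)) / complex_of_real (q n))"
  define M where "M = (\<lambda>n. 2 * real (Suc n) powr (- 2))"
  have q: "q n > 0" "(real (Suc n))\<^sup>2 \<le> q n" for n by (auto simp: q_def power2_eq_square intro!: mult_mono mult_pos_pos)
  have M: "summable M" unfolding M_def by (intro summable_mult summable_powr_Suc) simp
  have bd: "norm (e n z) \<le> M n" if z: "Re z > 0" for n z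
  proof -
    have "norm (exp (- z)) \<le> 1" using z by (simp add: norm_exp_eq_Re)
    moreover have "norm (exp (- of_nat (2 * n + 2) * z)) \<le> 1"
    proof -
      have "norm (exp (- of_nat k * z)) = exp (- (real k * Re z))" for k by (simp add: norm_exp_eq_Re)
      hence "norm (exp (- of_nat (2 * n + 2) * z)) = exp (- (real (2 * n + 2) * Re z))" .
      also have "\<dots> \<le> 1" using z by simp
      finally show ?thesis .
    qed
    ultimately have "norm (exp (- z) - exp (- of_nat (2 * n + 2) * z)) \<le> 2"
      using norm_triangle_ineq4[of "exp (- z)" "exp (- of_nat (2 * n + 2) * z)"] by linarith
    hence "norm (e n z) \<le> 2 / q n"
      unfolding e_def norm_divide using q(1)[of n] by (simp add: divide_right_mono)
    also have "\<dots> \<le> 2 / (real (Suc n))\<^sup>2" using q[of n] by (intro divide_left_mono mult_pos_pos) auto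
    also have "\<dots> = M n" by (simp add: M_def powr_minus powr_numeral divide_inverse del: of_nat_Suc)
    finally show ?thesis .
  qed
  define \<tau> where "\<tau> = (\<lambda>z. \<Sum>n. e n z)"
  have ul: "uniform_limit {z. Re z > 0} (\<lambda>N z. \<Sum>n<N. e n z) \<tau> sequentially"
    unfolding \<tau>_def by (rule Weierstrass_m_test[OF _ M]) (use bd in auto)
  have "\<tau> holomorphic_on {z. Re z > 0}"
  proof (rule holomorphic_uniform_sequence[OF open_Re_gt])
    show "(\<lambda>z. \<Sum>n<N. e n z) holomorphic_on {z. Re z > 0}" for N
      unfolding e_def using q(1) by (intro holomorphic_intros) (auto simp: less_imp_neq[symmetric])
    fix z :: complex assume "z \<in> {z. Re z > 0}"
    then obtain d where "d > 0" "cball z d \<subseteq> {z. Re z > 0}"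
      using open_Re_gt open_contains_cball by blast
    thus "\<exists>d>0. cball z d \<subseteq> {z. Re z > 0} \<and> uniform_limit (cball z d) (\<lambda>N z. \<Sum>n<N. e n z) \<tau> sequentially"
      using uniform_limit_on_subset[OF ul] by blast
  qed
  moreover have "\<tau> (of_real t) = of_real (trivial_part t)" if t: "t > 0" for t
  proof -
    have er: "e n (of_real t) = of_real ((exp (- t) - exp (- real (2 * n + 2) * t)) / q n)" for n
      unfolding e_def by (simp flip: exp_of_real)
    have "summable (\<lambda>n. complex_of_real ((exp (- t) - exp (- real (2 * n + 2) * t)) / q n))"
      unfolding er [symmetric] by (rule summable_comparison_test'[OF M, of 0]) (use bd t in auto)
    hence "summable (\<lambda>n. (exp (- t) - exp (- real (2 * n + 2) * t)) / q n)"
      by (simp only: summable_of_real_iff)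
    from suminf_of_real[OF this, where ?'a = complex]
    have "(\<Sum>n. e n (of_real t)) = of_real (\<Sum>n. (exp (- t) - exp (- real (2 * n + 2) * t)) / q n)"
      unfolding er by (rule sym)
    thus ?thesis unfolding \<tau>_def trivial_part_def q_def .
  qed
  ultimately show ?thesis by blast
qed

definition half_plane :: "complex set" where "half_plane = {z. Re z > 0}"

lemma open_half_plane: "open half_plane" and connected_half_plane: "connected half_plane"
  unfolding half_plane_def by (rule open_Re_gt, intro convex_connected convex_halfspace_Re_gt)

lemma fsigma_half_plane: "fsigma half_plane"
proof -
  have "z \<in> (\<Union>n. {z. Re z \<ge> 1 / real (Suc n)})" if "Re z > 0" for z
    using that nat_approx_posE[of "Re z"] by (auto intro: less_imp_le)
  moreover have "Re z > 0" if "Re z \<ge> 1 / real (Suc n)" for z n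
    using that by (rule less_le_trans[rotated]) simp
  ultimately have "half_plane = (\<Union>n. {z. Re z \<ge> 1 / real (Suc n)})"
    unfolding half_plane_def by blast
  moreover have "fsigma (\<Union>n. {z. Re z \<ge> 1 / real (Suc n)})"
    by (rule fsigma.intros) (rule closed_halfspace_Re_ge)
  ultimately show ?thesis by (simp only:)
qed

lemma has_field_derivative_Re_of_real:
  assumes "(G has_field_derivative D) (at (of_real t))"
  shows "((\<lambda>x. Re (G (of_real x))) has_real_derivative Re D) (at t)"
  using bounded_linear.has_vector_derivative[OF bounded_linear_Re has_vector_derivative_real_field[OF assms]]
  by (simp add: has_real_derivative_iff_has_vector_derivative)

text \<open>Apart from \<open>prime_part\<close>, every term of the explicit formula extends to the
  right half-plane, so the corners of \<open>H (exp t)\<close> can come from nowhere else.\<close>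

lemma H_exp_smooth_part:
  assumes RH: "riemann_hypothesis"
  shows "\<exists>G. G holomorphic_on half_plane \<and>
     (\<forall>t>0. of_real (exp (t / 2) * H (exp t) + prime_part t) = G (of_real t))"
proof -
  obtain A B where AB: "\<And>t. t \<ge> 0 \<Longrightarrow> exp (t / 2) * H (exp t) =
     A * exp (- t) + B * (1 - exp (- t)) + (exp t / 2 - 1 + exp (- t) / 2) + trivial_part t - prime_part t"
    using explicit_formula[OF RH] by blast
  obtain \<tau> where \<tau>: "\<tau> holomorphic_on {z. Re z > 0}" "\<And>t. t > 0 \<Longrightarrow> \<tau> (of_real t) = of_real (trivial_part t)"
    using trivial_part_holomorphic by blast
  define G where "G = (\<lambda>z. of_real A * exp (- z) + of_real B * (1 - exp (- z)) + (exp z / 2 - 1 + exp (- z) / 2) + \<tau> z)"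
  have "G holomorphic_on half_plane" unfolding G_def half_plane_def by (intro holomorphic_intros \<tau>(1)) auto
  moreover have "of_real (exp (t / 2) * H (exp t) + prime_part t) = G (of_real t)" if t: "t > 0" for t
  proof -
    have e: "exp (t / 2) * H (exp t) + prime_part t =
      A * exp (- t) + B * (1 - exp (- t)) + (exp t / 2 - 1 + exp (- t) / 2) + trivial_part t" using AB[of t] t by simp
    have "G (of_real t) = of_real (A * exp (- t) + B * (1 - exp (- t)) + (exp t / 2 - 1 + exp (- t) / 2) + trivial_part t)"
      unfolding G_def \<tau>(2)[OF t] by (simp flip: exp_of_real)
    thus ?thesis unfolding e by (rule sym)
  qed
  ultimately show ?thesis by blast
qed

text \<open>Both end points are included, since the ramp of an integer is 0 at its own logarithm;
  this lets neighbouring formulas meet at ln N.\<close>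

lemma prime_part_between:
  assumes N: "N \<ge> 1" and t: "ln (real N) \<le> t" "t \<le> ln (real (Suc N))"
  shows "prime_part t = (\<Sum>n<N. mangoldt (Suc n) * (1 - real (Suc n) * exp (- t)))"
proof -
  have N0: "real N > 0" using N by simp
  have et: "real N \<le> exp t" "exp t \<le> real (Suc N)"
    using t N0 by (metis exp_le_cancel_iff exp_ln, metis exp_le_cancel_iff exp_ln of_nat_0_less_iff zero_less_Suc)
  have "prime_part t = (\<Sum>n<N. mangoldt (Suc n) * max 0 (1 - real (Suc n) * exp (- t)))"
    unfolding prime_part_def
  proof (rule suminf_finite)
    fix n assume "n \<notin> {..<N}"
    hence "real (Suc N) \<le> real (Suc n)" by simp
    hence "exp t \<le> real (Suc n)" using et by linarith
    hence "real (Suc n) * exp (- t) \<ge> 1" by (simp add: exp_minus field_simps)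
    thus "mangoldt (Suc n) * max 0 (1 - real (Suc n) * exp (- t)) = (0::real)" by (simp del: of_nat_Suc)
  qed simp
  also have "\<dots> = (\<Sum>n<N. mangoldt (Suc n) * (1 - real (Suc n) * exp (- t)))"
  proof (rule sum.cong)
    fix n assume "n \<in> {..<N}"
    hence "real (Suc n) \<le> real N" by simp
    hence "real (Suc n) \<le> exp t" using et by linarith
    hence "real (Suc n) * exp (- t) \<le> 1" by (simp add: exp_minus field_simps)
    thus "mangoldt (Suc n) * max 0 (1 - real (Suc n) * exp (- t)) = mangoldt (Suc n) * (1 - real (Suc n) * exp (- t))"
      by (simp del: of_nat_Suc)
  qed simp
  finally show ?thesis .
qed

lemma H_exp_analytic_between:
  assumes RH: "riemann_hypothesis" and N: "N \<ge> 1"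
  shows "\<exists>G. G holomorphic_on half_plane \<and>
     (\<forall>t. ln (real N) \<le> t \<longrightarrow> t \<le> ln (real (Suc N)) \<longrightarrow> t > 0 \<longrightarrow> of_real (H (exp t)) = G (of_real t))"
proof -
  obtain G where G: "G holomorphic_on half_plane"
    "\<And>t. t > 0 \<Longrightarrow> of_real (exp (t / 2) * H (exp t) + prime_part t) = G (of_real t)"
    using H_exp_smooth_part[OF RH] by blast
  define K where "K = (\<lambda>z. exp (- z / 2) * (G z - (\<Sum>n<N. of_real (mangoldt (Suc n)) * (1 - of_nat (Suc n) * exp (- z)))))"
  have "K holomorphic_on half_plane" unfolding K_def by (intro holomorphic_intros G(1)) auto
  moreover have "of_real (H (exp t)) = K (of_real t)"
    if t: "ln (real N) \<le> t" "t \<le> ln (real (Suc N))" "t > 0" for t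
  proof -
    have "K (of_real t) = of_real (exp (- t / 2) * ((exp (t / 2) * H (exp t) + prime_part t) - prime_part t))"
      unfolding K_def G(2)[OF t(3), symmetric] by (subst (2) prime_part_between[OF N t(1,2)]) (simp flip: exp_of_real)
    also have "exp (- t / 2) * ((exp (t / 2) * H (exp t) + prime_part t) - prime_part t) = H (exp t)"
      by (simp add: mult.assoc [symmetric] flip: exp_add)
    finally show ?thesis by (rule sym)
  qed
  ultimately show ?thesis by blast
qed

text \<open>A finite sum of oscillations is differentiable, and then so would be
  \<open>prime_part\<close>. But at ln 2, where the first prime sets in, its one-sided derivatives
  are 0 and ln 2.\<close>

lemma infinite_ordinates:
  assumes RH: "riemann_hypothesis"
  shows "infinite ordinates"
proof
  assume fin: "finite ordinates"
  define t0 where "t0 = ln (2::real)"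
  have t0: "t0 > 0" "t0 < ln 3" by (simp_all add: t0_def)
  obtain G where G: "G holomorphic_on half_plane"
    "\<And>t. t > 0 \<Longrightarrow> of_real (exp (t / 2) * H (exp t) + prime_part t) = G (of_real t)"
    using H_exp_smooth_part[OF RH] by blast
  have "H (exp t) = (\<Sum>\<gamma>\<in>ordinates. osc \<gamma> t)" for t
    using has_sum_unique[OF H_exp[OF RH, of t] has_sum_finite[OF fin]] .
  hence H_eq: "(\<lambda>t. H (exp t)) = (\<lambda>t. \<Sum>\<gamma>\<in>ordinates. osc \<gamma> t)" by blast
  have osc_diff: "(\<lambda>t. osc \<gamma> t) differentiable (at t)" for \<gamma> t
  proof -
    have "osc \<gamma> = (\<lambda>t. Re (amp \<gamma>) * cos (\<gamma> * t) - Im (amp \<gamma>) * sin (\<gamma> * t))"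
      unfolding osc_def by (simp add: fun_eq_iff Re_exp Im_exp)
    moreover have "(\<lambda>t. Re (amp \<gamma>) * cos (\<gamma> * t) - Im (amp \<gamma>) * sin (\<gamma> * t)) differentiable (at t)"
      unfolding real_differentiable_def by (rule exI) (rule derivative_eq_intros refl)+
    ultimately show ?thesis by (simp only:)
  qed
  have exp_diff: "(\<lambda>t::real. exp (t / 2)) differentiable (at t)" for t
    unfolding real_differentiable_def by (rule exI) (rule derivative_eq_intros refl | simp)+
  have "(\<lambda>t. exp (t / 2) * H (exp t)) differentiable (at t0)"
    unfolding fun_cong[OF H_eq] by (intro differentiable_mult exp_diff differentiable_sum fin osc_diff ballI)
  moreover have "(\<lambda>t. exp (t / 2) * H (exp t) + prime_part t) differentiable (at t0)"
  proof -
    have "(G has_field_derivative deriv G (of_real t0)) (at (of_real t0))"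
      by (rule holomorphic_derivI[OF G(1) open_half_plane]) (simp add: half_plane_def t0)
    hence "((\<lambda>t. Re (G (of_real t))) has_real_derivative Re (deriv G (of_real t0))) (at t0)"
      by (rule has_field_derivative_Re_of_real)
    hence "((\<lambda>t. exp (t / 2) * H (exp t) + prime_part t) has_real_derivative Re (deriv G (of_real t0))) (at t0)"
    proof (rule has_field_derivative_transform_within_open[of _ _ _ "{0<..}"])
      fix t :: real assume "t \<in> {0<..}"
      thus "Re (G (of_real t)) = exp (t / 2) * H (exp t) + prime_part t" using G(2)[of t, symmetric] by simp
    qed (use t0 in auto)
    thus ?thesis by (auto simp: real_differentiable_def)
  qed
  ultimately have "(\<lambda>t. (exp (t / 2) * H (exp t) + prime_part t) - exp (t / 2) * H (exp t)) differentiable (at t0)"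
    by (rule differentiable_diff[rotated])
  hence "prime_part differentiable (at t0)" by simp
  then obtain D where D: "(prime_part has_real_derivative D) (at t0)" by (auto simp: real_differentiable_def)
  have "mangoldt (2::nat) = ln (2::real)" using mangoldt_prime[of 2, where 'a = real] by simp
  hence m: "mangoldt (Suc 0) = (0::real)" "mangoldt (Suc (Suc 0)) = ln (2::real)"
    unfolding numeral_2_eq_2 by simp_all
  have left: "prime_part t = 0" if "t \<in> {0<..t0}" for t
  proof -
    have "prime_part t = (\<Sum>n<1. mangoldt (Suc n) * (1 - real (Suc n) * exp (- t)))"
      by (rule prime_part_between) (use that in \<open>auto simp: t0_def\<close>)
    thus ?thesis by (simp add: m)
  qed
  have right: "prime_part t = ln 2 * (1 - 2 * exp (- t))" if "t \<in> {t0..<ln 3}" for t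
  proof -
    have "prime_part t = (\<Sum>n<2. mangoldt (Suc n) * (1 - real (Suc n) * exp (- t)))"
      by (rule prime_part_between) (use that in \<open>auto simp: t0_def\<close>)
    also have "{..<2} = {0, Suc 0}" by auto
    finally show ?thesis by (simp add: m)
  qed
  have pt0: "prime_part t0 = 0" using right[of t0] t0 by (simp add: t0_def exp_minus)
  have "(prime_part has_real_derivative D) (at t0 within {0<..t0})" using D by (rule has_field_derivative_at_within)
  hence "((\<lambda>_. 0) has_real_derivative D) (at t0 within {0<..t0})"
    by (rule has_field_derivative_transform_within[where d = 1]) (use left pt0 t0 in auto)
  hence "D = 0"
  proof (rule has_field_derivative_unique)
    show "((\<lambda>_. 0) has_real_derivative 0) (at t0 within {0<..t0})" by simp
    show "at t0 within {0<..t0} \<noteq> bot" using t0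
      using islimpt_subset[OF islimpt_greaterThanLessThan2[of 0 t0], of "{0<..t0}"] by (auto simp: trivial_limit_within)
  qed
  have "(prime_part has_real_derivative D) (at t0 within {t0..<ln 3})" using D by (rule has_field_derivative_at_within)
  hence "((\<lambda>t. ln 2 * (1 - 2 * exp (- t))) has_real_derivative D) (at t0 within {t0..<ln 3})"
    by (rule has_field_derivative_transform_within[where d = "ln 3 - t0"]) (use right t0 in \<open>auto simp: dist_real_def\<close>)
  hence "D = ln 2 * 1"
  proof (rule has_field_derivative_unique)
    have "((\<lambda>t. ln 2 * (1 - 2 * exp (- t))) has_real_derivative ln 2 * (2 * exp (- t0))) (at t0 within {t0..<ln 3})"
      by (auto intro!: derivative_eq_intros)
    thus "((\<lambda>t. ln 2 * (1 - 2 * exp (- t))) has_real_derivative ln 2 * 1) (at t0 within {t0..<ln 3})"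
      by (simp add: t0_def exp_minus)
    have "t0 islimpt {t0<..<ln (3::real)}" using t0 by (simp add: islimpt_greaterThanLessThan1)
    hence "t0 islimpt {t0..<ln 3}" by (rule islimpt_subset) auto
    thus "at t0 within {t0..<ln 3} \<noteq> bot" by (simp add: trivial_limit_within)
  qed
  thus False using \<open>D = 0\<close> by simp
qed

text \<open>On the preimage \<open>f\<close> is injective with a Lipschitz inverse, and Lipschitz
  maps send null sets to null sets.\<close>

lemma negligible_preimage_expanding:
  fixes f :: "real \<Rightarrow> real"
  assumes D: "negligible D" and c: "c > 0"
    and exp: "\<And>x y. x \<in> U \<Longrightarrow> y \<in> U \<Longrightarrow> \<bar>f x - f y\<bar> \<ge> c * \<bar>x - y\<bar>"
  shows "negligible {x\<in>U. f x \<in> D}"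
proof -
  define P where "P = {x\<in>U. f x \<in> D}"
  have inj: "inj_on f P"
  proof (rule inj_onI)
    fix x y assume "x \<in> P" "y \<in> P" "f x = f y"
    hence "c * \<bar>x - y\<bar> \<le> 0" using exp[of x y] by (simp add: P_def)
    thus "x = y" using c by (simp add: mult_le_0_iff)
  qed
  define k where "k = inv_into P f"
  have "P = k ` (f ` P)" unfolding k_def using inv_into_image_cancel[OF inj order_refl] by simp
  moreover have "negligible (k ` (f ` P))"
  proof (rule negligible_locally_Lipschitz_image)
    show "negligible (f ` P)" by (rule negligible_subset[OF D]) (auto simp: P_def)
    fix y assume y: "y \<in> f ` P"
    have "norm (k z - k y) \<le> 1 / c * norm (z - y)" if z: "z \<in> f ` P" for z
    proof -
      have ky: "k y \<in> P" "f (k y) = y" using y by (simp_all add: k_def inv_into_into f_inv_into_f)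
      have kz: "k z \<in> P" "f (k z) = z" using z by (simp_all add: k_def inv_into_into f_inv_into_f)
      have "c * \<bar>k z - k y\<bar> \<le> \<bar>z - y\<bar>" using exp[of "k z" "k y"] ky kz by (simp add: P_def)
      thus ?thesis using c by (simp add: field_simps)
    qed
    thus "\<exists>T B. open T \<and> y \<in> T \<and> (\<forall>z\<in>f ` P \<inter> T. norm (k z - k y) \<le> B * norm (z - y))"
      by (intro exI[of _ UNIV] exI[of _ "1 / c"]) auto
  qed simp
  ultimately show ?thesis by (simp add: P_def)
qed

text \<open>If the derivative vanishes identically, \<open>\<phi>\<close> is constant. Otherwise its
  zeros are countable, and around every other point the mean value theorem makes
  \<open>\<phi>\<close> expanding, so preimages of null sets are locally null there.\<close>

lemma negligible_preimage_analytic: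
  fixes \<phi> :: "real \<Rightarrow> real"
  assumes G: "G holomorphic_on half_plane" and a: "a \<ge> 0"
    and eq: "\<And>t. a < t \<Longrightarrow> t < b \<Longrightarrow> of_real (\<phi> t) = G (of_real t)"
    and D: "negligible D"
  shows "(\<exists>c. \<forall>t. a < t \<longrightarrow> t < b \<longrightarrow> \<phi> t = c) \<or> negligible {t\<in>{a<..<b}. \<phi> t \<in> D}"
proof -
  have hp: "of_real t \<in> half_plane" if "t > a" for t using that a by (simp add: half_plane_def)
  have G': "deriv G holomorphic_on half_plane" by (rule holomorphic_deriv[OF G open_half_plane])
  define d where "d = (\<lambda>t. Re (deriv G (of_real t)))"
  have der: "(\<phi> has_real_derivative d t) (at t)" if t: "a < t" "t < b" for t
  proof -
    have "(G has_field_derivative deriv G (of_real t)) (at (of_real t))"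
      by (rule holomorphic_derivI[OF G open_half_plane hp[OF t(1)]])
    hence "((\<lambda>t. Re (G (of_real t))) has_real_derivative d t) (at t)"
      unfolding d_def by (rule has_field_derivative_Re_of_real)
    thus ?thesis
      by (rule has_field_derivative_transform_within_open[of _ _ _ "{a<..<b}"]) (use t eq[symmetric] in auto)
  qed
  have dc: "continuous_on {a<..<b} d"
    unfolding d_def
    by (intro continuous_intros continuous_on_compose2[OF holomorphic_on_imp_continuous_on[OF G']]) (use hp in auto)
  \<comment> \<open>Needed to carry countability over: a priori a zero of \<open>d\<close> is only a
    zero of the real part of the derivative of \<open>G\<close>.\<close>
  have real: "deriv G (of_real t) = of_real (d t)" if t: "a < t" "t < b" for t
  proof -
    have "(G has_field_derivative deriv G (of_real t)) (at (of_real t))"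
      by (rule holomorphic_derivI[OF G open_half_plane hp[OF t(1)]])
    hence "((\<lambda>x. G (of_real x)) has_vector_derivative deriv G (of_real t)) (at t)"
      by (rule has_vector_derivative_real_field)
    hence 1: "((\<lambda>x. complex_of_real (\<phi> x)) has_vector_derivative deriv G (of_real t)) (at t)"
      by (rule has_vector_derivative_transform_within_open[of _ _ _ "{a<..<b}"]) (use t eq[symmetric] in auto)
    have 2: "((\<lambda>x. complex_of_real (\<phi> x)) has_vector_derivative of_real (d t)) (at t)"
      by (rule has_vector_derivative_of_real[OF der[OF t]])
    show ?thesis using vector_derivative_unique_at[OF 1 2] .
  qed
  show ?thesis
  proof (cases "\<forall>z\<in>half_plane. deriv G z = 0")
    case True
    have dz: "d t = 0" if "a < t" for t using True hp[OF that] by (simp add: d_def)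
    have "\<exists>c. \<forall>x\<in>{a<..<b}. \<phi> x = c"
    proof (rule has_field_derivative_zero_constant)
      show "(\<phi> has_real_derivative 0) (at x within {a<..<b})" if "x \<in> {a<..<b}" for x
        using der[of x] dz[of x] that by (auto intro: has_field_derivative_at_within)
    qed simp
    thus ?thesis by auto
  next
    case False
    have "countable {z\<in>half_plane. deriv G z = 0}"
    proof (cases "deriv G constant_on half_plane")
      case True
      then obtain c where "\<And>z. z \<in> half_plane \<Longrightarrow> deriv G z = c" by (auto simp: constant_on_def)
      hence "{z\<in>half_plane. deriv G z = 0} = {}" using False by auto
      thus ?thesis by (simp only: countable_empty)
    next
      case nc: False
      show ?thesis by (rule holomorphic_countable_zeros[OF G' open_half_plane connected_half_plane]) (use nc fsigma_half_plane in auto)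
    qed
    moreover define Z where "Z = {t\<in>{a<..<b}. d t = 0}"
    have "of_real ` Z \<subseteq> {z\<in>half_plane. deriv G z = 0}" using hp real by (auto simp: Z_def)
    ultimately have "countable (complex_of_real ` Z)" by (rule countable_subset[rotated])
    hence Z: "countable Z" by (rule countable_image_inj_on) (auto intro: inj_onI)
    define P where "P = {t\<in>{a<..<b}. \<phi> t \<in> D} - Z"
    have "negligible P"
    proof (subst locally_negligible_alt, rule ballI)
      fix t0 assume "t0 \<in> P"
      hence t0: "a < t0" "t0 < b" "d t0 \<noteq> 0" by (auto simp: P_def Z_def)
      define c where "c = \<bar>d t0\<bar> / 2"
      have c: "c > 0" using t0 by (simp add: c_def)
      have "isCont d t0" using dc t0 by (simp add: continuous_on_eq_continuous_at)
      then obtain e where e: "e > 0" "\<And>t. \<bar>t - t0\<bar> < e \<Longrightarrow> \<bar>d t - d t0\<bar> < c"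
        using c unfolding continuous_at_eps_delta by (auto simp: dist_real_def)
      define U where "U = {max a (t0 - e)<..<min b (t0 + e)}"
      have dU: "\<bar>d t\<bar> \<ge> c" if "t \<in> U" for t
      proof -
        have "\<bar>d t - d t0\<bar> < c" using that by (intro e(2)) (auto simp: U_def)
        thus ?thesis unfolding c_def by linarith
      qed
      have ex: "\<bar>\<phi> x - \<phi> y\<bar> \<ge> c * \<bar>x - y\<bar>" if xy: "x \<in> U" "y \<in> U" for x y
      proof -
        have *: "\<bar>\<phi> x - \<phi> y\<bar> \<ge> c * \<bar>x - y\<bar>" if xy: "x \<in> U" "y \<in> U" "y < x" for x y
        proof -
          have "\<exists>z>y. z < x \<and> \<phi> x - \<phi> y = (x - y) * d z"
            by (rule MVT2[OF xy(3)]) (use xy der in \<open>auto simp: U_def\<close>)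
          then obtain z where z: "y < z" "z < x" "\<phi> x - \<phi> y = (x - y) * d z" by blast
          have "z \<in> U" using z xy by (auto simp: U_def)
          hence "\<bar>x - y\<bar> * c \<le> \<bar>x - y\<bar> * \<bar>d z\<bar>" by (intro mult_left_mono dU) auto
          thus ?thesis using z(3) by (simp add: abs_mult mult.commute)
        qed
        show ?thesis
        proof (cases x y rule: linorder_cases)
          case less
          thus ?thesis using *[OF xy(2,1)] by (simp add: abs_minus_commute)
        qed (use *[OF xy] in auto)
      qed
      have "negligible {x\<in>U. \<phi> x \<in> D}" by (rule negligible_preimage_expanding[OF D c ex])
      hence "negligible (P \<inter> U)" by (rule negligible_subset) (auto simp: P_def)
      moreover have "openin (top_of_set P) (P \<inter> U)" by (rule openin_open_Int) (simp add: U_def)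
      moreover have "t0 \<in> P \<inter> U" using \<open>t0 \<in> P\<close> t0 e by (auto simp: U_def)
      ultimately show "\<exists>U. openin (top_of_set P) U \<and> t0 \<in> U \<and> negligible U" by blast
    qed
    moreover have "negligible Z"
      using countable_imp_null_set_lborel[OF Z] by (simp add: negligible_iff_null_sets null_sets_completionI)
    ultimately have "negligible (P \<union> Z)" by (rule negligible_Un)
    hence "negligible {t\<in>{a<..<b}. \<phi> t \<in> D}" by (rule negligible_subset) (auto simp: P_def)
    thus ?thesis by blast
  qed
qed

text \<open>\<open>\<Phi>\<close> agrees off a null set with a bounded Borel function, whose
  composition with the continuous function \<open>h\<close> is integrable. Between logarithms of
  consecutive integers either \<open>h\<close> is constant, or it enters the exceptional null set
  only at a null set of times.\<close>

lemma integrable_composition_H: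
  fixes \<Phi> :: "real \<Rightarrow> complex"
  assumes RH: "riemann_hypothesis"
    and meas: "\<Phi> \<in> borel_measurable (lebesgue_on {-B..B})"
    and bd: "\<And>x. \<bar>x\<bar> \<le> B \<Longrightarrow> norm (\<Phi> x) \<le> C"
    and B: "\<And>t. \<bar>H (exp t)\<bar> \<le> B"
  shows "(\<lambda>t. \<Phi> (H (exp t))) integrable_on {0..T}"
proof -
  define h where "h = (\<lambda>t. H (exp t))"
  have hB: "\<bar>h t\<bar> \<le> B" for t unfolding h_def by (rule B)
  have B0: "B \<ge> 0" using hB[of 0] by linarith
  have C0: "C \<ge> 0" using bd[of 0] B0 by (metis abs_zero norm_ge_zero order_trans)
  have hc: "continuous_on UNIV h" unfolding h_def by (rule H_exp_uniform(3)[OF RH])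
  \<comment> \<open>Measurability and the bound are known only on the range of \<open>h\<close>;
    extending by 0 makes them global.\<close>
  define \<Phi>0 where "\<Phi>0 = (\<lambda>x. if x \<in> {-B..B} then \<Phi> x else 0)"
  have bd0: "norm (\<Phi>0 x) \<le> C" for x using bd[of x] C0 by (auto simp: \<Phi>0_def)
  have \<Phi>0h: "\<Phi>0 (h t) = \<Phi> (h t)" for t using hB[of t] by (simp add: \<Phi>0_def abs_le_iff)
  have m0: "\<Phi>0 \<in> borel_measurable lebesgue"
    unfolding \<Phi>0_def by (rule borel_measurable_if_I[OF meas]) simp
  have "(\<lambda>x. Re (\<Phi>0 x)) \<in> borel_measurable lebesgue" "(\<lambda>x. Im (\<Phi>0 x)) \<in> borel_measurable lebesgue"
    using borel_measurable_complex_iff m0 by blast+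
  then obtain u v where uv: "u \<in> borel_measurable lborel" "AE x in lborel. Re (\<Phi>0 x) = u x"
    "v \<in> borel_measurable lborel" "AE x in lborel. Im (\<Phi>0 x) = v x"
    using completion_ex_borel_measurable_real[of "\<lambda>x. Re (\<Phi>0 x)" lborel]
      completion_ex_borel_measurable_real[of "\<lambda>x. Im (\<Phi>0 x)" lborel] by blast
  \<comment> \<open>The truncation keeps the Borel version bounded at every point, also where it
    differs from \<open>\<Phi>0\<close>.\<close>
  define \<Psi> where "\<Psi> = (\<lambda>x. if norm (Complex (u x) (v x)) \<le> C then Complex (u x) (v x) else 0)"
  have [measurable]: "u \<in> borel_measurable borel" "v \<in> borel_measurable borel" using uv by simp_all
  have "(\<lambda>x. Complex (u x) (v x)) \<in> borel_measurable borel"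
    unfolding borel_measurable_complex_iff by simp
  hence \<Psi>m: "\<Psi> \<in> borel_measurable borel" unfolding \<Psi>_def by measurable
  have \<Psi>C: "norm (\<Psi> x) \<le> C" for x using C0 by (simp add: \<Psi>_def)
  have "AE x in lborel. \<Phi>0 x = \<Psi> x"
    using uv(2,4)
  proof eventually_elim
    case (elim x)
    have "\<Phi>0 x = Complex (u x) (v x)" using elim by (simp add: complex_eq_iff)
    thus ?case using bd0[of x] by (simp add: \<Psi>_def)
  qed
  then obtain N where "N \<in> null_sets lborel" "{x. \<Phi>0 x \<noteq> \<Psi> x} \<subseteq> N"
    by (auto simp: eventually_ae_filter)
  hence D: "negligible {x. \<Phi>0 x \<noteq> \<Psi> x}"
    by (meson negligible_iff_null_sets negligible_subset null_sets_completionI)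
  have \<Psi>h: "(\<lambda>t. \<Psi> (h t)) integrable_on {a..b}" for a b
  proof (rule measurable_bounded_by_integrable_imp_integrable)
    have "h \<in> borel_measurable borel" using hc by (rule borel_measurable_continuous_onI)
    hence "(\<lambda>t. \<Psi> (h t)) \<in> borel_measurable borel" using \<Psi>m by (rule measurable_compose)
    hence "(\<lambda>t. \<Psi> (h t)) \<in> borel_measurable lborel" by simp
    hence "(\<lambda>t. \<Psi> (h t)) \<in> borel_measurable lebesgue" by (rule measurable_completion)
    thus "(\<lambda>t. \<Psi> (h t)) \<in> borel_measurable (lebesgue_on {a..b})" by (rule measurable_restrict_space1)
    show "(\<lambda>t. C) integrable_on {a..b}" by (rule Henstock_Kurzweil_Integration.integrable_const_ivl)
    show "norm (\<Psi> (h t)) \<le> C" for t by (rule \<Psi>C)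
  qed simp
  have piece: "(\<lambda>t. \<Phi> (h t)) integrable_on {ln (real N)..ln (real (Suc N))}" if N: "N \<ge> 1" for N
  proof -
    define a b where "a = ln (real N)" and "b = ln (real (Suc N))"
    have a0: "a \<ge> 0" using N by (simp add: a_def)
    obtain G where G: "G holomorphic_on half_plane"
      "\<And>t. ln (real N) \<le> t \<Longrightarrow> t \<le> ln (real (Suc N)) \<Longrightarrow> t > 0 \<Longrightarrow> of_real (H (exp t)) = G (of_real t)"
      using H_exp_analytic_between[OF RH N] by blast
    have eq: "of_real (h t) = G (of_real t)" if "a < t" "t < b" for t
      unfolding h_def by (rule G(2)) (use that a0 in \<open>auto simp: a_def b_def\<close>)
    from negligible_preimage_analytic[OF G(1) a0 eq D]
    have "(\<lambda>t. \<Phi> (h t)) integrable_on {a..b}"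
    proof
      \<comment> \<open>Here \<open>h\<close> may rest inside the exceptional set, but then
        \<open>\<Phi> (h t)\<close> is the constant \<open>\<Phi> c\<close> up to the two end
        points.\<close>
      assume "\<exists>c. \<forall>t. a < t \<longrightarrow> t < b \<longrightarrow> h t = c"
      then obtain c where c: "\<And>t. a < t \<Longrightarrow> t < b \<Longrightarrow> h t = c" by blast
      have "(\<lambda>_. \<Phi> c) integrable_on {a..b}" by (rule Henstock_Kurzweil_Integration.integrable_const_ivl)
      thus ?thesis
        by (rule integrable_spike[where S = "{a, b}"]) (use c in auto)
    next
      assume n: "negligible {t \<in> {a<..<b}. h t \<in> {x. \<Phi>0 x \<noteq> \<Psi> x}}"
      have "negligible (insert a (insert b {t \<in> {a<..<b}. h t \<in> {x. \<Phi>0 x \<noteq> \<Psi> x}}))" using n by simp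
      from \<Psi>h this show ?thesis
      proof (rule integrable_spike)
        fix t assume "t \<in> {a..b} - insert a (insert b {t \<in> {a<..<b}. h t \<in> {x. \<Phi>0 x \<noteq> \<Psi> x}})"
        hence "\<Phi>0 (h t) = \<Psi> (h t)" by auto
        thus "\<Phi> (h t) = \<Psi> (h t)" unfolding \<Phi>0h .
      qed
    qed
    thus ?thesis unfolding a_def b_def .
  qed
  have all: "(\<lambda>t. \<Phi> (h t)) integrable_on {0..ln (real (Suc N))}" for N
  proof (induction N)
    case 0
    show ?case using integrable_on_refl[of "\<lambda>t. \<Phi> (h t)" 0] by simp
  next
    case (Suc N)
    show ?case
      by (rule Henstock_Kurzweil_Integration.integrable_combine[OF _ _ Suc.IH piece]) auto
  qed
  obtain N where "exp T \<le> real N" using real_arch_simple by blast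
  hence "exp T \<le> real (Suc N)" by simp
  hence "T \<le> ln (real (Suc N))" by (subst ln_ge_iff) auto
  hence "(\<lambda>t. \<Phi> (h t)) integrable_on {0..T}"
    by (intro integrable_on_subinterval[OF all[of N]]) auto
  thus ?thesis unfolding h_def .
qed

section \<open>Mean values\<close>

definition has_mean :: "(real \<Rightarrow> complex) \<Rightarrow> complex \<Rightarrow> bool" where
  "has_mean f L \<longleftrightarrow> ((\<lambda>T. (1 / T) *\<^sub>R integral {0..T} f) \<longlongrightarrow> L) at_top"

lemma has_mean_add:
  assumes "has_mean f L" "has_mean g M" and c: "continuous_on UNIV f" "continuous_on UNIV g"
  shows "has_mean (\<lambda>t. f t + g t) (L + M)"
proof -
  have "integral {0..T} (\<lambda>t. f t + g t) = integral {0..T} f + integral {0..T} g" for T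
    by (intro integral_add integrable_continuous_interval continuous_on_subset[OF c(1)] continuous_on_subset[OF c(2)] subset_UNIV)
  thus ?thesis using tendsto_add[OF assms(1,2)[unfolded has_mean_def]]
    unfolding has_mean_def by (simp only: scaleR_add_right)
qed

lemma has_mean_cmult:
  assumes "has_mean f L"
  shows "has_mean (\<lambda>t. c * f t) (c * L)"
  using tendsto_mult_left[OF assms[unfolded has_mean_def], of c]
  unfolding has_mean_def integral_mult_right by (simp only: mult_scaleR_right)

lemma has_mean_sum:
  assumes "finite K" "\<And>k. k \<in> K \<Longrightarrow> has_mean (f k) (L k)" "\<And>k. k \<in> K \<Longrightarrow> continuous_on UNIV (f k)"
  shows "has_mean (\<lambda>t. \<Sum>k\<in>K. f k t) (\<Sum>k\<in>K. L k)"
  using assms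
proof (induction K rule: finite_induct)
  case empty
  thus ?case by (simp add: has_mean_def)
next
  case (insert k K)
  have "has_mean (\<lambda>t. f k t + (\<Sum>k\<in>K. f k t)) (L k + (\<Sum>k\<in>K. L k))"
    by (rule has_mean_add) (use insert in \<open>auto intro!: continuous_on_sum\<close>)
  thus ?case using insert.hyps by simp
qed

lemma norm_mean_le:
  fixes f :: "real \<Rightarrow> complex"
  assumes "T > 0" "continuous_on UNIV f" "\<And>t. norm (f t) \<le> B"
  shows "norm ((1 / T) *\<^sub>R integral {0..T} f) \<le> B"
proof -
  have "norm (integral {0..T} f) \<le> B * (T - 0)"
    by (rule integral_bound) (use assms in \<open>auto intro: continuous_on_subset\<close>)
  thus ?thesis using assms(1) by (simp add: field_simps)
qed

lemma has_mean_norm_le: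
  assumes "has_mean f L" "continuous_on UNIV f" "\<And>t. norm (f t) \<le> B"
  shows "norm L \<le> B"
proof (rule Lim_norm_ubound[OF _ assms(1)[unfolded has_mean_def]])
  show "\<forall>\<^sub>F T in at_top. norm ((1 / T) *\<^sub>R integral {0..T} f) \<le> B"
    using eventually_gt_at_top[of 0]
  proof eventually_elim
    case (elim T)
    thus ?case by (rule norm_mean_le[OF _ assms(2,3)])
  qed
qed simp

lemma dist_mean_le:
  fixes f g :: "real \<Rightarrow> complex"
  assumes T: "T > 0" and f: "continuous_on UNIV f" and g: "continuous_on UNIV g"
    and d: "\<And>t. dist (f t) (g t) \<le> e"
  shows "dist ((1 / T) *\<^sub>R integral {0..T} f) ((1 / T) *\<^sub>R integral {0..T} g) \<le> e"
proof -
  have "integral {0..T} (\<lambda>t. f t - g t) = integral {0..T} f - integral {0..T} g"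
    by (intro integral_diff integrable_continuous_interval continuous_on_subset[OF f] continuous_on_subset[OF g] subset_UNIV)
  moreover have "norm ((1 / T) *\<^sub>R integral {0..T} (\<lambda>t. f t - g t)) \<le> e"
    by (rule norm_mean_le[OF T]) (use d in \<open>auto simp: dist_norm intro!: continuous_on_diff f g\<close>)
  ultimately show ?thesis by (simp only: dist_norm scaleR_diff_right)
qed

text \<open>Convergence of the means \<open>L n\<close> is a conclusion: the averages of
  \<open>g\<close> at integer lengths form a Cauchy sequence, since each is eventually close to some
  \<open>L n\<close>. This later yields convergence of the infinite product of Bessel values without
  any product criterion.\<close>

lemma has_mean_uniform_limit_ex:
  fixes f :: "'a \<Rightarrow> real \<Rightarrow> complex"
  assumes ul: "uniform_limit UNIV f g F" and F: "F \<noteq> bot"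
    and fm: "\<forall>\<^sub>F n in F. continuous_on UNIV (f n) \<and> has_mean (f n) (L n)"
  shows "\<exists>M. (L \<longlongrightarrow> M) F \<and> has_mean g M"
proof -
  define m where "m = (\<lambda>f T. (1 / T) *\<^sub>R integral {0..T::real} f :: complex)"
  have g: "continuous_on UNIV g"
    by (rule uniform_limit_theorem[OF _ ul F]) (use fm in \<open>auto elim: eventually_mono\<close>)
  have ev: "\<forall>\<^sub>F n in F. continuous_on UNIV (f n) \<and> has_mean (f n) (L n) \<and> (\<forall>T>0. dist (m (f n) T) (m g T) \<le> e)"
    if "e > 0" for e
    using fm uniform_limitD[OF ul that]
  proof eventually_elim
    case (elim n)
    thus ?case unfolding m_def using dist_mean_le[of _ "f n" g e] g by (auto intro: less_imp_le)
  qed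
  have near: "\<forall>\<^sub>F T in at_top. dist (m g T) (L n) < 2 * e"
    if "has_mean (f n) (L n)" "\<forall>T>0. dist (m (f n) T) (m g T) \<le> e" "e > 0" for n e
    using tendstoD[OF that(1)[unfolded has_mean_def] that(3)] eventually_gt_at_top[of 0]
  proof eventually_elim
    case (elim T)
    have "dist (m g T) (L n) \<le> dist (m (f n) T) (m g T) + dist (m (f n) T) (L n)"
      by (rule dist_triangle3)
    also have "\<dots> < e + e" using elim that(2) unfolding m_def by (intro add_le_less_mono) auto
    finally show ?case by simp
  qed
  have "Cauchy (\<lambda>k. m g (real k))"
  proof (rule metric_CauchyI)
    fix e :: real assume e: "e > 0"
    hence "e / 4 > 0" by simp
    from eventually_happens'[OF F ev[OF this]] obtain n where
      n: "has_mean (f n) (L n)" "\<forall>T>0. dist (m (f n) T) (m g T) \<le> e / 4" by blast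
    from near[OF n \<open>e / 4 > 0\<close>] obtain N where N: "\<And>T. T \<ge> N \<Longrightarrow> dist (m g T) (L n) < 2 * (e / 4)"
      by (auto simp: eventually_at_top_linorder)
    obtain K where K: "N \<le> real K" using real_arch_simple by blast
    have "dist (m g (real i)) (m g (real j)) < e" if "i \<ge> K" "j \<ge> K" for i j
    proof -
      have "N \<le> real i" "N \<le> real j" using K that by linarith+
      hence "dist (m g (real i)) (L n) < 2 * (e / 4)" "dist (m g (real j)) (L n) < 2 * (e / 4)" by (simp_all only: N)
      thus ?thesis using dist_triangle2[of "m g (real i)" "m g (real j)" "L n"] by linarith
    qed
    thus "\<exists>K. \<forall>i\<ge>K. \<forall>j\<ge>K. dist (m g (real i)) (m g (real j)) < e" by blast
  qed
  then obtain M where M: "(\<lambda>k. m g (real k)) \<longlonglongrightarrow> M" using Cauchy_convergent convergent_def by blast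
  have LM: "\<forall>\<^sub>F n in F. has_mean (f n) (L n) \<and> (\<forall>T>0. dist (m (f n) T) (m g T) \<le> e) \<and> dist (L n) M \<le> 2 * e"
    if e: "e > 0" for e
    using ev[OF e]
  proof eventually_elim
    case (elim n)
    hence n: "has_mean (f n) (L n)" "\<forall>T>0. dist (m (f n) T) (m g T) \<le> e" by auto
    have "\<forall>\<^sub>F k in sequentially. dist (m g (real k)) (L n) < 2 * e"
      using near[OF n e] filterlim_real_sequentially unfolding filterlim_iff by blast
    hence "dist M (L n) \<le> 2 * e"
      by (intro tendsto_upperbound[OF tendsto_dist[OF M tendsto_const]]) (auto elim: eventually_mono)
    thus ?case using n by (simp add: dist_commute)
  qed
  have "(L \<longlongrightarrow> M) F"
  proof (rule tendstoI)
    fix e :: real assume "e > 0"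
    hence "e / 3 > 0" by simp
    from LM[OF this] show "\<forall>\<^sub>F n in F. dist (L n) M < e"
      by eventually_elim (use \<open>e > 0\<close> in auto)
  qed
  moreover have "has_mean g M"
    unfolding has_mean_def
  proof (rule tendstoI)
    fix e :: real assume "e > 0"
    hence e: "e / 4 > 0" by simp
    from eventually_happens'[OF F LM[OF e]] obtain n where
      n: "has_mean (f n) (L n)" "\<forall>T>0. dist (m (f n) T) (m g T) \<le> e / 4" "dist (L n) M \<le> 2 * (e / 4)" by blast
    show "\<forall>\<^sub>F T in at_top. dist ((1 / T) *\<^sub>R integral {0..T} g) M < e"
      using near[OF n(1,2) e]
    proof eventually_elim
      case (elim T)
      thus ?case using n(3) dist_triangle[of "m g T" M "L n"] unfolding m_def by linarith
    qed
  qed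
  ultimately show ?thesis by blast
qed

lemma has_mean_uniform_limit:
  fixes f :: "'a \<Rightarrow> real \<Rightarrow> complex"
  assumes "uniform_limit UNIV f g F" "F \<noteq> bot"
    and "\<And>n. continuous_on UNIV (f n)" "\<And>n. has_mean (f n) (L n)" "(L \<longlongrightarrow> M) F"
  shows "has_mean g M"
proof -
  obtain M' where "(L \<longlongrightarrow> M') F" "has_mean g M'"
    using has_mean_uniform_limit_ex[OF assms(1,2), of L] assms(3,4) by auto
  thus ?thesis using tendsto_unique[OF assms(2,5)] by blast
qed

lemma has_mean_const: "has_mean (\<lambda>_. c) c"
  unfolding has_mean_def
proof (rule Lim_transform_eventually)
  show "\<forall>\<^sub>F T in at_top. c = (1 / T) *\<^sub>R integral {0..T::real} (\<lambda>_. c)"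
    using eventually_gt_at_top[of 0] by eventually_elim simp
qed simp

lemma has_mean_exp:
  assumes "\<theta> \<noteq> 0"
  shows "has_mean (\<lambda>t. exp (\<i> * of_real (\<theta> * t))) 0"
  unfolding has_mean_def
proof (rule Lim_null_comparison)
  have "((\<lambda>T::real. 2 / \<bar>\<theta>\<bar> * inverse T) \<longlongrightarrow> 2 / \<bar>\<theta>\<bar> * 0) at_top"
    by (intro tendsto_mult_left tendsto_inverse_0_at_top filterlim_ident)
  thus "((\<lambda>T::real. 2 / \<bar>\<theta>\<bar> * inverse T) \<longlongrightarrow> 0) at_top" by simp
  show "\<forall>\<^sub>F T in at_top. norm ((1 / T) *\<^sub>R integral {0..T} (\<lambda>t. exp (\<i> * of_real (\<theta> * t)))) \<le> 2 / \<bar>\<theta>\<bar> * inverse T"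
    using eventually_gt_at_top[of 0]
  proof eventually_elim
    case (elim T)
    define G where "G = (\<lambda>z. exp (\<i> * of_real \<theta> * z) / (\<i> * of_real \<theta>))"
    have "((\<lambda>x. G (of_real x)) has_vector_derivative exp (\<i> * of_real (\<theta> * x))) (at x within {0..T})" for x
    proof (rule has_vector_derivative_real_field)
      show "(G has_field_derivative exp (\<i> * of_real (\<theta> * x))) (at (of_real x))"
        unfolding G_def using assms by (auto intro!: derivative_eq_intros simp: mult.assoc)
    qed
    hence "((\<lambda>t. exp (\<i> * of_real (\<theta> * t))) has_integral (G (of_real T) - G (of_real 0))) {0..T}"
      by (intro fundamental_theorem_of_calculus) (use elim in auto)
    hence e: "integral {0..T} (\<lambda>t. exp (\<i> * of_real (\<theta> * t))) = G (of_real T) - G (of_real 0)"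
      by (rule integral_unique)
    have G: "norm (G (of_real x)) = 1 / \<bar>\<theta>\<bar>" for x
    proof -
      have e: "G (of_real x) = exp (\<i> * of_real (\<theta> * x)) / (\<i> * of_real \<theta>)" by (simp add: G_def mult.assoc)
      show ?thesis unfolding e norm_divide norm_exp_i_times by (simp add: norm_mult)
    qed
    have "norm (G (of_real T) - G (of_real 0)) \<le> 1 / \<bar>\<theta>\<bar> + 1 / \<bar>\<theta>\<bar>"
      using norm_triangle_ineq4[of "G (of_real T)" "G (of_real 0)"] unfolding G .
    hence "norm (integral {0..T} (\<lambda>t. exp (\<i> * of_real (\<theta> * t)))) \<le> 2 / \<bar>\<theta>\<bar>" unfolding e by simp
    from mult_right_mono[OF this, of "inverse T"] show ?case using elim by (simp add: divide_inverse mult.commute)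
  qed
qed

section \<open>The Bessel function of order zero and its decay\<close>

definition bessel_coeff :: "nat \<Rightarrow> real" where
  "bessel_coeff n = (- 1) ^ n / (fact n)\<^sup>2"

text \<open>The Bessel function \<open>J\<^sub>0(y)\<close> is this series at \<open>y\<^sup>2/4\<close>.\<close>
definition bessel_series :: "real \<Rightarrow> real" where
  "bessel_series w = (\<Sum>n. bessel_coeff n * w ^ n)"

lemma summable_bessel: "summable (\<lambda>n. bessel_coeff n * w ^ n)"
proof (rule summable_comparison_test'[OF summable_exp_generic[of "\<bar>w\<bar>"], of 0])
  fix n :: nat
  have "\<bar>w\<bar> ^ n / (fact n)\<^sup>2 \<le> \<bar>w\<bar> ^ n / fact n"
    by (rule divide_left_mono) (use self_le_power[of "fact n :: real" 2] in \<open>auto simp: fact_ge_1\<close>)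
  thus "norm (bessel_coeff n * w ^ n) \<le> \<bar>w\<bar> ^ n /\<^sub>R fact n"
    by (simp add: bessel_coeff_def norm_mult norm_divide norm_power abs_mult power_abs divide_inverse mult.commute)
qed

lemma bessel_coeff_Suc: "(real (Suc n))\<^sup>2 * bessel_coeff (Suc n) = - bessel_coeff n"
proof -
  have "real (Suc n) \<noteq> 0" by simp
  thus ?thesis unfolding bessel_coeff_def fact_Suc power_mult_distrib by (simp add: field_simps del: of_nat_Suc)
qed

text \<open>This is w times the derivative of \<open>bessel_series\<close>. With it Bessel's
  equation becomes a first-order system, which keeps second derivatives out of the energy
  estimate.\<close>

definition bessel_flux :: "real \<Rightarrow> real" where
  "bessel_flux w = (\<Sum>n. (real n * bessel_coeff n) * w ^ n)"

lemma bessel_series_deriv: "w \<noteq> 0 \<Longrightarrow> (bessel_series has_real_derivative bessel_flux w / w) (at w)"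
  and bessel_flux_deriv: "(bessel_flux has_real_derivative - bessel_series w) (at w)"
proof -
  have d: "summable (\<lambda>n. diffs bessel_coeff n * w ^ n)" for w
    by (rule termdiff_converges_all[OF summable_bessel])
  have fs: "(\<lambda>n. (real n * bessel_coeff n) * w ^ n) sums (w * (\<Sum>n. diffs bessel_coeff n * w ^ n))" for w
  proof -
    have "(\<lambda>n. w * (diffs bessel_coeff n * w ^ n)) sums (w * (\<Sum>n. diffs bessel_coeff n * w ^ n))"
      by (rule sums_mult[OF summable_sums[OF d]])
    moreover have "w * (diffs bessel_coeff n * w ^ n) = (real (Suc n) * bessel_coeff (Suc n)) * w ^ Suc n" for n
      by (simp add: diffs_def)
    ultimately have "(\<lambda>n. (real (Suc n) * bessel_coeff (Suc n)) * w ^ Suc n) sums (w * (\<Sum>n. diffs bessel_coeff n * w ^ n))"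
      by (simp only:)
    from sums_Suc[OF this] show ?thesis by simp
  qed
  have s: "summable (\<lambda>n. (real n * bessel_coeff n) * w ^ n)" for w using fs by (rule sums_summable)
  have fl: "bessel_flux w = w * (\<Sum>n. diffs bessel_coeff n * w ^ n)" for w
    unfolding bessel_flux_def using sums_unique[OF fs] by (rule sym)
  show "(bessel_series has_real_derivative bessel_flux w / w) (at w)" if "w \<noteq> 0"
  proof -
    have "(bessel_series has_real_derivative (\<Sum>n. diffs bessel_coeff n * w ^ n)) (at w)"
      using termdiffs_strong_converges_everywhere[OF summable_bessel, of w]
      unfolding bessel_series_def [abs_def] .
    thus ?thesis using that by (simp add: fl)
  qed
  have "diffs (\<lambda>n. real n * bessel_coeff n) = (\<lambda>n. - bessel_coeff n)"
    using bessel_coeff_Suc by (simp add: fun_eq_iff diffs_def power2_eq_square mult.assoc del: of_nat_Suc)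
  moreover have "(\<Sum>n. - bessel_coeff n * w ^ n) = - bessel_series w"
    using suminf_minus[OF summable_bessel] by (simp add: bessel_series_def)
  ultimately show "(bessel_flux has_real_derivative - bessel_series w) (at w)"
    using termdiffs_strong_converges_everywhere[OF s, of w]
    unfolding bessel_flux_def [abs_def] by (simp only:)
qed

text \<open>
  The decay \<open>J\<^sub>0(y) = O(y\<^sup>-\<^sup>1\<^sup>/\<^sup>2)\<close> comes from an energy of Bessel's equation for
  \<open>g(y) = y\<^sup>1\<^sup>/\<^sup>2 J\<^sub>0(y)\<close>, namely \<open>g'\<^sup>2 + (1 + 1/(4y\<^sup>2)) g\<^sup>2\<close>, which is nonincreasing.
\<close>
lemma bessel_decay: "\<exists>C\<ge>0. \<forall>y. \<bar>y\<bar> \<ge> 1 \<longrightarrow> \<bar>bessel_series (y\<^sup>2 / 4)\<bar> \<le> C / sqrt \<bar>y\<bar>"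
proof -
  define J where "J = (\<lambda>y. bessel_series (y\<^sup>2 / 4))"
  define P where "P = (\<lambda>y. bessel_flux (y\<^sup>2 / 4))"
  \<comment> \<open>The energy multiplied out. For g = sqrt(y) J and J' = 2 P / y all square roots
    cancel, and the two terms J^2 / (4 y) from g'^2 and from the potential add up to the last
    summand.\<close>
  define E where "E = (\<lambda>y. 4 * (P y)\<^sup>2 / y + y * (J y)\<^sup>2 + 2 * P y * J y / y + (J y)\<^sup>2 / (2 * y))"
  have J': "(J has_real_derivative 2 * P y / y) (at y)" if "y > 0" for y
  proof -
    have "(J has_real_derivative (bessel_flux (y\<^sup>2 / 4) / (y\<^sup>2 / 4)) * (y / 2)) (at y)"
      unfolding J_def
      by (rule DERIV_chain2[OF bessel_series_deriv]) (use that in \<open>auto intro!: derivative_eq_intros\<close>)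
    moreover have "(bessel_flux (y\<^sup>2 / 4) / (y\<^sup>2 / 4)) * (y / 2) = 2 * P y / y"
      using that by (simp add: P_def power2_eq_square field_simps)
    ultimately show ?thesis by (simp only:)
  qed
  have P': "(P has_real_derivative - (J y * y / 2)) (at y)" for y
  proof -
    have "(P has_real_derivative (- bessel_series (y\<^sup>2 / 4)) * (y / 2)) (at y)"
      unfolding P_def by (rule DERIV_chain2[OF bessel_flux_deriv]) (auto intro!: derivative_eq_intros)
    moreover have "(- bessel_series (y\<^sup>2 / 4)) * (y / 2) = - (J y * y / 2)" by (simp add: J_def)
    ultimately show ?thesis by (simp only:)
  qed
  have E': "(E has_real_derivative - ((J y)\<^sup>2 / (2 * y\<^sup>2))) (at y)" if y: "y > 0" for y
  proof -
    have y0: "y \<noteq> 0" "2 * y \<noteq> 0" using y by auto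
    show ?thesis unfolding E_def
      by (rule J'[OF y] P' derivative_eq_intros refl y0)+
         (use y in \<open>simp add: power2_eq_square field_simps\<close>)
  qed
  have mono: "E y \<le> E 1" if "y \<ge> 1" for y
  proof (rule DERIV_nonpos_imp_nonincreasing[OF that])
    fix x :: real assume "1 \<le> x" "x \<le> y"
    thus "\<exists>d. (E has_real_derivative d) (at x) \<and> d \<le> 0" using E'[of x] by (intro exI conjI) auto
  qed
  have low: "y * (J y)\<^sup>2 \<le> E y" if "y > 0" for y
  proof -
    \<comment> \<open>Completing the square in \<open>P\<close> shows that the remaining terms of
      the energy are nonnegative.\<close>
    have "E y - y * (J y)\<^sup>2 = ((2 * P y + J y / 2)\<^sup>2 + (J y)\<^sup>2 / 4) / y"
      using that by (simp add: E_def power2_eq_square field_simps)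
    also have "\<dots> \<ge> 0" using that by simp
    finally show ?thesis by simp
  qed
  have main: "\<bar>J y\<bar> \<le> sqrt (E 1) / sqrt y" if "y \<ge> 1" for y
  proof -
    have "y * (J y)\<^sup>2 \<le> E 1" using low[of y] mono[OF that] that by linarith
    hence "(J y)\<^sup>2 \<le> E 1 / y" using that by (simp add: field_simps)
    hence "sqrt ((J y)\<^sup>2) \<le> sqrt (E 1 / y)" by (rule real_sqrt_le_mono)
    thus ?thesis by (simp add: real_sqrt_divide)
  qed
  have "E 1 \<ge> 0" using low[of 1] zero_le_power2[of "J 1"] by linarith
  moreover have "\<bar>bessel_series (y\<^sup>2 / 4)\<bar> \<le> sqrt (E 1) / sqrt \<bar>y\<bar>" if "\<bar>y\<bar> \<ge> 1" for y
    using main[OF that] by (simp add: J_def)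
  ultimately show ?thesis by (intro exI[of _ "sqrt (E 1)"]) auto
qed

section \<open>Means of products of oscillations\<close>

lemma uniform_limit_exp_partial_sums:
  fixes \<alpha> :: complex and z :: "real \<Rightarrow> complex"
  assumes z: "\<And>t. norm (z t) = 1"
  shows "uniform_limit UNIV (\<lambda>N t. \<Sum>m<N. \<alpha> ^ m / fact m * z t ^ m) (\<lambda>t. exp (\<alpha> * z t)) sequentially"
proof -
  have "uniform_limit UNIV (\<lambda>N t. \<Sum>m<N. (\<alpha> * z t) ^ m /\<^sub>R fact m) (\<lambda>t. \<Sum>m. (\<alpha> * z t) ^ m /\<^sub>R fact m) sequentially"
  proof (rule Weierstrass_m_test)
    show "summable (\<lambda>m. norm \<alpha> ^ m /\<^sub>R fact m)" by (rule summable_exp_generic)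
    show "norm ((\<alpha> * z t) ^ m /\<^sub>R fact m) \<le> norm \<alpha> ^ m /\<^sub>R fact m" for m t
      by (simp add: norm_power norm_mult z)
  qed
  moreover have "(\<Sum>m. (\<alpha> * z t) ^ m /\<^sub>R fact m) = exp (\<alpha> * z t)" for t by (simp add: exp_def)
  moreover have "(\<alpha> * z t) ^ m /\<^sub>R fact m = \<alpha> ^ m / fact m * z t ^ m" for m t
    by (simp add: power_mult_distrib scaleR_conv_of_real divide_inverse mult_ac)
  ultimately show ?thesis by (simp only:)
qed

text \<open>\<open>osc \<gamma> t\<close> is half the sum of a rotating vector and its conjugate, so
  exp (i x osc) is a product of two exponential series in the rotation and its inverse. The pair
  holds the two exponents; the frequency is their difference.\<close>

definition wave_coeff :: "real \<Rightarrow> real \<Rightarrow> nat \<times> nat \<Rightarrow> complex" where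
  "wave_coeff x \<gamma> q = (\<i> * of_real x * amp \<gamma> / 2) ^ fst q / fact (fst q) * ((\<i> * of_real x * cnj (amp \<gamma>) / 2) ^ snd q / fact (snd q))"

definition wave_freq :: "nat \<times> nat \<Rightarrow> int" where
  "wave_freq q = int (fst q) - int (snd q)"

lemma exp_osc_uniform_limit:
  "uniform_limit UNIV (\<lambda>N t. \<Sum>q\<in>{..<N} \<times> {..<N}. wave_coeff x \<gamma> q * exp (\<i> * of_real (of_int (wave_freq q) * \<gamma> * t)))
     (\<lambda>t. exp (\<i> * of_real (x * osc \<gamma> t))) sequentially"
proof -
  define \<alpha> where "\<alpha> = \<i> * of_real x * amp \<gamma> / 2"
  define \<beta> where "\<beta> = \<i> * of_real x * cnj (amp \<gamma>) / 2"
  define z where "z = (\<lambda>t. exp (\<i> * of_real (\<gamma> * t)))"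
  define z' where "z' = (\<lambda>t. exp (\<i> * of_real (- (\<gamma> * t))))"
  have zn: "norm (z t) = 1" "norm (z' t) = 1" for t unfolding z_def z'_def by (rule norm_exp_i_times)+
  have bdd: "bounded (range (\<lambda>t. exp (c * w t)))" if "\<And>t. norm (w t) = 1" for c :: complex and w :: "real \<Rightarrow> complex"
  proof (rule boundedI)
    fix y assume "y \<in> range (\<lambda>t. exp (c * w t))"
    then obtain t where "y = exp (c * w t)" by blast
    thus "norm y \<le> exp (norm c)" using norm_exp[of "c * w t"] that by (simp add: norm_mult)
  qed
  have "uniform_limit UNIV (\<lambda>N t. (\<Sum>m<N. \<alpha> ^ m / fact m * z t ^ m) * (\<Sum>n<N. \<beta> ^ n / fact n * z' t ^ n))
     (\<lambda>t. exp (\<alpha> * z t) * exp (\<beta> * z' t)) sequentially"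
    by (rule uniform_lim_mult[OF uniform_limit_exp_partial_sums[OF zn(1)] uniform_limit_exp_partial_sums[OF zn(2)]
          bdd[OF zn(1)] bdd[OF zn(2)]])
  moreover have "exp (\<alpha> * z t) * exp (\<beta> * z' t) = exp (\<i> * of_real (x * osc \<gamma> t))" for t
  proof -
    have "z' t = cnj (z t)" unfolding z'_def z_def by (simp add: exp_cnj)
    hence "\<alpha> * z t + \<beta> * z' t = \<i> * of_real x * ((amp \<gamma> * z t + cnj (amp \<gamma> * z t)) / 2)"
      by (simp add: \<alpha>_def \<beta>_def field_simps)
    also have "(amp \<gamma> * z t + cnj (amp \<gamma> * z t)) / 2 = of_real (osc \<gamma> t)"
      unfolding complex_add_cnj osc_def z_def by simp
    finally show ?thesis by (simp add: mult.assoc flip: exp_add)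
  qed
  moreover have "(\<Sum>m<N. \<alpha> ^ m / fact m * z t ^ m) * (\<Sum>n<N. \<beta> ^ n / fact n * z' t ^ n) =
     (\<Sum>q\<in>{..<N} \<times> {..<N}. wave_coeff x \<gamma> q * exp (\<i> * of_real (of_int (wave_freq q) * \<gamma> * t)))" for N t
  proof -
    have e: "z t ^ m * z' t ^ n = exp (\<i> * of_real (of_int (wave_freq (m, n)) * \<gamma> * t))" for m n
    proof -
      have "z t ^ m = exp (of_nat m * (\<i> * of_real (\<gamma> * t)))" "z' t ^ n = exp (of_nat n * (\<i> * of_real (- (\<gamma> * t))))"
        unfolding z_def z'_def by (simp_all only: exp_of_nat_mult)
      hence "z t ^ m * z' t ^ n = exp (of_nat m * (\<i> * of_real (\<gamma> * t)) + of_nat n * (\<i> * of_real (- (\<gamma> * t))))"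
        by (simp only: exp_add)
      also have "of_nat m * (\<i> * of_real (\<gamma> * t)) + of_nat n * (\<i> * of_real (- (\<gamma> * t))) = \<i> * of_real (of_int (wave_freq (m, n)) * \<gamma> * t)"
        by (simp add: wave_freq_def algebra_simps)
      finally show ?thesis .
    qed
    have c: "(\<alpha> ^ m / fact m * z t ^ m) * (\<beta> ^ n / fact n * z' t ^ n) =
       wave_coeff x \<gamma> (m, n) * exp (\<i> * of_real (of_int (wave_freq (m, n)) * \<gamma> * t))" for m n
    proof -
      have "(\<alpha> ^ m / fact m * z t ^ m) * (\<beta> ^ n / fact n * z' t ^ n) = (\<alpha> ^ m / fact m * (\<beta> ^ n / fact n)) * (z t ^ m * z' t ^ n)"
        by (simp only: mult_ac)
      thus ?thesis unfolding e wave_coeff_def \<alpha>_def \<beta>_def by (simp only: fst_conv snd_conv)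
    qed
    show ?thesis unfolding sum_product c sum.cartesian_product by (rule sum.cong) auto
  qed
  ultimately show ?thesis by (simp only:)
qed

text \<open>Only the pairs with equal exponents have frequency 0. Their coefficients are (- w)^m /
  (m!)^2 with w = (x |amp \<gamma>|)^2 / 4, which is the Bessel series.\<close>

lemma wave_mean:
  "(\<lambda>N. \<Sum>q\<in>{..<N} \<times> {..<N}. if wave_freq q = 0 then wave_coeff x \<gamma> q else 0)
     \<longlonglongrightarrow> of_real (bessel_series ((x * norm (amp \<gamma>))\<^sup>2 / 4))"
proof -
  define w where "w = (x * norm (amp \<gamma>))\<^sup>2 / 4"
  have ww: "(\<i> * of_real x * amp \<gamma> / 2) * (\<i> * of_real x * cnj (amp \<gamma>) / 2) = of_real (- w)"
  proof -
    have "(\<i> * of_real x * amp \<gamma> / 2) * (\<i> * of_real x * cnj (amp \<gamma>) / 2) = - ((of_real x)\<^sup>2 * (amp \<gamma> * cnj (amp \<gamma>)) / 4)"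
    proof -
      have "\<i> * X * a * (\<i> * X * b) = (\<i> * \<i>) * (X * X * (a * b))" for X a b by (simp only: mult_ac)
      hence "(\<i> * X * a / 2) * (\<i> * X * b / 2) = - (X\<^sup>2 * (a * b) / 4)" for X a b
        unfolding times_divide_times_eq by (simp add: power2_eq_square)
      thus ?thesis .
    qed
    also have "amp \<gamma> * cnj (amp \<gamma>) = of_real ((norm (amp \<gamma>))\<^sup>2)" using complex_norm_square[of "amp \<gamma>"] by simp
    finally show ?thesis by (simp add: w_def power_mult_distrib)
  qed
  have diag: "wave_coeff x \<gamma> (m, m) = of_real (bessel_coeff m * w ^ m)" for m
  proof -
    have "wave_coeff x \<gamma> (m, m) = ((\<i> * of_real x * amp \<gamma> / 2) * (\<i> * of_real x * cnj (amp \<gamma>) / 2)) ^ m / (fact m)\<^sup>2"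
      unfolding wave_coeff_def power_mult_distrib by (simp add: power2_eq_square)
    also have "\<dots> = of_real ((- w) ^ m / (fact m)\<^sup>2)" unfolding ww by simp
    also have "(- w) ^ m / (fact m)\<^sup>2 = bessel_coeff m * w ^ m" unfolding bessel_coeff_def power_minus[of w] by simp
    finally show ?thesis .
  qed
  have "(\<Sum>q\<in>{..<N} \<times> {..<N}. if wave_freq q = 0 then wave_coeff x \<gamma> q else 0) =
     (\<Sum>m<N. \<Sum>n<N. if m = n then wave_coeff x \<gamma> (m, n) else 0)" for N
    unfolding sum.cartesian_product by (rule sum.cong) (auto simp: wave_freq_def)
  also have "(\<Sum>m<N. \<Sum>n<N. if m = n then wave_coeff x \<gamma> (m, n) else 0) = of_real (\<Sum>m<N. bessel_coeff m * w ^ m)" for N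
    unfolding of_real_sum by (intro sum.cong refl) (simp add: diag)
  finally have eq: "(\<Sum>q\<in>{..<N} \<times> {..<N}. if wave_freq q = 0 then wave_coeff x \<gamma> q else 0) =
     of_real (\<Sum>m<N. bessel_coeff m * w ^ m)" for N .
  have "(\<lambda>N. \<Sum>m<N. bessel_coeff m * w ^ m) \<longlonglongrightarrow> bessel_series w"
    using summable_LIMSEQ[OF summable_bessel] by (simp add: bessel_series_def)
  hence "(\<lambda>N. complex_of_real (\<Sum>m<N. bessel_coeff m * w ^ m)) \<longlonglongrightarrow> of_real (bessel_series w)"
    by (rule tendsto_of_real)
  thus ?thesis unfolding eq w_def .
qed

text \<open>
  In the induction step one factor is replaced by its trigonometric approximations; their
  frequencies are absorbed into the integer combination \<open>k\<close>.
\<close>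
lemma has_mean_prod:
  fixes f :: "real \<Rightarrow> real \<Rightarrow> complex" and c :: "real \<Rightarrow> 'q \<Rightarrow> complex" and j :: "'q \<Rightarrow> int" and Q :: "nat \<Rightarrow> 'q set"
  assumes indep: "\<And>B k. finite B \<Longrightarrow> B \<subseteq> S \<Longrightarrow> (\<Sum>\<gamma>\<in>B. of_int (k \<gamma>) * \<gamma>) = (0::real) \<Longrightarrow> \<forall>\<gamma>\<in>B. k \<gamma> = (0::int)"
    and finQ: "\<And>N. finite (Q N)"
    and f: "\<And>\<gamma> t. norm (f \<gamma> t) = 1" "\<And>\<gamma>. continuous_on UNIV (f \<gamma>)"
    and ul: "\<And>\<gamma>. uniform_limit UNIV (\<lambda>N t. \<Sum>q\<in>Q N. c \<gamma> q * exp (\<i> * of_real (of_int (j q) * \<gamma> * t))) (f \<gamma>) sequentially"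
    and lim: "\<And>\<gamma>. (\<lambda>N. \<Sum>q\<in>Q N. if j q = 0 then c \<gamma> q else 0) \<longlonglongrightarrow> m \<gamma>"
    and A: "finite A"
  shows "A \<subseteq> S \<Longrightarrow> finite B \<Longrightarrow> B \<subseteq> S \<Longrightarrow> A \<inter> B = {} \<Longrightarrow>
     has_mean (\<lambda>t. exp (\<i> * of_real ((\<Sum>\<gamma>\<in>B. of_int (k \<gamma>) * \<gamma>) * t)) * (\<Prod>\<gamma>\<in>A. f \<gamma> t))
       (if \<forall>\<gamma>\<in>B. k \<gamma> = 0 then \<Prod>\<gamma>\<in>A. m \<gamma> else 0)"
  using A
proof (induction A arbitrary: B k rule: finite_induct)
  case empty
  show ?case
  proof (cases "\<forall>\<gamma>\<in>B. k \<gamma> = 0")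
    case True
    hence "(\<Sum>\<gamma>\<in>B. of_int (k \<gamma>) * \<gamma>) = 0" by (intro sum.neutral) auto
    thus ?thesis using True has_mean_const[of 1] by simp
  next
    case False
    hence "(\<Sum>\<gamma>\<in>B. of_int (k \<gamma>) * \<gamma>) \<noteq> 0" using indep empty by blast
    from has_mean_exp[OF this] show ?thesis unfolding if_not_P[OF False] by (simp only: prod.empty mult_1_right)
  qed
next
  case (insert \<gamma>0 A)
  define g where "g = (\<lambda>t. exp (\<i> * of_real ((\<Sum>\<gamma>\<in>B. of_int (k \<gamma>) * \<gamma>) * t)) * (\<Prod>\<gamma>\<in>A. f \<gamma> t))"
  define p where "p = (\<lambda>N t. \<Sum>q\<in>Q N. c \<gamma>0 q * exp (\<i> * of_real (of_int (j q) * \<gamma>0 * t)))"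
  have gc: "continuous_on UNIV g" unfolding g_def by (intro continuous_intros f(2))
  have gn: "norm (g t) = 1" for t
    unfolding g_def norm_mult norm_exp_i_times prod_norm [symmetric] f(1) by simp
  have pc: "continuous_on UNIV (p N)" for N unfolding p_def by (intro continuous_intros)
  have ulg: "uniform_limit UNIV (\<lambda>N t. p N t * g t) (\<lambda>t. f \<gamma>0 t * g t) sequentially"
  proof (rule uniform_limitI)
    fix e :: real assume "e > 0"
    from uniform_limitD[OF ul[of \<gamma>0] this]
    show "\<forall>\<^sub>F N in sequentially. \<forall>t\<in>UNIV. dist (p N t * g t) (f \<gamma>0 t * g t) < e"
    proof eventually_elim
      case (elim N)
      have "dist (p N t * g t) (f \<gamma>0 t * g t) = dist (p N t) (f \<gamma>0 t)" for t
        unfolding dist_norm left_diff_distrib [symmetric] norm_mult gn by simp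
      thus ?case using elim by (simp add: p_def)
    qed
  qed
  have fresh: "\<gamma>0 \<notin> B" "A \<inter> insert \<gamma>0 B = {}" "A \<subseteq> S" "insert \<gamma>0 B \<subseteq> S" "finite (insert \<gamma>0 B)"
    using insert by auto
  define P where "P = (\<forall>\<gamma>\<in>B. k \<gamma> = 0)"
  have mean_q: "has_mean (\<lambda>t. exp (\<i> * of_real (of_int (j q) * \<gamma>0 * t)) * g t)
      (if j q = 0 \<and> P then \<Prod>\<gamma>\<in>A. m \<gamma> else 0)" for q
  proof -
    \<comment> \<open>\<open>\<gamma>0\<close> enters \<open>B\<close> with coefficient
      \<open>j q\<close>. As it is new there, the extended combination is trivial exactly if the old
      one is and \<open>j q = 0\<close>.\<close>
    define k' where "k' = k(\<gamma>0 := j q)"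
    have "(\<Sum>\<gamma>\<in>insert \<gamma>0 B. of_int (k' \<gamma>) * \<gamma>) = of_int (j q) * \<gamma>0 + (\<Sum>\<gamma>\<in>B. of_int (k' \<gamma>) * \<gamma>)"
      using fresh insert by (simp add: k'_def)
    also have "(\<Sum>\<gamma>\<in>B. of_int (k' \<gamma>) * \<gamma>) = (\<Sum>\<gamma>\<in>B. of_int (k \<gamma>) * \<gamma>)"
      using fresh(1) by (intro sum.cong) (auto simp: k'_def)
    finally have s: "(\<Sum>\<gamma>\<in>insert \<gamma>0 B. of_int (k' \<gamma>) * \<gamma>) = of_int (j q) * \<gamma>0 + (\<Sum>\<gamma>\<in>B. of_int (k \<gamma>) * \<gamma>)" .
    have z: "(\<forall>\<gamma>\<in>insert \<gamma>0 B. k' \<gamma> = 0) \<longleftrightarrow> j q = 0 \<and> P"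
      using fresh(1) unfolding P_def k'_def by auto
    have "exp (\<i> * of_real ((of_int (j q) * \<gamma>0 + b) * t)) = exp (\<i> * of_real (of_int (j q) * \<gamma>0 * t)) * exp (\<i> * of_real (b * t))" for b t
      by (simp add: distrib_right distrib_left flip: exp_add)
    moreover have "has_mean (\<lambda>t. exp (\<i> * of_real ((\<Sum>\<gamma>\<in>insert \<gamma>0 B. of_int (k' \<gamma>) * \<gamma>) * t)) * (\<Prod>\<gamma>\<in>A. f \<gamma> t))
       (if \<forall>\<gamma>\<in>insert \<gamma>0 B. k' \<gamma> = 0 then \<Prod>\<gamma>\<in>A. m \<gamma> else 0)"
      by (rule insert.IH[OF fresh(3,5,4,2)])
    ultimately show ?thesis unfolding s z g_def by (simp only: mult.assoc)
  qed
  have mean_p: "has_mean (\<lambda>t. p N t * g t) (\<Sum>q\<in>Q N. c \<gamma>0 q * (if j q = 0 \<and> P then \<Prod>\<gamma>\<in>A. m \<gamma> else 0))" for N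
  proof -
    have "has_mean (\<lambda>t. \<Sum>q\<in>Q N. c \<gamma>0 q * (exp (\<i> * of_real (of_int (j q) * \<gamma>0 * t)) * g t))
       (\<Sum>q\<in>Q N. c \<gamma>0 q * (if j q = 0 \<and> P then \<Prod>\<gamma>\<in>A. m \<gamma> else 0))"
      by (intro has_mean_sum finQ has_mean_cmult mean_q continuous_intros gc)
    moreover have "(\<Sum>q\<in>Q N. c \<gamma>0 q * (exp (\<i> * of_real (of_int (j q) * \<gamma>0 * t)) * g t)) = p N t * g t" for t
      unfolding p_def sum_distrib_right mult.assoc ..
    ultimately show ?thesis by (simp only:)
  qed
  have "(\<lambda>N. (\<Sum>q\<in>Q N. if j q = 0 then c \<gamma>0 q else 0) * (if P then \<Prod>\<gamma>\<in>A. m \<gamma> else 0))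
      \<longlonglongrightarrow> m \<gamma>0 * (if P then \<Prod>\<gamma>\<in>A. m \<gamma> else 0)"
    by (rule tendsto_mult_right[OF lim])
  also have "(\<lambda>N. (\<Sum>q\<in>Q N. if j q = 0 then c \<gamma>0 q else 0) * (if P then \<Prod>\<gamma>\<in>A. m \<gamma> else 0)) =
     (\<lambda>N. \<Sum>q\<in>Q N. c \<gamma>0 q * (if j q = 0 \<and> P then \<Prod>\<gamma>\<in>A. m \<gamma> else 0))"
    unfolding sum_distrib_right by (intro ext sum.cong) auto
  finally have l: "(\<lambda>N. \<Sum>q\<in>Q N. c \<gamma>0 q * (if j q = 0 \<and> P then \<Prod>\<gamma>\<in>A. m \<gamma> else 0))
      \<longlonglongrightarrow> m \<gamma>0 * (if P then \<Prod>\<gamma>\<in>A. m \<gamma> else 0)" .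
  have pgc: "continuous_on UNIV (\<lambda>t. p N t * g t)" for N by (intro continuous_on_mult pc gc)
  have "has_mean (\<lambda>t. f \<gamma>0 t * g t) (m \<gamma>0 * (if P then \<Prod>\<gamma>\<in>A. m \<gamma> else 0))"
    by (rule has_mean_uniform_limit[OF ulg sequentially_bot pgc mean_p l])
  moreover have "f \<gamma>0 t * g t = exp (\<i> * of_real ((\<Sum>\<gamma>\<in>B. of_int (k \<gamma>) * \<gamma>) * t)) * (\<Prod>\<gamma>\<in>insert \<gamma>0 A. f \<gamma> t)" for t
    unfolding g_def prod.insert[OF insert.hyps(1,2)] by (simp only: mult_ac)
  moreover have "m \<gamma>0 * (if P then \<Prod>\<gamma>\<in>A. m \<gamma> else 0) = (if \<forall>\<gamma>\<in>B. k \<gamma> = 0 then \<Prod>\<gamma>\<in>insert \<gamma>0 A. m \<gamma> else 0)"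
    using insert.hyps by (simp add: P_def)
  ultimately show ?case by (simp only:)
qed

lemma ordinates_independent:
  fixes k :: "real \<Rightarrow> int"
  assumes RH: "riemann_hypothesis" and LI: "linear_independence_hypothesis"
    and B: "finite B" "B \<subseteq> ordinates" and s: "(\<Sum>\<gamma>\<in>B. of_int (k \<gamma>) * \<gamma>) = 0"
  shows "\<forall>\<gamma>\<in>B. k \<gamma> = 0"
proof -
  interpret V: vector_space "\<lambda>(q::rat) (x::real). of_rat q * x" by (rule vector_space_rat_real)
  have "ordinates = {\<gamma>. \<gamma> > 0 \<and> (\<exists>\<rho>\<in>nontrivial_zeros. Im \<rho> = \<gamma>)}"
    unfolding nontrivial_zeros_RH[OF RH]
  proof (intro equalityI subsetI)
    fix \<gamma> assume g: "\<gamma> \<in> ordinates"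
    hence "1/2 + \<i> * of_real \<gamma> \<in> (\<lambda>\<gamma>. 1/2 + \<i> * of_real \<gamma>) ` ordinates" "Im (1/2 + \<i> * of_real \<gamma>) = \<gamma>" by auto
    moreover have "\<gamma> > 0" using g by (simp add: ordinates_def)
    ultimately show "\<gamma> \<in> {\<gamma>. \<gamma> > 0 \<and> (\<exists>\<rho>\<in>(\<lambda>\<gamma>. 1/2 + \<i> * of_real \<gamma>) ` ordinates \<union> (\<lambda>\<gamma>. 1/2 - \<i> * of_real \<gamma>) ` ordinates. Im \<rho> = \<gamma>)}"
      by blast
  qed (auto simp: ordinates_def)
  hence ind: "V.independent ordinates"
    using LI unfolding linear_independence_hypothesis_def by simp
  have "(of_int (k \<gamma>) :: rat) = 0" if "\<gamma> \<in> B" for \<gamma>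
    by (rule V.independentD[OF ind B(1,2) _ that, where u = "\<lambda>\<gamma>. of_int (k \<gamma>)"]) (use s in simp)
  thus ?thesis by simp
qed

lemma norm_exp_i_diff_le: "norm (exp (\<i> * of_real a) - exp (\<i> * of_real b)) \<le> \<bar>a - b\<bar>"
proof -
  have "exp (\<i> * of_real a) - exp (\<i> * of_real b) = exp (\<i> * of_real b) * (exp (\<i> * of_real (a - b)) - 1)"
    by (simp add: algebra_simps flip: exp_add)
  hence "norm (exp (\<i> * of_real a) - exp (\<i> * of_real b)) = norm (exp (\<i> * of_real (a - b)) - 1)"
    by (simp only: norm_mult norm_exp_i_times mult_1)
  also have "\<dots> \<le> \<bar>a - b\<bar>" using iexp_approx1[of "a - b" 0] by simp
  finally show ?thesis .
qed

lemma osc_continuous: "continuous_on A (osc \<gamma>)"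
  unfolding osc_def by (intro continuous_intros)

lemma amp_nonzero: "\<gamma> \<in> ordinates \<Longrightarrow> amp \<gamma> \<noteq> 0"
proof -
  assume "\<gamma> \<in> ordinates"
  moreover have "1/2 + \<i> * of_real \<gamma> \<noteq> 0" "1/2 + \<i> * of_real \<gamma> + 1 \<noteq> 0" by (auto simp: complex_eq_iff)
  ultimately show ?thesis using zero_mult_pos[of \<gamma>] unfolding amp_def by simp
qed

text \<open>Each Bessel factor is itself the mean of a unimodular function and hence at most 1 in
  absolute value, so the limit of the finite products is bounded by any finite subproduct.\<close>

lemma characteristic_mean:
  assumes RH: "riemann_hypothesis" and LI: "linear_independence_hypothesis"
  shows "\<exists>\<psi> C. \<forall>x. has_mean (\<lambda>t. exp (\<i> * of_real (x * H (exp t)))) (\<psi> x) \<and> (1 + x\<^sup>2) * norm (\<psi> x) \<le> C"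
proof -
  define J where "J = (\<lambda>x \<gamma>. bessel_series ((x * norm (amp \<gamma>))\<^sup>2 / 4))"
  define f where "f = (\<lambda>x \<gamma> t. exp (\<i> * of_real (x * osc \<gamma> t)) :: complex)"
  have fc: "continuous_on UNIV (f x \<gamma>)" for x \<gamma> unfolding f_def by (intro continuous_intros osc_continuous)
  have fn: "norm (f x \<gamma> t) = 1" for x \<gamma> t unfolding f_def by (rule norm_exp_i_times)
  have prod: "has_mean (\<lambda>t. \<Prod>\<gamma>\<in>A. f x \<gamma> t) (\<Prod>\<gamma>\<in>A. of_real (J x \<gamma>))" if A: "finite A" "A \<subseteq> ordinates" for x A
  proof -
    have "has_mean (\<lambda>t. exp (\<i> * of_real ((\<Sum>\<gamma>\<in>{}. of_int ((\<lambda>_. 0) \<gamma>) * \<gamma>) * t)) * (\<Prod>\<gamma>\<in>A. f x \<gamma> t))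
       (if \<forall>\<gamma>\<in>{}. (\<lambda>_::real. 0::int) \<gamma> = 0 then \<Prod>\<gamma>\<in>A. of_real (J x \<gamma>) else 0)"
    proof (rule has_mean_prod[where S = ordinates and Q = "\<lambda>N. {..<N} \<times> {..<N}" and c = "wave_coeff x" and j = wave_freq])
      show "\<forall>\<gamma>\<in>B. k \<gamma> = 0" if "finite B" "B \<subseteq> ordinates" "(\<Sum>\<gamma>\<in>B. of_int (k \<gamma>) * \<gamma>) = 0" for B k
        by (rule ordinates_independent[OF RH LI that])
      show "uniform_limit UNIV (\<lambda>N t. \<Sum>q\<in>{..<N} \<times> {..<N}. wave_coeff x \<gamma> q * exp (\<i> * of_real (of_int (wave_freq q) * \<gamma> * t))) (f x \<gamma>) sequentially" for \<gamma>
        unfolding f_def by (rule exp_osc_uniform_limit)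
      show "(\<lambda>N. \<Sum>q\<in>{..<N} \<times> {..<N}. if wave_freq q = 0 then wave_coeff x \<gamma> q else 0) \<longlonglongrightarrow> of_real (J x \<gamma>)" for \<gamma>
        unfolding J_def by (rule wave_mean)
    qed (use A fn fc in auto)
    thus ?thesis by simp
  qed
  have J1: "\<bar>J x \<gamma>\<bar> \<le> 1" if "\<gamma> \<in> ordinates" for x \<gamma>
  proof -
    have "has_mean (f x \<gamma>) (of_real (J x \<gamma>))" using prod[of "{\<gamma>}" x] that by simp
    from has_mean_norm_le[OF this fc, of 1] show ?thesis by (simp add: fn)
  qed
  have ul: "uniform_limit UNIV (\<lambda>A t. \<Prod>\<gamma>\<in>A. f x \<gamma> t) (\<lambda>t. exp (\<i> * of_real (x * H (exp t)))) (finite_subsets_at_top ordinates)" for x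
  proof (rule uniform_limitI)
    fix e :: real assume e: "e > 0"
    define e' where "e' = e / (\<bar>x\<bar> + 1)"
    have e': "e' > 0" "\<bar>x\<bar> * e' < e" using e by (auto simp: e'_def field_simps)
    have "\<forall>\<^sub>F A in finite_subsets_at_top ordinates. finite A" by (rule eventually_finite_subsets_at_top_weakI)
    with uniform_limitD[OF H_exp_uniform(1)[OF RH] e'(1)]
    show "\<forall>\<^sub>F A in finite_subsets_at_top ordinates. \<forall>t\<in>UNIV. dist (\<Prod>\<gamma>\<in>A. f x \<gamma> t) (exp (\<i> * of_real (x * H (exp t)))) < e"
    proof eventually_elim
      case (elim A)
      show ?case
      proof
        fix t :: real
        have "(\<Prod>\<gamma>\<in>A. f x \<gamma> t) = exp (\<i> * of_real (x * (\<Sum>\<gamma>\<in>A. osc \<gamma> t)))"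
          unfolding f_def using elim(2) by (simp add: exp_sum sum_distrib_left)
        hence "dist (\<Prod>\<gamma>\<in>A. f x \<gamma> t) (exp (\<i> * of_real (x * H (exp t)))) \<le> \<bar>x * (\<Sum>\<gamma>\<in>A. osc \<gamma> t) - x * H (exp t)\<bar>"
          using norm_exp_i_diff_le by (simp only: dist_norm)
        also have "\<dots> = \<bar>x\<bar> * dist (\<Sum>\<gamma>\<in>A. osc \<gamma> t) (H (exp t))"
          by (simp add: dist_real_def abs_mult flip: right_diff_distrib)
        also have "\<dots> \<le> \<bar>x\<bar> * e'" using elim(1) by (intro mult_left_mono) (auto intro: less_imp_le)
        also note e'(2)
        finally show "dist (\<Prod>\<gamma>\<in>A. f x \<gamma> t) (exp (\<i> * of_real (x * H (exp t)))) < e" .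
      qed
    qed
  qed
  \<comment> \<open>The infinite product converges along finite subsets because the corresponding
    means do.\<close>
  have "\<exists>M. ((\<lambda>A. \<Prod>\<gamma>\<in>A. complex_of_real (J x \<gamma>)) \<longlongrightarrow> M) (finite_subsets_at_top ordinates) \<and>
      has_mean (\<lambda>t. exp (\<i> * of_real (x * H (exp t)))) M" for x
    by (rule has_mean_uniform_limit_ex[OF ul finite_subsets_at_top_neq_bot])
       (rule eventually_finite_subsets_at_top_weakI, use prod in \<open>auto intro!: continuous_on_prod fc\<close>)
  then obtain \<psi> where \<psi>: "\<And>x. ((\<lambda>A. \<Prod>\<gamma>\<in>A. complex_of_real (J x \<gamma>)) \<longlongrightarrow> \<psi> x) (finite_subsets_at_top ordinates)"
    "\<And>x. has_mean (\<lambda>t. exp (\<i> * of_real (x * H (exp t)))) (\<psi> x)" by metis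
  \<comment> \<open>Four factors of size |x|^(-1/2) give |x|^(-2), enough for an integrable
    characteristic function.\<close>
  obtain A where A: "finite A" "card A = 4" "A \<subseteq> ordinates"
    using infinite_arbitrarily_large[OF infinite_ordinates[OF RH], of 4] by blast
  have \<psi>A: "norm (\<psi> x) \<le> (\<Prod>\<gamma>\<in>A. \<bar>J x \<gamma>\<bar>)" for x
  proof (rule Lim_norm_ubound[OF finite_subsets_at_top_neq_bot \<psi>(1)])
    show "\<forall>\<^sub>F D in finite_subsets_at_top ordinates. norm (\<Prod>\<gamma>\<in>D. complex_of_real (J x \<gamma>)) \<le> (\<Prod>\<gamma>\<in>A. \<bar>J x \<gamma>\<bar>)"
      unfolding eventually_finite_subsets_at_top
    proof (intro exI[of _ A] conjI allI impI A(1,3))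
      fix D assume D: "finite D \<and> A \<subseteq> D \<and> D \<subseteq> ordinates"
      have "norm (\<Prod>\<gamma>\<in>D. complex_of_real (J x \<gamma>)) = (\<Prod>\<gamma>\<in>D. \<bar>J x \<gamma>\<bar>)" by (simp add: prod_norm [symmetric])
      also have "\<dots> = (\<Prod>\<gamma>\<in>D - A. \<bar>J x \<gamma>\<bar>) * (\<Prod>\<gamma>\<in>A. \<bar>J x \<gamma>\<bar>)"
        by (rule prod.subset_diff) (use D in auto)
      also have "\<dots> \<le> 1 * (\<Prod>\<gamma>\<in>A. \<bar>J x \<gamma>\<bar>)"
        by (intro mult_right_mono prod_le_1 prod_nonneg) (use D J1 in auto)
      finally show "norm (\<Prod>\<gamma>\<in>D. complex_of_real (J x \<gamma>)) \<le> (\<Prod>\<gamma>\<in>A. \<bar>J x \<gamma>\<bar>)" by simp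
    qed
  qed
  obtain C where C: "C \<ge> 0" "\<And>y. \<bar>y\<bar> \<ge> 1 \<Longrightarrow> \<bar>bessel_series (y\<^sup>2 / 4)\<bar> \<le> C / sqrt \<bar>y\<bar>"
    using bessel_decay by blast
  \<comment> \<open>The smallest of the four amplitudes: |x| r >= 1 brings all four Bessel arguments
    into the range of the decay estimate at once. For smaller \<open>x\<close> the trivial bound 1
    is used.\<close>
  define r where "r = Min ((\<lambda>\<gamma>. norm (amp \<gamma>)) ` A)"
  have Ane: "A \<noteq> {}" using A(2) by auto
  have r: "r > 0" unfolding r_def using A Ane amp_nonzero by (subst Min_gr_iff) auto
  have rA: "r \<le> norm (amp \<gamma>)" if "\<gamma> \<in> A" for \<gamma> unfolding r_def using A(1) that by (intro Min_le) auto
  have one: "norm (\<psi> x) \<le> 1" for x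
    by (rule order_trans[OF \<psi>A]) (use J1 A(3) in \<open>auto intro!: prod_le_1\<close>)
  have far: "x\<^sup>2 * norm (\<psi> x) \<le> C ^ 4 / r\<^sup>2" if x: "\<bar>x\<bar> * r \<ge> 1" for x
  proof -
    have xr: "\<bar>x\<bar> * r > 0" using x by linarith
    have "\<bar>J x \<gamma>\<bar> \<le> C / sqrt (\<bar>x\<bar> * r)" if "\<gamma> \<in> A" for \<gamma>
    proof -
      have m: "\<bar>x\<bar> * r \<le> \<bar>x * norm (amp \<gamma>)\<bar>"
        unfolding abs_mult using rA[OF that] r by (intro mult_mono) auto
      hence "\<bar>J x \<gamma>\<bar> \<le> C / sqrt \<bar>x * norm (amp \<gamma>)\<bar>" unfolding J_def using x by (intro C(2)) linarith
      also have "\<dots> \<le> C / sqrt (\<bar>x\<bar> * r)"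
        using m xr C(1) by (intro divide_left_mono mult_pos_pos real_sqrt_le_mono) (auto simp del: abs_mult)
      finally show ?thesis .
    qed
    hence "(\<Prod>\<gamma>\<in>A. \<bar>J x \<gamma>\<bar>) \<le> (\<Prod>\<gamma>\<in>A. C / sqrt (\<bar>x\<bar> * r))" by (intro prod_mono) auto
    also have "\<dots> = (C / sqrt (\<bar>x\<bar> * r)) ^ 4" using A(2) by simp
    also have "\<dots> = C ^ 4 / ((sqrt (\<bar>x\<bar> * r))\<^sup>2)\<^sup>2" by (simp add: power_divide flip: power_mult)
    also have "\<dots> = C ^ 4 / (x\<^sup>2 * r\<^sup>2)" using xr by (simp add: power_mult_distrib)
    finally have "norm (\<psi> x) \<le> C ^ 4 / (x\<^sup>2 * r\<^sup>2)" using \<psi>A[of x] by linarith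
    hence "x\<^sup>2 * norm (\<psi> x) \<le> x\<^sup>2 * (C ^ 4 / (x\<^sup>2 * r\<^sup>2))" by (rule mult_left_mono) simp
    also have "\<dots> = C ^ 4 / r\<^sup>2" using x by (cases "x = 0") auto
    finally show ?thesis .
  qed
  have near: "x\<^sup>2 * norm (\<psi> x) \<le> (1 / r)\<^sup>2" if "\<not> \<bar>x\<bar> * r \<ge> 1" for x
  proof -
    have "\<bar>x\<bar> \<le> 1 / r" using that r by (simp add: field_simps)
    hence "\<bar>x\<bar>\<^sup>2 \<le> (1 / r)\<^sup>2" by (rule power_mono) simp
    hence "x\<^sup>2 * norm (\<psi> x) \<le> (1 / r)\<^sup>2 * 1" using one[of x] by (intro mult_mono) auto
    thus ?thesis by simp
  qed
  have "(1 + x\<^sup>2) * norm (\<psi> x) \<le> 1 + (C ^ 4 / r\<^sup>2 + (1 / r)\<^sup>2)" for x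
  proof -
    have "x\<^sup>2 * norm (\<psi> x) \<le> C ^ 4 / r\<^sup>2 + (1 / r)\<^sup>2"
    proof (cases "\<bar>x\<bar> * r \<ge> 1")
      case True
      thus ?thesis using far[OF True] zero_le_power2[of "1 / r"] by linarith
    next
      case False
      moreover have "C ^ 4 / r\<^sup>2 \<ge> 0" by simp
      ultimately show ?thesis using near[OF False] by linarith
    qed
    thus ?thesis using one[of x] by (simp add: distrib_right)
  qed
  thus ?thesis using \<psi>(2) by blast
qed

section \<open>The limit distribution\<close>

lemma fourier_continuous:
  assumes \<phi>: "integrable lborel (\<phi> :: real \<Rightarrow> complex)"
  shows "continuous_on UNIV (\<lambda>u. LINT t|lborel. iexp (- (t * u)) * \<phi> t)"
  unfolding continuous_on_sequentially
proof (intro allI ballI impI)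
  fix x :: "nat \<Rightarrow> real" and a :: real
  assume "a \<in> UNIV" "(\<forall>n. x n \<in> UNIV) \<and> x \<longlonglongrightarrow> a"
  hence x: "x \<longlonglongrightarrow> a" by blast
  have [measurable]: "\<phi> \<in> borel_measurable borel" using borel_measurable_integrable[OF \<phi>] by simp
  show "((\<lambda>u. LINT t|lborel. iexp (- (t * u)) * \<phi> t) \<circ> x) \<longlonglongrightarrow> (LINT t|lborel. iexp (- (t * a)) * \<phi> t)"
    unfolding o_def
  proof (rule integral_dominated_convergence[where w = "\<lambda>t. norm (\<phi> t)"])
    show "integrable lborel (\<lambda>t. norm (\<phi> t))" using \<phi> by (rule integrable_norm)
    show "AE t in lborel. (\<lambda>n. iexp (- (t * x n)) * \<phi> t) \<longlonglongrightarrow> iexp (- (t * a)) * \<phi> t"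
      by (intro AE_I2 tendsto_intros x)
    show "AE t in lborel. norm (iexp (- (t * x n)) * \<phi> t) \<le> norm (\<phi> t)" for n
      unfolding norm_mult norm_exp_i_times by simp
  qed measurable
qed

lemma integral_iexp_interval:
  assumes "a \<le> b" "t \<noteq> 0"
  shows "(LINT u|lborel. indicator {a..b} u *\<^sub>R (iexp (- (t * u)) * c)) = (iexp (- (t * a)) - iexp (- (t * b))) / (\<i> * t) * c"
proof -
  define k where "k = - c / (\<i> * of_real t)"
  have k: "(- (\<i> * of_real t)) * k = c" using assms(2) by (simp add: k_def)
  define G where "G = (\<lambda>z. exp (- (\<i> * of_real t * z)) * k)"
  have "((\<lambda>u. G (of_real u)) has_vector_derivative iexp (- (t * u)) * c) (at u within {a..b})" for u
  proof (rule has_vector_derivative_real_field)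
    show "(G has_field_derivative iexp (- (t * u)) * c) (at (of_real u))"
    proof -
      have "(G has_field_derivative (exp (- (\<i> * of_real t * of_real u)) * (- (\<i> * of_real t))) * k) (at (of_real u))"
        unfolding G_def by (auto intro!: derivative_eq_intros)
      thus ?thesis unfolding mult.assoc[of "exp _"] k by (simp add: mult.assoc)
    qed
  qed
  hence "((\<lambda>u. iexp (- (t * u)) * c) has_integral (G (of_real b) - G (of_real a))) {a..b}"
    by (intro fundamental_theorem_of_calculus assms(1))
  hence "integral {a..b} (\<lambda>u. iexp (- (t * u)) * c) = G (of_real b) - G (of_real a)" by (rule integral_unique)
  moreover have "(LINT u:{a..b}|lborel. iexp (- (t * u)) * c) = integral {a..b} (\<lambda>u. iexp (- (t * u)) * c)"
    by (intro set_borel_integral_eq_integral borel_integrable_atLeastAtMost') (intro continuous_intros)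
  moreover have "G (of_real b) - G (of_real a) = (iexp (- (t * a)) - iexp (- (t * b))) / (\<i> * t) * c"
    unfolding G_def k_def using assms(2) by (simp add: field_simps)
  ultimately show ?thesis unfolding set_lebesgue_integral_def by (simp only:)
qed

lemma fourier_fubini:
  fixes \<phi> :: "real \<Rightarrow> complex"
  assumes \<phi>: "integrable lborel \<phi>" and ab: "a \<le> b"
  shows "(LINT t|lborel. LINT u|lborel. indicator {a..b} u *\<^sub>R (iexp (- (t * u)) * \<phi> t)) =
     (LINT u|lborel. indicator {a..b} u *\<^sub>R (LINT t|lborel. iexp (- (t * u)) * \<phi> t))"
proof -
  have [measurable]: "\<phi> \<in> borel_measurable borel" using borel_measurable_integrable[OF \<phi>] by simp
  define F where "F = (\<lambda>(t, u). indicator {a..b} u *\<^sub>R (iexp (- (t * u)) * \<phi> t))"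
  have Fm: "F \<in> borel_measurable (lborel \<Otimes>\<^sub>M lborel)" unfolding F_def by measurable
  have nF: "norm (F (t, u)) = indicat_real {a..b} u * norm (\<phi> t)" for t u
    unfolding F_def prod.case norm_scaleR norm_mult norm_exp_i_times by simp
  have "integrable (lborel \<Otimes>\<^sub>M lborel) F"
  proof (rule lborel_pair.Fubini_integrable[OF Fm])
    have "(\<lambda>t. LINT u|lborel. norm (F (t, u))) = (\<lambda>t. (b - a) * norm (\<phi> t))"
      unfolding nF using ab by simp
    thus "integrable lborel (\<lambda>t. LINT u|lborel. norm (F (t, u)))"
      using \<phi> by simp
    show "AE t in lborel. integrable lborel (\<lambda>u. F (t, u))"
    proof (rule AE_I2)
      fix t :: real
      show "integrable lborel (\<lambda>u. F (t, u))"
      proof (rule Bochner_Integration.integrable_bound)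
        show "integrable lborel (\<lambda>u. norm (\<phi> t) * indicat_real {a..b} u)" using ab by simp
        show "(\<lambda>u. F (t, u)) \<in> borel_measurable lborel" unfolding F_def prod.case by measurable
      qed (use nF in simp)
    qed
  qed
  hence "integrable (lborel \<Otimes>\<^sub>M lborel) (\<lambda>(t, u). F (t, u))" by simp
  from lborel_pair.Fubini_integral[OF this]
  have "(LINT u|lborel. LINT t|lborel. F (t, u)) = (LINT t|lborel. LINT u|lborel. F (t, u))" .
  thus ?thesis unfolding F_def prod.case by simp
qed

text \<open>When the characteristic function is integrable, the principal value in Levy's formula is
  an ordinary integral. Its kernel is the integral of exp (- i t u) over \<open>u\<close> between
  \<open>a\<close> and \<open>b\<close>, so Fubini exhibits the Fourier integral as a
  density.\<close>

lemma Levy_Inversion_integrable: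
  assumes M: "real_distribution M" and \<phi>: "integrable lborel (char M)" and ab: "a \<le> b"
    and atoms: "measure M {a} = 0" "measure M {b} = 0"
  shows "of_real (measure M {a<..b}) = (LINT u|lborel. indicator {a..b} u *\<^sub>R (1 / (2 * pi) * (LINT t|lborel. iexp (- (t * u)) * char M t)))"
proof -
  interpret real_distribution M by (rule M)
  have [measurable]: "char M \<in> borel_measurable borel" using borel_measurable_integrable[OF \<phi>] by simp
  define f where "f = (\<lambda>t. (iexp (- (t * a)) - iexp (- (t * b))) / (\<i> * t) * char M t)"
  have [measurable]: "f \<in> borel_measurable borel" unfolding f_def by measurable
  have fn: "norm (f t) \<le> (b - a) * norm (char M t)" for t
  proof (cases "t = 0")
    case True
    thus ?thesis using ab by (simp add: f_def)
  next
    case False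
    have "norm ((iexp (- (t * a)) - iexp (- (t * b))) / (\<i> * t)) \<le> b - a"
      using Levy_Inversion_aux2[of "- b" "- a" t] ab False by simp
    thus ?thesis unfolding f_def norm_mult by (intro mult_right_mono) auto
  qed
  have dom: "integrable lborel (\<lambda>t. (b - a) * norm (char M t))" using \<phi> by simp
  have "(\<lambda>n. LINT t|lborel. indicator {- real n..real n} t *\<^sub>R f t) \<longlonglongrightarrow> (LINT t|lborel. f t)"
  proof (rule integral_dominated_convergence[OF _ _ dom])
    show "AE t in lborel. (\<lambda>n. indicator {- real n..real n} t *\<^sub>R f t) \<longlonglongrightarrow> f t"
    proof (rule AE_I2, rule tendsto_eventually)
      fix t :: real
      obtain N where N: "\<bar>t\<bar> \<le> real N" using real_arch_simple by blast
      show "\<forall>\<^sub>F n in sequentially. indicator {- real n..real n} t *\<^sub>R f t = f t"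
        using eventually_ge_at_top[of N]
      proof eventually_elim
        case (elim n)
        hence "\<bar>t\<bar> \<le> real n" using N by linarith
        thus ?case by (simp add: abs_le_iff)
      qed
    qed
    show "AE t in lborel. norm (indicator {- real n..real n} t *\<^sub>R f t) \<le> (b - a) * norm (char M t)" for n
      by (rule AE_I2) (use fn ab in \<open>auto simp: indicator_def\<close>)
  qed measurable
  moreover have "(LINT t|lborel. indicator {- real n..real n} t *\<^sub>R f t) = (CLBINT t=-real n..real n. f t)" for n
    unfolding set_lebesgue_integral_def [symmetric] by (rule interval_integral_Icc [symmetric]) simp
  ultimately have "(\<lambda>n. CLBINT t=-real n..real n. f t) \<longlonglongrightarrow> (LINT t|lborel. f t)" by (simp only:)
  hence 1: "(\<lambda>n. 1 / (2 * pi) * (CLBINT t=-real n..real n. f t)) \<longlonglongrightarrow> 1 / (2 * pi) * (LINT t|lborel. f t)"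
    by (rule tendsto_mult_left)
  have "(\<lambda>n. 1 / (2 * pi) * (CLBINT t=-real n..real n. f t)) \<longlonglongrightarrow> of_real (measure M {a<..b})"
    using Levy_Inversion[OF ab atoms] unfolding f_def by simp
  with 1 have "of_real (measure M {a<..b}) = 1 / (2 * pi) * (LINT t|lborel. f t)"
    by (rule LIMSEQ_unique[rotated])
  also have "(LINT t|lborel. f t) = (LINT t|lborel. LINT u|lborel. indicator {a..b} u *\<^sub>R (iexp (- (t * u)) * char M t))"
  proof (rule integral_cong_AE)
    have "AE t in lborel. t \<noteq> (0::real)" by (rule AE_lborel_singleton)
    thus "AE t in lborel. f t = (LINT u|lborel. indicator {a..b} u *\<^sub>R (iexp (- (t * u)) * char M t))"
    proof eventually_elim
      case (elim t)
      show ?case unfolding f_def by (rule integral_iexp_interval[OF ab elim, symmetric])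
    qed
  qed measurable
  also have "\<dots> = (LINT u|lborel. indicator {a..b} u *\<^sub>R (LINT t|lborel. iexp (- (t * u)) * char M t))"
    by (rule fourier_fubini[OF \<phi> ab])
  also have "1 / (2 * pi) * \<dots> = (LINT u|lborel. 1 / (2 * pi) * (indicator {a..b} u *\<^sub>R (LINT t|lborel. iexp (- (t * u)) * char M t)))"
    by (rule integral_mult_right_zero [symmetric])
  finally show ?thesis by (simp only: mult_scaleR_right)
qed

text \<open>The inversion formula applies only between points without mass. There are countably many
  atoms, so such points lie arbitrarily close to any point on both sides; the density is locally
  bounded, which squeezes the mass of every single point to 0. Nonnegativity follows because a
  negative value would persist on an interval.\<close>

lemma density_of_integrable_char:
  assumes M: "real_distribution M" and \<phi>: "integrable lborel (char M)"
  shows "\<exists>m. continuous_on UNIV m \<and> (\<forall>u. m u \<ge> 0) \<and>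
     (\<forall>a b. a \<le> b \<longrightarrow> measure M {a} = 0 \<and> measure M {a<..b} = integral {a..b} m)"
proof -
  interpret real_distribution M by (rule M)
  define g where "g = (\<lambda>u. 1 / (2 * pi) * (LINT t|lborel. iexp (- (t * u)) * char M t))"
  have gc: "continuous_on UNIV g" unfolding g_def by (intro continuous_intros fourier_continuous[OF \<phi>])
  define m where "m = (\<lambda>u. Re (g u))"
  have mc: "continuous_on A m" for A
    unfolding m_def by (intro continuous_intros continuous_on_subset[OF gc]) auto
  have inv: "measure M {a<..b} = integral {a..b} m"
    if "a \<le> b" "measure M {a} = 0" "measure M {b} = 0" for a b
  proof -
    have s: "set_integrable lborel {a..b} g"
      by (intro borel_integrable_atLeastAtMost' continuous_on_subset[OF gc]) auto
    have "of_real (measure M {a<..b}) = (LINT u:{a..b}|lborel. g u)"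
      using Levy_Inversion_integrable[OF M \<phi> that] unfolding g_def set_lebesgue_integral_def .
    also have "\<dots> = integral {a..b} g" by (rule set_borel_integral_eq_integral[OF s])
    finally have "measure M {a<..b} = Re (integral {a..b} g)" by (metis Re_complex_of_real)
    also have "\<dots> = integral {a..b} m"
      unfolding m_def o_def
      by (rule integral_linear[OF _ bounded_linear_Re, unfolded o_def, symmetric])
         (intro integrable_continuous_interval continuous_on_subset[OF gc], simp)
    finally show ?thesis .
  qed
  have ex: "\<exists>x. a < x \<and> x < b \<and> measure M {x} = 0" if "a < b" for a b
  proof -
    have "uncountable ({a<..<b} - {x. measure M {x} > 0})"
      by (intro uncountable_minus_countable countable_atoms) (use that in \<open>simp add: uncountable_open_interval\<close>)
    hence "{a<..<b} - {x. measure M {x} > 0} \<noteq> {}" by (metis countable_empty)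
    then obtain x where "x \<in> {a<..<b} - {x. measure M {x} > 0}" by blast
    hence "a < x" "x < b" "\<not> measure M {x} > 0" by simp_all
    thus ?thesis using measure_nonneg[of M "{x}"] by (intro exI[of _ x]) auto
  qed
  have at: "measure M {p} = 0" for p
  proof -
    have "compact (m ` {p - 1..p + 1})" by (intro compact_continuous_image mc) auto
    hence "bounded (m ` {p - 1..p + 1})" by (rule compact_imp_bounded)
    then obtain K where "\<forall>x\<in>m ` {p - 1..p + 1}. norm x \<le> K" unfolding bounded_iff by blast
    hence K: "\<bar>m u\<bar> \<le> K" if "u \<in> {p - 1..p + 1}" for u using that by auto
    have K0: "K \<ge> 0" using K[of p] by auto
    have "measure M {p} \<le> 0 + e" if e: "e > 0" for e
    proof -
      \<comment> \<open>An interval of length at most \<open>2 * d\<close> on which the density is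
        at most \<open>K\<close> has mass at most \<open>e\<close>; adding 1 to \<open>K\<close>
        guards against \<open>K = 0\<close>.\<close>
      define d where "d = min 1 (e / (2 * (K + 1)))"
      have d: "d > 0" "d \<le> 1" "2 * d * K \<le> e"
      proof -
        show "d > 0" "d \<le> 1" using e K0 by (auto simp: d_def)
        have "2 * d * K \<le> 2 * (e / (2 * (K + 1))) * K" using K0 by (intro mult_right_mono mult_left_mono) (auto simp: d_def)
        also have "\<dots> = e * (K / (K + 1))" using K0 by (simp add: field_simps)
        also have "\<dots> \<le> e * 1" using K0 e by (intro mult_left_mono) auto
        finally show "2 * d * K \<le> e" by simp
      qed
      obtain a where a: "p - d < a" "a < p" "measure M {a} = 0" using ex[of "p - d" p] d by auto
      obtain b where b: "p < b" "b < p + d" "measure M {b} = 0" using ex[of p "p + d"] d by auto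
      have "measure M {p} \<le> measure M {a<..b}" by (rule finite_measure_mono) (use a b in auto)
      also have "\<dots> = integral {a..b} m" by (rule inv) (use a b in auto)
      also have "\<dots> \<le> norm (integral {a..b} m)" by simp
      also have "\<dots> \<le> K * (b - a)"
        by (rule integral_bound) (use a b d K mc in auto)
      also have "\<dots> \<le> K * (2 * d)" using a b K0 by (intro mult_left_mono) auto
      also have "\<dots> \<le> e" using d(3) by (simp add: mult_ac)
      finally show ?thesis by simp
    qed
    hence "measure M {p} \<le> 0" using field_le_epsilon[of "measure M {p}" 0] by blast
    thus ?thesis using measure_nonneg[of M "{p}"] by simp
  qed
  have "m u \<ge> 0" for u
  proof (rule ccontr)
    assume "\<not> m u \<ge> 0"
    hence neg: "m u < 0" by simp
    have "isCont m u" using mc[of UNIV] by (simp add: continuous_on_eq_continuous_at)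
    then obtain d where d: "d > 0" "\<And>v. \<bar>v - u\<bar> < d \<Longrightarrow> \<bar>m v - m u\<bar> < - m u / 2"
      using neg unfolding continuous_at_eps_delta dist_real_def by (metis half_gt_zero neg_0_less_iff_less)
    have "m v \<le> m u / 2" if "v \<in> {u..u + d / 2}" for v
    proof -
      have "\<bar>m v - m u\<bar> < - m u / 2" by (rule d(2)) (use that d(1) in auto)
      thus ?thesis by linarith
    qed
    hence "integral {u..u + d / 2} m \<le> integral {u..u + d / 2} (\<lambda>_. m u / 2)"
      by (intro integral_le integrable_continuous_interval mc) auto
    also have "\<dots> < 0" using d(1) neg by (simp add: mult_pos_neg)
    also have "integral {u..u + d / 2} m = measure M {u<..u + d / 2}" by (rule inv [symmetric]) (use at d in auto)
    finally show False using measure_nonneg[of M "{u<..u + d / 2}"] by simp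
  qed
  thus ?thesis using mc inv at by blast
qed

text \<open>The law of \<open>h\<close> at a time chosen uniformly from [0, T]; despite its name it
  is a measure. Time averages of functions of \<open>h\<close> become expectations.\<close>

definition hit_density :: "(real \<Rightarrow> real) \<Rightarrow> real \<Rightarrow> real measure" where
  "hit_density h T = distr (density lborel (\<lambda>t. ennreal (indicator {0..T} t / T))) borel h"

lemma hit_density:
  fixes g :: "real \<Rightarrow> 'b :: {banach, second_countable_topology}"
  assumes h: "h \<in> borel_measurable borel" and T: "T > 0"
  shows "real_distribution (hit_density h T)"
    and "g \<in> borel_measurable borel \<Longrightarrow>
      integral\<^sup>L (hit_density h T) g = (1 / T) *\<^sub>R (LINT t:{0..T}|lborel. g (h t))"
proof -
  note h [measurable]
  let ?D = "density lborel (\<lambda>t. ennreal (indicator {0..T} t / T))"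
  have "prob_space ?D"
  proof (rule prob_spaceI)
    have "emeasure ?D (space ?D) = (\<integral>\<^sup>+ t. ennreal (1 / T) * indicator {0..T} t \<partial>lborel)"
      by (subst emeasure_density) (auto intro!: nn_integral_cong simp: indicator_def)
    also have "\<dots> = ennreal (1 / T) * ennreal T" using T by (simp add: nn_integral_cmult_indicator)
    also have "\<dots> = 1" using T by (simp flip: ennreal_mult)
    finally show "emeasure ?D (space ?D) = 1" .
  qed
  then interpret D: prob_space ?D .
  show "real_distribution (hit_density h T)"
    unfolding hit_density_def by (rule D.real_distribution_distr) simp
  assume g [measurable]: "g \<in> borel_measurable borel"
  have "integral\<^sup>L (hit_density h T) g = (LINT t|?D. g (h t))"
  proof -
    have "h \<in> ?D \<rightarrow>\<^sub>M borel" by simp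
    from integral_distr[OF this g] show ?thesis unfolding hit_density_def .
  qed
  also have "\<dots> = (LINT t|lborel. (indicator {0..T} t / T) *\<^sub>R g (h t))"
  proof (rule integral_density)
    show "(\<lambda>t. g (h t)) \<in> borel_measurable lborel" by measurable
    show "(\<lambda>t. indicat_real {0..T} t / T) \<in> borel_measurable lborel" by measurable
    show "AE t in lborel. 0 \<le> indicat_real {0..T} t / T" using T by simp
  qed
  also have "\<dots> = (LINT t|lborel. (1 / T) *\<^sub>R (indicator {0..T} t *\<^sub>R g (h t)))"
    by simp
  also have "\<dots> = (1 / T) *\<^sub>R (LINT t|lborel. indicator {0..T} t *\<^sub>R g (h t))"
    by (rule integral_scaleR_right)
  finally show "integral\<^sup>L (hit_density h T) g = (1 / T) *\<^sub>R (LINT t:{0..T}|lborel. g (h t))"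
    unfolding set_lebesgue_integral_def .
qed

lemma indicator_hit_integrable:
  fixes h :: "real \<Rightarrow> real"
  assumes h: "h \<in> borel_measurable borel"
  shows "set_integrable lborel {0..T::real} (\<lambda>t. indicat_real {a<..b} (h t))"
proof -
  have [measurable]: "(\<lambda>t. indicat_real {a<..b} (h t)) \<in> borel_measurable borel"
    by (rule measurable_compose[OF h]) simp
  have "integrable lborel (\<lambda>t. indicat_real {0..T} t)"
    by (cases "0 \<le> T") simp_all
  thus ?thesis unfolding set_integrable_def
  proof (rule Bochner_Integration.integrable_bound)
    show "(\<lambda>t. indicat_real {0..T} t *\<^sub>R indicat_real {a<..b} (h t)) \<in> borel_measurable lborel" by measurable
  qed (auto simp: indicator_def)
qed

lemma measure_hit_density:
  assumes h: "h \<in> borel_measurable borel" and T: "T > 0"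
  shows "measure (hit_density h T) {a<..b} = 1 / T * integral {0..T} (\<lambda>t. indicat_real {a<..b} (h t))"
proof -
  interpret real_distribution "hit_density h T" by (rule hit_density(1)[OF h T])
  have "measure (hit_density h T) {a<..b} = (LINT u|hit_density h T. indicat_real {a<..b} u)" by simp
  also have "\<dots> = (1 / T) *\<^sub>R (LINT t:{0..T}|lborel. indicat_real {a<..b} (h t))"
    by (rule hit_density(2)[OF h T]) simp
  also have "(LINT t:{0..T}|lborel. indicat_real {a<..b} (h t)) = integral {0..T} (\<lambda>t. indicat_real {a<..b} (h t))"
    by (rule set_borel_integral_eq_integral[OF indicator_hit_integrable[OF h]])
  finally show ?thesis by simp
qed

lemma char_hit_density:
  assumes h: "continuous_on UNIV h" and T: "T > 0"
  shows "char (hit_density h T) x = (1 / T) *\<^sub>R integral {0..T} (\<lambda>t. exp (\<i> * of_real (x * h t)))"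
proof -
  have hm: "h \<in> borel_measurable borel" by (rule borel_measurable_continuous_onI[OF h])
  have "char (hit_density h T) x = (1 / T) *\<^sub>R (LINT t:{0..T}|lborel. iexp (x * h t))"
    unfolding char_def by (rule hit_density(2)[OF hm T], intro borel_measurable_continuous_onI continuous_intros)
  also have "(LINT t:{0..T}|lborel. iexp (x * h t)) = integral {0..T} (\<lambda>t. iexp (x * h t))"
    by (intro set_borel_integral_eq_integral borel_integrable_atLeastAtMost' continuous_intros continuous_on_subset[OF h]) auto
  finally show ?thesis .
qed

text \<open>
  Along the sample lengths \<open>T = n + 1\<close> a subsequence converges by tightness; the limit is identified
  by its characteristic function, hence does not depend on the way in which \<open>T\<close> tends to infinity.
\<close>
lemma limit_density:
  assumes h: "continuous_on UNIV h" and B: "\<And>t. \<bar>h t\<bar> \<le> B"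
    and mean: "\<And>x. has_mean (\<lambda>t. exp (\<i> * of_real (x * h t))) (\<psi> x)"
    and decay: "\<And>x. (1 + x\<^sup>2) * norm (\<psi> x) \<le> C"
  shows "\<exists>m. continuous_on UNIV m \<and> (\<forall>u. m u \<ge> 0) \<and>
     (\<forall>a b. a \<le> b \<longrightarrow> ((\<lambda>T. 1 / T * integral {0..T} (\<lambda>t. indicat_real {a<..b} (h t))) \<longlongrightarrow> integral {a..b} m) at_top)"
proof -
  have hm: "h \<in> borel_measurable borel" by (rule borel_measurable_continuous_onI[OF h])
  have cl: "(\<lambda>n. char (hit_density h (X n)) x) \<longlonglongrightarrow> \<psi> x"
    if X: "filterlim X at_top sequentially" for X x
  proof (rule Lim_transform_eventually)
    show "(\<lambda>n. (1 / X n) *\<^sub>R integral {0..X n} (\<lambda>t. exp (\<i> * of_real (x * h t)))) \<longlonglongrightarrow> \<psi> x"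
      by (rule filterlim_compose[OF mean[unfolded has_mean_def] X])
    have "\<forall>\<^sub>F n in sequentially. X n > 0" using X by (simp add: filterlim_at_top_dense)
    thus "\<forall>\<^sub>F n in sequentially. (1 / X n) *\<^sub>R integral {0..X n} (\<lambda>t. exp (\<i> * of_real (x * h t))) = char (hit_density h (X n)) x"
      by eventually_elim (simp only: char_hit_density[OF h])
  qed
  define \<mu> where "\<mu> = (\<lambda>n. hit_density h (real (Suc n)))"
  have \<mu>d: "real_distribution (\<mu> n)" for n unfolding \<mu>_def by (rule hit_density(1)[OF hm]) simp
  \<comment> \<open>As \<open>h\<close> is bounded, all these laws live on one bounded interval,
    which is what tightness asks for. The margin 1 on the left is due to the half-open form.\<close>
  have full: "measure (\<mu> n) {- B - 1<..B + 1} = 1" for n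
  proof -
    have "indicat_real {- B - 1<..B + 1} (h t) = 1" for t using B[of t] by (simp add: indicator_def abs_le_iff)
    thus ?thesis unfolding \<mu>_def by (subst measure_hit_density[OF hm]) (simp_all del: of_nat_Suc)
  qed
  have "tight \<mu>"
    unfolding tight_def
  proof (intro conjI allI impI \<mu>d)
    fix e :: real assume "e > 0"
    moreover have "B \<ge> 0" using B[of 0] by linarith
    ultimately show "\<exists>a b. a < b \<and> (\<forall>n. 1 - e < measure (\<mu> n) {a<..b})"
      by (intro exI[of _ "- B - 1"] exI[of _ "B + 1"]) (simp add: full)
  qed
  from tight_imp_convergent_subsubsequence[OF this strict_mono_id] obtain r \<nu> where
    r: "strict_mono (r :: nat \<Rightarrow> nat)" and \<nu>: "real_distribution \<nu>" and w: "weak_conv_m (\<mu> \<circ> id \<circ> r) \<nu>" by blast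
  have "char \<nu> x = \<psi> x" for x
  proof (rule LIMSEQ_unique)
    show "(\<lambda>n. char ((\<mu> \<circ> id \<circ> r) n) x) \<longlonglongrightarrow> char \<nu> x"
      by (rule levy_continuity1[OF _ \<nu> w]) (simp add: \<mu>d)
    have "filterlim (\<lambda>n. Suc (r n)) sequentially sequentially"
      by (rule filterlim_compose[OF filterlim_Suc filterlim_subseq[OF r]])
    hence "filterlim (\<lambda>n. real (Suc (r n))) at_top sequentially"
      by (rule filterlim_compose[OF filterlim_real_sequentially])
    from cl[OF this] show "(\<lambda>n. char ((\<mu> \<circ> id \<circ> r) n) x) \<longlonglongrightarrow> \<psi> x" by (simp add: \<mu>_def)
  qed
  hence \<psi>: "\<psi> = char \<nu>" by (simp add: fun_eq_iff)
  interpret N: real_distribution \<nu> by (rule \<nu>)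
  have int: "integrable lborel (char \<nu>)"
  proof (rule Bochner_Integration.integrable_bound)
    have "integrable lborel (\<lambda>x::real. inverse (1 + x\<^sup>2))"
      using integrable_inverse_1_plus_square by (simp add: set_integrable_def)
    thus "integrable lborel (\<lambda>x::real. C * inverse (1 + x\<^sup>2))" by simp
    show "char \<nu> \<in> borel_measurable lborel" using N.char_measurable by simp
    show "AE x in lborel. norm (char \<nu> x) \<le> norm (C * inverse (1 + x\<^sup>2))"
    proof (rule AE_I2)
      fix x :: real
      have p: "1 + x\<^sup>2 > 0" by (simp add: add_pos_nonneg)
      hence "norm (char \<nu> x) \<le> C * inverse (1 + x\<^sup>2)" using decay[of x] by (simp add: \<psi> field_simps)
      thus "norm (char \<nu> x) \<le> norm (C * inverse (1 + x\<^sup>2))" by simp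
    qed
  qed
  obtain m where m: "continuous_on UNIV m" "\<And>u. m u \<ge> 0" "\<And>a. measure \<nu> {a} = 0"
    "\<And>a b. a \<le> b \<Longrightarrow> measure \<nu> {a<..b} = integral {a..b} m"
    using density_of_integrable_char[OF \<nu> int] by blast
  have "((\<lambda>T. 1 / T * integral {0..T} (\<lambda>t. indicat_real {a<..b} (h t))) \<longlongrightarrow> integral {a..b} m) at_top"
    if ab: "a \<le> b" for a b
  proof (rule tendsto_at_topI_sequentially)
    fix X :: "nat \<Rightarrow> real" assume X: "filterlim X at_top sequentially"
    \<comment> \<open>The laws are probability measures only for positive lengths; from some index
      on \<open>Y\<close> equals \<open>X\<close>.\<close>
    define Y where "Y = (\<lambda>n. max 1 (X n))"
    have Y0: "Y n > 0" for n by (simp add: Y_def)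
    have Y: "filterlim Y at_top sequentially"
      by (rule filterlim_at_top_mono[OF X]) (simp add: Y_def)
    have wY: "weak_conv_m (\<lambda>n. hit_density h (Y n)) \<nu>"
      by (rule levy_continuity[OF hit_density(1)[OF hm Y0] \<nu>]) (use cl[OF Y] in \<open>simp add: \<psi>\<close>)
    have "(\<lambda>n. measure (hit_density h (Y n)) {a<..b}) \<longlonglongrightarrow> measure \<nu> {a<..b}"
    proof (rule weak_conv_imp_continuity_set_conv[OF hit_density(1)[OF hm Y0] \<nu> wY])
      have "measure \<nu> (frontier {a<..b}) \<le> measure \<nu> {a, b}"
      proof (rule N.finite_measure_mono)
        have "closure {a<..b} \<subseteq> {a..b}" by (rule closure_minimal) auto
        moreover have "{a<..<b} \<subseteq> interior {a<..b}" by (rule interior_maximal) auto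
        ultimately show "frontier {a<..b} \<subseteq> {a, b}" by (fastforce simp: frontier_def)
      qed simp
      also have "\<dots> = 0" by (subst N.finite_measure_eq_sum_singleton) (simp_all add: m(3))
      finally have "measure \<nu> (frontier {a<..b}) = 0" using measure_nonneg[of \<nu> "frontier {a<..b}"] by simp
      thus "emeasure \<nu> (frontier {a<..b}) = 0" by (simp add: N.emeasure_eq_measure)
    qed simp
    hence 1: "(\<lambda>n. 1 / Y n * integral {0..Y n} (\<lambda>t. indicat_real {a<..b} (h t))) \<longlonglongrightarrow> integral {a..b} m"
      unfolding m(4)[OF ab] measure_hit_density[OF hm Y0] .
    have "\<forall>\<^sub>F n in sequentially. X n \<ge> 1" using X by (simp add: filterlim_at_top)
    hence "\<forall>\<^sub>F n in sequentially. 1 / Y n * integral {0..Y n} (\<lambda>t. indicat_real {a<..b} (h t)) = 1 / X n * integral {0..X n} (\<lambda>t. indicat_real {a<..b} (h t))"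
      by eventually_elim (simp add: Y_def max_def)
    from Lim_transform_eventually[OF 1 this]
    show "(\<lambda>n. 1 / X n * integral {0..X n} (\<lambda>t. indicat_real {a<..b} (h t))) \<longlonglongrightarrow> integral {a..b} m" .
  qed
  thus ?thesis using m(1,2) by blast
qed

section \<open>Riemann integrable test functions\<close>

definition grid :: "real \<Rightarrow> real \<Rightarrow> nat \<Rightarrow> nat \<Rightarrow> real" where
  "grid a b N i = a + real i * ((b - a) / real N)"

lemma grid_Suc: "grid a b N (Suc i) = grid a b N i + (b - a) / real N"
  unfolding grid_def of_nat_Suc distrib_right by simp

lemma grid_mono: "a \<le> b \<Longrightarrow> i \<le> j \<Longrightarrow> grid a b N i \<le> grid a b N j"
  unfolding grid_def by (intro add_left_mono mult_right_mono) auto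

lemma grid_ends: "grid a b N 0 = a" "N > 0 \<Longrightarrow> grid a b N N = b"
  by (simp_all add: grid_def)

text \<open>The cells are open on the left, as are the intervals whose frequencies are known;
  therefore they are disjoint and miss only the left end point \<open>a\<close>.\<close>

lemma grid_locate:
  assumes "a < x" "x \<le> b" "N > 0"
  shows "\<exists>i<N. grid a b N i < x \<and> x \<le> grid a b N (Suc i)"
proof -
  have "\<exists>k. x \<le> grid a b N k" using assms(2) grid_ends(2)[OF assms(3), of a b] by (intro exI[of _ N]) simp
  define k where "k = (LEAST k. x \<le> grid a b N k)"
  have k: "x \<le> grid a b N k" unfolding k_def by (rule LeastI_ex) fact
  have kN: "k \<le> N" unfolding k_def by (rule Least_le) (use assms grid_ends in simp)
  have "k \<noteq> 0" using k assms(1) by (auto simp: grid_ends intro: ccontr)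
  then obtain i where i: "k = Suc i" by (cases k) auto
  have "\<not> x \<le> grid a b N i" using not_less_Least[of i "\<lambda>k. x \<le> grid a b N k"] i unfolding k_def by simp
  thus ?thesis using k kN i by (intro exI[of _ i]) auto
qed

lemma grid_tagged_division:
  assumes ab: "a < b" and N: "N > 0" and x: "\<And>i. i < N \<Longrightarrow> x i \<in> {grid a b N i..grid a b N (Suc i)}"
  shows "(\<lambda>i. (x i, {grid a b N i..grid a b N (Suc i)})) ` {..<N} tagged_division_of {a..b}"
proof (rule tagged_division_ofI)
  let ?K = "\<lambda>i. {grid a b N i..grid a b N (Suc i)}"
  have le: "grid a b N i \<le> grid a b N (Suc i)" for i using ab by (intro grid_mono) auto
  show "finite ((\<lambda>i. (x i, ?K i)) ` {..<N})" by simp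
  show "y \<in> K" if "(y, K) \<in> (\<lambda>i. (x i, ?K i)) ` {..<N}" for y K using that x by auto
  show "K \<subseteq> {a..b}" if "(y, K) \<in> (\<lambda>i. (x i, ?K i)) ` {..<N}" for y K
  proof -
    obtain i where i: "i < N" "K = ?K i" using \<open>(y, K) \<in> _\<close> by auto
    have "a \<le> grid a b N i" using grid_mono[of a b 0 i N] ab by (simp add: grid_ends)
    moreover have "grid a b N (Suc i) \<le> b" using grid_mono[of a b "Suc i" N N] ab i N by (simp add: grid_ends)
    ultimately show ?thesis using i by auto
  qed
  show "\<exists>c d. K = cbox c d" if "(y, K) \<in> (\<lambda>i. (x i, ?K i)) ` {..<N}" for y K
    using that by (auto simp: cbox_interval)
  show "interior K1 \<inter> interior K2 = {}"
    if h: "(x1, K1) \<in> (\<lambda>i. (x i, ?K i)) ` {..<N}" "(x2, K2) \<in> (\<lambda>i. (x i, ?K i)) ` {..<N}" "(x1, K1) \<noteq> (x2, K2)" for x1 K1 x2 K2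
  proof -
    obtain i j where ij: "K1 = ?K i" "K2 = ?K j" "x1 = x i" "x2 = x j" using h(1,2) by auto
    have "{grid a b N i<..<grid a b N (Suc i)} \<inter> {grid a b N j<..<grid a b N (Suc j)} = {}" if "i < j" for i j
      using grid_mono[of a b "Suc i" j N] ab that by auto
    moreover have "i \<noteq> j" using h(3) ij by auto
    ultimately show ?thesis unfolding ij interior_atLeastAtMost_real by (metis Int_commute linorder_neqE_nat)
  qed
  show "\<Union>{K. \<exists>y. (y, K) \<in> (\<lambda>i. (x i, ?K i)) ` {..<N}} = {a..b}"
  proof (intro equalityI subsetI)
    fix y assume "y \<in> \<Union>{K. \<exists>y. (y, K) \<in> (\<lambda>i. (x i, ?K i)) ` {..<N}}"
    then obtain i where i: "i < N" "y \<in> ?K i" by auto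
    have "a \<le> grid a b N i" using grid_mono[of a b 0 i N] ab by (simp add: grid_ends)
    moreover have "grid a b N (Suc i) \<le> b" using grid_mono[of a b "Suc i" N N] ab i N by (simp add: grid_ends)
    ultimately show "y \<in> {a..b}" using i by auto
  next
    fix y assume y: "y \<in> {a..b}"
    have "\<exists>i<N. y \<in> ?K i"
    proof (cases "y = a")
      case True
      thus ?thesis using N le[of 0] by (intro exI[of _ 0]) (auto simp: grid_ends)
    next
      case False
      thus ?thesis using grid_locate[of a y b N] y N by (auto intro: less_imp_le)
    qed
    thus "y \<in> \<Union>{K. \<exists>y. (y, K) \<in> (\<lambda>i. (x i, ?K i)) ` {..<N}}" by blast
  qed
qed

text \<open>Real and imaginary parts, each split by sign, give four partial sums without
  cancellation.\<close>

lemma sum_norm_complex_le: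
  fixes z :: "nat \<Rightarrow> complex"
  assumes "finite A" and "\<And>J. J \<subseteq> A \<Longrightarrow> norm (\<Sum>i\<in>J. z i) \<le> e"
  shows "(\<Sum>i\<in>A. norm (z i)) \<le> 4 * e"
proof -
  have part: "(\<Sum>i\<in>A. \<bar>f (z i)\<bar>) \<le> 2 * e"
    if add: "\<And>J. f (\<Sum>i\<in>J. z i) = (\<Sum>i\<in>J. f (z i))" and le: "\<And>w. \<bar>f w\<bar> \<le> norm w" for f :: "complex \<Rightarrow> real"
  proof -
    define P where "P = {i\<in>A. f (z i) \<ge> 0}"
    have "(\<Sum>i\<in>A. \<bar>f (z i)\<bar>) = (\<Sum>i\<in>A - P. \<bar>f (z i)\<bar>) + (\<Sum>i\<in>P. \<bar>f (z i)\<bar>)"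
      by (rule sum.subset_diff) (use assms(1) in \<open>auto simp: P_def\<close>)
    also have "(\<Sum>i\<in>P. \<bar>f (z i)\<bar>) = (\<Sum>i\<in>P. f (z i))" by (rule sum.cong) (auto simp: P_def)
    also have "(\<Sum>i\<in>A - P. \<bar>f (z i)\<bar>) = - (\<Sum>i\<in>A - P. f (z i))"
      unfolding sum_negf [symmetric] by (rule sum.cong) (auto simp: P_def)
    also have "- (\<Sum>i\<in>A - P. f (z i)) \<le> e"
      using le[of "\<Sum>i\<in>A - P. z i"] assms(2)[of "A - P"] unfolding add by auto
    also have "(\<Sum>i\<in>P. f (z i)) \<le> e"
      using le[of "\<Sum>i\<in>P. z i"] assms(2)[of P] unfolding add by (auto simp: P_def)
    finally show ?thesis by simp
  qed
  have "(\<Sum>i\<in>A. norm (z i)) \<le> (\<Sum>i\<in>A. \<bar>Re (z i)\<bar> + \<bar>Im (z i)\<bar>)"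
    by (intro sum_mono cmod_le)
  also have "\<dots> = (\<Sum>i\<in>A. \<bar>Re (z i)\<bar>) + (\<Sum>i\<in>A. \<bar>Im (z i)\<bar>)" by (rule sum.distrib)
  also have "\<dots> \<le> 2 * e + 2 * e"
    by (intro add_mono part Re_sum Im_sum abs_Re_le_cmod abs_Im_le_cmod)
  finally show ?thesis by simp
qed

text \<open>
  The sum of the oscillations is controlled by comparing the Riemann sums of two families of tags
  which differ only on an arbitrary set of cells.
\<close>
lemma riemann_oscillation:
  fixes \<Phi> :: "real \<Rightarrow> complex"
  assumes R: "riemann_integrable_on \<Phi> a b" and ab: "a < b" and e: "e > 0"
  shows "\<exists>N>0. \<exists>\<omega>. (\<forall>i<N. \<forall>x\<in>{grid a b N i..grid a b N (Suc i)}. norm (\<Phi> x - \<Phi> (grid a b N i)) \<le> \<omega> i) \<and>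
     (\<Sum>i<N. \<omega> i * ((b - a) / real N)) \<le> e"
proof -
  \<comment> \<open>Two Riemann sums then differ by at most e / 8;
    \<open>sum_norm_complex_le\<close> costs a factor 4, and tags reaching only half of the supremum
    a factor 2, which adds up to \<open>e\<close>.\<close>
  have e16: "e / 16 > 0" using e by simp
  obtain I d where d: "d > 0" "\<And>p. p tagged_division_of {a..b} \<Longrightarrow> (\<forall>(x, K)\<in>p. diameter K < d) \<Longrightarrow>
      norm ((\<Sum>(x, K)\<in>p. measure lborel K *\<^sub>R \<Phi> x) - I) < e / 16"
    using R e16 unfolding riemann_integrable_on_def by blast
  obtain N0 where N0: "(b - a) / d < real N0" using reals_Archimedean2 by blast
  define N where "N = Suc N0"
  have N: "N > 0" by (simp add: N_def)
  define \<delta> where "\<delta> = (b - a) / real N"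
  have \<delta>: "\<delta> > 0" "\<delta> < d"
  proof -
    show "\<delta> > 0" using ab N by (simp add: \<delta>_def)
    have "(b - a) / d < real N" using N0 by (simp add: N_def)
    thus "\<delta> < d" using d(1) N unfolding \<delta>_def by (simp add: field_simps)
  qed
  define K where "K = (\<lambda>i. {grid a b N i..grid a b N (Suc i)})"
  define c where "c = grid a b N"
  have K: "K i = {c i..c i + \<delta>}" for i unfolding K_def c_def grid_Suc \<delta>_def ..
  have cK: "c i \<in> K i" for i using \<delta> by (simp add: K)
  have near: "norm ((\<Sum>i<N. \<delta> *\<^sub>R \<Phi> (x i)) - I) < e / 16" if x: "\<And>i. i < N \<Longrightarrow> x i \<in> K i" for x
  proof -
    define p where "p = (\<lambda>i. (x i, K i)) ` {..<N}"
    have inj: "inj_on (\<lambda>i. (x i, K i)) {..<N}"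
    proof (rule inj_onI)
      fix i j assume "(x i, K i) = (x j, K j)"
      hence "c i = c j" using \<delta> by (auto simp: K Icc_eq_Icc)
      hence "real i * \<delta> = real j * \<delta>" by (simp add: c_def grid_def \<delta>_def)
      thus "i = j" using \<delta> by simp
    qed
    have "p tagged_division_of {a..b}"
      unfolding p_def K_def by (rule grid_tagged_division[OF ab N]) (use x in \<open>simp add: K_def\<close>)
    moreover have "\<forall>(x, K)\<in>p. diameter K < d" using \<delta> by (auto simp: p_def K)
    ultimately have "norm ((\<Sum>(x, K)\<in>p. measure lborel K *\<^sub>R \<Phi> x) - I) < e / 16" by (rule d(2))
    also have "(\<Sum>(x, K)\<in>p. measure lborel K *\<^sub>R \<Phi> x) = (\<Sum>i<N. \<delta> *\<^sub>R \<Phi> (x i))"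
      unfolding p_def sum.reindex[OF inj] using \<delta> by (intro sum.cong) (auto simp: K)
    finally show ?thesis .
  qed
  have total: "(\<Sum>i<N. \<delta> * norm (\<Phi> (x i) - \<Phi> (c i))) \<le> e / 2" if x: "\<And>i. i < N \<Longrightarrow> x i \<in> K i" for x
  proof -
    have "norm (\<Sum>i\<in>J. \<delta> *\<^sub>R (\<Phi> (x i) - \<Phi> (c i))) \<le> e / 8" if J: "J \<subseteq> {..<N}" for J
    proof -
      define y where "y = (\<lambda>i. if i \<in> J then x i else c i)"
      have n1: "norm ((\<Sum>i<N. \<delta> *\<^sub>R \<Phi> (y i)) - I) < e / 16" by (rule near) (use x cK in \<open>auto simp: y_def\<close>)
      have n2: "norm ((\<Sum>i<N. \<delta> *\<^sub>R \<Phi> (c i)) - I) < e / 16" by (rule near[OF cK])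
      have "norm ((\<Sum>i<N. \<delta> *\<^sub>R \<Phi> (y i)) - (\<Sum>i<N. \<delta> *\<^sub>R \<Phi> (c i))) \<le> e / 16 + e / 16"
        using norm_triangle_ineq4[of "(\<Sum>i<N. \<delta> *\<^sub>R \<Phi> (y i)) - I" "(\<Sum>i<N. \<delta> *\<^sub>R \<Phi> (c i)) - I"]
          n1 n2 by simp
      also have "(\<Sum>i<N. \<delta> *\<^sub>R \<Phi> (y i)) - (\<Sum>i<N. \<delta> *\<^sub>R \<Phi> (c i)) = (\<Sum>i<N. if i \<in> J then \<delta> *\<^sub>R (\<Phi> (x i) - \<Phi> (c i)) else 0)"
        unfolding sum_subtractf [symmetric] by (intro sum.cong) (auto simp: y_def scaleR_diff_right)
      also have "\<dots> = (\<Sum>i\<in>J. \<delta> *\<^sub>R (\<Phi> (x i) - \<Phi> (c i)))"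
        using J by (subst sum.inter_restrict [symmetric]) (auto simp: Int_absorb1)
      finally show ?thesis by simp
    qed
    hence "(\<Sum>i<N. norm (\<delta> *\<^sub>R (\<Phi> (x i) - \<Phi> (c i)))) \<le> 4 * (e / 8)"
      by (intro sum_norm_complex_le) auto
    thus ?thesis using \<delta> by simp
  qed
  define S where "S = (\<lambda>i. (\<lambda>x. norm (\<Phi> x - \<Phi> (c i))) ` K i)"
  define \<omega> where "\<omega> = (\<lambda>i. Sup (S i))"
  \<comment> \<open>Boundedness of \<open>\<Phi>\<close> is not assumed: moving a single tag changes
    the total by a bounded amount, and this bounds the oscillation on its cell.\<close>
  have bdd: "bdd_above (S i)" if i: "i < N" for i
  proof (rule bdd_aboveI)
    fix y assume "y \<in> S i"
    then obtain x where x: "x \<in> K i" "y = norm (\<Phi> x - \<Phi> (c i))" by (auto simp: S_def)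
    have "\<delta> * y = (\<Sum>j\<in>{i}. \<delta> * norm (\<Phi> ((c(i := x)) j) - \<Phi> (c j)))" using x by simp
    also have "\<dots> \<le> (\<Sum>j<N. \<delta> * norm (\<Phi> ((c(i := x)) j) - \<Phi> (c j)))"
      by (rule sum_mono2) (use i \<delta> in auto)
    also have "\<dots> \<le> e / 2" by (rule total) (use x cK in auto)
    finally show "y \<le> (e / 2) / \<delta>" using \<delta> by (simp add: field_simps)
  qed
  have ne: "S i \<noteq> {}" for i using cK by (auto simp: S_def)
  have osc: "norm (\<Phi> x - \<Phi> (c i)) \<le> \<omega> i" if "i < N" "x \<in> K i" for i x
    unfolding \<omega>_def by (rule cSup_upper[OF _ bdd[OF that(1)]]) (use that in \<open>auto simp: S_def\<close>)
  \<comment> \<open>The supremum need not be attained, so half of it is aimed at. A cell without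
    oscillation keeps its left end point as tag.\<close>
  have "\<exists>x. x \<in> K i \<and> \<omega> i / 2 \<le> norm (\<Phi> x - \<Phi> (c i))" if "i < N" for i
  proof (cases "\<omega> i > 0")
    case True
    hence "\<omega> i / 2 < Sup (S i)" by (simp add: \<omega>_def)
    then obtain y where "y \<in> S i" "\<omega> i / 2 < y" using less_cSupD[OF ne] by blast
    thus ?thesis by (auto simp: S_def intro: less_imp_le)
  next
    case False
    thus ?thesis using cK[of i] by (intro exI[of _ "c i"]) auto
  qed
  then obtain x where x: "\<And>i. i < N \<Longrightarrow> x i \<in> K i" "\<And>i. i < N \<Longrightarrow> \<omega> i / 2 \<le> norm (\<Phi> (x i) - \<Phi> (c i))" by metis
  have "(\<Sum>i<N. \<omega> i * \<delta>) = 2 * (\<Sum>i<N. \<delta> * (\<omega> i / 2))" unfolding sum_distrib_left by (rule sum.cong) auto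
  also have "\<dots> \<le> 2 * (\<Sum>i<N. \<delta> * norm (\<Phi> (x i) - \<Phi> (c i)))"
    using \<delta> x(2) by (intro mult_left_mono sum_mono) auto
  also have "\<dots> \<le> 2 * (e / 2)" by (intro mult_left_mono total x(1)) auto
  finally have "(\<Sum>i<N. \<omega> i * \<delta>) \<le> e" by simp
  thus ?thesis using N osc unfolding K_def c_def \<delta>_def by blast
qed

text \<open>On each of finitely many cells \<open>\<Phi>\<close> stays within a finite distance of
  its value at the left end.\<close>

lemma riemann_integrable_bounded:
  fixes \<Phi> :: "real \<Rightarrow> complex"
  assumes R: "riemann_integrable_on \<Phi> a b" and ab: "a < b"
  shows "\<exists>C. \<forall>x\<in>{a..b}. norm (\<Phi> x) \<le> C"
proof -
  obtain N \<omega> where N: "N > 0" and w: "\<And>i x. i < N \<Longrightarrow> x \<in> {grid a b N i..grid a b N (Suc i)} \<Longrightarrow> norm (\<Phi> x - \<Phi> (grid a b N i)) \<le> \<omega> i"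
    using riemann_oscillation[OF R ab zero_less_one] by blast
  define C where "C = (\<Sum>i<N. norm (\<Phi> (grid a b N i)) + \<bar>\<omega> i\<bar>)"
  have "norm (\<Phi> x) \<le> norm (\<Phi> a) + C" if x: "x \<in> {a..b}" for x
  proof (cases "x = a")
    case True
    have "C \<ge> 0" unfolding C_def by (intro sum_nonneg) auto
    thus ?thesis using True by simp
  next
    case False
    then obtain i where i: "i < N" "grid a b N i < x" "x \<le> grid a b N (Suc i)"
      using grid_locate[of a x b N] x N by auto
    have "norm (\<Phi> x) \<le> norm (\<Phi> (grid a b N i)) + norm (\<Phi> x - \<Phi> (grid a b N i))" by (rule norm_triangle_sub)
    also have "\<dots> \<le> norm (\<Phi> (grid a b N i)) + \<bar>\<omega> i\<bar>" using w[OF i(1), of x] i by auto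
    also have "\<dots> \<le> C" unfolding C_def
      by (rule member_le_sum[where f = "\<lambda>i. norm (\<Phi> (grid a b N i)) + \<bar>\<omega> i\<bar>"]) (use i in auto)
    finally show ?thesis using norm_ge_zero[of "\<Phi> a"] by linarith
  qed
  thus ?thesis by blast
qed

section \<open>From half-open intervals to Riemann integrable functions\<close>

lemma has_integral_density_cell:
  fixes m :: "real \<Rightarrow> real"
  assumes m: "continuous_on UNIV m" and "a \<le> c" "c \<le> d" "d \<le> b"
  shows "((\<lambda>u. m u * indicat_real {c<..d} u) has_integral integral {c..d} m) {a..b}"
proof -
  have "m integrable_on {c..d}"
    by (intro integrable_continuous_interval continuous_on_subset[OF m]) auto
  hence "(m has_integral integral {c..d} m) (cbox c d)"
    unfolding cbox_interval by (rule integrable_integral)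
  hence "((\<lambda>u. if u \<in> cbox c d then m u else 0) has_integral integral {c..d} m) (cbox a b)"
    by (rule has_integral_restrict_closed_subinterval) (use assms in auto)
  hence "((\<lambda>u. if u \<in> {c..d} then m u else 0) has_integral integral {c..d} m) {a..b}" by simp
  thus ?thesis
    by (rule has_integral_spike_finite[of "{c}", rotated 2]) (auto simp: indicator_def)
qed

text \<open>\<open>\<Phi>\<close> is replaced by a step function \<open>s\<close>, with pointwise
  error at most another step function \<open>w\<close>. For both the limit of the means is known
  cell by cell, and the bounded density turns the small total oscillation into a small integral of
  \<open>w\<close>.\<close>

lemma mean_of_riemann_integrable:
  fixes \<Phi> :: "real \<Rightarrow> complex" and h m :: "real \<Rightarrow> real"
  assumes h: "continuous_on UNIV h" and B: "\<And>t. \<bar>h t\<bar> \<le> B"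
    and m: "continuous_on UNIV m" "\<And>u. m u \<ge> 0"
    and lim: "\<And>a b. a \<le> b \<Longrightarrow> ((\<lambda>T. 1 / T * integral {0..T} (\<lambda>t. indicat_real {a<..b} (h t))) \<longlongrightarrow> integral {a..b} m) at_top"
    and R: "riemann_integrable_on \<Phi> (- B - 1) (B + 1)"
    and int: "\<And>T. (\<lambda>t. \<Phi> (h t)) integrable_on {0..T}"
  shows "((\<lambda>T. (1 / T) *\<^sub>R integral {0..T} (\<lambda>t. \<Phi> (h t))) \<longlongrightarrow> integral {- B - 1..B + 1} (\<lambda>u. m u *\<^sub>R \<Phi> u)) at_top"
proof (rule tendstoI)
  fix e :: real assume e: "e > 0"
  \<comment> \<open>The interval is wider than the range of \<open>h\<close>, so \<open>h\<close>
    never meets the left end point, which lies in no cell.\<close>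
  define a b where "a = - B - 1" and "b = B + 1"
  have "B \<ge> 0" using B[of 0] by linarith
  hence ab: "a < b" by (simp add: a_def b_def)
  have hab: "a < h t" "h t \<le> b" for t using B[of t] by (auto simp: a_def b_def)
  have hm: "h \<in> borel_measurable borel" by (rule borel_measurable_continuous_onI[OF h])
  have "compact (m ` {a..b})" by (intro compact_continuous_image continuous_on_subset[OF m(1)]) auto
  hence "bounded (m ` {a..b})" by (rule compact_imp_bounded)
  then obtain L0 where L0: "\<forall>x\<in>m ` {a..b}. norm x \<le> L0" unfolding bounded_iff by blast
  define L where "L = \<bar>L0\<bar> + 1"
  have L: "m u \<le> L" if "u \<in> {a..b}" for u
  proof -
    have "norm (m u) \<le> L0" using L0 that by blast
    thus ?thesis unfolding L_def real_norm_def by linarith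
  qed
  have L1: "L > 0" by (simp add: L_def)
  obtain C where C: "\<And>x. x \<in> {a..b} \<Longrightarrow> norm (\<Phi> x) \<le> C"
    using riemann_integrable_bounded[OF R[folded a_def b_def] ab] by blast
  have meas: "\<Phi> \<in> borel_measurable (lebesgue_on {a..b})"
    by (rule integrable_imp_measurable[OF riemann_integrable_imp_integrable_on[OF R[folded a_def b_def]]])
  \<comment> \<open>As the density is at most \<open>L\<close>, this makes \<open>W\<close> at most
    e / 4. In the end \<open>W\<close> is spent twice and e / 4 twice more.\<close>
  have e': "e / (4 * L) > 0" using e L1 by simp
  obtain N \<omega> where N: "N > 0"
    and \<omega>: "\<And>i x. i < N \<Longrightarrow> x \<in> {grid a b N i..grid a b N (Suc i)} \<Longrightarrow> norm (\<Phi> x - \<Phi> (grid a b N i)) \<le> \<omega> i"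
    and \<omega>e: "(\<Sum>i<N. \<omega> i * ((b - a) / real N)) \<le> e / (4 * L)"
    using riemann_oscillation[OF R[folded a_def b_def] ab e'] by blast
  define c where "c = grid a b N"
  define \<delta> where "\<delta> = (b - a) / real N"
  have \<delta>: "\<delta> > 0" using ab N by (simp add: \<delta>_def)
  have cS: "c (Suc i) = c i + \<delta>" for i unfolding c_def \<delta>_def by (rule grid_Suc)
  have c_in: "a \<le> c i" "c i \<le> c (Suc i)" "c (Suc i) \<le> b" if "i < N" for i
    using grid_mono[of a b 0 i N] grid_mono[of a b i "Suc i" N] grid_mono[of a b "Suc i" N N] ab that N
    by (simp_all add: c_def grid_ends)
  have \<omega>0: "\<omega> i \<ge> 0" if "i < N" for i using \<omega>[OF that, of "c i"] c_in[OF that] by (simp add: c_def)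
  define E where "E = (\<lambda>i. indicat_real {c i<..c (Suc i)})"
  define s where "s = (\<lambda>u. \<Sum>i<N. E i u *\<^sub>R \<Phi> (c i))"
  define w where "w = (\<lambda>u. \<Sum>i<N. E i u * \<omega> i)"
  define A where "A = (\<lambda>i. integral {c i..c (Suc i)} m)"
  have sw: "norm (\<Phi> u - s u) \<le> w u" if u: "a < u" "u \<le> b" for u
  proof -
    obtain i where i: "i < N" "c i < u" "u \<le> c (Suc i)" using grid_locate[OF u N] unfolding c_def by blast
    have other: "E j u = (if j = i then 1 else 0)" if "j < N" for j
    proof (cases j i rule: linorder_cases)
      case less
      hence "c (Suc j) \<le> c i" using ab unfolding c_def by (intro grid_mono) auto
      thus ?thesis using i less by (simp add: E_def indicator_def)
    next
      case greater
      hence "c (Suc i) \<le> c j" using ab unfolding c_def by (intro grid_mono) auto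
      thus ?thesis using i greater by (simp add: E_def indicator_def)
    qed (use i in \<open>simp add: E_def indicator_def\<close>)
    have "s u = (\<Sum>j<N. if j = i then \<Phi> (c j) else 0)" unfolding s_def by (rule sum.cong) (auto simp: other)
    hence s: "s u = \<Phi> (c i)" using i(1) by simp
    have "w u = (\<Sum>j<N. if j = i then \<omega> j else 0)" unfolding w_def by (rule sum.cong) (auto simp: other)
    hence w: "w u = \<omega> i" using i(1) by simp
    show ?thesis unfolding s w c_def by (rule \<omega>[OF i(1)]) (use i in \<open>simp add: c_def\<close>)
  qed
  have Eint: "(\<lambda>t. E i (h t)) integrable_on {0..T}" for i T
    unfolding E_def by (rule set_borel_integral_eq_integral(1)[OF indicator_hit_integrable[OF hm]])
  have limE: "((\<lambda>T. 1 / T * integral {0..T} (\<lambda>t. E i (h t))) \<longlongrightarrow> A i) at_top" if "i < N" for i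
    unfolding E_def A_def by (rule lim[OF c_in(2)[OF that]])
  have s_int: "((\<lambda>t. s (h t)) has_integral (\<Sum>i<N. integral {0..T} (\<lambda>t. E i (h t)) *\<^sub>R \<Phi> (c i))) {0..T}" for T
    unfolding s_def by (intro has_integral_sum has_integral_scaleR_left integrable_integral Eint) auto
  have w_int: "((\<lambda>t. w (h t)) has_integral (\<Sum>i<N. integral {0..T} (\<lambda>t. E i (h t)) * \<omega> i)) {0..T}" for T
    unfolding w_def by (intro has_integral_sum has_integral_mult_left integrable_integral Eint) auto
  define W where "W = (\<Sum>i<N. A i * \<omega> i)"
  define S where "S = (\<Sum>i<N. A i *\<^sub>R \<Phi> (c i))"
  have "A i \<le> L * \<delta>" if "i < N" for i
  proof -
    have "A i \<le> integral {c i..c (Suc i)} (\<lambda>_. L)"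
      unfolding A_def using c_in[OF that]
      by (intro integral_le integrable_continuous_interval continuous_on_subset[OF m(1)] L) auto
    also have "\<dots> = L * \<delta>" using c_in[OF that] by (simp add: cS)
    finally show ?thesis .
  qed
  hence "W \<le> (\<Sum>i<N. (L * \<delta>) * \<omega> i)" unfolding W_def by (intro sum_mono mult_right_mono \<omega>0) auto
  also have "\<dots> = L * (\<Sum>i<N. \<omega> i * \<delta>)" unfolding sum_distrib_left by (rule sum.cong) auto
  also have "\<dots> \<le> L * (e / (4 * L))" using \<omega>e L1 unfolding \<delta>_def by (intro mult_left_mono) auto
  also have "\<dots> = e / 4" using L1 by simp
  finally have W: "W \<le> e / 4" .
  have mE: "((\<lambda>u. m u * E i u) has_integral A i) {a..b}" if "i < N" for i
    unfolding E_def A_def by (rule has_integral_density_cell[OF m(1) c_in[OF that]])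
  have ms: "((\<lambda>u. m u *\<^sub>R s u) has_integral S) {a..b}"
  proof -
    have "((\<lambda>u. \<Sum>i<N. (m u * E i u) *\<^sub>R \<Phi> (c i)) has_integral S) {a..b}"
      unfolding S_def by (intro has_integral_sum has_integral_scaleR_left mE) auto
    thus ?thesis by (simp add: s_def scaleR_sum_right)
  qed
  have mw: "((\<lambda>u. m u * w u) has_integral W) {a..b}"
  proof -
    have "((\<lambda>u. \<Sum>i<N. (m u * E i u) * \<omega> i) has_integral W) {a..b}"
      unfolding W_def by (intro has_integral_sum has_integral_mult_left mE) auto
    thus ?thesis by (simp add: w_def sum_distrib_left mult.assoc)
  qed
  have m\<Phi>: "(\<lambda>u. m u *\<^sub>R \<Phi> u) integrable_on {a..b}"
  proof (rule measurable_bounded_by_integrable_imp_integrable)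
    have "m \<in> borel_measurable (lebesgue_on {a..b})"
      by (intro continuous_imp_measurable_on_sets_lebesgue continuous_on_subset[OF m(1)]) auto
    thus "(\<lambda>u. m u *\<^sub>R \<Phi> u) \<in> borel_measurable (lebesgue_on {a..b})" by (intro borel_measurable_scaleR meas)
    show "(\<lambda>u. L * C) integrable_on {a..b}" by (rule Henstock_Kurzweil_Integration.integrable_const_ivl)
    show "norm (m u *\<^sub>R \<Phi> u) \<le> L * C" if "u \<in> {a..b}" for u
      using L[OF that] C[OF that] m(2)[of u] L1 by (simp add: mult_mono)
  qed simp
  have 1: "norm (integral {a..b} (\<lambda>u. m u *\<^sub>R \<Phi> u) - S) \<le> W"
  proof -
    have i1: "((\<lambda>u. m u *\<^sub>R \<Phi> u - m u *\<^sub>R s u) has_integral (integral {a..b} (\<lambda>u. m u *\<^sub>R \<Phi> u) - S)) {a..b}"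
      by (intro has_integral_diff integrable_integral m\<Phi> ms)
    \<comment> \<open>At \<open>a\<close> every cell indicator is 0 and the comparison of
      \<open>\<Phi>\<close> with \<open>s\<close> fails, so that point is taken out of both
      integrals.\<close>
    have i2: "((\<lambda>u. if u = a then 0 else m u *\<^sub>R \<Phi> u - m u *\<^sub>R s u) has_integral (integral {a..b} (\<lambda>u. m u *\<^sub>R \<Phi> u) - S)) {a..b}"
      by (rule has_integral_spike_finite[of "{a}", OF _ _ i1]) auto
    have i3: "((\<lambda>u. if u = a then 0 else m u * w u) has_integral W) {a..b}"
      by (rule has_integral_spike_finite[of "{a}", OF _ _ mw]) auto
    have "norm (integral {a..b} (\<lambda>u. if u = a then 0 else m u *\<^sub>R \<Phi> u - m u *\<^sub>R s u)) \<le> integral {a..b} (\<lambda>u. if u = a then 0 else m u * w u)"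
    proof (rule Henstock_Kurzweil_Integration.integral_norm_bound_integral)
      fix u assume u: "u \<in> {a..b}"
      have "norm (m u *\<^sub>R (\<Phi> u - s u)) \<le> m u * w u" if "u \<noteq> a"
        using sw[of u] u that m(2)[of u] by (simp add: mult_left_mono)
      thus "norm (if u = a then 0 else m u *\<^sub>R \<Phi> u - m u *\<^sub>R s u) \<le> (if u = a then 0 else m u * w u)"
        by (simp add: scaleR_diff_right)
    qed (use i2 i3 in \<open>auto simp: integrable_on_def\<close>)
    thus ?thesis unfolding integral_unique[OF i2] integral_unique[OF i3] .
  qed
  have 2: "norm ((1 / T) *\<^sub>R integral {0..T} (\<lambda>t. \<Phi> (h t)) - (\<Sum>i<N. (1 / T * integral {0..T} (\<lambda>t. E i (h t))) *\<^sub>R \<Phi> (c i)))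
      \<le> (\<Sum>i<N. (1 / T * integral {0..T} (\<lambda>t. E i (h t))) * \<omega> i)" if T: "T > 0" for T
  proof -
    have i1: "((\<lambda>t. \<Phi> (h t) - s (h t)) has_integral (integral {0..T} (\<lambda>t. \<Phi> (h t)) - (\<Sum>i<N. integral {0..T} (\<lambda>t. E i (h t)) *\<^sub>R \<Phi> (c i)))) {0..T}"
      by (intro has_integral_diff integrable_integral int s_int)
    have "norm (integral {0..T} (\<lambda>t. \<Phi> (h t) - s (h t))) \<le> integral {0..T} (\<lambda>t. w (h t))"
      by (rule Henstock_Kurzweil_Integration.integral_norm_bound_integral) (use i1 w_int[of T] sw hab in \<open>auto simp: integrable_on_def\<close>)
    hence "norm (integral {0..T} (\<lambda>t. \<Phi> (h t)) - (\<Sum>i<N. integral {0..T} (\<lambda>t. E i (h t)) *\<^sub>R \<Phi> (c i))) \<le> (\<Sum>i<N. integral {0..T} (\<lambda>t. E i (h t)) * \<omega> i)"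
      unfolding integral_unique[OF i1] integral_unique[OF w_int] .
    hence "1 / T * norm (integral {0..T} (\<lambda>t. \<Phi> (h t)) - (\<Sum>i<N. integral {0..T} (\<lambda>t. E i (h t)) *\<^sub>R \<Phi> (c i))) \<le> 1 / T * (\<Sum>i<N. integral {0..T} (\<lambda>t. E i (h t)) * \<omega> i)"
      using T by (intro mult_left_mono) auto
    also have "1 / T * norm (integral {0..T} (\<lambda>t. \<Phi> (h t)) - (\<Sum>i<N. integral {0..T} (\<lambda>t. E i (h t)) *\<^sub>R \<Phi> (c i))) =
      norm ((1 / T) *\<^sub>R (integral {0..T} (\<lambda>t. \<Phi> (h t)) - (\<Sum>i<N. integral {0..T} (\<lambda>t. E i (h t)) *\<^sub>R \<Phi> (c i))))"
      using T by simp
    finally show ?thesis by (simp only: scaleR_diff_right scaleR_sum_right scaleR_scaleR sum_distrib_left mult.assoc)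
  qed
  have lS: "((\<lambda>T. \<Sum>i<N. (1 / T * integral {0..T} (\<lambda>t. E i (h t))) *\<^sub>R \<Phi> (c i)) \<longlongrightarrow> S) at_top"
    unfolding S_def by (intro tendsto_sum tendsto_scaleR tendsto_const limE) auto
  have lW: "((\<lambda>T. \<Sum>i<N. (1 / T * integral {0..T} (\<lambda>t. E i (h t))) * \<omega> i) \<longlongrightarrow> W) at_top"
    unfolding W_def by (intro tendsto_sum tendsto_mult_right limE) auto
  have q: "e / 4 > 0" using e by simp
  from tendstoD[OF lS q] tendstoD[OF lW q] eventually_gt_at_top[of 0]
  show "\<forall>\<^sub>F T in at_top. dist ((1 / T) *\<^sub>R integral {0..T} (\<lambda>t. \<Phi> (h t))) (integral {- B - 1..B + 1} (\<lambda>u. m u *\<^sub>R \<Phi> u)) < e"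
    unfolding a_def [symmetric] b_def [symmetric]
  proof eventually_elim
    case (elim T)
    define x where "x = (1 / T) *\<^sub>R integral {0..T} (\<lambda>t. \<Phi> (h t))"
    define y where "y = (\<Sum>i<N. (1 / T * integral {0..T} (\<lambda>t. E i (h t))) *\<^sub>R \<Phi> (c i))"
    define v where "v = (\<Sum>i<N. (1 / T * integral {0..T} (\<lambda>t. E i (h t))) * \<omega> i)"
    define z where "z = integral {a..b} (\<lambda>u. m u *\<^sub>R \<Phi> u)"
    have "dist x y \<le> v" using 2[OF elim(3)] by (simp only: x_def y_def v_def dist_norm)
    moreover have "v < W + e / 4"
    proof -
      have "dist v W < e / 4" using elim(2) unfolding v_def .
      thus ?thesis unfolding dist_real_def by linarith
    qed
    moreover have "dist y S < e / 4" using elim(1) by (simp add: y_def)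
    moreover have "dist z S \<le> W" using 1 by (simp only: z_def dist_norm)
    moreover have "dist x z \<le> dist x y + dist y S + dist z S"
      using dist_triangle[of x z y] dist_triangle[of y z S] by (simp add: dist_commute)
    ultimately have "dist x z < e" using W by linarith
    thus ?case unfolding x_def z_def .
  qed
qed

theorem theorem1p1:
  assumes RH: "riemann_hypothesis"
    and LI: "linear_independence_hypothesis"
  shows "\<exists>M :: real \<Rightarrow> real.
    (\<forall>\<Phi> :: real \<Rightarrow> complex. locally_riemann_integrable \<Phi> \<longrightarrow>
       ((\<lambda>T::real. (1 / T) *\<^sub>R integral {0..T} (\<lambda>t. \<Phi> (H (exp t))))
          \<longlongrightarrow> (1 / sqrt (2 * pi)) *\<^sub>R integral UNIV (\<lambda>u. M u *\<^sub>R \<Phi> u)) at_top) \<and>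
    continuous_on UNIV M \<and>
    (\<forall>u. M u \<ge> 0) \<and>
    compact (closure {u. M u \<noteq> 0}) \<and>
    1 / sqrt (2 * pi) * integral UNIV M = 1"
proof -
  define h where "h = (\<lambda>t. H (exp t))"
  define B where "B = (\<Sum>\<^sub>\<infinity>\<gamma>\<in>ordinates. norm (amp \<gamma>))"
  have h: "continuous_on UNIV h" unfolding h_def by (rule H_exp_uniform(3)[OF RH])
  have B: "\<bar>h t\<bar> \<le> B" for t unfolding h_def B_def by (rule H_exp_uniform(2)[OF RH])
  obtain \<psi> C where \<psi>: "\<And>x. has_mean (\<lambda>t. exp (\<i> * of_real (x * h t))) (\<psi> x)" "\<And>x. (1 + x\<^sup>2) * norm (\<psi> x) \<le> C"
    using characteristic_mean[OF RH LI] unfolding h_def by blast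
  obtain m where m: "continuous_on UNIV m" "\<And>u. m u \<ge> 0"
    and lim: "\<And>a b. a \<le> b \<Longrightarrow> ((\<lambda>T. 1 / T * integral {0..T} (\<lambda>t. indicat_real {a<..b} (h t))) \<longlongrightarrow> integral {a..b} m) at_top"
    using limit_density[OF h B \<psi>] by blast
  have B0: "B \<ge> 0" using B[of 0] by linarith
  \<comment> \<open>An interval that \<open>h\<close> never enters has frequency 0 for every length,
    hence mass 0 in the limit.\<close>
  have zero: "integral {c..d} m = 0" if "c \<le> d" "\<And>t. \<not> (c < h t \<and> h t \<le> d)" for c d
  proof -
    have "indicat_real {c<..d} (h t) = 0" for t using that(2)[of t] by (auto simp: indicator_def)
    hence "((\<lambda>T::real. 0::real) \<longlongrightarrow> integral {c..d} m) at_top" using lim[OF that(1)] by simp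
    from tendsto_unique[OF trivial_limit_at_top_linorder this tendsto_const] show ?thesis .
  qed
  have out: "m u = 0" if u: "\<bar>u\<bar> > B" for u
  proof -
    \<comment> \<open>An interval that starts at \<open>u\<close> and stays outside the range: for
      \<open>u > B\<close> it extends to the right, for \<open>u < - B\<close> it stops halfway
      between \<open>u\<close> and \<open>- B\<close>. A continuous nonnegative function with
      integral 0 over it vanishes at \<open>u\<close>.\<close>
    define c d where "c = u" and "d = (if u > 0 then u + 1 else (u - B) / 2)"
    have cd: "c < d" "\<And>t. \<not> (c < h t \<and> h t \<le> d)"
    proof -
      show "c < d" using u B0 by (auto simp: c_def d_def abs_if field_simps split: if_splits)
      show "\<not> (c < h t \<and> h t \<le> d)" for t
        using u B0 B[of t] by (auto simp: c_def d_def abs_if field_simps split: if_splits)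
    qed
    have "(m has_integral 0) {c..d}"
      using zero[OF less_imp_le[OF cd(1)] cd(2)] integrable_continuous_interval[OF continuous_on_subset[OF m(1)], of c d]
      by (metis integrable_integral subset_UNIV)
    hence "m x = 0" if "x \<in> {c..d}" for x
      using has_integral_0_cbox_imp_0[of c d m x] continuous_on_subset[OF m(1)] m(2) cd(1) that by auto
    thus ?thesis using cd(1) by (simp add: c_def)
  qed
  have UNIV_int: "integral UNIV f = integral {- B - 1..B + 1} f" if "\<And>u. \<bar>u\<bar> > B \<Longrightarrow> f u = 0" for f :: "real \<Rightarrow> 'c :: banach"
  proof -
    have "integral UNIV f = integral UNIV (\<lambda>u. if u \<in> {- B - 1..B + 1} then f u else 0)"
      by (rule arg_cong[of _ _ "integral UNIV"]) (use that in \<open>auto simp: fun_eq_iff\<close>)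
    thus ?thesis by (simp only: integral_restrict_UNIV)
  qed
  \<comment> \<open>\<open>m\<close> is the probability density itself; the factor cancels the
    normalisation 1 / sqrt (2 pi) of the statement.\<close>
  define M where "M = (\<lambda>u. sqrt (2 * pi) * m u)"
  have pi: "sqrt (2 * pi) > 0" by simp
  have "((\<lambda>T::real. (1 / T) *\<^sub>R integral {0..T} (\<lambda>t. \<Phi> (H (exp t))))
          \<longlongrightarrow> (1 / sqrt (2 * pi)) *\<^sub>R integral UNIV (\<lambda>u. M u *\<^sub>R \<Phi> u)) at_top"
    if \<Phi>: "locally_riemann_integrable \<Phi>" for \<Phi> :: "real \<Rightarrow> complex"
  proof -
    have R: "riemann_integrable_on \<Phi> (- B - 1) (B + 1)"
      using \<Phi> B0 unfolding locally_riemann_integrable_def by auto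
    have "\<exists>K. \<forall>x\<in>{- B - 1..B + 1}. norm (\<Phi> x) \<le> K"
      by (rule riemann_integrable_bounded[OF R]) (use B0 in simp)
    then obtain K where K: "\<And>x. x \<in> {- B - 1..B + 1} \<Longrightarrow> norm (\<Phi> x) \<le> K" by blast
    have meas: "\<Phi> \<in> borel_measurable (lebesgue_on {- (B + 1)..B + 1})"
      using integrable_imp_measurable[OF riemann_integrable_imp_integrable_on[OF R]] by simp
    have int: "(\<lambda>t. \<Phi> (h t)) integrable_on {0..T}" for T
      unfolding h_def
    proof (rule integrable_composition_H[OF RH meas])
      show "norm (\<Phi> x) \<le> K" if "\<bar>x\<bar> \<le> B + 1" for x using that by (intro K) auto
      show "\<bar>H (exp t)\<bar> \<le> B + 1" for t using B[of t] by (simp add: h_def)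
    qed
    have "((\<lambda>T. (1 / T) *\<^sub>R integral {0..T} (\<lambda>t. \<Phi> (h t))) \<longlongrightarrow> integral {- B - 1..B + 1} (\<lambda>u. m u *\<^sub>R \<Phi> u)) at_top"
      by (rule mean_of_riemann_integrable[OF h B m lim R int])
    also have "integral {- B - 1..B + 1} (\<lambda>u. m u *\<^sub>R \<Phi> u) = integral UNIV (\<lambda>u. m u *\<^sub>R \<Phi> u)"
      by (rule UNIV_int [symmetric]) (simp add: out)
    also have "\<dots> = (1 / sqrt (2 * pi)) *\<^sub>R integral UNIV (\<lambda>u. sqrt (2 * pi) *\<^sub>R (m u *\<^sub>R \<Phi> u))"
      unfolding integral_cmul using pi by simp
    finally show ?thesis unfolding h_def M_def by (simp only: scaleR_scaleR)
  qed
  moreover have "continuous_on UNIV M" unfolding M_def by (intro continuous_intros m(1))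
  moreover have "\<forall>u. M u \<ge> 0" unfolding M_def using m(2) by simp
  moreover have "compact (closure {u. M u \<noteq> 0})"
  proof -
    have "{u. M u \<noteq> 0} \<subseteq> {- B..B}" using out by (auto simp: M_def not_less abs_le_iff) (use out in force)+
    hence "bounded {u. M u \<noteq> 0}" by (rule bounded_subset[rotated]) simp
    thus ?thesis by (simp add: compact_closure)
  qed
  moreover have "1 / sqrt (2 * pi) * integral UNIV M = 1"
  proof -
    have "indicat_real {- B - 1<..B + 1} (h t) = 1" for t using B[of t] by (simp add: indicator_def abs_le_iff)
    hence l: "((\<lambda>T. 1 / T * integral {0..T} (\<lambda>t. 1)) \<longlongrightarrow> integral {- B - 1..B + 1} m) at_top"
      using lim[of "- B - 1" "B + 1"] B0 by simp
    have "\<forall>\<^sub>F T in at_top. 1 / T * integral {0..T} (\<lambda>t. 1) = (1::real)"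
      using eventually_gt_at_top[of 0] by eventually_elim simp
    from Lim_transform_eventually[OF l this] have "((\<lambda>T. 1) \<longlongrightarrow> integral {- B - 1..B + 1} m) (at_top :: real filter)" .
    hence "integral {- B - 1..B + 1} m = 1"
      by (rule tendsto_unique[OF trivial_limit_at_top_linorder _ tendsto_const])
    hence "integral UNIV m = 1" using UNIV_int[of m] out by simp
    moreover have "integral UNIV M = sqrt (2 * pi) * integral UNIV m" unfolding M_def by (rule integral_mult_right)
    ultimately show ?thesis using pi by simp
  qed
  ultimately show ?thesis by blast
qed

end
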